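(* Let $Q$ be a symmetric quiver with vertex set $I$. For each $\mathbf w\in\mathbb N^I$ there is a commutative diagram $$\begin{array}{ccc}\mathcal P_Q^\vee&\xrightarrow{\;F\;}&\mathcal H_Q\\ \downarrow&&\downarrow\\ \mathcal Q_{\mathbf w}^\vee&\xrightarrow{\;\sim\;}&\mathcal M_{\mathbf w}\end{array}$$ where the left vertical map is the surjection dual to the inclusion $\mathcal Q_{\mathbf w}\subset\mathcal P_Q$, the right vertical map is the quotient map $\mathcal H_Q\to\mathcal M_{\mathbf w}$, $F$ is the isomorphism given on $\xi\in\mathcal P_{Q,\mathbf d}^\vee$ by $$F_\xi=\prod_{k<l}(z_k-z_l)^{\mathcal N(i_k,i_l)}\cdot\langle\xi,\,Y(i_1,z_1)\cdots Y(i_p,z_p)\mathbf 1\rangle\Big|_{z_{\mathbf d_1+\dots+\mathbf d_{j-1}+k}=x_{j,k}},$$ and the bottom map is an isomorphism.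
   Context: The ground field is $\mathbb Q$. $Q$ is a finite quiver with vertex set $I$ which is symmetric (as many arrows $i\to j$ as $j\to i$). $L=\mathbb Z^I$ has standard basis $(e_i)$ and Euler form $\chi(\mathbf d,\mathbf e)=\sum_i\mathbf d_i\mathbf e_i-\sum_{a:i\to j}\mathbf d_i\mathbf e_j$. $L$-graded vector spaces have braiding $a\otimes b\mapsto(-1)^{\chi(\alpha,\beta)}b\otimes a$ for $a,b$ of $L$-degrees $\alpha,\beta$; Lie algebras and enveloping algebras are taken in this symmetric monoidal category. Shifts: $M[k]^n=M^{n+k}$. Graded dual: $(M^\vee)_{\mathbf d}^n=(M_{\mathbf d}^{-n})^\vee$. $\mathcal N(i,j)=-\chi(e_i,e_j)$, $\mathcal N_+=\max(\mathcal N,0)$. $\mathfrak L$ is the Lie algebra generated by symbols $i(n)$ ($i\in I$, $n\in\mathbb Z$) of $L$-degree $e_i$ and weight $\frac12\chi(e_i,e_i)-n-1$ (cohomological degree is $-2$ times weight), with relations $\sum_{k=0}^N(-1)^k\binom Nk[i(m-k),j(n+k)]=0$, $N=\mathcal N_+(i,j)$, for all $i,j\in I$, $m,n\in\mathbb Z$. The principal free vertex algebra is $\mathcal P_Q=U(\mathfrak L)/U(\mathfrak L)\{i(n):n\ge0\}$ with cyclic vector (vacuum) $\mathbf 1$ of degree $0$, and $Y(i,z)=\sum_ni(n)z^{-n-1}$ acting on it. $\mathcal Q_{\mathbf w}\subset\mathcal P_Q$ is the subspace obtained by applying elements of $X_{\mathbf w}=\{i(n):i\in I,n\ge-\mathbf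 w_i\}$ to the vacuum, i.e. the span of all $i_1(n_1)\cdots i_p(n_p)\mathbf 1$, $p\ge0$, with all $i_k(n_k)\in X_{\mathbf w}$. $\mathcal H_Q=\bigoplus_{\mathbf d\in\mathbb N^I}\mathcal H_{Q,\mathbf d}$, $\mathcal H_{Q,\mathbf d}=\Lambda_{\mathbf d}[-\chi(\mathbf d,\mathbf d)]$, $\Lambda_{\mathbf d}=\mathbb Q[x_{i,k}:i\in I,1\le k\le\mathbf d_i]^{\Sigma_{\mathbf d}}$, $\Sigma_{\mathbf d}=\prod_i\Sigma_{\mathbf d_i}$, $\deg x_{i,k}=2$, is the cohomological Hall algebra, with shuffle product $f*g=\sum_\sigma\sigma(f(x)g(y)K(x,y))$ for $f\in\mathcal H_{Q,\mathbf d}$, $g\in\mathcal H_{Q,\mathbf e}$, $K=\prod_{i,j}\prod_{k=1}^{\mathbf d_i}\prod_{\ell=1}^{\mathbf e_j}(y_{j,\ell}-x_{i,k})^{-\chi(e_i,e_j)}$, where $x_{i,k}$ are the first $\mathbf d_i$ and $y_{i,\ell}$ the last $\mathbf e_i$ variables of colour $i$ and $\sigma\in\Sigma_{\mathbf d+\mathbf e}$ runs over $(\mathbf d,\mathbf e)$-shuffles (each $\sigma_i$ increasing on $\{1,\dots,\mathbf d_i\}$ and on $\{\mathbf d_i+1,\dots,\mathbf d_i+\mathbf e_i\}$). $\mathcal M_{\mathbf w}=\mathcal H_Q/(e_{\mathbf d}^{\mathbf w}\mathcal H_{Q,\mathbf d}:\mathbf d>0)$, where $e_{\mathbf d}^{\mathbf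 w}=\prod_{i\in I}\prod_{k=1}^{\mathbf d_i}x_{i,k}^{\mathbf w_i}$, $e_{\mathbf d}^{\mathbf w}\mathcal H_{Q,\mathbf d}$ uses the ordinary product of $\Lambda_{\mathbf d}$, and the denominator is the ideal generated with respect to $*$, i.e. $\sum_{\mathbf d'\ge0,\mathbf d>0}\mathcal H_{Q,\mathbf d'}*e_{\mathbf d}^{\mathbf w}\mathcal H_{Q,\mathbf d}$. (By a known theorem $\mathcal M_{\mathbf w}$ is the CoHA-module $\bigoplus_{\mathbf d}H^{BM}(\mathrm{Hilb}_{\mathbf d,\mathbf w})[\chi(\mathbf d,\mathbf d)-2\mathbf w\cdot\mathbf d]$ of Borel–Moore homologies of non-commutative Hilbert schemes, i.e. moduli spaces of stable $\mathbf w$-framed representations of $Q$ of dimension $\mathbf d$.) In the formula for $F_\xi$, $I=\{1,\dots,r\}$ via a chosen order, $p=\sum_i\mathbf d_i$, $i_{\mathbf d_1+\dots+\mathbf d_{j-1}+k}=j$ for $1\le k\le\mathbf d_j$, and negative powers of $z_k-z_l$ ($k<l$) are expanded in non-negative powers of $z_l$. *)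

theory Defs
  imports
    "Graph_Theory.Digraph"
    "HOL-Combinatorics.Permutations"
    "HOL-Algebra.QuotRing"
    "HOL-Algebra.Module"
    "HOL-Library.Poly_Mapping"
    "HOL-Library.Product_Lexorder"
    "HOL-Library.Function_Algebras"
    "HOL-Computational_Algebra.Fraction_Field"
begin

hide_const (open) Multiset.mult

section \<open>Linear algebra over the rationals\<close>

text \<open>
  Vector spaces over the rationals, with or without a multiplication, are records of type
  \<^typ>\<open>(rat, 'b) module\<close>. The field \<^const>\<open>mult\<close> is the product of an associative algebra, the
  bracket of a Lie algebra, or \<^const>\<open>undefined\<close> when there is no product.
\<close>

definition ratring :: "rat ring" where
  "ratring = \<lparr>carrier = UNIV, mult = (*), one = 1, zero = 0, add = (+)\<rparr>"

definition lin_span :: "(rat, 'b) module \<Rightarrow> 'b set \<Rightarrow> 'b set" where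
  "lin_span M S = \<Inter>{W. submodule W ratring M \<and> S \<subseteq> W}"

definition ideal_gen :: "(rat, 'b) module \<Rightarrow> 'b set \<Rightarrow> 'b set" where
  "ideal_gen M S = \<Inter>{W. submodule W ratring M \<and> S \<subseteq> W \<and>
     (\<forall>a\<in>carrier M. \<forall>x\<in>W. a \<otimes>\<^bsub>M\<^esub> x \<in> W \<and> x \<otimes>\<^bsub>M\<^esub> a \<in> W)}"

text \<open>The product below is only meaningful when \<open>W\<close> is a two-sided ideal.\<close>

definition quot_module :: "(rat, 'b) module \<Rightarrow> 'b set \<Rightarrow> (rat, 'b set) module" where
  "quot_module M W =
    \<lparr>carrier = a_rcosets\<^bsub>M\<^esub> W, mult = rcoset_mult M W, one = W +>\<^bsub>M\<^esub> \<one>\<^bsub>M\<^esub>,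
     zero = W, add = set_add M, smult = (\<lambda>c X. \<Union>x\<in>X. W +>\<^bsub>M\<^esub> (c \<odot>\<^bsub>M\<^esub> x))\<rparr>"

text \<open>The action of \<open>u\<close> on the quotient of an algebra \<open>A\<close> by a left ideal \<open>J\<close>.\<close>

definition left_act :: "(rat, 'b) module \<Rightarrow> 'b set \<Rightarrow> 'b \<Rightarrow> 'b set \<Rightarrow> 'b set" where
  "left_act A J u X = (\<Union>x\<in>X. J +>\<^bsub>A\<^esub> (u \<otimes>\<^bsub>A\<^esub> x))"

definition lin_map :: "(rat, 'b) module \<Rightarrow> (rat, 'c) module \<Rightarrow> ('b \<Rightarrow> 'c) \<Rightarrow> bool" where
  "lin_map M N f \<longleftrightarrow> f \<in> carrier M \<rightarrow> carrier N \<and>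
     (\<forall>x\<in>carrier M. \<forall>y\<in>carrier M. f (x \<oplus>\<^bsub>M\<^esub> y) = f x \<oplus>\<^bsub>N\<^esub> f y) \<and>
     (\<forall>c. \<forall>x\<in>carrier M. f (c \<odot>\<^bsub>M\<^esub> x) = c \<odot>\<^bsub>N\<^esub> f x)"

text \<open>
  A grading of \<open>M\<close> is a family \<open>A\<close> of subspaces; \<open>A \<alpha> n\<close> is the part of \<open>L\<close>-degree \<open>\<alpha>\<close> and
  cohomological degree \<open>n\<close>.
\<close>

definition graded_iso ::
  "(rat, 'b) module \<Rightarrow> ('l \<Rightarrow> int \<Rightarrow> 'b set) \<Rightarrow> (rat, 'c) module \<Rightarrow> ('l \<Rightarrow> int \<Rightarrow> 'c set)
    \<Rightarrow> ('b \<Rightarrow> 'c) \<Rightarrow> bool" where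
  "graded_iso M A N B f \<longleftrightarrow> lin_map M N f \<and> bij_betw f (carrier M) (carrier N) \<and>
     (\<forall>\<alpha> n. f ` A \<alpha> n = B \<alpha> n)"

text \<open>
  The graded dual of \<open>M\<close>, i.e. the direct sum of the duals of the graded parts, realised as the
  space of linear functionals on \<open>M\<close> which vanish on all but finitely many graded parts.
  Functionals are extended by \<open>0\<close> outside the carrier, so that equality of functions is equality
  of functionals.
\<close>

definition gdual :: "(rat, 'b) module \<Rightarrow> ('l \<Rightarrow> int \<Rightarrow> 'b set) \<Rightarrow> (rat, 'b \<Rightarrow> rat) module" where
  "gdual M A =
    \<lparr>carrier = {\<xi>. (\<forall>x. x \<notin> carrier M \<longrightarrow> \<xi> x = 0) \<and>
        (\<forall>x\<in>carrier M. \<forall>y\<in>carrier M. \<xi> (x \<oplus>\<^bsub>M\<^esub> y) = \<xi> x + \<xi> y) \<and>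
        (\<forall>c. \<forall>x\<in>carrier M. \<xi> (c \<odot>\<^bsub>M\<^esub> x) = c * \<xi> x) \<and>
        finite {(\<alpha>, n). \<exists>x\<in>A \<alpha> n. \<xi> x \<noteq> 0}},
     mult = undefined, one = undefined, zero = 0, add = (+), smult = (\<lambda>c \<xi> x. c * \<xi> x)\<rparr>"

definition gdual_piece ::
  "(rat, 'b) module \<Rightarrow> ('l \<Rightarrow> int \<Rightarrow> 'b set) \<Rightarrow> 'l \<Rightarrow> int \<Rightarrow> ('b \<Rightarrow> rat) set" where
  "gdual_piece M A \<alpha> n = {\<xi> \<in> carrier (gdual M A).
     \<forall>\<beta> m. (\<beta>, m) \<noteq> (\<alpha>, - n) \<longrightarrow> (\<forall>x\<in>A \<beta> m. \<xi> x = 0)}"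

definition gdual_comp ::
  "(rat, 'b) module \<Rightarrow> ('l \<Rightarrow> int \<Rightarrow> 'b set) \<Rightarrow> 'l \<Rightarrow> ('b \<Rightarrow> rat) set" where
  "gdual_comp M A \<alpha> = {\<xi> \<in> carrier (gdual M A).
     \<forall>\<beta> m. \<beta> \<noteq> \<alpha> \<longrightarrow> (\<forall>x\<in>A \<beta> m. \<xi> x = 0)}"

text \<open>
  The vector space with basis \<open>S\<close>, with the bilinear product extending the operation \<open>f\<close> on \<open>S\<close>.
\<close>

definition free_alg :: "('x \<Rightarrow> 'x \<Rightarrow> 'x) \<Rightarrow> 'x \<Rightarrow> 'x set \<Rightarrow> (rat, 'x \<Rightarrow>\<^sub>0 rat) module" where
  "free_alg f e S =
    \<lparr>carrier = {p. Poly_Mapping.keys p \<subseteq> S},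
     mult = (\<lambda>p q. \<Sum>s\<in>Poly_Mapping.keys p. \<Sum>t\<in>Poly_Mapping.keys q.
       Poly_Mapping.single (f s t) (Poly_Mapping.lookup p s * Poly_Mapping.lookup q t)),
     one = Poly_Mapping.single e 1, zero = 0, add = (+),
     smult = (\<lambda>c. Poly_Mapping.map ((*) c))\<rparr>"


section \<open>Symmetric quivers\<close>

text \<open>
  A finite quiver is a finite multi-digraph, loops allowed. The vertex type is linearly ordered;
  this is the chosen order on the set of vertices. (The library predicate \<^const>\<open>symmetric\<close>
  ignores multiplicities.)
\<close>

definition num_arrows :: "('v, 'a) pre_digraph \<Rightarrow> 'v \<Rightarrow> 'v \<Rightarrow> nat" where
  "num_arrows Q i j = card {a \<in> arcs Q. tail Q a = i \<and> head Q a = j}"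

definition symmetric_quiver :: "('v, 'a) pre_digraph \<Rightarrow> bool" where
  "symmetric_quiver Q \<longleftrightarrow> fin_digraph Q \<and>
     (\<forall>i\<in>verts Q. \<forall>j\<in>verts Q. num_arrows Q i j = num_arrows Q j i)"

definition euler_form :: "('v, 'a) pre_digraph \<Rightarrow> ('v \<Rightarrow> int) \<Rightarrow> ('v \<Rightarrow> int) \<Rightarrow> int" where
  "euler_form Q d e = (\<Sum>i\<in>verts Q. d i * e i) - (\<Sum>a\<in>arcs Q. d (tail Q a) * e (head Q a))"

definition basis_vec :: "'v \<Rightarrow> 'v \<Rightarrow> int" where
  "basis_vec i = (\<lambda>j. if j = i then 1 else 0)"

definition NN :: "('v, 'a) pre_digraph \<Rightarrow> 'v \<Rightarrow> 'v \<Rightarrow> int" where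
  "NN Q i j = - euler_form Q (basis_vec i) (basis_vec j)"

definition NNplus :: "('v, 'a) pre_digraph \<Rightarrow> 'v \<Rightarrow> 'v \<Rightarrow> nat" where
  "NNplus Q i j = nat (max (NN Q i j) 0)"

definition braid_sign :: "('v, 'a) pre_digraph \<Rightarrow> ('v \<Rightarrow> int) \<Rightarrow> ('v \<Rightarrow> int) \<Rightarrow> rat" where
  "braid_sign Q \<alpha> \<beta> = (-1) powi euler_form Q \<alpha> \<beta>"

text \<open>Dimension vectors are extended by \<open>0\<close> outside the set of vertices.\<close>

definition dimvecs :: "('v, 'a) pre_digraph \<Rightarrow> ('v \<Rightarrow> nat) set" where
  "dimvecs Q = {d. \<forall>i. i \<notin> verts Q \<longrightarrow> d i = 0}"

definition ldim :: "('v \<Rightarrow> nat) \<Rightarrow> 'v \<Rightarrow> int" where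
  "ldim d = (\<lambda>i. int (d i))"


section \<open>The Lie algebra and its enveloping algebra\<close>

text \<open>The symbol \<open>i(n)\<close> is the pair \<open>(i, n)\<close>.\<close>

definition symbols :: "('v, 'a) pre_digraph \<Rightarrow> ('v \<times> int) set" where
  "symbols Q = verts Q \<times> UNIV"

definition weight :: "('v, 'a) pre_digraph \<Rightarrow> 'v \<times> int \<Rightarrow> rat" where
  "weight Q = (\<lambda>(i, n).
     of_int (euler_form Q (basis_vec i) (basis_vec i)) / 2 - of_int n - 1)"

text \<open>
  The Lie algebra is presented as the quotient of the free non-associative algebra on the symbols,
  whose basis consists of the bracketed words, by the ideal generated by the axioms of a Lie
  algebra in the category of \<open>L\<close>-graded spaces and by the defining relations.
\<close>

datatype 'g bracketing = Gen 'g | Br "'g bracketing" "'g bracketing"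

primrec ldeg :: "('v \<times> int) bracketing \<Rightarrow> 'v \<Rightarrow> int" where
  "ldeg (Gen g) = basis_vec (fst g)"
| "ldeg (Br s t) = ldeg s + ldeg t"

type_synonym 'v nonassoc = "('v \<times> int) bracketing \<Rightarrow>\<^sub>0 rat"

definition free_nonassoc :: "('v, 'a) pre_digraph \<Rightarrow> (rat, 'v nonassoc) module" where
  "free_nonassoc Q = free_alg Br undefined {t. set_bracketing t \<subseteq> symbols Q}"

definition nonassoc_comp :: "('v, 'a) pre_digraph \<Rightarrow> ('v \<Rightarrow> int) \<Rightarrow> 'v nonassoc set" where
  "nonassoc_comp Q \<alpha> =
     {p \<in> carrier (free_nonassoc Q). \<forall>t\<in>Poly_Mapping.keys p. ldeg t = \<alpha>}"

definition lie_axioms :: "('v, 'a) pre_digraph \<Rightarrow> 'v nonassoc set" where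
  "lie_axioms Q = (let F = free_nonassoc Q in
     {a \<otimes>\<^bsub>F\<^esub> b + braid_sign Q \<alpha> \<beta> \<odot>\<^bsub>F\<^esub> (b \<otimes>\<^bsub>F\<^esub> a) | a b \<alpha> \<beta>.
        a \<in> nonassoc_comp Q \<alpha> \<and> b \<in> nonassoc_comp Q \<beta>} \<union>
     {a \<otimes>\<^bsub>F\<^esub> (b \<otimes>\<^bsub>F\<^esub> c) - (a \<otimes>\<^bsub>F\<^esub> b) \<otimes>\<^bsub>F\<^esub> c
        - braid_sign Q \<alpha> \<beta> \<odot>\<^bsub>F\<^esub> (b \<otimes>\<^bsub>F\<^esub> (a \<otimes>\<^bsub>F\<^esub> c)) | a b c \<alpha> \<beta> \<gamma>.
        a \<in> nonassoc_comp Q \<alpha> \<and> b \<in> nonassoc_comp Q \<beta> \<and> c \<in> nonassoc_comp Q \<gamma>})"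

definition locality_rels :: "('v, 'a) pre_digraph \<Rightarrow> 'v nonassoc set" where
  "locality_rels Q =
     {\<Sum>k\<le>NNplus Q i j.
        Poly_Mapping.single (Br (Gen (i, m - int k)) (Gen (j, n + int k)))
          ((-1) ^ k * of_nat (NNplus Q i j choose k)) | i j m n.
        i \<in> verts Q \<and> j \<in> verts Q}"

definition lie_ideal :: "('v, 'a) pre_digraph \<Rightarrow> 'v nonassoc set" where
  "lie_ideal Q = ideal_gen (free_nonassoc Q) (lie_axioms Q \<union> locality_rels Q)"

type_synonym 'v lie = "'v nonassoc set"

definition LL :: "('v, 'a) pre_digraph \<Rightarrow> (rat, 'v lie) module" where
  "LL Q = quot_module (free_nonassoc Q) (lie_ideal Q)"

definition LL_comp :: "('v, 'a) pre_digraph \<Rightarrow> ('v \<Rightarrow> int) \<Rightarrow> 'v lie set" where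
  "LL_comp Q \<alpha> = (\<lambda>p. lie_ideal Q +>\<^bsub>free_nonassoc Q\<^esub> p) ` nonassoc_comp Q \<alpha>"

definition LL_gen :: "('v, 'a) pre_digraph \<Rightarrow> 'v \<times> int \<Rightarrow> 'v lie" where
  "LL_gen Q g = lie_ideal Q +>\<^bsub>free_nonassoc Q\<^esub> Poly_Mapping.single (Gen g) 1"

text \<open>
  The enveloping algebra is presented as the free associative algebra on the underlying set of the
  Lie algebra modulo linearity (this gives the tensor algebra) and
  \<open>a \<otimes> b - (-1)\<^bsup>\<chi>(\<alpha>,\<beta>)\<^esup> b \<otimes> a = [a, b]\<close>.
\<close>

type_synonym 'v words = "'v lie list \<Rightarrow>\<^sub>0 rat"

definition word_alg :: "('v, 'a) pre_digraph \<Rightarrow> (rat, 'v words) module" where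
  "word_alg Q = free_alg (@) [] (lists (carrier (LL Q)))"

definition env_ideal :: "('v, 'a) pre_digraph \<Rightarrow> 'v words set" where
  "env_ideal Q = ideal_gen (word_alg Q)
    ({Poly_Mapping.single [x \<oplus>\<^bsub>LL Q\<^esub> y] 1 - Poly_Mapping.single [x] 1 - Poly_Mapping.single [y] 1
        | x y. x \<in> carrier (LL Q) \<and> y \<in> carrier (LL Q)} \<union>
     {Poly_Mapping.single [c \<odot>\<^bsub>LL Q\<^esub> x] 1 - Poly_Mapping.single [x] c | c x. x \<in> carrier (LL Q)} \<union>
     {Poly_Mapping.single [a, b] 1 - Poly_Mapping.single [b, a] (braid_sign Q \<alpha> \<beta>)
        - Poly_Mapping.single [a \<otimes>\<^bsub>LL Q\<^esub> b] 1 | a b \<alpha> \<beta>. a \<in> LL_comp Q \<alpha> \<and> b \<in> LL_comp Q \<beta>})"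

type_synonym 'v env = "'v words set"

definition UU :: "('v, 'a) pre_digraph \<Rightarrow> (rat, 'v env) module" where
  "UU Q = quot_module (word_alg Q) (env_ideal Q)"

definition UU_gen :: "('v, 'a) pre_digraph \<Rightarrow> 'v \<times> int \<Rightarrow> 'v env" where
  "UU_gen Q g = env_ideal Q +>\<^bsub>word_alg Q\<^esub> Poly_Mapping.single [LL_gen Q g] 1"


section \<open>The principal free vertex algebra and its subspaces\<close>

definition vac_ideal :: "('v, 'a) pre_digraph \<Rightarrow> 'v env set" where
  "vac_ideal Q = lin_span (UU Q)
     {u \<otimes>\<^bsub>UU Q\<^esub> UU_gen Q (i, n) | u i n. u \<in> carrier (UU Q) \<and> i \<in> verts Q \<and> n \<ge> 0}"

type_synonym 'v pfva = "'v env set"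

definition PP :: "('v, 'a) pre_digraph \<Rightarrow> (rat, 'v pfva) module" where
  "PP Q = quot_module (UU Q) (vac_ideal Q)"

definition vacuum :: "('v, 'a) pre_digraph \<Rightarrow> 'v pfva" where
  "vacuum Q = vac_ideal Q +>\<^bsub>UU Q\<^esub> \<one>\<^bsub>UU Q\<^esub>"

text \<open>\<open>word_vec Q [(i\<^sub>1,n\<^sub>1),\<dots>,(i\<^sub>p,n\<^sub>p)]\<close> is \<open>i\<^sub>1(n\<^sub>1) \<cdots> i\<^sub>p(n\<^sub>p) 1\<close>.\<close>

definition word_vec :: "('v, 'a) pre_digraph \<Rightarrow> ('v \<times> int) list \<Rightarrow> 'v pfva" where
  "word_vec Q gs = foldr (\<lambda>g. left_act (UU Q) (vac_ideal Q) (UU_gen Q g)) gs (vacuum Q)"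

text \<open>The cohomological degree is \<open>-2\<close> times the weight.\<close>

definition PP_piece :: "('v, 'a) pre_digraph \<Rightarrow> ('v \<Rightarrow> int) \<Rightarrow> int \<Rightarrow> 'v pfva set" where
  "PP_piece Q \<alpha> n = lin_span (PP Q)
     {word_vec Q gs | gs. set gs \<subseteq> symbols Q \<and> (\<Sum>g\<leftarrow>gs. basis_vec (fst g)) = \<alpha> \<and>
        of_int n = - 2 * (\<Sum>g\<leftarrow>gs. weight Q g)}"

definition QQ_space :: "('v, 'a) pre_digraph \<Rightarrow> ('v \<Rightarrow> nat) \<Rightarrow> 'v pfva set" where
  "QQ_space Q w = lin_span (PP Q)
     {word_vec Q gs | gs. set gs \<subseteq> {(i, n). i \<in> verts Q \<and> n \<ge> - int (w i)}}"

definition QQ :: "('v, 'a) pre_digraph \<Rightarrow> ('v \<Rightarrow> nat) \<Rightarrow> (rat, 'v pfva) module" where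
  "QQ Q w = PP Q\<lparr>carrier := QQ_space Q w\<rparr>"

definition QQ_piece ::
  "('v, 'a) pre_digraph \<Rightarrow> ('v \<Rightarrow> nat) \<Rightarrow> ('v \<Rightarrow> int) \<Rightarrow> int \<Rightarrow> 'v pfva set" where
  "QQ_piece Q w \<alpha> n = QQ_space Q w \<inter> PP_piece Q \<alpha> n"

definition dual_restrict ::
  "('v, 'a) pre_digraph \<Rightarrow> ('v \<Rightarrow> nat) \<Rightarrow> ('v pfva \<Rightarrow> rat) \<Rightarrow> 'v pfva \<Rightarrow> rat" where
  "dual_restrict Q w \<xi> = (\<lambda>x. if x \<in> QQ_space Q w then \<xi> x else 0)"


section \<open>The cohomological Hall algebra\<close>

text \<open>Rational polynomials in variables \<open>x\<^sub>i\<^sub>,\<^sub>k\<close>, indexed by pairs \<open>(i, k)\<close>.\<close>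

type_synonym 'v mpoly = "(('v \<times> nat) \<Rightarrow>\<^sub>0 nat) \<Rightarrow>\<^sub>0 rat"

definition var :: "'v \<times> nat \<Rightarrow> 'v mpoly" where
  "var x = Poly_Mapping.single (Poly_Mapping.single x 1) 1"

definition rename :: "('v \<times> nat \<Rightarrow> 'v \<times> nat) \<Rightarrow> 'v mpoly \<Rightarrow> 'v mpoly" where
  "rename \<tau> f = (\<Sum>m\<in>Poly_Mapping.keys f.
     Poly_Mapping.single
       (\<Sum>x\<in>Poly_Mapping.keys m. Poly_Mapping.single (\<tau> x) (Poly_Mapping.lookup m x))
       (Poly_Mapping.lookup f m))"

definition Lam :: "('v \<Rightarrow> nat) \<Rightarrow> 'v mpoly set" where
  "Lam d = {f. (\<forall>m\<in>Poly_Mapping.keys f. Poly_Mapping.keys m \<subseteq> {(i, k). k \<in> {1..d i}}) \<and>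
     (\<forall>\<sigma>. (\<forall>i. \<sigma> i permutes {1..d i}) \<longrightarrow> rename (\<lambda>(i, k). (i, \<sigma> i k)) f = f)}"

text \<open>The homogeneous part of degree \<open>n\<close>, with all variables of degree \<open>2\<close>.\<close>

definition Lam_piece :: "('v \<Rightarrow> nat) \<Rightarrow> int \<Rightarrow> 'v mpoly set" where
  "Lam_piece d n = {f \<in> Lam d. \<forall>m\<in>Poly_Mapping.keys f.
     2 * (\<Sum>x\<in>Poly_Mapping.keys m. int (Poly_Mapping.lookup m x)) = n}"

definition shuffles_of :: "('v \<Rightarrow> nat) \<Rightarrow> ('v \<Rightarrow> nat) \<Rightarrow> ('v \<Rightarrow> nat \<Rightarrow> nat) set" where
  "shuffles_of d e = {\<sigma>. \<forall>i. \<sigma> i permutes {1..d i + e i} \<and>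
     strict_mono_on {1..d i} (\<sigma> i) \<and> strict_mono_on {d i + 1..d i + e i} (\<sigma> i)}"

text \<open>
  The image under \<open>\<sigma>\<close> of the kernel \<open>K\<close>, a rational function: \<open>\<sigma>\<close> maps \<open>x\<^sub>i\<^sub>,\<^sub>k\<close> to the variable
  \<open>(i, \<sigma>\<^sub>i(k))\<close> and \<open>y\<^sub>j\<^sub>,\<^sub>l\<close> to the variable \<open>(j, \<sigma>\<^sub>j(d\<^sub>j + l))\<close>.
\<close>

definition shuffle_kernel ::
  "('v::linorder, 'a) pre_digraph \<Rightarrow> ('v \<Rightarrow> nat) \<Rightarrow> ('v \<Rightarrow> nat) \<Rightarrow> ('v \<Rightarrow> nat \<Rightarrow> nat)
    \<Rightarrow> 'v mpoly fract" where
  "shuffle_kernel Q d e \<sigma> =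
     (\<Prod>i\<in>verts Q. \<Prod>j\<in>verts Q. \<Prod>k\<in>{1..d i}. \<Prod>l\<in>{1..e j}.
        Fract (var (j, \<sigma> j (d j + l)) - var (i, \<sigma> i k)) 1
          powi (- euler_form Q (basis_vec i) (basis_vec j)))"

definition shuffle_sum ::
  "('v::linorder, 'a) pre_digraph \<Rightarrow> ('v \<Rightarrow> nat) \<Rightarrow> ('v \<Rightarrow> nat) \<Rightarrow> 'v mpoly \<Rightarrow> 'v mpoly
    \<Rightarrow> 'v mpoly fract" where
  "shuffle_sum Q d e f g = (\<Sum>\<sigma>\<in>shuffles_of d e.
     Fract (rename (\<lambda>(i, k). (i, \<sigma> i k)) f) 1 *
     Fract (rename (\<lambda>(i, k). (i, \<sigma> i (d i + k))) g) 1 *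
     shuffle_kernel Q d e \<sigma>)"

text \<open>For symmetric polynomials \<open>f\<close> and \<open>g\<close> the shuffle sum is a polynomial.\<close>

definition shuffle_prod ::
  "('v::linorder, 'a) pre_digraph \<Rightarrow> ('v \<Rightarrow> nat) \<Rightarrow> ('v \<Rightarrow> nat) \<Rightarrow> 'v mpoly \<Rightarrow> 'v mpoly
    \<Rightarrow> 'v mpoly" where
  "shuffle_prod Q d e f g = (THE h. Fract h 1 = shuffle_sum Q d e f g)"

type_synonym 'v coha = "('v \<Rightarrow> nat) \<Rightarrow>\<^sub>0 'v mpoly"

definition HH :: "('v::linorder, 'a) pre_digraph \<Rightarrow> (rat, 'v coha) module" where
  "HH Q =
    \<lparr>carrier = {h. \<forall>d\<in>Poly_Mapping.keys h. d \<in> dimvecs Q \<and> Poly_Mapping.lookup h d \<in> Lam d},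
     mult = (\<lambda>f g. \<Sum>d\<in>Poly_Mapping.keys f. \<Sum>e\<in>Poly_Mapping.keys g.
       Poly_Mapping.single (d + e)
         (shuffle_prod Q d e (Poly_Mapping.lookup f d) (Poly_Mapping.lookup g e))),
     one = Poly_Mapping.single 0 1, zero = 0, add = (+),
     smult = (\<lambda>c. Poly_Mapping.map (Poly_Mapping.map ((*) c)))\<rparr>"

definition HH_piece ::
  "('v::linorder, 'a) pre_digraph \<Rightarrow> ('v \<Rightarrow> int) \<Rightarrow> int \<Rightarrow> 'v coha set" where
  "HH_piece Q \<alpha> n = {h \<in> carrier (HH Q). \<forall>d\<in>Poly_Mapping.keys h.
     ldim d = \<alpha> \<and> Poly_Mapping.lookup h d \<in> Lam_piece d (n - euler_form Q (ldim d) (ldim d))}"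

definition euler_class :: "('v, 'a) pre_digraph \<Rightarrow> ('v \<Rightarrow> nat) \<Rightarrow> ('v \<Rightarrow> nat) \<Rightarrow> 'v mpoly" where
  "euler_class Q w d = (\<Prod>i\<in>verts Q. \<Prod>k\<in>{1..d i}. var (i, k) ^ w i)"

definition MM_ideal :: "('v::linorder, 'a) pre_digraph \<Rightarrow> ('v \<Rightarrow> nat) \<Rightarrow> 'v coha set" where
  "MM_ideal Q w = lin_span (HH Q)
     {h \<otimes>\<^bsub>HH Q\<^esub> Poly_Mapping.single d (euler_class Q w d * f) | h d f.
        h \<in> carrier (HH Q) \<and> d \<in> dimvecs Q \<and> d \<noteq> 0 \<and> f \<in> Lam d}"

definition MM :: "('v::linorder, 'a) pre_digraph \<Rightarrow> ('v \<Rightarrow> nat) \<Rightarrow> (rat, 'v coha set) module" where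
  "MM Q w = quot_module (HH Q) (MM_ideal Q w)"

definition MM_proj :: "('v::linorder, 'a) pre_digraph \<Rightarrow> ('v \<Rightarrow> nat) \<Rightarrow> 'v coha \<Rightarrow> 'v coha set" where
  "MM_proj Q w h = MM_ideal Q w +>\<^bsub>HH Q\<^esub> h"

definition MM_piece ::
  "('v::linorder, 'a) pre_digraph \<Rightarrow> ('v \<Rightarrow> nat) \<Rightarrow> ('v \<Rightarrow> int) \<Rightarrow> int \<Rightarrow> 'v coha set set" where
  "MM_piece Q w \<alpha> n = MM_proj Q w ` HH_piece Q \<alpha> n"


section \<open>Correlation functions\<close>

text \<open>
  The variables \<open>x\<^sub>j\<^sub>,\<^sub>k\<close> in the order in which they are substituted for \<open>z\<^sub>1,\<dots>,z\<^sub>p\<close>; the first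
  components form the sequence \<open>i\<^sub>1,\<dots>,i\<^sub>p\<close>. Positions are counted from \<open>0\<close>.
\<close>

definition var_list :: "('v::linorder, 'a) pre_digraph \<Rightarrow> ('v \<Rightarrow> nat) \<Rightarrow> ('v \<times> nat) list" where
  "var_list Q d =
     concat (map (\<lambda>j. map (\<lambda>k. (j, k)) [1..<d j + 1]) (sorted_list_of_set (verts Q)))"

text \<open>
  A formal distribution in \<open>z\<^sub>1,\<dots>,z\<^sub>p\<close> is its family of coefficients, indexed by lists of \<open>p\<close>
  exponents. The coefficient of \<open>z\<^sup>m\<close> in \<open>Y(i\<^sub>1,z\<^sub>1) \<cdots> Y(i\<^sub>p,z\<^sub>p)1\<close> comes from the
  modes \<open>n\<^sub>k = - m\<^sub>k - 1\<close>.
\<close>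

definition correlator ::
  "('v, 'a) pre_digraph \<Rightarrow> 'v list \<Rightarrow> ('v pfva \<Rightarrow> rat) \<Rightarrow> int list \<Rightarrow> rat" where
  "correlator Q is \<xi> m = \<xi> (word_vec Q (zip is (map (\<lambda>a. - a - 1) m)))"

text \<open>
  Multiplication by \<open>(z\<^sub>k - z\<^sub>l)\<^sup>N = \<Sum>\<^sub>r (-1)\<^sup>r (N gchoose r) z\<^sub>k\<^bsup>N-r\<^esup> z\<^sub>l\<^sup>r\<close>. On the distributions
  at hand, which are Laurent series in \<open>z\<^sub>p\<close> over Laurent series in \<open>z\<^sub>p\<^sub>-\<^sub>1\<close> and so on, only
  finitely many \<open>r\<close> contribute to each coefficient, and the order of such factors is irrelevant.
\<close>

definition mult_diff_power ::
  "nat \<Rightarrow> nat \<Rightarrow> int \<Rightarrow> (int list \<Rightarrow> rat) \<Rightarrow> int list \<Rightarrow> rat" where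
  "mult_diff_power k l N f m = Sum_any (\<lambda>r::nat.
     (-1) ^ r * (of_int N gchoose r) * f (m[k := m ! k - N + int r, l := m ! l - int r]))"

definition F_series ::
  "('v::linorder, 'a) pre_digraph \<Rightarrow> ('v \<Rightarrow> nat) \<Rightarrow> ('v pfva \<Rightarrow> rat) \<Rightarrow> int list \<Rightarrow> rat" where
  "F_series Q d \<xi> = (let is = map fst (var_list Q d) in
     foldr (\<lambda>(k, l). mult_diff_power k l (NN Q (is ! k) (is ! l)))
       [(k, l). l \<leftarrow> [0..<length is], k \<leftarrow> [0..<l]]
       (correlator Q is \<xi>))"

text \<open>The coefficient in a polynomial of the Laurent monomial with exponents \<open>m\<close>.\<close>

definition poly_series :: "('v \<times> nat) list \<Rightarrow> 'v mpoly \<Rightarrow> int list \<Rightarrow> rat" where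
  "poly_series xs f m = (if \<forall>a\<in>set m. a \<ge> 0
     then Poly_Mapping.lookup f (\<Sum>k<length xs. Poly_Mapping.single (xs ! k) (nat (m ! k)))
     else 0)"

definition is_F ::
  "('v::linorder, 'a) pre_digraph \<Rightarrow> (('v pfva \<Rightarrow> rat) \<Rightarrow> 'v coha) \<Rightarrow> bool" where
  "is_F Q F \<longleftrightarrow> (\<forall>d\<in>dimvecs Q. \<forall>\<xi>\<in>gdual_comp (PP Q) (PP_piece Q) (ldim d).
     Poly_Mapping.keys (F \<xi>) \<subseteq> {d} \<and>
     (\<forall>m. length m = length (var_list Q d) \<longrightarrow>
        poly_series (var_list Q d) (Poly_Mapping.lookup (F \<xi>) d) m = F_series Q d \<xi> m))"

end

theory Submission
  imports Defs "HOL-Computational_Algebra.Formal_Power_Series"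
begin

hide_const (open) Multiset.mult

text \<open>
  A functional on \<open>\<P>\<^sub>Q\<close> is the same as a system \<open>\<Phi>\<close> of values on the words
  \<open>i\<^sub>1(n\<^sub>1) \<cdots> i\<^sub>p(n\<^sub>p)\<close> which satisfies the locality relations and vanishes on words whose last mode
  is non-negative. For a fixed sequence of colours, such a system is a family of formal distributions,
  one for each order of the variables; after multiplication by
  \<open>\<Prod> (z\<^sub>k - z\<^sub>l)\<^bsup>\<N>\<^esup>\<close> all of them agree, so that the result is a symmetric Laurent series which is
  regular in every variable, and a polynomial if the degrees are bounded. Conversely a symmetric
  polynomial divided by the product is expanded in the region given by each order. This is \<open>F\<close>.

  In these terms the value of \<open>f * g\<close> on a word is the sum over all subwords of the product of the
  values of \<open>f\<close> on the subword and of \<open>g\<close> on its complement, up to sign. A functional in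
  \<open>e\<^sup>w \<Lambda>\<close> vanishes on words whose last mode \<open>i(n)\<close> has \<open>n \<ge> -w\<^sub>i\<close>, hence the ideal annihilates
  \<open>\<Q>\<^sub>w\<close>. For the converse let \<open>\<Phi>\<close> vanish on all words \<open>ab\<close> with \<open>b\<close> in the modes \<open>X\<^sub>w\<close> and \<open>a\<close> of length
  less than \<open>c\<close>. For words \<open>a\<close> of length \<open>c\<close>, the function \<open>a \<mapsto> \<Phi>(ab)\<close> comes from a polynomial
  in \<open>e\<^sup>w \<Lambda>\<close> of bounded degree, while \<open>b \<mapsto> \<Phi>(ab)\<close> comes from a polynomial. So \<open>\<Phi>\<close> can be
  corrected by finitely many products in the ideal, and \<open>c\<close> increases until \<open>\<Phi> = 0\<close>.
\<close>

section \<open>Multiplication by powers of differences\<close>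

text \<open>The Lie algebra and its enveloping algebra are known only by generators and relations,
  so a functional cannot be prescribed on a basis. Instead the generators act from the right on
  functions of words; the relations act by zero on local functions, and a system
  \<open>\<Phi>\<close> defines a functional by evaluation at the empty word after the action. The
  exponents \<open>NN Q i j\<close> are at least -1, with -1 only for equal colours: there locality
  is a mere sign, and the resulting antisymmetry makes both expansions of the inverse factor agree.
  Total degrees of a system are bounded below on words of a given content; the finiteness condition
  in the graded dual supplies the upper bound that makes regular parts polynomials. The formula for
  \<open>f * g\<close> holds because the kernel \<open>K\<close> cancels, up to sign, the
  denominators of pairs with one variable from each factor. It also yields polynomiality: the sum
  over subwords comes from a polynomial, which is then identified with the shuffle sum as a rational
  function. In the induction on \<open>c\<close> the degree of the prefix part is bounded uniformly
  in \<open>b\<close>, so finitely many products suffice.\<close>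

type_synonym 'x distr = "('x \<Rightarrow> int) \<Rightarrow> rat"
type_synonym 'v shuffle = "'v \<Rightarrow> nat \<Rightarrow> nat"
type_synonym 'v corr_fun = "('v \<times> int) list \<Rightarrow> rat"

abbreviation "lookup \<equiv> Poly_Mapping.lookup"
abbreviation "single \<equiv> Poly_Mapping.single"
abbreviation "keys \<equiv> Poly_Mapping.keys"
abbreviation "scaled c \<equiv> Poly_Mapping.map ((*) c)"

text \<open>The term \<open>z_x^(N-r) z_y^r\<close> of the expansion carries the coefficient of
  \<open>f\<close> at \<open>m - (N-r) e_x - r e_y\<close> to the exponent \<open>m\<close>. As
  \<open>r\<close> grows, \<open>x\<close> gains what \<open>y\<close> loses.\<close>

definition shift_vec :: "'x \<Rightarrow> 'x \<Rightarrow> int \<Rightarrow> nat \<Rightarrow> 'x \<Rightarrow> int" where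
  "shift_vec x y N r = (\<lambda>z. (if z = x then int r - N else 0) - (if z = y then int r else 0))"

definition diff_coeff :: "int \<Rightarrow> nat \<Rightarrow> rat" where
  "diff_coeff N r = (-1) ^ r * (of_int N gchoose r)"

definition diff_power :: "'x \<Rightarrow> 'x \<Rightarrow> int \<Rightarrow> 'x distr \<Rightarrow> 'x distr" where
  "diff_power x y N f m = Sum_any (\<lambda>r. diff_coeff N r * f (m + shift_vec x y N r))"

text \<open>
  Multiplication by \<open>(z\<^sub>x - z\<^sub>y)\<^sup>N\<close>, expanded in non-negative powers of \<open>z\<^sub>y\<close>, is a finite sum on
  distributions whose exponents have bounded-below sums over some set which contains \<open>y\<close> but not \<open>x\<close>.
  One bound for all sets in \<open>\<U>\<close> makes these operators commute.
\<close>

definition bdd_support :: "'x set set \<Rightarrow> 'x distr \<Rightarrow> bool" where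
  "bdd_support \<U> f \<longleftrightarrow> (\<exists>c. \<forall>m. f m \<noteq> 0 \<longrightarrow> (\<forall>U\<in>\<U>. c \<le> sum m U))"

text \<open>A set of \<open>\<U>\<close> may contain \<open>x\<close> only together with
  \<open>y\<close>; otherwise a shift of index \<open>r\<close> would raise the sum over it by
  \<open>r - N\<close>, and bounded support would not survive the multiplication. The separating set
  makes the sum over \<open>r\<close> finite.\<close>

definition precedes :: "'x set set \<Rightarrow> 'x \<Rightarrow> 'x \<Rightarrow> bool" where
  "precedes \<U> x y \<longleftrightarrow> (\<forall>U\<in>\<U>. finite U) \<and> (\<forall>U\<in>\<U>. x \<in> U \<longrightarrow> y \<in> U) \<and> (\<exists>U\<in>\<U>. y \<in> U \<and> x \<notin> U)"

lemma diff_coeff_0 [simp]: "diff_coeff N 0 = 1" by (simp add: diff_coeff_def)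

lemma diff_coeff_zero: "r > 0 \<Longrightarrow> diff_coeff 0 r = 0" by (cases r) (simp_all add: diff_coeff_def)

lemma diff_coeff_nat: "diff_coeff (int N) r = (-1) ^ r * of_nat (N choose r)"
  by (simp add: diff_coeff_def binomial_gbinomial)

lemma diff_coeff_minus_one: "diff_coeff (-1) r = 1"
proof -
  have "((-1::rat) gchoose r) = (-1) ^ r * (of_nat r gchoose r)"
    using gbinomial_negated_upper[of "-1::rat" r] by simp
  also have "\<dots> = (-1) ^ r" by (metis binomial_gbinomial binomial_n_n mult.right_neutral of_nat_1)
  finally show ?thesis by (simp add: diff_coeff_def flip: power_mult_distrib)
qed

lemma diff_coeff_Vandermonde:
  "(\<Sum>k\<le>n. diff_coeff N k * diff_coeff M (n - k)) = diff_coeff (N + M) n"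
proof -
  have "(\<Sum>k\<le>n. diff_coeff N k * diff_coeff M (n - k))
      = (-1) ^ n * (\<Sum>k\<le>n. (of_int N gchoose k) * (of_int M gchoose (n - k)))" unfolding sum_distrib_left
  proof (rule sum.cong[OF refl])
    fix k assume "k \<in> {..n}"
    then have "((-1)::rat) ^ n = (-1) ^ k * (-1) ^ (n - k)" by (simp flip: power_add)
    then show "diff_coeff N k * diff_coeff M (n - k)
        = (-1) ^ n * ((of_int N gchoose k) * (of_int M gchoose (n - k)))"
      by (simp add: diff_coeff_def mult_ac)
  qed
  then show ?thesis using gbinomial_Vandermonde[of "of_int N :: rat" "of_int M" n]
    by (simp add: diff_coeff_def atMost_atLeast0)
qed

lemma sum_shift_vec:
  "finite U \<Longrightarrow> sum (shift_vec x y N r) U = (if x \<in> U then int r - N else 0) - (if y \<in> U then int r else 0)"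
  by (simp add: shift_vec_def sum_subtractf)

lemma sum_plus_fun: "sum (m + m' :: 'x \<Rightarrow> int) U = sum m U + sum m' U" by (simp add: sum.distrib)

lemma shift_vec_le:
  assumes "precedes \<U> x y" "U \<in> \<U>"
  shows "sum (shift_vec x y N r) U \<le> \<bar>N\<bar>" using assms by (auto simp: sum_shift_vec precedes_def)

lemma finite_nat_bounded:
  assumes "\<And>r. r \<in> A \<Longrightarrow> int r \<le> B"
  shows "finite A"
proof (rule finite_subset)
  show "A \<subseteq> {..nat B}" using assms by fastforce
qed simp

lemma diff_power_finite:
  assumes "bdd_support \<U> f" "precedes \<U> x y"
  shows "finite {r. f (m + shift_vec x y N r) \<noteq> 0}"
proof -
  obtain c where c: "\<And>m U. f m \<noteq> 0 \<Longrightarrow> U \<in> \<U> \<Longrightarrow> c \<le> sum m U" using assms(1) by (auto simp: bdd_support_def)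
  obtain U where U: "U \<in> \<U>" "y \<in> U" "x \<notin> U" "finite U" using assms(2) by (auto simp: precedes_def)
  show ?thesis
  proof (rule finite_nat_bounded)
    fix r assume "r \<in> {r. f (m + shift_vec x y N r) \<noteq> 0}"
    then have "c \<le> sum (m + shift_vec x y N r) U" using c U(1) by blast
    also have "\<dots> = sum m U - int r" using U by (simp only: sum_plus_fun sum_shift_vec) simp
    finally have "c \<le> sum m U - int r" .
    then show "int r \<le> sum m U - c" by simp
  qed
qed

lemma diff_power_finite':
  assumes "bdd_support \<U> f" "precedes \<U> x y"
  shows "finite {r. a r * f (m + shift_vec x y N r) \<noteq> 0}"
  by (rule finite_subset[OF _ diff_power_finite[OF assms, of m N]]) auto

lemma Sum_any_nonzero: "Sum_any g \<noteq> 0 \<Longrightarrow> \<exists>r. g r \<noteq> 0" using Sum_any.not_neutral_obtains_not_neutral by blast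

lemma diff_power_nonzero:
  "diff_power x y N f m \<noteq> 0 \<Longrightarrow> \<exists>r. f (m + shift_vec x y N r) \<noteq> 0"
  using Sum_any_nonzero[of "\<lambda>r. diff_coeff N r * f (m + shift_vec x y N r)"] by (auto simp: diff_power_def)

lemma bdd_support_diff_power:
  assumes "bdd_support \<U> f" "precedes \<U> x y"
  shows "bdd_support \<U> (diff_power x y N f)"
proof -
  obtain c where c: "\<And>m U. f m \<noteq> 0 \<Longrightarrow> U \<in> \<U> \<Longrightarrow> c \<le> sum m U" using assms(1) by (auto simp: bdd_support_def)
  have "c - \<bar>N\<bar> \<le> sum m U" if nz: "diff_power x y N f m \<noteq> 0" and U: "U \<in> \<U>" for m U
  proof -
    obtain r where "f (m + shift_vec x y N r) \<noteq> 0" using diff_power_nonzero[OF nz] by blast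
    then have "c \<le> sum m U + sum (shift_vec x y N r) U"
      using c[OF _ U] unfolding sum_plus_fun[symmetric] by blast
    with shift_vec_le[OF assms(2) U, of N r] show ?thesis by linarith
  qed
  then show ?thesis unfolding bdd_support_def by blast
qed

lemma bdd_support_Un:
  assumes "bdd_support \<U> f" "bdd_support \<V> f"
  shows "bdd_support (\<U> \<union> \<V>) f"
proof -
  obtain c where c: "\<And>m U. f m \<noteq> 0 \<Longrightarrow> U \<in> \<U> \<Longrightarrow> c \<le> sum m U" using assms(1) by (auto simp: bdd_support_def)
  obtain d where d: "\<And>m U. f m \<noteq> 0 \<Longrightarrow> U \<in> \<V> \<Longrightarrow> d \<le> sum m U" using assms(2) by (auto simp: bdd_support_def)
  have "\<forall>m. f m \<noteq> 0 \<longrightarrow> (\<forall>U\<in>\<U> \<union> \<V>. min c d \<le> sum m U)" using c d by (metis UnE min.coboundedI1 min.coboundedI2)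
  then show ?thesis unfolding bdd_support_def by blast
qed

lemma bdd_support_add:
  assumes "bdd_support \<U> f" "bdd_support \<U> g"
  shows "bdd_support \<U> (\<lambda>m. f m + g m)"
proof -
  obtain c where c: "\<And>m U. f m \<noteq> 0 \<Longrightarrow> U \<in> \<U> \<Longrightarrow> c \<le> sum m U" using assms(1) by (auto simp: bdd_support_def)
  obtain d where d: "\<And>m U. g m \<noteq> 0 \<Longrightarrow> U \<in> \<U> \<Longrightarrow> d \<le> sum m U" using assms(2) by (auto simp: bdd_support_def)
  have "min c d \<le> sum m U" if "f m + g m \<noteq> 0" "U \<in> \<U>" for m U
  proof -
    from that have "f m \<noteq> 0 \<or> g m \<noteq> 0" by auto
    then show ?thesis using c d that(2) by (metis min.coboundedI1 min.coboundedI2)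
  qed
  then show ?thesis unfolding bdd_support_def by blast
qed

lemma bdd_support_zero [simp]: "bdd_support \<U> (\<lambda>m. 0)" by (simp add: bdd_support_def)

lemma bdd_support_scale: "bdd_support \<U> f \<Longrightarrow> bdd_support \<U> (\<lambda>m. c * f m)"
  unfolding bdd_support_def by (metis mult_zero_right)

lemma bdd_support_sum:
  "(\<And>i. i \<in> A \<Longrightarrow> bdd_support \<U> (f i)) \<Longrightarrow> bdd_support \<U> (\<lambda>m. \<Sum>i\<in>A. f i m)"
  by (induction A rule: infinite_finite_induct) (simp_all add: bdd_support_add)

lemma diff_power_zero_fun [simp]: "diff_power x y N (\<lambda>m. 0) = (\<lambda>m. 0)"
  by (simp add: diff_power_def fun_eq_iff)

lemma diff_power_add:
  assumes "bdd_support \<U> f" "bdd_support \<U> g" "precedes \<U> x y"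
  shows "diff_power x y N (\<lambda>m. f m + g m) = (\<lambda>m. diff_power x y N f m + diff_power x y N g m)"
  unfolding diff_power_def distrib_left
  by (rule ext, rule Sum_any.distrib) (rule diff_power_finite'[OF _ assms(3)], fact)+

lemma Sum_any_mult_field:
  fixes c :: "'a::field"
  shows "Sum_any (\<lambda>r. c * g r) = c * Sum_any g"
proof (cases "c = 0")
  case False
  then have "{r. c * g r \<noteq> 0} = {r. g r \<noteq> 0}" by auto
  then show ?thesis by (simp add: Sum_any.expand_set sum_distrib_left)
qed simp

lemma diff_power_scale: "diff_power x y N (\<lambda>m. c * f m) = (\<lambda>m. c * diff_power x y N f m)"
  unfolding diff_power_def by (simp flip: Sum_any_mult_field add: mult.left_commute)

lemma diff_power_sum:
  assumes "\<And>i. i \<in> A \<Longrightarrow> bdd_support \<U> (f i)" "precedes \<U> x y"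
  shows "diff_power x y N (\<lambda>m. \<Sum>i\<in>A. f i m) = (\<lambda>m. \<Sum>i\<in>A. diff_power x y N (f i) m)" using assms
proof (induction A rule: infinite_finite_induct)
  case (insert i A)
  then show ?case using diff_power_add[of \<U> "f i" "\<lambda>m. \<Sum>i\<in>A. f i m" x y N] bdd_support_sum[of A \<U> f] by simp
qed simp_all

lemma diff_power_mult_const:
  assumes "\<And>r. g (m + shift_vec x y N r) = g m"
  shows "diff_power x y N (\<lambda>m. f m * g m) m = diff_power x y N f m * g m" unfolding diff_power_def assms
  using Sum_any_mult_field[of "g m" "\<lambda>r. diff_coeff N r * f (m + shift_vec x y N r)"] by (simp add: mult_ac)

lemma diff_power_0 [simp]: "diff_power x y 0 f = f"
proof
  fix m
  have "shift_vec x y 0 0 = (\<lambda>z. 0)" by (auto simp: shift_vec_def)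
  then have "f (m + shift_vec x y 0 0) = f m" by (simp add: plus_fun_def)
  then have "(\<lambda>r. diff_coeff 0 r * f (m + shift_vec x y 0 r)) = (\<lambda>r. f m when r = 0)"
    by (auto simp: fun_eq_iff when_def diff_coeff_zero)
  then have "diff_power x y 0 f m = Sum_any (\<lambda>r. f m when r = (0::nat))"
    unfolding diff_power_def by (rule arg_cong)
  then show "diff_power x y 0 f m = f m" by simp
qed

text \<open>The separating set of each pair bounds the index of that pair, up to the bounded effect
  of the other shift. So finitely many \<open>(r, s)\<close> contribute and the two sums may be
  exchanged.\<close>

lemma diff_power_commute:
  assumes f: "bdd_support \<U> f" and xy: "precedes \<U> x y" and uv: "precedes \<U> u v"
  shows "diff_power x y N (diff_power u v M f) = diff_power u v M (diff_power x y N f)"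
proof
  fix m
  obtain c where c: "\<And>m U. f m \<noteq> 0 \<Longrightarrow> U \<in> \<U> \<Longrightarrow> c \<le> sum m U" using f by (auto simp: bdd_support_def)
  define g where "g r s = diff_coeff N r * (diff_coeff M s * f (m + shift_vec x y N r + shift_vec u v M s))" for r s
  obtain U V where U: "U \<in> \<U>" "y \<in> U" "x \<notin> U" "finite U" and V: "V \<in> \<U>" "v \<in> V" "u \<notin> V" "finite V"
    using xy uv by (auto simp: precedes_def)
  have bound: "int r \<le> sum m U + \<bar>M\<bar> - c \<and> int s \<le> sum m V + \<bar>N\<bar> - c" if "g r s \<noteq> 0" for r s
  proof -
    have nz: "f (m + shift_vec x y N r + shift_vec u v M s) \<noteq> 0" using that by (auto simp: g_def)
    have "c \<le> sum m U + sum (shift_vec x y N r) U + sum (shift_vec u v M s) U"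
         "c \<le> sum m V + sum (shift_vec x y N r) V + sum (shift_vec u v M s) V"
      using c[OF nz U(1)] c[OF nz V(1)] unfolding sum_plus_fun by simp_all
    moreover have "sum (shift_vec x y N r) U = - int r" "sum (shift_vec u v M s) V = - int s"
      using U V by (simp_all add: sum_shift_vec)
    ultimately show ?thesis
      using shift_vec_le[OF uv U(1), of M s] shift_vec_le[OF xy V(1), of N r] by linarith
  qed
  have "finite {r. \<exists>s. g r s \<noteq> 0}" "finite {s. \<exists>r. g r s \<noteq> 0}"
    by (rule finite_nat_bounded, use bound in blast)+
  then have swap: "Sum_any (\<lambda>r. Sum_any (g r)) = Sum_any (\<lambda>s. Sum_any (\<lambda>r. g r s))"
    by (intro Sum_any.swap[of "{r. \<exists>s. g r s \<noteq> 0} \<times> {s. \<exists>r. g r s \<noteq> 0}"]) auto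
  have "diff_power x y N (diff_power u v M f) m = Sum_any (\<lambda>r. Sum_any (g r))"
    by (simp add: diff_power_def g_def Sum_any_mult_field)
  also have "\<dots> = diff_power u v M (diff_power x y N f) m"
    unfolding swap by (simp add: diff_power_def g_def Sum_any_mult_field mult.left_commute add_ac)
  finally show "diff_power x y N (diff_power u v M f) m = diff_power u v M (diff_power x y N f) m" .
qed

lemma shift_vec_add: "shift_vec x y N r + shift_vec x y M s = shift_vec x y (N + M) (r + s)"
  by (auto simp: shift_vec_def fun_eq_iff)

text \<open>Only \<open>r + s\<close> enters the argument of \<open>f\<close>, so the double sum is
  regrouped along \<open>t = r + s\<close> and each diagonal is evaluated by the Vandermonde
  convolution.\<close>

lemma diff_power_diff_power:
  assumes f: "bdd_support \<U> f" and xy: "precedes \<U> x y"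
  shows "diff_power x y N (diff_power x y M f) = diff_power x y (N + M) f"
proof
  fix m
  define F where "F t = f (m + shift_vec x y (N + M) t)" for t
  \<comment> \<open>One bound on \<open>t\<close> truncates all the sums, since \<open>r\<close> and
    \<open>s\<close> are at most \<open>r + s\<close>.\<close>
  obtain B where B: "\<And>t. F t \<noteq> 0 \<Longrightarrow> t \<le> B" using diff_power_finite[OF f xy, of m "N + M"] unfolding F_def
    by (metis (mono_tags, lifting) Max_ge mem_Collect_eq)
  have S: "Sum_any g = sum g {..B}" if "\<And>r. r > B \<Longrightarrow> g r = 0" for g :: "nat \<Rightarrow> rat"
    by (rule Sum_any.expand_superset) (use that not_le in \<open>auto intro: ccontr\<close>)
  have "diff_power x y N (diff_power x y M f) m
      = Sum_any (\<lambda>r. diff_coeff N r * Sum_any (\<lambda>s. diff_coeff M s * F (r + s)))"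
    by (simp add: diff_power_def F_def add.assoc shift_vec_add)
  also have "\<dots> = (\<Sum>r\<le>B. diff_coeff N r * Sum_any (\<lambda>s. diff_coeff M s * F (r + s)))"
  proof (rule S)
    fix r assume "r > B"
    then have "F (r + s) = 0" for s using B[of "r + s"] by force
    then show "diff_coeff N r * Sum_any (\<lambda>s. diff_coeff M s * F (r + s)) = 0" by simp
  qed
  also have "\<dots> = (\<Sum>r\<le>B. \<Sum>s\<le>B. diff_coeff N r * (diff_coeff M s * F (r + s)))"
    unfolding sum_distrib_left[symmetric]
    by (intro sum.cong refl arg_cong2[where f = "(*)"] S) (use B in fastforce)
  also have "\<dots> = (\<Sum>r\<le>B. \<Sum>t\<le>B. if r \<le> t then diff_coeff N r * diff_coeff M (t - r) * F t else 0)"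
  proof (rule sum.cong[OF refl])
    fix r assume "r \<in> {..B}"
    have "(\<Sum>t\<le>B. if r \<le> t then diff_coeff N r * diff_coeff M (t - r) * F t else 0)
        = (\<Sum>t\<in>{r..B}. diff_coeff N r * diff_coeff M (t - r) * F t)" by (rule sum.mono_neutral_cong_right) auto
    also have "\<dots> = (\<Sum>s\<in>{..B-r}. diff_coeff N r * diff_coeff M s * F (r + s))"
      by (rule sum.reindex_bij_witness[of _ "\<lambda>s. r + s" "\<lambda>t. t - r"]) (use \<open>r \<in> {..B}\<close> in auto)
    also have "\<dots> = (\<Sum>s\<le>B. diff_coeff N r * (diff_coeff M s * F (r + s)))"
    proof (rule sum.mono_neutral_cong_left)
      have "F (r + s) = 0" if "s \<in> {..B} - {..B - r}" for s using B[of "r + s"] that by fastforce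
      then show "\<forall>s\<in>{..B} - {..B - r}. diff_coeff N r * (diff_coeff M s * F (r + s)) = 0" by simp
    qed auto
    finally show "(\<Sum>s\<le>B. diff_coeff N r * (diff_coeff M s * F (r + s)))
        = (\<Sum>t\<le>B. if r \<le> t then diff_coeff N r * diff_coeff M (t - r) * F t else 0)" ..
  qed
  also have "\<dots> = (\<Sum>t\<le>B. \<Sum>r\<le>B. if r \<le> t then diff_coeff N r * diff_coeff M (t - r) * F t else 0)"
    by (rule sum.swap)
  also have "\<dots> = (\<Sum>t\<le>B. diff_coeff (N + M) t * F t)"
  proof (rule sum.cong[OF refl])
    fix t assume "t \<in> {..B}"
    then have "(\<Sum>r\<le>B. if r \<le> t then diff_coeff N r * diff_coeff M (t - r) * F t else 0)
        = (\<Sum>r\<le>t. diff_coeff N r * diff_coeff M (t - r) * F t)" by (intro sum.mono_neutral_cong_right) auto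
    then show "(\<Sum>r\<le>B. if r \<le> t then diff_coeff N r * diff_coeff M (t - r) * F t else 0)
        = diff_coeff (N + M) t * F t" by (simp flip: sum_distrib_right add: diff_coeff_Vandermonde)
  qed
  also have "\<dots> = diff_power x y (N + M) f m"
    unfolding diff_power_def F_def[symmetric] by (rule S[symmetric]) (use B in fastforce)
  finally show "diff_power x y N (diff_power x y M f) m = diff_power x y (N + M) f m" .
qed

lemma diff_power_nat:
  "diff_power x y (int N) f m = (\<Sum>r\<le>N. (-1) ^ r * of_nat (N choose r) * f (m + shift_vec x y (int N) r))"
  unfolding diff_power_def diff_coeff_nat
  by (rule Sum_any.expand_superset, simp, rule subsetI, rule ccontr) (simp add: binomial_eq_0)

text \<open>For a natural exponent the binomial expansion is finite, so the direction of expansion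
  is immaterial; the reflection \<open>r \<mapsto> N - r\<close> exchanges the two variables and
  leaves a sign.\<close>

lemma diff_power_flip:
  "diff_power y x (int N) f = (\<lambda>m. (-1) ^ N * diff_power x y (int N) f m)"
proof
  fix m
  have "diff_power y x (int N) f m
      = (\<Sum>r\<le>N. (-1) ^ (N - r) * of_nat (N choose (N - r)) * f (m + shift_vec y x (int N) (N - r)))"
    unfolding diff_power_nat by (rule sum.reindex_bij_witness[of _ "\<lambda>r. N - r" "\<lambda>r. N - r"]) auto
  also have "\<dots> = (\<Sum>r\<le>N. (-1) ^ N * ((-1) ^ r * of_nat (N choose r) * f (m + shift_vec x y (int N) r)))"
  proof (rule sum.cong[OF refl])
    fix r assume r: "r \<in> {..N}"
    have "shift_vec y x (int N) (N - r) = shift_vec x y (int N) r"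
      using r by (auto simp: shift_vec_def fun_eq_iff of_nat_diff)
    moreover have "((-1)::rat) ^ (N - r) = (-1) ^ N * (-1) ^ r" using r by (auto simp: minus_one_power_iff)
    ultimately show "(-1) ^ (N - r) * of_nat (N choose (N - r)) * f (m + shift_vec y x (int N) (N - r))
        = (-1) ^ N * ((-1) ^ r * of_nat (N choose r) * f (m + shift_vec x y (int N) r))"
      using r by (simp add: binomial_symmetric[symmetric])
  qed
  finally show "diff_power y x (int N) f m = (-1) ^ N * diff_power x y (int N) f m"
    by (simp add: diff_power_nat sum_distrib_left)
qed

text \<open>
  The two expansions of \<open>(z\<^sub>x - z\<^sub>y)\<^sup>-\<^sup>1 f\<close> differ by the sum of the coefficients of \<open>f\<close> along a line,
  which vanishes when \<open>f\<close> is antisymmetric.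
\<close>

lemma diff_power_inverse_antisym:
  fixes f :: "'x distr"
  assumes f: "bdd_support \<U> f"
    and U: "U \<in> \<U>" "finite U" "y \<in> U" "x \<notin> U" and V: "V \<in> \<U>" "finite V" "x \<in> V" "y \<notin> V"
    and anti: "\<And>m. f (m \<circ> transpose x y) = - f m"
  shows "diff_power y x (-1) f = (\<lambda>m. - diff_power x y (-1) f m)"
proof
  fix m :: "'x \<Rightarrow> int"
  have xy: "x \<noteq> y" using U by auto
  obtain c where c: "\<And>m U. f m \<noteq> 0 \<Longrightarrow> U \<in> \<U> \<Longrightarrow> c \<le> sum m U" using f by (auto simp: bdd_support_def)
  \<comment> \<open>The factor has degree -1, so the coefficients of \<open>f\<close> that reach
    \<open>m\<close> have exponents at \<open>x\<close> and \<open>y\<close> with sum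
    \<open>m x + m y + 1\<close>; \<open>\<phi>\<close> runs along this line.\<close>
  define s where "s = m x + m y + 1"
  define \<phi> where "\<phi> a = f (m(x := a, y := s - a))" for a :: int
  have s1: "m + shift_vec x y (-1) r = m(x := m x + 1 + int r, y := s - (m x + 1 + int r))" for r
    using xy by (auto simp: shift_vec_def s_def)
  have s2: "m + shift_vec y x (-1) r = m(x := m x - int r, y := s - (m x - int r))" for r
    using xy by (auto simp: shift_vec_def s_def)
  have refl: "\<phi> (s - a) = - \<phi> a" for a
  proof -
    have "m(x := a, y := s - a) \<circ> transpose x y = m(x := s - a, y := s - (s - a))"
      using xy by (auto simp: fun_eq_iff transpose_def)
    then show ?thesis using anti[of "m(x := a, y := s - a)"] by (simp add: \<phi>_def)
  qed
  have "finite {a. \<phi> a \<noteq> 0}"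
  proof (rule finite_subset)
    \<comment> \<open>\<open>V\<close> contains \<open>x\<close> but not \<open>y\<close> and bounds
      \<open>a\<close> from below; \<open>U\<close> contains \<open>y\<close> but not
      \<open>x\<close> and bounds \<open>s - a\<close> from below.\<close>
    show "{a. \<phi> a \<noteq> 0} \<subseteq> {c - sum m (V - {x}) .. s + sum m (U - {y}) - c}"
    proof
      fix a assume "a \<in> {a. \<phi> a \<noteq> 0}"
      then have a: "\<phi> a \<noteq> 0" by simp
      have "sum (m(x := a, y := s - a)) V = a + sum m (V - {x})"
        using V xy by (subst sum.remove[of V x]) (auto intro!: sum.cong split: if_splits)
      moreover have "sum (m(x := a, y := s - a)) U = s - a + sum m (U - {y})"
        using U xy by (subst sum.remove[of U y]) (auto intro!: sum.cong split: if_splits)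
      ultimately show "a \<in> {c - sum m (V - {x}) .. s + sum m (U - {y}) - c}"
        using c[OF a[unfolded \<phi>_def], of V] c[OF a[unfolded \<phi>_def], of U] U V by auto
    qed
  qed auto
  note fin = this
  \<comment> \<open>One expansion sums \<open>\<phi>\<close> over \<open>a > m x\<close>, the other
    over \<open>a \<le> m x\<close>. Together they give the sum over the whole line, which vanishes
    because \<open>a \<mapsto> s - a\<close> changes the sign of \<open>\<phi>\<close>.\<close>
  have A: "diff_power x y (-1) f m = sum \<phi> {a. \<phi> a \<noteq> 0 \<and> a > m x}"
  proof -
    have "diff_power x y (-1) f m = (\<Sum>r\<in>{r. \<phi> (m x + 1 + int r) \<noteq> 0}. \<phi> (m x + 1 + int r))"
      by (simp add: diff_power_def diff_coeff_minus_one s1 \<phi>_def[symmetric] Sum_any.expand_set)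
    also have "\<dots> = sum \<phi> {a. \<phi> a \<noteq> 0 \<and> a > m x}"
      by (rule sum.reindex_bij_witness[of _ "\<lambda>a. nat (a - m x - 1)" "\<lambda>r. m x + 1 + int r"]) auto
    finally show ?thesis .
  qed
  have B: "diff_power y x (-1) f m = sum \<phi> {a. \<phi> a \<noteq> 0 \<and> a \<le> m x}"
  proof -
    have "diff_power y x (-1) f m = (\<Sum>r\<in>{r. \<phi> (m x - int r) \<noteq> 0}. \<phi> (m x - int r))"
      by (simp add: diff_power_def diff_coeff_minus_one s2 \<phi>_def[symmetric] Sum_any.expand_set)
    also have "\<dots> = sum \<phi> {a. \<phi> a \<noteq> 0 \<and> a \<le> m x}"
      by (rule sum.reindex_bij_witness[of _ "\<lambda>a. nat (m x - a)" "\<lambda>r. m x - int r"]) auto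
    finally show ?thesis .
  qed
  have "sum \<phi> {a. \<phi> a \<noteq> 0} = sum (\<lambda>a. \<phi> (s - a)) {a. \<phi> a \<noteq> 0}"
    by (rule sum.reindex_bij_witness[of _ "\<lambda>a. s - a" "\<lambda>a. s - a"]) (auto simp: refl)
  then have "sum \<phi> {a. \<phi> a \<noteq> 0} = 0" by (simp add: refl sum_negf)
  moreover have "sum \<phi> {a. \<phi> a \<noteq> 0} = sum \<phi> {a. \<phi> a \<noteq> 0 \<and> a > m x} + sum \<phi> {a. \<phi> a \<noteq> 0 \<and> a \<le> m x}"
    using fin by (subst sum.union_disjoint[symmetric]) (auto intro!: sum.cong)
  ultimately show "diff_power y x (-1) f m = - diff_power x y (-1) f m" using A B by simp
qed

lemma diff_power_rename:
  fixes \<tau> :: "'x \<Rightarrow> 'y"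
  assumes "inj \<tau>"
  shows "diff_power (\<tau> x) (\<tau> y) N (\<lambda>m. f (m \<circ> \<tau>)) m = diff_power x y N f (m \<circ> \<tau>)"
proof -
  have "(m + shift_vec (\<tau> x) (\<tau> y) N r) \<circ> \<tau> = (m \<circ> \<tau>) + shift_vec x y N r" for r
    using assms by (auto simp: fun_eq_iff shift_vec_def inj_eq)
  then show ?thesis by (simp add: diff_power_def)
qed

section \<open>Products of difference powers along a list of pairs\<close>

definition diff_pows ::
  "('x \<Rightarrow> 'x \<Rightarrow> int) \<Rightarrow> ('x \<times> 'x) list \<Rightarrow> 'x distr \<Rightarrow> 'x distr" where
  "diff_pows \<nu> L = foldr (\<lambda>(x, y). diff_power x y (\<nu> x y)) L"

lemma diff_pows_Nil [simp]: "diff_pows \<nu> [] f = f" and diff_pows_Cons [simp]: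
    "diff_pows \<nu> ((x, y) # L) f = diff_power x y (\<nu> x y) (diff_pows \<nu> L f)"
  and diff_pows_append: "diff_pows \<nu> (L @ L') f = diff_pows \<nu> L (diff_pows \<nu> L' f)"
  by (simp_all add: diff_pows_def)

lemma bdd_support_diff_pows:
  assumes "bdd_support \<U> f" "\<And>x y. (x, y) \<in> set L \<Longrightarrow> precedes \<U> x y"
  shows "bdd_support \<U> (diff_pows \<nu> L f)" using assms(2)
proof (induction L)
  case (Cons p L)
  then show ?case by (cases p) (auto intro: bdd_support_diff_power)
qed (simp add: assms(1))

lemma diff_power_diff_pows_commute:
  assumes "bdd_support \<U> f" "\<And>u v. (u, v) \<in> set L \<Longrightarrow> precedes \<U> u v" "precedes \<U> x y"
  shows "diff_power x y N (diff_pows \<nu> L f) = diff_pows \<nu> L (diff_power x y N f)" using assms(2)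
proof (induction L)
  case (Cons p L)
  obtain u v where p: "p = (u, v)" by force
  have "diff_power x y N (diff_pows \<nu> (p # L) f)
      = diff_power u v (\<nu> u v) (diff_power x y N (diff_pows \<nu> L f))" unfolding p diff_pows_Cons
    by (rule diff_power_commute[OF bdd_support_diff_pows[OF assms(1)]]) (use Cons.prems assms(3) p in auto)
  then show ?case using Cons p by simp
qed simp

text \<open>All factors are expanded in one region and therefore commute; from here on a list of
  pairs stands for a multiset of factors.\<close>

lemma diff_pows_mset:
  assumes "mset L = mset L'" "bdd_support \<U> f" "\<And>x y. (x, y) \<in> set L \<Longrightarrow> precedes \<U> x y"
  shows "diff_pows \<nu> L f = diff_pows \<nu> L' f" using assms(1,3)
proof (induction L arbitrary: L')
  case (Cons p L)
  obtain x y where p: "p = (x, y)" by force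
  have "p \<in> set L'" using Cons.prems(1) by (metis list.set_intros(1) set_mset_mset)
  then obtain L1 L2 where L': "L' = L1 @ p # L2" by (meson split_list)
  have "mset L = mset (L1 @ L2)" using Cons.prems(1) L' by simp
  then have IH: "diff_pows \<nu> L f = diff_pows \<nu> (L1 @ L2) f" using Cons by simp
  have set: "set (p # L) = set L'" using Cons.prems(1) mset_eq_setD by blast
  have good: "precedes \<U> u v" if "(u, v) \<in> set L'" for u v using Cons.prems(2) set that by blast
  have "diff_pows \<nu> L' f = diff_pows \<nu> L1 (diff_power x y (\<nu> x y) (diff_pows \<nu> L2 f))"
    by (simp add: L' p diff_pows_append)
  also have "\<dots> = diff_power x y (\<nu> x y) (diff_pows \<nu> L1 (diff_pows \<nu> L2 f))"
    by (rule diff_power_diff_pows_commute[symmetric, where \<U> = \<U>])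
      (rule bdd_support_diff_pows[OF assms(2)] good, use L' p in auto)+
  finally show ?case by (simp add: p IH diff_pows_append)
qed simp

lemma diff_pows_diff_pows:
  assumes "bdd_support \<U> f" "\<And>x y. (x, y) \<in> set L \<Longrightarrow> precedes \<U> x y"
  shows "diff_pows \<nu> L (diff_pows \<mu> L f) = diff_pows (\<lambda>x y. \<nu> x y + \<mu> x y) L f" using assms(2)
proof (induction L)
  case (Cons p L)
  obtain x y where p: "p = (x, y)" by force
  have "diff_pows \<nu> (p # L) (diff_pows \<mu> (p # L) f)
      = diff_power x y (\<nu> x y) (diff_pows \<nu> L (diff_power x y (\<mu> x y) (diff_pows \<mu> L f)))" by (simp add: p)
  also have "\<dots> = diff_power x y (\<nu> x y) (diff_power x y (\<mu> x y) (diff_pows \<nu> L (diff_pows \<mu> L f)))"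
    using Cons.prems p by (subst diff_power_diff_pows_commute[where \<U> = \<U>])
      (auto intro!: bdd_support_diff_pows assms(1))
  also have "\<dots> = diff_power x y (\<nu> x y + \<mu> x y) (diff_pows \<nu> L (diff_pows \<mu> L f))" using Cons.prems p
    by (intro diff_power_diff_power[where \<U> = \<U>] bdd_support_diff_pows assms(1)) auto
  finally show ?case using Cons p by simp
qed simp

lemma diff_pows_zero_weight: "(\<And>x y. (x, y) \<in> set L \<Longrightarrow> \<nu> x y = 0) \<Longrightarrow> diff_pows \<nu> L f = f" by (induction L) auto

lemma diff_pows_inverse:
  assumes "bdd_support \<U> f" "\<And>x y. (x, y) \<in> set L \<Longrightarrow> precedes \<U> x y"
    "\<And>x y. \<mu> x y = - \<nu> x y"
  shows "diff_pows \<nu> L (diff_pows \<mu> L f) = f"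
  using assms by (simp add: diff_pows_diff_pows[of \<U>] diff_pows_zero_weight)

lemma diff_pows_zero_fun [simp]: "diff_pows \<nu> L (\<lambda>m. 0) = (\<lambda>m. 0)" by (induction L) auto

lemma diff_pows_scale: "diff_pows \<nu> L (\<lambda>m. c * f m) = (\<lambda>m. c * diff_pows \<nu> L f m)"
  by (induction L) (auto simp: diff_power_scale)

lemma diff_pows_sum:
  assumes "\<And>i. i \<in> A \<Longrightarrow> bdd_support \<U> (f i)" "\<And>x y. (x, y) \<in> set L \<Longrightarrow> precedes \<U> x y"
  shows "diff_pows \<nu> L (\<lambda>m. \<Sum>i\<in>A. f i m) = (\<lambda>m. \<Sum>i\<in>A. diff_pows \<nu> L (f i) m)" using assms(2)
proof (induction L)
  case (Cons p L)
  then show ?case by (cases p) (simp, rule diff_power_sum[where \<U> = \<U>],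
      auto intro!: bdd_support_diff_pows assms(1))
qed simp

lemma diff_pows_rename:
  assumes "inj \<tau>" "\<And>x y. (x, y) \<in> set L \<Longrightarrow> \<nu> (\<tau> x) (\<tau> y) = \<mu> x y"
  shows "diff_pows \<nu> (map (map_prod \<tau> \<tau>) L) (\<lambda>m. f (m \<circ> \<tau>)) = (\<lambda>m. diff_pows \<mu> L f (m \<circ> \<tau>))" using assms(2)
proof (induction L)
  case (Cons p L)
  obtain x y where p: "p = (x, y)" by force
  have "diff_pows \<nu> (map (map_prod \<tau> \<tau>) L) (\<lambda>m. f (m \<circ> \<tau>)) = (\<lambda>m. diff_pows \<mu> L f (m \<circ> \<tau>))"
    by (rule Cons.IH) (use Cons.prems in auto)
  then show ?case using Cons.prems[of x y] diff_power_rename[OF assms(1), of x y "\<mu> x y" "diff_pows \<mu> L f"]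
    by (simp add: p del: comp_apply)
qed simp

text \<open>A variable that is never the first of a pair enters the expansions only with
  non-negative powers, so no factor lowers its exponent. The last variable of an ordering is of this
  kind.\<close>

lemma diff_pows_lower:
  assumes "\<And>m. f m \<noteq> 0 \<Longrightarrow> c \<le> m z" "\<And>x y. (x, y) \<in> set L \<Longrightarrow> x \<noteq> z"
    "diff_pows \<nu> L f m \<noteq> 0"
  shows "c \<le> m z" using assms(2,3)
proof (induction L arbitrary: m)
  case (Cons p L)
  obtain x y where p: "p = (x, y)" by force
  obtain r where "diff_pows \<nu> L f (m + shift_vec x y (\<nu> x y) r) \<noteq> 0"
    using Cons.prems(2) diff_power_nonzero[of x y "\<nu> x y" "diff_pows \<nu> L f" m] p by auto
  then have "c \<le> (m + shift_vec x y (\<nu> x y) r) z" using Cons.IH Cons.prems(1) by (meson list.set_intros(2))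
  also have "\<dots> \<le> m z" using Cons.prems(1)[of x y] p by (auto simp: shift_vec_def)
  finally show ?case .
qed (use assms(1) in auto)

text \<open>Each factor is homogeneous of degree \<open>\<nu> x y\<close>. A set \<open>D\<close> of
  degrees instead of a single one covers exact degrees and upper bounds alike.\<close>

lemma diff_pows_total:
  assumes "\<And>m. f m \<noteq> 0 \<Longrightarrow> sum m X \<in> D" "finite X" "\<And>x y. (x, y) \<in> set L \<Longrightarrow> x \<in> X \<and> y \<in> X"
    "diff_pows \<nu> L f m \<noteq> 0"
  shows "sum m X - (\<Sum>(x, y)\<leftarrow>L. \<nu> x y) \<in> D" using assms(3,4)
proof (induction L arbitrary: m)
  case (Cons p L)
  obtain x y where p: "p = (x, y)" by force
  obtain r where "diff_pows \<nu> L f (m + shift_vec x y (\<nu> x y) r) \<noteq> 0"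
    using Cons.prems(2) diff_power_nonzero[of x y "\<nu> x y" "diff_pows \<nu> L f" m] p by auto
  then have "sum (m + shift_vec x y (\<nu> x y) r) X - (\<Sum>(x, y)\<leftarrow>L. \<nu> x y) \<in> D"
    using Cons.IH Cons.prems(1) by (meson list.set_intros(2))
  moreover have "sum (m + shift_vec x y (\<nu> x y) r) X = sum m X - \<nu> x y"
    using Cons.prems(1)[of x y] p assms(2) by (simp only: sum_plus_fun sum_shift_vec) simp
  ultimately have "sum m X - \<nu> x y - (\<Sum>(x, y)\<leftarrow>L. \<nu> x y) \<in> D" by (simp only:)
  then show ?case by (simp add: p diff_diff_eq)
qed (use assms(1) in auto)

lemma diff_pows_cong_on:
  assumes "\<And>m m'. (\<And>x. x \<in> X \<Longrightarrow> m x = m' x) \<Longrightarrow> f m = f m'" "\<And>x. x \<in> X \<Longrightarrow> m x = m' x"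
  shows "diff_pows \<nu> L f m = diff_pows \<nu> L f m'" using assms(2)
proof (induction L arbitrary: m m')
  case (Cons p L)
  obtain x y where p: "p = (x, y)" by force
  have "diff_pows \<nu> L f (m + shift_vec x y (\<nu> x y) r) = diff_pows \<nu> L f (m' + shift_vec x y (\<nu> x y) r)" for r
    by (rule Cons.IH) (use Cons.prems in simp)
  then show ?case by (simp add: p diff_power_def)
next
  case Nil
  then show ?case using assms(1)[of m m'] by simp
qed

text \<open>A factor with both variables on one side leaves the exponents of the other side alone,
  and mixed pairs carry exponent 0. In this way a term of a shuffle product splits into two
  correlation functions.\<close>

lemma diff_pows_product:
  assumes f: "\<And>m m'. (\<And>x. x \<in> A \<Longrightarrow> m x = m' x) \<Longrightarrow> f m = f m'"
    and g: "\<And>m m'. (\<And>x. x \<in> B \<Longrightarrow> m x = m' x) \<Longrightarrow> g m = g m'"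
    and "A \<inter> B = {}" "\<And>x y. (x, y) \<in> set L \<Longrightarrow> x \<in> A \<union> B \<and> y \<in> A \<union> B"
    and "\<And>x y. (x, y) \<in> set L \<Longrightarrow> \<mu> x y = (if (x \<in> A) = (y \<in> A) then \<nu> x y else 0)"
  shows "diff_pows \<mu> L (\<lambda>m. f m * g m) = (\<lambda>m. diff_pows \<nu> (filter (\<lambda>(x, y). x \<in> A \<and> y \<in> A) L) f m
        * diff_pows \<nu> (filter (\<lambda>(x, y). x \<in> B \<and> y \<in> B) L) g m)" using assms(4,5)
proof (induction L)
  case (Cons p L)
  obtain x y where p: "p = (x, y)" by force
  define F where "F = diff_pows \<nu> (filter (\<lambda>(x, y). x \<in> A \<and> y \<in> A) L) f"
  define G where "G = diff_pows \<nu> (filter (\<lambda>(x, y). x \<in> B \<and> y \<in> B) L) g"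
  have F: "F m = F m'" if "\<And>x. x \<in> A \<Longrightarrow> m x = m' x" for m m'
    unfolding F_def by (rule diff_pows_cong_on[of A, OF f that])
  have G: "G m = G m'" if "\<And>x. x \<in> B \<Longrightarrow> m x = m' x" for m m'
    unfolding G_def by (rule diff_pows_cong_on[of B, OF g that])
  have IH: "diff_pows \<mu> L (\<lambda>m. f m * g m) = (\<lambda>m. F m * G m)"
    unfolding F_def G_def by (rule Cons.IH) (use Cons.prems in \<open>meson list.set_intros(2)\<close>)+
  have FG: "(\<lambda>m. G m * F m) = (\<lambda>m. F m * G m)" by (simp add: mult.commute)
  have mem: "x \<in> A \<union> B" "y \<in> A \<union> B" and \<mu>: "\<mu> x y = (if (x \<in> A) = (y \<in> A) then \<nu> x y else 0)"
    using Cons.prems p by auto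
  consider "x \<in> A" "y \<in> A" | "x \<in> B" "y \<in> B" | "(x \<in> A) \<noteq> (y \<in> A)" using mem assms(3) by blast
  then show ?case
  proof cases
    case 1
    then have "G (m + shift_vec x y (\<nu> x y) r) = G m" for m r
      using assms(3) by (intro G) (auto simp: shift_vec_def)
    then have "diff_power x y (\<nu> x y) (\<lambda>m. F m * G m) = (\<lambda>m. diff_power x y (\<nu> x y) F m * G m)"
      by (simp add: fun_eq_iff diff_power_mult_const)
    moreover have "x \<notin> B" using 1 assms(3) by auto
    ultimately show ?thesis using 1 by (simp add: p IH \<mu> F_def G_def)
  next
    case 2
    then have "F (m + shift_vec x y (\<nu> x y) r) = F m" for m r
      using assms(3) by (intro F) (auto simp: shift_vec_def)
    then have "diff_power x y (\<nu> x y) (\<lambda>m. G m * F m) = (\<lambda>m. diff_power x y (\<nu> x y) G m * F m)"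
      by (simp add: fun_eq_iff diff_power_mult_const)
    then have "diff_power x y (\<nu> x y) (\<lambda>m. F m * G m) = (\<lambda>m. F m * diff_power x y (\<nu> x y) G m)"
      unfolding FG by (simp only: mult.commute)
    moreover have "x \<notin> A" "y \<notin> A" using 2 assms(3) by auto
    ultimately show ?thesis using 2 by (simp add: p IH \<mu> F_def G_def)
  next
    case 3
    then have "\<not> (x \<in> A \<and> y \<in> A)" "\<not> (x \<in> B \<and> y \<in> B)" "\<mu> x y = 0" using assms(3) \<mu> by auto
    then show ?thesis by (auto simp: p IH F_def[symmetric] G_def[symmetric])
  qed
qed simp

section \<open>Regular parts of local families\<close>

fun pairs :: "'x list \<Rightarrow> ('x \<times> 'x) list" where
  "pairs [] = []"
| "pairs (x # xs) = map (Pair x) xs @ pairs xs"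

lemma set_pairs_nth: "set (pairs xs) = {(xs ! k, xs ! l) | k l. k < l \<and> l < length xs}"
proof (induction xs)
  case (Cons x xs)
  have "{((x # xs) ! k, (x # xs) ! l) | k l. k < l \<and> l < length (x # xs)}
      = {(x, xs ! l) | l. l < length xs} \<union> {(xs ! k, xs ! l) | k l. k < l \<and> l < length xs}"
    (is "?A = ?B \<union> ?C")
  proof (intro equalityI subsetI)
    fix p assume "p \<in> ?A"
    then obtain k l where kl: "p = ((x # xs) ! k, (x # xs) ! l)" "k < l" "l < Suc (length xs)" by auto
    then obtain l' where l': "l = Suc l'" by (cases l) auto
    show "p \<in> ?B \<union> ?C" using kl l' by (cases k) auto
  next
    fix p assume "p \<in> ?B \<union> ?C"
    then consider l where "p = (x, xs ! l)" "l < length xs"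
      | k l where "p = (xs ! k, xs ! l)" "k < l" "l < length xs" by auto
    then show "p \<in> ?A"
    proof cases
      case 1
      then have "p = ((x # xs) ! 0, (x # xs) ! Suc l) \<and> 0 < Suc l \<and> Suc l < length (x # xs)" by simp
      then show ?thesis by blast
    next
      case 2
      then have "p = ((x # xs) ! Suc k, (x # xs) ! Suc l) \<and> Suc k < Suc l \<and> Suc l < length (x # xs)" by simp
      then show ?thesis by blast
    qed
  qed
  moreover have "set (map (Pair x) xs) = ?B" by (auto simp: in_set_conv_nth image_iff)
  ultimately show ?case using Cons by simp
qed simp

lemma in_pairs_set: "(x, y) \<in> set (pairs xs) \<Longrightarrow> x \<in> set xs \<and> y \<in> set xs" by (auto simp: set_pairs_nth)

lemma pairs_neq: "distinct xs \<Longrightarrow> (x, y) \<in> set (pairs xs) \<Longrightarrow> x \<noteq> y"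
  by (auto simp: set_pairs_nth nth_eq_iff_index_eq)

lemma pairs_not_last: "distinct xs \<Longrightarrow> (x, y) \<in> set (pairs xs) \<Longrightarrow> x \<noteq> last xs"
proof
  assume "distinct xs" "(x, y) \<in> set (pairs xs)" "x = last xs"
  then obtain k l where kl: "x = xs ! k" "k < l" "l < length xs" "xs ! k = last xs"
    by (auto simp: set_pairs_nth)
  then have "xs ! k = xs ! (length xs - 1)" by (metis last_conv_nth list.size(3) not_less_zero)
  then show False using \<open>distinct xs\<close> kl by (simp add: nth_eq_iff_index_eq)
qed

lemma pairs_map: "pairs (map f xs) = map (map_prod f f) (pairs xs)" by (induction xs) (auto simp: comp_def)

lemma pairs_filter: "pairs (filter P xs) = filter (\<lambda>(x, y). P x \<and> P y) (pairs xs)"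
  by (induction xs) (auto simp: filter_map comp_def)

lemma mset_pairs_append:
  "mset (pairs (xs @ ys)) = mset (pairs xs) + mset (pairs ys) + mset (List.product xs ys)"
  by (induction xs) auto

text \<open>Lower bounds for the sums over final segments describe the expansion in the region
  \<open>|z_1| > |z_2| > ...\<close> of the list: the final segment starting at a later variable
  contains it but no earlier one.\<close>

definition upsets :: "'x list \<Rightarrow> 'x set set" where
  "upsets xs = range (\<lambda>k. set (drop k xs))"

lemma precedes_upsets:
  assumes "distinct xs" "(x, y) \<in> set (pairs xs)"
  shows "precedes (upsets xs) x y"
proof -
  obtain k l where kl: "x = xs ! k" "y = xs ! l" "k < l" "l < length xs"
    using assms(2) by (auto simp: set_pairs_nth)
  have mem: "xs ! i \<in> set (drop n xs) \<longleftrightarrow> n \<le> i" if "i < length xs" for i n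
  proof
    assume "xs ! i \<in> set (drop n xs)"
    then obtain j where "j < length xs - n" "xs ! (n + j) = xs ! i" by (auto simp: in_set_conv_nth)
    then show "n \<le> i" using assms(1) that by (auto simp: nth_eq_iff_index_eq)
  next
    assume "n \<le> i"
    then show "xs ! i \<in> set (drop n xs)" using that by (auto simp: in_set_conv_nth intro!: exI[of _ "i - n"])
  qed
  have "y \<in> set (drop l xs) \<and> x \<notin> set (drop l xs)" using kl mem[of l l] mem[of k l] by auto
  moreover have "x \<in> set (drop n xs) \<Longrightarrow> y \<in> set (drop n xs)" for n using kl mem[of k n] mem[of l n] by auto
  ultimately show ?thesis by (auto simp: precedes_def upsets_def)
qed

text \<open>All pairs except that of the neighbours \<open>x\<close> and \<open>y\<close>. As a
  multiset they do not change when the neighbours trade places, so a swap affects a single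
  factor.\<close>

definition swap_rest :: "'x list \<Rightarrow> 'x \<Rightarrow> 'x \<Rightarrow> 'x list \<Rightarrow> ('x \<times> 'x) list" where
  "swap_rest us x y vs =
     pairs us @ map (Pair x) vs @ map (Pair y) vs @ pairs vs @ List.product us (x # y # vs)"

lemma mset_product_Cons: "mset (List.product us (x # ys)) = mset (map (\<lambda>u. (u, x)) us) + mset (List.product us ys)"
  by (induction us) auto

lemma mset_pairs_swap_rest: "mset (pairs (us @ x # y # vs)) = mset ((x, y) # swap_rest us x y vs)"
  by (simp add: mset_pairs_append swap_rest_def)

lemma mset_swap_rest: "mset (swap_rest us x y vs) = mset (swap_rest us y x vs)"
  by (simp add: swap_rest_def mset_product_Cons)

lemma mset_pairs_swap_rest': "mset (pairs (us @ y # x # vs)) = mset ((y, x) # swap_rest us x y vs)"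
  unfolding mset_pairs_swap_rest by (simp add: mset_swap_rest[of us x])

lemma swap_rest_map:
  "map (map_prod f f) (swap_rest us x y vs) = swap_rest (map f us) (f x) (f y) (map f vs)"
proof -
  have "map (map_prod f f) (List.product us ys) = List.product (map f us) (map f ys)" for ys
    by (induction us) (auto simp: comp_def)
  then show ?thesis by (simp add: swap_rest_def pairs_map comp_def)
qed

lemma swap_rest_precedes:
  assumes "distinct (us @ x # y # vs)" "(a, b) \<in> set (swap_rest us x y vs)"
  shows "precedes (upsets (us @ x # y # vs)) a b"
    "precedes (upsets (us @ x # y # vs) \<union> upsets (us @ y # x # vs)) a b"
proof -
  have "(a, b) \<in> set (pairs (us @ x # y # vs))" "(a, b) \<in> set (pairs (us @ y # x # vs))"
    using assms(2) mset_pairs_swap_rest[of us x y vs] mset_pairs_swap_rest'[of us y x vs]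
    by (metis list.set_intros(2) mset_eq_setD)+
  then have A: "precedes (upsets (us @ x # y # vs)) a b" and B: "precedes (upsets (us @ y # x # vs)) a b"
    using assms(1) by (auto intro!: precedes_upsets)
  show "precedes (upsets (us @ x # y # vs)) a b" by (rule A)
  show "precedes (upsets (us @ x # y # vs) \<union> upsets (us @ y # x # vs)) a b"
    using A B unfolding precedes_def by blast
qed

text \<open>Any two orderings of a set are connected by transpositions of neighbours.\<close>

lemma adjacent_swaps:
  assumes "\<And>us x y vs. mset (us @ x # y # vs) = mset xs \<Longrightarrow> G (us @ x # y # vs) = G (us @ y # x # vs)"
    and "mset xs = mset ys"
  shows "G xs = G ys" using assms
proof (induction ys arbitrary: xs G)
  case (Cons y ys)
  have "y \<in> set xs" using Cons.prems(2) by (metis list.set_intros(1) set_mset_mset)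
  then obtain xs1 xs2 where xs: "xs = xs1 @ y # xs2" by (meson split_list)
  have "G (zs @ y # xs2') = G (y # zs @ xs2')" if "mset (zs @ y # xs2') = mset xs" for zs xs2' using that
  proof (induction zs arbitrary: xs2' rule: rev_induct)
    case (snoc z zs)
    have "G ((zs @ [z]) @ y # xs2') = G (zs @ y # z # xs2')"
      using Cons.prems(1)[of zs z y xs2'] snoc.prems by simp
    also have "\<dots> = G (y # zs @ z # xs2')"
      using snoc.IH[of "z # xs2'"] snoc.prems by (simp add: add_mset_commute)
    finally show ?case by simp
  qed simp
  from this[of xs1 xs2] have "G xs = G (y # xs1 @ xs2)" by (simp add: xs)
  also have "\<dots> = G (y # ys)"
  proof (rule Cons.IH[of "xs1 @ xs2" "\<lambda>zs. G (y # zs)"])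
    show "G (y # us @ x # y' # vs) = G (y # us @ y' # x # vs)"
      if "mset (us @ x # y' # vs) = mset (xs1 @ xs2)" for us x y' vs
      using Cons.prems(1)[of "y # us" x y' vs] that by (simp add: xs)
  qed (use Cons.prems(2) xs in simp)
  finally show ?case .
qed simp

definition sgn_of :: "int \<Rightarrow> rat" where
  "sgn_of n = (-1) powi n"

lemma sgn_of_nat: "sgn_of (int n) = (-1) ^ n" and sgn_of_neg_one: "sgn_of (-1) = -1"
  by (simp_all add: sgn_of_def)

lemma sgn_of_square [simp]: "sgn_of n * sgn_of n = 1"
  unfolding sgn_of_def by (simp flip: power_int_mult_distrib)

definition ordering :: "'x set \<Rightarrow> 'x list \<Rightarrow> bool" where
  "ordering X xs \<longleftrightarrow> distinct xs \<and> set xs = X"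

lemma ordering_swap: "ordering X (us @ x # y # vs) \<Longrightarrow> ordering X (us @ y # x # vs)"
  by (auto simp: ordering_def)

definition depends_on :: "'x set \<Rightarrow> 'x distr \<Rightarrow> bool" where
  "depends_on X f \<longleftrightarrow> (\<forall>m m'. (\<forall>x\<in>X. m x = m' x) \<longrightarrow> f m = f m')"

lemma bdd_support_nonneg:
  assumes "\<And>m x. G m \<noteq> 0 \<Longrightarrow> x \<in> X \<Longrightarrow> 0 \<le> m x" "\<And>U. U \<in> \<U> \<Longrightarrow> U \<subseteq> X"
  shows "bdd_support \<U> G" unfolding bdd_support_def
  by (rule exI[of _ 0]) (use assms in \<open>auto intro!: sum_nonneg\<close>)

lemma upsets_subset: "U \<in> upsets xs \<Longrightarrow> U \<subseteq> set xs" by (auto simp: upsets_def dest: in_set_dropD)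

abbreviation "pair_word us i m j n vs k \<equiv> us @ (i, m - int k) # (j, n + int k) # vs"
abbreviation "swap_word us i m j n vs k \<equiv> us @ (j, n + int k) # (i, m - int k) # vs"

text \<open>For a symmetric quiver \<open>N i j\<close> is the number of arrows minus the Kronecker
  delta; hence the bound -1 and its occurrence only for equal colours.\<close>

locale charges =
  fixes N :: "'v \<Rightarrow> 'v \<Rightarrow> int" and col :: "'x \<Rightarrow> 'v"
  assumes N_commute: "N i j = N j i" and N_lower: "- 1 \<le> N i j" and N_negative: "N i j < 0 \<Longrightarrow> i = j"
begin

definition nu :: "'x \<Rightarrow> 'x \<Rightarrow> int" where
  "nu x y = N (col x) (col y)"

definition colour_sym :: "'x set \<Rightarrow> ('x \<Rightarrow> 'x) \<Rightarrow> bool" where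
  "colour_sym X \<tau> \<longleftrightarrow> \<tau> permutes X \<and> (\<forall>x. col (\<tau> x) = col x)"

text \<open>
  The correlation functions of a vertex algebra element for all orders of the variables: they are
  expanded in the region given by the order, local, and regular in the last variable.
\<close>

definition family :: "'x set \<Rightarrow> ('x list \<Rightarrow> ('x \<Rightarrow> int) \<Rightarrow> rat) \<Rightarrow> bool" where
  "family X f \<longleftrightarrow> (\<forall>xs. ordering X xs \<longrightarrow> bdd_support (upsets xs) (f xs) \<and> depends_on X (f xs) \<and>
        (\<forall>m. xs \<noteq> [] \<longrightarrow> f xs m \<noteq> 0 \<longrightarrow> 0 \<le> m (last xs)) \<and>
        (\<forall>\<tau> m. colour_sym X \<tau> \<longrightarrow> f (map \<tau> xs) m = f xs (m \<circ> \<tau>))) \<and>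
     (\<forall>us x y vs m. ordering X (us @ x # y # vs) \<longrightarrow> diff_power x y (max (nu x y) 0) (f (us @ x # y # vs)) m
        = sgn_of (nu x y) * diff_power x y (max (nu x y) 0) (f (us @ y # x # vs)) m)"

lemma familyD:
  assumes "family X f" "ordering X xs"
  shows "bdd_support (upsets xs) (f xs)" "depends_on X (f xs)"
    "xs \<noteq> [] \<Longrightarrow> f xs m \<noteq> 0 \<Longrightarrow> 0 \<le> m (last xs)"
    "colour_sym X \<tau> \<Longrightarrow> f (map \<tau> xs) m = f xs (m \<circ> \<tau>)" using assms unfolding family_def by auto

lemma family_local:
  assumes "family X f" "ordering X (us @ x # y # vs)"
  shows "diff_power x y (max (nu x y) 0) (f (us @ x # y # vs))
        = (\<lambda>m. sgn_of (nu x y) * diff_power x y (max (nu x y) 0) (f (us @ y # x # vs)) m)"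
  by (rule ext) (use assms in \<open>simp add: family_def\<close>)

lemma nu_commute: "nu x y = nu y x" by (simp add: nu_def N_commute)

lemma nu_cases:
  obtains n where "nu x y = int n" | "nu x y = -1" "col x = col y"
proof (cases "nu x y \<ge> 0")
  case True
  then show ?thesis using that(1) by (metis zero_le_imp_eq_int)
next
  case False
  then have "nu x y = -1" using N_lower[of "col x" "col y"] by (simp add: nu_def)
  moreover have "col x = col y" using False by (intro N_negative) (simp add: nu_def)
  ultimately show ?thesis using that(2) by blast
qed

definition regular_part ::
  "('x list \<Rightarrow> ('x \<Rightarrow> int) \<Rightarrow> rat) \<Rightarrow> 'x list \<Rightarrow> 'x distr" where
  "regular_part f xs = diff_pows nu (pairs xs) (f xs)"

lemma colour_sym_transpose:
  "x \<in> X \<Longrightarrow> y \<in> X \<Longrightarrow> col x = col y \<Longrightarrow> colour_sym X (transpose x y)"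
  by (auto simp: colour_sym_def permutes_swap_id transpose_def)

lemma map_transpose_swap:
  assumes "distinct (us @ x # y # vs)"
  shows "map (transpose x y) (us @ x # y # vs) = us @ y # x # vs"
proof -
  have "map (transpose x y) us = us" "map (transpose x y) vs = vs"
    using assms by (auto intro!: map_idI simp: transpose_def)
  then show ?thesis by simp
qed

lemma set_in_upsets: "xs = us @ vs \<Longrightarrow> set vs \<in> upsets xs"
  unfolding upsets_def by (rule range_eqI[of _ _ "length us"]) simp

text \<open>For \<open>nu x y \<ge> 0\<close> this is locality multiplied by the remaining factors,
  and the sign in locality is that of reversing \<open>(z_x - z_y)^N\<close>. For
  \<open>nu x y = -1\<close> locality only compares signs; since the colours agree, it says that
  \<open>f\<close> is antisymmetric under exchanging \<open>x\<close> and \<open>y\<close>, and then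
  the two expansions of the inverse factor are compatible.\<close>

lemma regular_part_swap:
  assumes fam: "family X f" and ord: "ordering X (us @ x # y # vs)"
  shows "regular_part f (us @ x # y # vs) = regular_part f (us @ y # x # vs)"
proof -
  define xs ys R where "xs = us @ x # y # vs" and "ys = us @ y # x # vs" and "R = swap_rest us x y vs"
  have ordy: "ordering X ys" unfolding ys_def using ord by (rule ordering_swap)
  have dist: "distinct xs" "distinct ys" using ord ordy by (auto simp: ordering_def xs_def)
  have ordx: "ordering X xs" using ord by (simp add: xs_def)
  note bx = familyD(1)[OF fam ordx] and by' = familyD(1)[OF fam ordy]
  have px: "precedes (upsets xs) a b" if "(a, b) \<in> set (pairs xs)" for a b
    using that dist by (intro precedes_upsets)
  have py: "precedes (upsets ys) a b" if "(a, b) \<in> set (pairs ys)" for a b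
    using that dist by (intro precedes_upsets)
  have mx: "mset (pairs xs) = mset ((x, y) # R)" and my: "mset (pairs ys) = mset ((y, x) # R)"
    unfolding xs_def ys_def R_def by (rule mset_pairs_swap_rest, rule mset_pairs_swap_rest')
  have sx: "set (pairs xs) = insert (x, y) (set R)" and sy: "set (pairs ys) = insert (y, x) (set R)"
    using mset_eq_setD[OF mx] mset_eq_setD[OF my] by simp_all
  have Gx: "regular_part f xs = diff_power x y (nu x y) (diff_pows nu R (f xs))"
    unfolding regular_part_def using diff_pows_mset[OF mx bx px] by simp
  have Gy: "regular_part f ys = diff_power y x (nu x y) (diff_pows nu R (f ys))"
    unfolding regular_part_def using diff_pows_mset[OF my by' py] by (simp add: nu_commute[of y x])
  have loc: "diff_power x y (max (nu x y) 0) (f xs)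
      = (\<lambda>m. sgn_of (nu x y) * diff_power x y (max (nu x y) 0) (f ys) m)"
    using family_local[OF fam ord] by (simp add: xs_def ys_def)
  show ?thesis
  proof (cases x y rule: nu_cases)
    case (1 n)
    have "regular_part f xs = diff_pows nu R (diff_power x y (nu x y) (f xs))"
      unfolding Gx by (rule diff_power_diff_pows_commute[OF bx]) (use px sx in auto)
    also have "diff_power x y (nu x y) (f xs) = diff_power y x (nu x y) (f ys)"
      using loc by (simp add: 1 diff_power_flip[of y x] sgn_of_nat)
    also have "diff_pows nu R (diff_power y x (nu x y) (f ys)) = regular_part f ys"
      unfolding Gy by (rule diff_power_diff_pows_commute[OF by', symmetric]) (use py sy in auto)
    finally show ?thesis by (simp add: xs_def ys_def)
  next
    case 2
    define \<tau> where "\<tau> = transpose x y"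
    define \<U> where "\<U> = upsets xs \<union> upsets ys"
    have \<tau>: "colour_sym X \<tau>"
      unfolding \<tau>_def using ord 2 by (intro colour_sym_transpose) (auto simp: ordering_def)
    have fy: "f ys = (\<lambda>m. - f xs m)" using loc by (simp add: 2 sgn_of_neg_one fun_eq_iff)
    have fy': "f ys = (\<lambda>m. f xs (m \<circ> \<tau>))"
      using familyD(4)[OF fam ordx \<tau>] dist map_transpose_swap[of us x y vs]
      by (simp add: fun_eq_iff xs_def ys_def \<tau>_def)
    \<comment> \<open>Up to sign \<open>f xs\<close> is also the function of the other order, so its
      support is bounded for both orders at once. This makes both expansions of the inverse
      available for the same function.\<close>
    have "bdd_support (upsets ys) (f xs)" using bdd_support_scale[OF by', of "-1"] by (simp add: fy)
    then have bU: "bdd_support \<U> (f xs)" unfolding \<U>_def using bx by (intro bdd_support_Un)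
    have pR: "precedes \<U> a b" if "(a, b) \<in> set R" for a b unfolding \<U>_def xs_def ys_def
      by (rule swap_rest_precedes) (use dist that in \<open>auto simp: xs_def R_def\<close>)
    define h where "h = diff_pows nu R (f xs)"
    have bh: "bdd_support \<U> h" unfolding h_def by (rule bdd_support_diff_pows[OF bU pR])
    have hy: "diff_pows nu R (f ys) = (\<lambda>m. - h m)"
      using diff_pows_scale[of nu R "-1" "f xs"] by (simp add: fy h_def)
    have inj: "inj \<tau>" unfolding \<tau>_def by simp
    have nu\<tau>: "nu (\<tau> a) (\<tau> b) = nu a b" for a b using \<tau> by (simp add: colour_sym_def nu_def)
    have "map \<tau> us = us" "map \<tau> vs = vs" "\<tau> x = y" "\<tau> y = x"
      using dist by (auto simp: xs_def \<tau>_def transpose_def intro!: map_idI)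
    \<comment> \<open>The transposition only permutes the remaining factors, so \<open>h\<close>
      inherits the antisymmetry of \<open>f xs\<close>.\<close>
    then have "map (map_prod \<tau> \<tau>) R = swap_rest us y x vs" by (simp add: R_def swap_rest_map)
    then have mR: "mset R = mset (map (map_prod \<tau> \<tau>) R)" by (simp add: R_def mset_swap_rest)
    have "bdd_support \<U> (f ys)" using bdd_support_scale[OF bU, of "-1"] by (simp add: fy)
    then have "diff_pows nu R (f ys) = diff_pows nu (map (map_prod \<tau> \<tau>) R) (f ys)"
      by (rule diff_pows_mset[OF mR _ pR])
    also have "\<dots> = (\<lambda>m. h (m \<circ> \<tau>))" unfolding fy' h_def by (rule diff_pows_rename[OF inj]) (rule nu\<tau>)
    finally have anti: "h (m \<circ> transpose x y) = - h m" for m using hy by (simp add: fun_eq_iff \<tau>_def)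
    have "diff_power y x (-1) h = (\<lambda>m. - diff_power x y (-1) h m)"
    proof (rule diff_power_inverse_antisym[OF bh _ _ _ _ _ _ _ _ anti])
      show "set (y # vs) \<in> \<U>" unfolding \<U>_def xs_def
        using set_in_upsets[of "us @ x # y # vs" "us @ [x]" "y # vs"] by simp
      show "set (x # vs) \<in> \<U>" unfolding \<U>_def ys_def
        using set_in_upsets[of "us @ y # x # vs" "us @ [y]" "x # vs"] by simp
    qed (use dist in \<open>auto simp: xs_def\<close>)
    moreover have "diff_power y x (-1) (\<lambda>m. - h m) = (\<lambda>m. - diff_power y x (-1) h m)"
      using diff_power_scale[of y x "-1" "-1" h] by simp
    ultimately have "diff_power y x (-1) (\<lambda>m. - h m) = diff_power x y (-1) h" by (simp add: fun_eq_iff)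
    then have "regular_part f xs = regular_part f ys" by (simp add: Gx Gy 2 hy h_def[symmetric])
    then show ?thesis by (simp add: xs_def ys_def)
  qed
qed

lemma regular_part_ordering:
  assumes "family X f" "ordering X xs" "ordering X ys"
  shows "regular_part f xs = regular_part f ys"
proof (rule adjacent_swaps)
  show m: "mset xs = mset ys"
    using assms(2,3) set_eq_iff_mset_eq_distinct[of xs ys] by (simp add: ordering_def)
  fix us x y vs assume "mset (us @ x # y # vs) = mset xs"
  then have "ordering X (us @ x # y # vs)"
    using assms(2) unfolding ordering_def by (metis mset_eq_imp_distinct_iff mset_eq_setD)
  then show "regular_part f (us @ x # y # vs) = regular_part f (us @ y # x # vs)"
    by (rule regular_part_swap[OF assms(1)])
qed

text \<open>Independence of the ordering allows \<open>x\<close> to be moved to the end, where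
  \<open>f\<close> is regular and no factor lowers its exponent.\<close>

lemma regular_part_nonneg:
  assumes "family X f" "ordering X xs" "regular_part f xs m \<noteq> 0" "x \<in> X"
  shows "0 \<le> m x"
proof -
  obtain us vs where xs: "xs = us @ x # vs" using assms(2,4) split_list unfolding ordering_def by metis
  define ys where "ys = us @ vs @ [x]"
  have ord: "ordering X ys" using assms(2) by (auto simp: ordering_def xs ys_def)
  have "diff_pows nu (pairs ys) (f ys) m \<noteq> 0"
    using assms regular_part_ordering[OF assms(1,2) ord] by (simp add: regular_part_def)
  moreover have "f ys m \<noteq> 0 \<Longrightarrow> 0 \<le> m x" for m using familyD(3)[OF assms(1) ord] by (auto simp: ys_def)
  moreover have "a \<noteq> x" if "(a, b) \<in> set (pairs ys)" for a b
    using pairs_not_last[of ys a b] ord that by (auto simp: ordering_def ys_def)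
  ultimately show ?thesis using diff_pows_lower[of "f ys" 0 x "pairs ys" nu m] by blast
qed

lemma ordering_map: "colour_sym X \<tau> \<Longrightarrow> ordering X xs \<Longrightarrow> ordering X (map \<tau> xs)"
  unfolding ordering_def colour_sym_def
  by (auto simp: distinct_map permutes_image dest: permutes_inj intro: inj_on_subset)

lemma nu_colour_sym: "colour_sym X \<tau> \<Longrightarrow> nu (\<tau> x) (\<tau> y) = nu x y" by (simp add: nu_def colour_sym_def)

lemma colour_sym_inj: "colour_sym X \<tau> \<Longrightarrow> inj \<tau>" by (auto simp: colour_sym_def dest: permutes_inj)

lemma regular_part_sym:
  assumes "family X f" "ordering X xs" "colour_sym X \<tau>"
  shows "regular_part f xs (m \<circ> \<tau>) = regular_part f xs m"
proof -
  have fm: "f (map \<tau> xs) = (\<lambda>m. f xs (m \<circ> \<tau>))" by (rule ext) (rule familyD(4)[OF assms])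
  have "regular_part f xs m = regular_part f (map \<tau> xs) m"
    using regular_part_ordering[OF assms(1,2) ordering_map[OF assms(3,2)]] by simp
  also have "\<dots> = diff_pows nu (map (map_prod \<tau> \<tau>) (pairs xs)) (\<lambda>m. f xs (m \<circ> \<tau>)) m"
    by (simp add: regular_part_def pairs_map fm)
  also have "\<dots> = regular_part f xs (m \<circ> \<tau>)" unfolding regular_part_def
    by (subst diff_pows_rename[OF colour_sym_inj[OF assms(3)]])
      (simp_all add: nu_colour_sym[OF assms(3)])
  finally show ?thesis ..
qed

lemma regular_part_depends:
  assumes "family X f" "ordering X xs"
  shows "depends_on X (regular_part f xs)" unfolding depends_on_def regular_part_def
proof (intro allI impI)
  fix m m' :: "'x \<Rightarrow> int" assume "\<forall>x\<in>X. m x = m' x"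
  then show "diff_pows nu (pairs xs) (f xs) m = diff_pows nu (pairs xs) (f xs) m'"
    using familyD(2)[OF assms] by (intro diff_pows_cong_on[of X]) (auto simp: depends_on_def)
qed

definition expansion ::
  "'x distr \<Rightarrow> 'x list \<Rightarrow> 'x distr" where
  "expansion G xs = diff_pows (\<lambda>x y. - nu x y) (pairs xs) G"

lemma expansion_regular_part:
  assumes "family X f" "ordering X xs"
  shows "expansion (regular_part f xs) xs = f xs" unfolding expansion_def regular_part_def
  by (rule diff_pows_inverse[OF familyD(1)[OF assms]])
    (use assms(2) in \<open>auto simp: ordering_def intro!: precedes_upsets\<close>)

text \<open>For \<open>\<mu> x y \<ge> 0\<close> the power cancels either expansion of its inverse;
  for -1 the factor \<open>(z_x - z_y)^1\<close> is a polynomial whose orientation costs a sign. The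
  exponents are arbitrary because terms of a shuffle product carry exponents that vanish on mixed
  pairs.\<close>

lemma diff_pows_swap:
  fixes \<mu> :: "'x \<Rightarrow> 'x \<Rightarrow> int"
  assumes G: "\<And>m x. G m \<noteq> 0 \<Longrightarrow> x \<in> X \<Longrightarrow> 0 \<le> m x" and ord: "ordering X (us @ x # y # vs)"
    and sym: "\<mu> x y = \<mu> y x" and lower: "-1 \<le> \<mu> x y"
  shows "diff_power x y (max (\<mu> x y) 0) (diff_pows (\<lambda>x y. - \<mu> x y) (pairs (us @ x # y # vs)) G)
    = (\<lambda>m. sgn_of (\<mu> x y) *
        diff_power x y (max (\<mu> x y) 0) (diff_pows (\<lambda>x y. - \<mu> x y) (pairs (us @ y # x # vs)) G) m)"
proof -
  define xs ys R where "xs = us @ x # y # vs" and "ys = us @ y # x # vs" and "R = swap_rest us x y vs"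
  have dist: "distinct xs" "distinct ys" using ord by (auto simp: ordering_def xs_def ys_def)
  have set: "set xs = X" "set ys = X" using ord by (auto simp: ordering_def xs_def ys_def)
  have bx: "bdd_support (upsets xs) G" and by': "bdd_support (upsets ys) G"
    by (rule bdd_support_nonneg[of G X]; use G upsets_subset set in blast)+
  have px: "precedes (upsets xs) a b" if "(a, b) \<in> set (pairs xs)" for a b
    using that dist by (intro precedes_upsets)
  have py: "precedes (upsets ys) a b" if "(a, b) \<in> set (pairs ys)" for a b
    using that dist by (intro precedes_upsets)
  have mx: "mset (pairs xs) = mset ((x, y) # R)" and my: "mset (pairs ys) = mset ((y, x) # R)"
    unfolding xs_def ys_def R_def by (rule mset_pairs_swap_rest, rule mset_pairs_swap_rest')
  have sx: "set (pairs xs) = insert (x, y) (set R)" and sy: "set (pairs ys) = insert (y, x) (set R)"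
    using mset_eq_setD[OF mx] mset_eq_setD[OF my] by simp_all
  define h where "h = diff_pows (\<lambda>x y. - \<mu> x y) R G"
  have hx: "bdd_support (upsets xs) h" and hy: "bdd_support (upsets ys) h"
    unfolding h_def using px py sx sy by (auto intro!: bdd_support_diff_pows bx by')
  have Gx: "diff_pows (\<lambda>x y. - \<mu> x y) (pairs xs) G = diff_power x y (- \<mu> x y) h"
    using diff_pows_mset[OF mx bx px] by (simp add: h_def)
  have Gy: "diff_pows (\<lambda>x y. - \<mu> x y) (pairs ys) G = diff_power y x (- \<mu> x y) h"
    using diff_pows_mset[OF my by' py] by (simp add: h_def sym)
  have xy: "precedes (upsets xs) x y" and yx: "precedes (upsets ys) y x" using px sx py sy by auto
  consider n where "\<mu> x y = int n" | "\<mu> x y = -1"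
    using lower by (metis add.commute add_0 antisym_conv2 diff_self int_one_le_iff_zero_less
      minus_diff_eq zero_le_imp_eq_int zle_add1_eq_le not_less uminus_add_conv_diff)
  then have "diff_power x y (max (\<mu> x y) 0) (diff_power x y (- \<mu> x y) h)
    = (\<lambda>m. sgn_of (\<mu> x y) * diff_power x y (max (\<mu> x y) 0) (diff_power y x (- \<mu> x y) h) m)"
  proof cases
    case 1
    have "diff_power y x (int n) (diff_power y x (- int n) h) = h"
      by (simp add: diff_power_diff_power[OF hy yx])
    then show ?thesis by (simp add: 1 diff_power_diff_power[OF hx xy] diff_power_flip[of x y] sgn_of_nat
        flip: mult.assoc power_add)
  next
    case 2
    show ?thesis using diff_power_flip[of y x 1 h] by (simp add: 2 sgn_of_neg_one)
  qed
  then show ?thesis by (simp only: Gx Gy flip: xs_def ys_def)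
qed

text \<open>Regularity in all variables bounds the support for every ordering, and it survives at
  the last variable, which is never the first of a pair; locality is
  \<open>diff_pows_swap\<close>.\<close>

lemma family_expansion:
  assumes G: "\<And>m x. G m \<noteq> 0 \<Longrightarrow> x \<in> X \<Longrightarrow> 0 \<le> m x" and dep: "depends_on X G"
    and sym: "\<And>\<tau> m. colour_sym X \<tau> \<Longrightarrow> G (m \<circ> \<tau>) = G m"
  shows "family X (expansion G)" unfolding family_def
proof (intro conjI allI impI)
  fix xs assume ord: "ordering X xs"
  then have dist: "distinct xs" and set: "set xs = X" by (auto simp: ordering_def)
  have prec: "precedes (upsets xs) a b" if "(a, b) \<in> set (pairs xs)" for a b
    using that dist by (intro precedes_upsets)
  have bG: "bdd_support (upsets xs) G" by (rule bdd_support_nonneg[of G X]; use G upsets_subset set in blast)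
  show "bdd_support (upsets xs) (expansion G xs)"
    unfolding expansion_def by (rule bdd_support_diff_pows[OF bG prec])
  show "depends_on X (expansion G xs)" unfolding depends_on_def expansion_def
  proof (intro allI impI)
    fix m m' :: "'x \<Rightarrow> int" assume "\<forall>x\<in>X. m x = m' x"
    then show "diff_pows (\<lambda>x y. - nu x y) (pairs xs) G m = diff_pows (\<lambda>x y. - nu x y) (pairs xs) G m'"
      using dep by (intro diff_pows_cong_on[of X]) (auto simp: depends_on_def)
  qed
  show "0 \<le> m (last xs)" if "xs \<noteq> []" "expansion G xs m \<noteq> 0" for m
  proof (rule diff_pows_lower[of G 0 "last xs" "pairs xs"])
    show "0 \<le> m (last xs)" if "G m \<noteq> 0" for m using G[OF that] \<open>xs \<noteq> []\<close> set by auto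
    show "a \<noteq> last xs" if "(a, b) \<in> set (pairs xs)" for a b using pairs_not_last[OF dist that] .
  qed (use that in \<open>simp add: expansion_def\<close>)
  fix \<tau> m assume \<tau>: "colour_sym X \<tau>"
  have "diff_pows (\<lambda>x y. - nu x y) (map (map_prod \<tau> \<tau>) (pairs xs)) (\<lambda>m. G (m \<circ> \<tau>))
      = (\<lambda>m. diff_pows (\<lambda>x y. - nu x y) (pairs xs) G (m \<circ> \<tau>))"
    by (rule diff_pows_rename[OF colour_sym_inj[OF \<tau>]]) (simp add: nu_colour_sym[OF \<tau>])
  moreover have "(\<lambda>m. G (m \<circ> \<tau>)) = G" by (simp add: sym[OF \<tau>])
  ultimately show "expansion G (map \<tau> xs) m = expansion G xs (m \<circ> \<tau>)" by (simp add: expansion_def pairs_map)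
next
  fix us x y vs m assume ord: "ordering X (us @ x # y # vs)"
  show "diff_power x y (max (nu x y) 0) (expansion G (us @ x # y # vs)) m
      = sgn_of (nu x y) * diff_power x y (max (nu x y) 0) (expansion G (us @ y # x # vs)) m"
    unfolding expansion_def
    using diff_pows_swap[of G X us x y vs nu] G ord nu_commute[of x y] N_lower[of "col x" "col y"]
    by (simp add: nu_def)
qed

lemma regular_part_expansion:
  assumes G: "\<And>m x. G m \<noteq> 0 \<Longrightarrow> x \<in> X \<Longrightarrow> 0 \<le> m x" and ord: "ordering X xs"
  shows "diff_pows nu (pairs xs) (expansion G xs) = G" unfolding expansion_def
proof (rule diff_pows_inverse)
  show "bdd_support (upsets xs) G"
    by (rule bdd_support_nonneg[of G X]; use G upsets_subset ord in \<open>unfold ordering_def, blast\<close>)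
  show "precedes (upsets xs) x y" if "(x, y) \<in> set (pairs xs)" for x y
    using that ord by (auto simp: ordering_def intro!: precedes_upsets)
qed simp

end

section \<open>Systems of correlation functions on words\<close>

definition content :: "('v \<times> int) list \<Rightarrow> 'v \<Rightarrow> nat" where
  "content gs = count_list (map fst gs)"

text \<open>The mode \<open>i(n)\<close> is the coefficient of \<open>z^(-n-1)\<close>, so this is
  the total degree in the variables \<open>z\<close>.\<close>

definition total :: "('v \<times> int) list \<Rightarrow> int" where
  "total gs = (\<Sum>g\<leftarrow>gs. - snd g - 1)"

definition word_of :: "('v \<times> 'k) list \<Rightarrow> ('v \<times> 'k \<Rightarrow> int) \<Rightarrow> ('v \<times> int) list" where
  "word_of xs m = map (\<lambda>x. (fst x, - m x - 1)) xs"

definition vars :: "('v \<Rightarrow> nat) \<Rightarrow> ('v \<times> nat) set" where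
  "vars d = {(i, k). 1 \<le> k \<and> k \<le> d i}"

lemma content_append: "content (gs @ hs) = content gs + content hs" by (simp add: content_def fun_eq_iff)

lemma content_Nil [simp]: "content [] = 0" by (simp add: content_def fun_eq_iff)

lemma content_Cons: "content (g # gs) = (content gs)(fst g := Suc (content gs (fst g)))"
  by (auto simp: content_def fun_eq_iff)

lemma total_append [simp]: "total (gs @ hs) = total gs + total hs" by (simp add: total_def)

lemma map_fst_word_of: "map fst (word_of xs m) = map fst xs" by (simp add: word_of_def)

lemma total_word_of: "distinct xs \<Longrightarrow> total (word_of xs m) = sum m (set xs)"
  by (simp add: total_def word_of_def comp_def sum_list_distinct_conv_sum_set)

lemma word_of_append [simp]: "word_of (xs @ ys) m = word_of xs m @ word_of ys m"
  and word_of_Cons [simp]: "word_of (x # xs) m = (fst x, - m x - 1) # word_of xs m"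
  and word_of_Nil [simp]: "word_of [] m = []" by (simp_all add: word_of_def)

lemma word_of_cong: "(\<And>x. x \<in> set xs \<Longrightarrow> m x = m' x) \<Longrightarrow> word_of xs m = word_of xs m'" by (simp add: word_of_def)

lemma word_of_split:
  assumes "us @ a # b # vs = word_of xs m"
  obtains us' x y vs' where "xs = us' @ x # y # vs'" "word_of us' m = us" "word_of vs' m = vs"
    "(fst x, - m x - 1) = a" "(fst y, - m y - 1) = b"
proof -
  define n where "n = length us"
  have len: "Suc n < length xs" using arg_cong[OF assms, of length] by (simp add: word_of_def n_def)
  have xs: "xs = take n xs @ xs ! n # xs ! Suc n # drop (Suc (Suc n)) xs"
    using Cons_nth_drop_Suc[of n xs] Cons_nth_drop_Suc[of "Suc n" xs] len append_take_drop_id[of n xs] by simp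
  have nth: "(fst (xs ! k), - m (xs ! k) - 1) = (us @ a # b # vs) ! k" if "k < length xs" for k
    unfolding assms using that by (simp add: word_of_def)
  have "word_of (take n xs) m = take n (us @ a # b # vs)"
    "word_of (drop (Suc (Suc n)) xs) m = drop (Suc (Suc n)) (us @ a # b # vs)"
    unfolding assms by (simp_all add: word_of_def take_map drop_map)
  moreover have "(us @ a # b # vs) ! n = a" "(us @ a # b # vs) ! Suc n = b"
    by (simp_all add: n_def nth_append)
  ultimately show ?thesis using that[OF xs] nth[of n] nth[of "Suc n"] len by (simp add: n_def)
qed

lemma content_word_of:
  assumes "ordering (vars d) xs"
  shows "content (word_of xs m) = d"
proof
  fix i
  have "content (word_of xs m) i = length (filter (\<lambda>x. fst x = i) xs)"
    by (simp add: content_def word_of_def count_list_eq_length_filter filter_map comp_def eq_commute)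
  also have "\<dots> = card (set (filter (\<lambda>x. fst x = i) xs))"
    using assms by (intro distinct_card[symmetric]) (simp add: ordering_def)
  also have "set (filter (\<lambda>x. fst x = i) xs) = {x \<in> vars d. fst x = i}"
    using assms by (simp add: ordering_def)
  also have "{x \<in> vars d. fst x = i} = Pair i ` {1..d i}" by (auto simp: vars_def)
  finally show "content (word_of xs m) i = d i" by (simp add: card_image inj_on_def)
qed

lemma finite_vars: "finite {i. d i \<noteq> 0} \<Longrightarrow> finite (vars d)"
  by (rule finite_subset[of _ "Sigma {i. d i \<noteq> 0} (\<lambda>i. {..d i})"]) (auto simp: vars_def)

lemma finite_content: "finite {i. content gs i \<noteq> 0}"
proof (rule finite_subset)
  show "{i. content gs i \<noteq> 0} \<subseteq> set (map fst gs)" by (auto simp: content_def count_list_0_iff)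
qed simp

lemma vars_Suc: "vars (d(i := Suc (d i))) = insert (i, Suc (d i)) (vars d)"
  by (auto simp: vars_def le_Suc_eq split: if_splits)

text \<open>A new letter at the front receives the next free index of its colour. Words thereby
  become orderings of variables with exponents, unique up to a renumbering that preserves
  colours.\<close>

lemma word_representation:
  obtains xs m where "ordering (vars (content gs)) xs" "gs = word_of xs m"
proof -
  have "\<exists>xs m. ordering (vars (content gs)) xs \<and> gs = word_of xs m"
  proof (induction gs)
    case Nil
    then show ?case by (auto simp: ordering_def vars_def intro!: exI[of _ "[]"])
  next
    case (Cons g gs)
    then obtain xs m where xs: "ordering (vars (content gs)) xs" "gs = word_of xs m" by blast
    define x where "x = (fst g, Suc (content gs (fst g)))"
    have nx: "x \<notin> set xs" using xs by (auto simp: ordering_def vars_def x_def)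
    have "word_of xs (m(x := - snd g - 1)) = word_of xs m" using nx by (intro word_of_cong) auto
    then have "g # gs = word_of (x # xs) (m(x := - snd g - 1))" by (simp add: xs x_def)
    moreover have "ordering (vars (content (g # gs))) (x # xs)"
      using xs nx by (simp add: ordering_def content_Cons vars_Suc x_def)
    ultimately show ?case by blast
  qed
  then show ?thesis using that by blast
qed

locale correlators = charges N "fst :: 'v \<times> nat \<Rightarrow> 'v" for N :: "'v \<Rightarrow> 'v \<Rightarrow> int"
begin

lemma colour_sym_fst: "colour_sym X \<tau> \<Longrightarrow> fst (\<tau> x) = fst x" unfolding colour_sym_def by blast

lemma word_of_eqD:
  fixes xs ys :: "('v \<times> nat) list"
  assumes "ordering X xs" "ordering X ys" "word_of xs m = word_of ys m'"
  obtains \<tau> where "colour_sym X \<tau>" "ys = map \<tau> xs" "\<And>x. x \<in> X \<Longrightarrow> m x = m' (\<tau> x)"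
proof -
  have len: "length ys = length xs" using arg_cong[OF assms(3), of length] by (simp add: word_of_def)
  have dist: "distinct xs" "distinct ys" and set: "set xs = X" "set ys = X"
    using assms by (auto simp: ordering_def)
  define \<tau> where "\<tau> x = (if x \<in> X then the (map_of (zip xs ys) x) else x)" for x
  have \<tau>: "\<tau> (xs ! k) = ys ! k" if "k < length xs" for k
    using that dist len set nth_mem[OF that] by (simp add: \<tau>_def map_of_zip_nth)
  have map: "ys = map \<tau> xs" using len \<tau> by (auto simp: list_eq_iff_nth_eq)
  have "bij_betw \<tau> X X" using dist set map by (metis bij_betw_def distinct_map set_map)
  then have perm: "\<tau> permutes X" by (rule bij_imp_permutes) (simp add: \<tau>_def)
  have eq: "fst (\<tau> x) = fst x \<and> m x = m' (\<tau> x)" if "x \<in> X" for x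
  proof -
    have "x \<in> set xs" using that set by simp
    then obtain k where k: "k < length xs" "xs ! k = x" unfolding in_set_conv_nth by blast
    have "word_of xs m ! k = word_of ys m' ! k" using assms(3) by simp
    then show ?thesis using k(1) len \<tau>[OF k(1)] by (simp add: word_of_def k(2)[symmetric])
  qed
  then have "colour_sym X \<tau>" unfolding colour_sym_def using perm by (metis permutes_def)
  then show ?thesis using that map eq by blast
qed

text \<open>The relations of the Lie algebra inside arbitrary contexts \<open>us\<close> and
  \<open>vs\<close>, the bracket written out as a signed commutator, and the vacuum condition.
  Letters range over all colours, so functions on words of a quiver are later extended by 0.\<close>

definition is_system :: "'v corr_fun \<Rightarrow> bool" where
  "is_system \<Phi> \<longleftrightarrow> (\<forall>us vs i j m n. (\<Sum>k\<le>nat (max (N i j) 0). (-1) ^ k * of_nat (nat (max (N i j) 0) choose k) *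
        (\<Phi> (pair_word us i m j n vs k) - sgn_of (N i j) * \<Phi> (swap_word us i m j n vs k))) = 0) \<and>
     (\<forall>us i n. 0 \<le> n \<longrightarrow> \<Phi> (us @ [(i, n)]) = 0)"

lemma system_prefix: "is_system \<Phi> \<Longrightarrow> is_system (\<lambda>w. \<Phi> (us @ w))"
  unfolding is_system_def append_assoc[symmetric] by blast

text \<open>All words in one relation share their content and total, so a system can be cut down to
  any set of such values.\<close>

lemma system_restrict:
  assumes "is_system \<Phi>"
  shows "is_system (\<lambda>gs. if P (content gs) (total gs) then \<Phi> gs else 0)"
proof -
  have "(if P (content (pair_word us i m j n vs k)) (total (pair_word us i m j n vs k))
      then \<Phi> (pair_word us i m j n vs k) else 0)
    - sgn_of (N i j) * (if P (content (swap_word us i m j n vs k)) (total (swap_word us i m j n vs k))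
      then \<Phi> (swap_word us i m j n vs k) else 0)
    = (if P (content (us @ (i, m) # (j, n) # vs)) (total (us @ (i, m) # (j, n) # vs)) then 1 else 0) *
      (\<Phi> (pair_word us i m j n vs k) - sgn_of (N i j) * \<Phi> (swap_word us i m j n vs k))" for us vs i j m n k
  proof -
    have "content (pair_word us i m j n vs k) = content (us @ (i, m) # (j, n) # vs)"
      "content (swap_word us i m j n vs k) = content (us @ (i, m) # (j, n) # vs)"
      "total (pair_word us i m j n vs k) = total (us @ (i, m) # (j, n) # vs)"
      "total (swap_word us i m j n vs k) = total (us @ (i, m) # (j, n) # vs)"
      by (simp_all add: content_append content_Cons total_def fun_eq_iff)
    then show ?thesis by simp
  qed
  note step = this
  show ?thesis unfolding is_system_def step
  proof (intro conjI allI impI)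
    fix us vs i j m n
    have "(\<Sum>k\<le>nat (max (N i j) 0). (-1) ^ k * of_nat (nat (max (N i j) 0) choose k) *
        (\<Phi> (pair_word us i m j n vs k) - sgn_of (N i j) * \<Phi> (swap_word us i m j n vs k))) = 0"
      using assms by (simp add: is_system_def)
    then show "(\<Sum>k\<le>nat (max (N i j) 0). (-1) ^ k * of_nat (nat (max (N i j) 0) choose k) *
        ((if P (content (us @ (i, m) # (j, n) # vs)) (total (us @ (i, m) # (j, n) # vs)) then 1 else 0) *
        (\<Phi> (pair_word us i m j n vs k) - sgn_of (N i j) * \<Phi> (swap_word us i m j n vs k)))) = 0"
      by (cases "P (content (us @ (i, m) # (j, n) # vs)) (total (us @ (i, m) # (j, n) # vs))")
        (simp_all only: if_True if_False mult_1 mult_zero_left mult_zero_right sum.neutral_const)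
  qed (use assms in \<open>simp add: is_system_def\<close>)
qed

definition fam :: "'v corr_fun \<Rightarrow> ('v \<times> nat) list \<Rightarrow> ('v \<times> nat) distr" where
  "fam \<Phi> xs m = \<Phi> (word_of xs m)"

text \<open>Under \<open>n = -m - 1\<close> the terms of the expanded power become the terms of the
  mode relation; the degree of the factor appears as a shift of the first mode.\<close>

lemma fam_local:
  assumes "distinct (us @ x # y # vs)"
  shows "diff_power x y (max (nu x y) 0) (fam \<Phi> (us @ x # y # vs)) m
      - sgn_of (nu x y) * diff_power x y (max (nu x y) 0) (fam \<Phi> (us @ y # x # vs)) m
    = (\<Sum>k\<le>nat (max (nu x y) 0). (-1) ^ k * of_nat (nat (max (nu x y) 0) choose k) *
        (\<Phi> (word_of us m @ (fst x, - m x - 1 + max (nu x y) 0 - int k) # (fst y, - m y - 1 + int k) # word_of vs m)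
          - sgn_of (nu x y) * \<Phi> (word_of us m @ (fst y, - m y - 1 + int k) #
              (fst x, - m x - 1 + max (nu x y) 0 - int k) # word_of vs m)))"
proof -
  define n where "n = nat (max (nu x y) 0)"
  have n: "max (nu x y) 0 = int n" by (simp add: n_def)
  have w: "word_of us (m + shift_vec x y (int n) k) = word_of us m"
    "word_of vs (m + shift_vec x y (int n) k) = word_of vs m" for k
    using assms by (auto intro!: word_of_cong simp: shift_vec_def)
  have xy: "x \<noteq> y" using assms by auto
  have v: "- (m + shift_vec x y (int n) k) x - 1 = - m x - 1 + int n - int k"
    "- (m + shift_vec x y (int n) k) y - 1 = - m y - 1 + int k" for k using xy by (auto simp: shift_vec_def)
  show ?thesis unfolding n diff_power_nat nat_int fam_def word_of_append word_of_Cons w v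
    by (simp add: sum_distrib_left right_diff_distrib mult_ac flip: sum_subtractf)
qed

text \<open>The bound on supports is a hypothesis here, since the general bound
  \<open>system_bound\<close> is itself derived by means of families.\<close>

lemma family_fam:
  assumes sys: "is_system \<Phi>" and bdd: "\<And>xs. ordering X xs \<Longrightarrow> bdd_support (upsets xs) (fam \<Phi> xs)"
  shows "family X (fam \<Phi>)" unfolding family_def
proof (intro conjI allI impI)
  fix xs assume ord: "ordering X xs"
  show "bdd_support (upsets xs) (fam \<Phi> xs)" by (rule bdd[OF ord])
  show "depends_on X (fam \<Phi> xs)" unfolding depends_on_def fam_def using ord
    by (metis ordering_def word_of_cong)
  show "0 \<le> m (last xs)" if "xs \<noteq> []" "fam \<Phi> xs m \<noteq> 0" for m
  proof (rule ccontr)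
    assume neg: "\<not> 0 \<le> m (last xs)"
    have "word_of xs m = word_of (butlast xs) m @ [(fst (last xs), - m (last xs) - 1)]"
      using that(1) by (metis append_butlast_last_id word_of_Cons word_of_Nil word_of_append)
    then have "fam \<Phi> xs m = 0" using sys neg unfolding is_system_def fam_def by simp
    then show False using that(2) by simp
  qed
  fix \<tau> m assume "colour_sym X \<tau>"
  then show "fam \<Phi> (map \<tau> xs) m = fam \<Phi> xs (m \<circ> \<tau>)" by (simp add: fam_def word_of_def colour_sym_fst comp_def)
next
  fix us x y vs m assume "ordering X (us @ x # y # vs)"
  then have dist: "distinct (us @ x # y # vs)" by (simp add: ordering_def)
  have "diff_power x y (max (nu x y) 0) (fam \<Phi> (us @ x # y # vs)) m
      - sgn_of (nu x y) * diff_power x y (max (nu x y) 0) (fam \<Phi> (us @ y # x # vs)) m = 0"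
    unfolding fam_local[OF dist] using sys unfolding is_system_def nu_def by blast
  then show "diff_power x y (max (nu x y) 0) (fam \<Phi> (us @ x # y # vs)) m
      = sgn_of (nu x y) * diff_power x y (max (nu x y) 0) (fam \<Phi> (us @ y # x # vs)) m" by simp
qed

definition charge :: "'v list \<Rightarrow> int" where
  "charge is = (\<Sum>(i, j)\<leftarrow>pairs is. N i j)"

lemma sum_pairs_nu: "(\<Sum>(x, y)\<leftarrow>pairs xs. nu x y) = charge (map fst xs)"
  by (simp add: charge_def pairs_map comp_def case_prod_unfold nu_def)

text \<open>The signed charge of a final segment may exceed that of the whole word; absolute values
  give one bound for all final segments.\<close>

definition abs_charge :: "'v list \<Rightarrow> int" where
  "abs_charge is = (\<Sum>(i, j)\<leftarrow>pairs is. \<bar>N i j\<bar>)"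

lemma charge_le_abs: "charge is \<le> abs_charge is"
  unfolding charge_def abs_charge_def by (rule sum_list_mono) auto

lemma abs_charge_drop: "abs_charge (drop k is) \<le> abs_charge is"
proof (induction "is" arbitrary: k)
  case (Cons i "is")
  have "0 \<le> (\<Sum>j\<leftarrow>is. \<bar>N i j\<bar>)" by (rule sum_list_nonneg) auto
  then have "abs_charge is \<le> abs_charge (i # is)" by (simp add: abs_charge_def comp_def)
  with Cons[of "k - 1"] show ?case by (cases k) auto
qed (simp add: abs_charge_def)

text \<open>
  Cutting a correlation function down to one total degree, its regular part is a homogeneous
  polynomial, hence zero in negative degrees.
\<close>

lemma system_bound:
  assumes "is_system \<Phi>" "\<Phi> gs \<noteq> 0"
  shows "- charge (map fst gs) \<le> total gs" using assms
proof (induction gs arbitrary: \<Phi> rule: length_induct)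
  case (1 gs)
  obtain xs m where xs: "ordering (vars (content gs)) xs" "gs = word_of xs m" by (rule word_representation)
  define X where "X = vars (content gs)"
  have ordX: "ordering X xs" and distx: "distinct xs" and setx: "set xs = X" and finX: "finite X"
    using xs(1) finite_vars[OF finite_content, of gs] by (auto simp: X_def ordering_def)
  define M where "M = total gs"
  define \<Psi> where "\<Psi> hs = (if total hs = M then \<Phi> hs else 0)" for hs
  have \<Psi>: "is_system \<Psi>" unfolding \<Psi>_def using system_restrict[OF 1(2), of "\<lambda>_ t. t = M"] .
  have bdd: "bdd_support (upsets ys) (fam \<Psi> ys)" if ord: "ordering X ys" for ys unfolding bdd_support_def
  proof (intro exI allI impI ballI)
    fix m' U assume nz: "fam \<Psi> ys m' \<noteq> 0" and "U \<in> upsets ys"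
    then obtain k where U: "U = set (drop k ys)" by (auto simp: upsets_def)
    have dist: "distinct ys" and set: "set ys = X" using ord by (auto simp: ordering_def)
    have len: "length ys = length gs"
      using ord ordX xs(2) distinct_card by (metis length_map ordering_def word_of_def)
    have tot: "sum m' X = M"
      using nz total_word_of[OF dist, of m'] by (auto simp: fam_def \<Psi>_def set split: if_splits)
    show "min M (- abs_charge (map fst ys)) \<le> sum m' U"
    \<comment> \<open>The sum over all of \<open>X\<close> is \<open>M\<close>. A proper final
      segment is a shorter word for the system in which the initial letters are held fixed, so the
      induction hypothesis applies.\<close>
    proof (cases "k = 0 \<or> ys = []")
      case True
      then show ?thesis using tot U set by auto
    next
      case False
      define \<Theta> where "\<Theta> w = \<Psi> (word_of (take k ys) m' @ w)" for w
      have "is_system \<Theta>" unfolding \<Theta>_def by (rule system_prefix[OF \<Psi>])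
      moreover have "\<Theta> (word_of (drop k ys) m') \<noteq> 0"
        using nz unfolding \<Theta>_def fam_def by (metis append_take_drop_id word_of_append)
      moreover have "length (word_of (drop k ys) m') < length gs"
        using False len by (auto simp: word_of_def intro!: diff_less)
      ultimately have "- charge (map fst (word_of (drop k ys) m')) \<le> total (word_of (drop k ys) m')"
        using 1(1) by blast
      then have "- charge (drop k (map fst ys)) \<le> sum m' U"
        using dist by (simp add: map_fst_word_of U total_word_of drop_map)
      moreover have "charge (drop k (map fst ys)) \<le> abs_charge (map fst ys)"
        using charge_le_abs abs_charge_drop order_trans by blast
      ultimately show ?thesis by linarith
    qed
  qed
  have famX: "family X (fam \<Psi>)" by (rule family_fam[OF \<Psi> bdd])
  have nz: "fam \<Psi> xs m \<noteq> 0" using 1(3) xs(2) by (simp add: fam_def \<Psi>_def M_def)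
  \<comment> \<open>Expansion recovers the family from its regular part, so a nonzero value forces a
    nonzero coefficient there. Its degree is \<open>M\<close> plus the charge, and regularity makes
    it non-negative.\<close>
  have "regular_part (fam \<Psi>) xs \<noteq> (\<lambda>m. 0)"
  proof
    assume "regular_part (fam \<Psi>) xs = (\<lambda>m. 0)"
    then have "fam \<Psi> xs = (\<lambda>m. 0)" using expansion_regular_part[OF famX ordX] by (simp add: expansion_def)
    then show False using nz by simp
  qed
  then obtain m' where m': "regular_part (fam \<Psi>) xs m' \<noteq> 0" by (auto simp: fun_eq_iff)
  have "sum m' X - (\<Sum>(x, y)\<leftarrow>pairs xs. nu x y) \<in> {M}"
  proof (rule diff_pows_total[of "fam \<Psi> xs"])
    show "sum m'' X \<in> {M}" if "fam \<Psi> xs m'' \<noteq> 0" for m''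
      using that total_word_of[OF distx, of m''] by (auto simp: fam_def \<Psi>_def setx split: if_splits)
    show "x \<in> X \<and> y \<in> X" if "(x, y) \<in> set (pairs xs)" for x y using in_pairs_set[OF that] setx by simp
    show "diff_pows nu (pairs xs) (fam \<Psi> xs) m' \<noteq> 0" using m' by (simp add: regular_part_def)
  qed (rule finX)
  moreover have "0 \<le> sum m' X" by (rule sum_nonneg) (rule regular_part_nonneg[OF famX ordX m'])
  ultimately have "- (\<Sum>(x, y)\<leftarrow>pairs xs. nu x y) \<le> M" by simp
  then show ?case using xs(2) by (simp add: sum_pairs_nu M_def map_fst_word_of)
qed

text \<open>\<open>system_bound\<close>, applied with the initial letters held fixed, bounds the sum
  over each final segment.\<close>

lemma system_family:
  assumes sys: "is_system \<Phi>"
  shows "family X (fam \<Phi>)"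
proof (rule family_fam[OF sys])
  fix xs assume ord: "ordering X xs"
  show "bdd_support (upsets xs) (fam \<Phi> xs)" unfolding bdd_support_def
  proof (intro exI allI impI ballI)
    fix m U assume nz: "fam \<Phi> xs m \<noteq> 0" and "U \<in> upsets xs"
    then obtain k where U: "U = set (drop k xs)" by (auto simp: upsets_def)
    have dist: "distinct xs" using ord by (auto simp: ordering_def)
    have "is_system (\<lambda>w. \<Phi> (word_of (take k xs) m @ w))" by (rule system_prefix[OF sys])
    moreover have "\<Phi> (word_of (take k xs) m @ word_of (drop k xs) m) \<noteq> 0"
      using nz unfolding fam_def by (metis append_take_drop_id word_of_append)
    ultimately have "- charge (map fst (word_of (drop k xs) m)) \<le> total (word_of (drop k xs) m)"
      by (rule system_bound)
    then have "- charge (drop k (map fst xs)) \<le> sum m U"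
      using dist by (simp add: map_fst_word_of U total_word_of drop_map)
    moreover have "charge (drop k (map fst xs)) \<le> abs_charge (map fst xs)"
      using charge_le_abs abs_charge_drop order_trans by blast
    ultimately show "- abs_charge (map fst xs) \<le> sum m U" by linarith
  qed
qed

definition correlator_of ::
  "('v \<Rightarrow> nat) \<Rightarrow> (('v \<times> nat) list \<Rightarrow> ('v \<times> nat \<Rightarrow> int) \<Rightarrow> rat) \<Rightarrow> 'v corr_fun" where
  "correlator_of d f gs = (if content gs = d
     then (case SOME (xs, m). ordering (vars d) xs \<and> gs = word_of xs m of (xs, m) \<Rightarrow> f xs m) else 0)"

text \<open>The choice inside \<open>correlator_of\<close> is harmless: two representations of a
  word differ by a permutation preserving colours, under which the family is invariant.\<close>

lemma correlator_of_word:
  assumes "family (vars d) f" "ordering (vars d) xs"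
  shows "correlator_of d f (word_of xs m) = f xs m"
proof -
  define p where "p = (SOME (ys, m'). ordering (vars d) ys \<and> word_of xs m = word_of ys m')"
  obtain ys m' where p: "p = (ys, m')" by force
  have "case p of (ys, m') \<Rightarrow> ordering (vars d) ys \<and> word_of xs m = word_of ys m'"
    unfolding p_def by (rule someI[of _ "(xs, m)"]) (use assms(2) in simp)
  then have ys: "ordering (vars d) ys" "word_of xs m = word_of ys m'" by (auto simp: p)
  then obtain \<tau> where \<tau>: "colour_sym (vars d) \<tau>" "ys = map \<tau> xs" "\<And>x. x \<in> vars d \<Longrightarrow> m x = m' (\<tau> x)"
    using word_of_eqD[OF assms(2)] by metis
  have "f ys m' = f xs (m' \<circ> \<tau>)" using familyD(4)[OF assms \<tau>(1)] \<tau>(2) by simp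
  also have "\<dots> = f xs m" using familyD(2)[OF assms] \<tau>(3) by (auto simp: depends_on_def)
  finally have "f ys m' = f xs m" .
  then show ?thesis using content_word_of[OF assms(2)] by (simp add: correlator_of_def p p_def[symmetric])
qed

lemma correlator_of_content: "content gs \<noteq> d \<Longrightarrow> correlator_of d f gs = 0" by (simp add: correlator_of_def)

lemma is_system_correlator_of:
  assumes fam: "family (vars d) f"
  shows "is_system (correlator_of d f)" unfolding is_system_def
proof (intro conjI allI impI)
  fix us vs i j m n
  show "(\<Sum>k\<le>nat (max (N i j) 0). (-1) ^ k * of_nat (nat (max (N i j) 0) choose k) *
        (correlator_of d f (pair_word us i m j n vs k)
          - sgn_of (N i j) * correlator_of d f (swap_word us i m j n vs k))) = 0"
    (is "?S = 0")
  \<comment> \<open>Subtracting \<open>max (N i j) 0\<close> from the first mode compensates the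
    shift by the degree of the factor in \<open>fam_local\<close>.\<close>
  proof (cases "content (us @ (i, m - max (N i j) 0) # (j, n) # vs) = d")
    case False
    have "content (pair_word us i m j n vs k) = content (us @ (i, m - max (N i j) 0) # (j, n) # vs)"
      "content (swap_word us i m j n vs k) = content (us @ (i, m - max (N i j) 0) # (j, n) # vs)" for k
      by (simp_all add: content_append content_Cons fun_eq_iff)
    with False show ?thesis by (simp add: correlator_of_content)
  next
    case True
    obtain xs \<mu> where "ordering (vars (content (us @ (i, m - max (N i j) 0) # (j, n) # vs))) xs"
      and xs2: "us @ (i, m - max (N i j) 0) # (j, n) # vs = word_of xs \<mu>" by (rule word_representation)
    then have xs: "ordering (vars d) xs" "us @ (i, m - max (N i j) 0) # (j, n) # vs = word_of xs \<mu>"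
      unfolding True .
    from xs(2) obtain us' x y vs' where split: "xs = us' @ x # y # vs'" "word_of us' \<mu> = us" "word_of vs' \<mu> = vs"
      "(fst x, - \<mu> x - 1) = (i, m - max (N i j) 0)" "(fst y, - \<mu> y - 1) = (j, n)" by (rule word_of_split)
    have dist: "distinct (us' @ x # y # vs')" and ord: "ordering (vars d) (us' @ x # y # vs')"
      using xs(1) split(1) by (auto simp: ordering_def)
    have nuN: "nu x y = N i j" using split by (simp add: nu_def)
    have mx: "- \<mu> x - 1 = m - max (N i j) 0" and my: "- \<mu> y - 1 = n" and fx: "fst x = i" and fy: "fst y = j"
      using split by auto
    have D: "fam (correlator_of d f) (us' @ x # y # vs') = f (us' @ x # y # vs')"
      "fam (correlator_of d f) (us' @ y # x # vs') = f (us' @ y # x # vs')" unfolding fam_def fun_eq_iff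
      using correlator_of_word[OF fam ord] correlator_of_word[OF fam ordering_swap[OF ord]] by blast+
    have "?S = diff_power x y (max (nu x y) 0) (fam (correlator_of d f) (us' @ x # y # vs')) \<mu>
      - sgn_of (nu x y) * diff_power x y (max (nu x y) 0) (fam (correlator_of d f) (us' @ y # x # vs')) \<mu>"
      unfolding fam_local[OF dist] unfolding split(2,3) fx fy mx my nuN by simp
    also have "\<dots> = 0" unfolding D family_local[OF fam ord] by simp
    finally show ?thesis .
  qed
next
  fix us i n assume n: "0 \<le> (n::int)"
  show "correlator_of d f (us @ [(i, n)]) = 0"
  proof (cases "content (us @ [(i, n)]) = d")
    case True
    obtain xs \<mu> where "ordering (vars (content (us @ [(i, n)]))) xs"
      and xs2: "us @ [(i, n)] = word_of xs \<mu>" by (rule word_representation)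
    then have xs: "ordering (vars d) xs" "us @ [(i, n)] = word_of xs \<mu>" unfolding True .
    have ne: "xs \<noteq> []" using xs(2) by auto
    have "last (word_of xs \<mu>) = (i, n)" using xs(2) by (metis last_snoc)
    then have "- \<mu> (last xs) - 1 = n" using ne by (simp add: word_of_def last_map)
    then have "f xs \<mu> = 0" using familyD(3)[OF fam xs(1) ne, of \<mu>] n by linarith
    then show ?thesis using correlator_of_word[OF fam xs(1)] xs(2) by simp
  qed (simp add: correlator_of_content)
qed

end

section \<open>Polynomials as functions of integer exponents\<close>

definition monom_of :: "'x set \<Rightarrow> ('x \<Rightarrow> int) \<Rightarrow> 'x \<Rightarrow>\<^sub>0 nat" where
  "monom_of X m = (\<Sum>x\<in>X. single x (nat (m x)))"

definition poly_in :: "'x set \<Rightarrow> (('x \<Rightarrow>\<^sub>0 nat) \<Rightarrow>\<^sub>0 rat) \<Rightarrow> bool" where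
  "poly_in X g \<longleftrightarrow> (\<forall>\<mu>\<in>keys g. keys \<mu> \<subseteq> X)"

text \<open>Integer exponents, with value 0 as soon as one of them is negative, make a polynomial a
  formal distribution, so that the operators above apply to it. Exponents outside \<open>X\<close>
  are ignored.\<close>

definition pcoef :: "'x set \<Rightarrow> (('x \<Rightarrow>\<^sub>0 nat) \<Rightarrow>\<^sub>0 rat) \<Rightarrow> 'x distr" where
  "pcoef X g m = (if \<forall>x\<in>X. 0 \<le> m x then lookup g (monom_of X m) else 0)"

lemma lookup_monom_of:
  "finite X \<Longrightarrow> lookup (monom_of X m) y = (if y \<in> X then nat (m y) else 0)"
  by (simp add: monom_of_def lookup_sum lookup_single when_def)

lemma monom_of_lookup:
  assumes "finite X" "keys \<mu> \<subseteq> X"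
  shows "monom_of X (\<lambda>x. int (lookup \<mu> x)) = \<mu>"
  using assms by (intro poly_mapping_eqI) (auto simp: lookup_monom_of in_keys_iff)

lemma lookup_scale: "lookup (scaled c g) k = (c::'a::mult_zero) * lookup g k"
  by (simp add: Poly_Mapping.map.rep_eq when_def)

lemma lookup_eq_pcoef:
  assumes "finite X" "keys \<mu> \<subseteq> X"
  shows "lookup g \<mu> = pcoef X g (\<lambda>x. int (lookup \<mu> x))"
  using monom_of_lookup[OF assms] by (simp add: pcoef_def)

lemma pcoef_inj:
  assumes "finite X" "poly_in X g" "poly_in X h" "pcoef X g = pcoef X h"
  shows "g = h"
proof (rule poly_mapping_eqI)
  fix \<mu>
  show "lookup g \<mu> = lookup h \<mu>"
  proof (cases "keys \<mu> \<subseteq> X")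
    case True
    then show ?thesis using lookup_eq_pcoef[OF assms(1) True] assms(4) by metis
  next
    case False
    then have "\<mu> \<notin> keys g" "\<mu> \<notin> keys h" using assms(2,3) by (auto simp: poly_in_def)
    then show ?thesis by (simp add: in_keys_iff)
  qed
qed

lemma pcoef_nonneg: "pcoef X g m \<noteq> 0 \<Longrightarrow> x \<in> X \<Longrightarrow> 0 \<le> m x" by (auto simp: pcoef_def split: if_splits)

lemma depends_on_pcoef:
  fixes X :: "'x set"
  shows "depends_on X (pcoef X g)" unfolding depends_on_def
proof (intro allI impI)
  fix m m' :: "'x \<Rightarrow> int" assume *: "\<forall>x\<in>X. m x = m' x"
  then have "monom_of X m = monom_of X m'" unfolding monom_of_def by (intro sum.cong) auto
  then show "pcoef X g m = pcoef X g m'" using * by (simp add: pcoef_def)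
qed

lemma pcoef_zero [simp]: "pcoef X 0 = (\<lambda>m. 0)" by (simp add: pcoef_def fun_eq_iff)

lemma pcoef_add: "pcoef X (g + h) = (\<lambda>m. pcoef X g m + pcoef X h m)"
  by (simp add: pcoef_def fun_eq_iff lookup_add)

lemma pcoef_diff: "pcoef X (g - h) = (\<lambda>m. pcoef X g m - pcoef X h m)"
  by (simp add: pcoef_def fun_eq_iff lookup_minus)

lemma pcoef_scale: "pcoef X (scaled c g) = (\<lambda>m. c * pcoef X g m)"
  by (simp add: pcoef_def fun_eq_iff lookup_scale)

lemma poly_in_zero [simp]: "poly_in X 0" by (simp add: poly_in_def)

lemma poly_in_add: "poly_in X g \<Longrightarrow> poly_in X h \<Longrightarrow> poly_in X (g + h)"
  unfolding poly_in_def using keys_add[of g h] by blast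

lemma poly_in_scale: "poly_in X g \<Longrightarrow> poly_in X (scaled c g)"
  unfolding poly_in_def by (auto simp: in_keys_iff lookup_scale)

lemma poly_in_mono: "poly_in X g \<Longrightarrow> X \<subseteq> Y \<Longrightarrow> poly_in Y g" unfolding poly_in_def by blast

lemma exists_poly:
  assumes fin: "finite X" and G: "\<And>m x. G m \<noteq> 0 \<Longrightarrow> x \<in> X \<Longrightarrow> 0 \<le> m x"
    and dep: "depends_on X G" and bdd: "\<And>m. G m \<noteq> 0 \<Longrightarrow> sum m X \<le> B"
  obtains g where "poly_in X g" "pcoef X g = G"
proof -
  define c where "c \<mu> = (if keys \<mu> \<subseteq> X then G (\<lambda>x. int (lookup \<mu> x)) else 0)" for \<mu>
  have "finite {\<mu>. c \<mu> \<noteq> 0}"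
  proof (rule finite_subset)
    \<comment> \<open>Non-negative exponents with bounded sum lie in a finite box.\<close>
    show "{\<mu>. c \<mu> \<noteq> 0} \<subseteq> monom_of X ` (PiE X (\<lambda>_. {0..B}))"
    proof
      fix \<mu> assume "\<mu> \<in> {\<mu>. c \<mu> \<noteq> 0}"
      then have k: "keys \<mu> \<subseteq> X" and nz: "G (\<lambda>x. int (lookup \<mu> x)) \<noteq> 0" by (auto simp: c_def split: if_splits)
      define m where "m = restrict (\<lambda>x. int (lookup \<mu> x)) X"
      have "int (lookup \<mu> x) \<le> B" if "x \<in> X" for x
      proof -
        have "int (lookup \<mu> x) \<le> (\<Sum>x\<in>X. int (lookup \<mu> x))" by (rule member_le_sum[OF that _ fin]) simp
        also have "\<dots> \<le> B" by (rule bdd[OF nz])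
        finally show ?thesis .
      qed
      then have "m \<in> PiE X (\<lambda>_. {0..B})" by (auto simp: m_def)
      moreover have "monom_of X m = \<mu>" using monom_of_lookup[OF fin k] by (simp add: m_def monom_of_def)
      ultimately show "\<mu> \<in> monom_of X ` (PiE X (\<lambda>_. {0..B}))" by blast
    qed
    show "finite (monom_of X ` (PiE X (\<lambda>_. {0..B})))" using fin by (intro finite_imageI finite_PiE) auto
  qed
  then have look: "lookup (Abs_poly_mapping c) = c" by (rule lookup_Abs_poly_mapping)
  have "poly_in X (Abs_poly_mapping c)"
    by (auto simp: poly_in_def in_keys_iff[of _ "Abs_poly_mapping c"] look c_def split: if_splits)
  moreover have "pcoef X (Abs_poly_mapping c) m = G m" for m
  proof (cases "\<forall>x\<in>X. 0 \<le> m x")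
    case True
    have "keys (monom_of X m) \<subseteq> X" using fin by (auto simp: in_keys_iff lookup_monom_of split: if_splits)
    then have "c (monom_of X m) = G (\<lambda>x. int (lookup (monom_of X m) x))" by (simp add: c_def)
    also have "\<dots> = G m"
      by (rule dep[unfolded depends_on_def, rule_format]) (use True fin in \<open>simp add: lookup_monom_of\<close>)
    finally show ?thesis using True by (simp add: pcoef_def look)
  next
    case False
    then have "G m = 0" using G by blast
    then show ?thesis by (simp only: pcoef_def False if_False)
  qed
  ultimately show ?thesis using that by (auto simp: fun_eq_iff)
qed

lemma keys_degree_iff:
  assumes "finite X" "poly_in X g"
  shows "(\<forall>\<mu>\<in>keys g. P (\<Sum>x\<in>keys \<mu>. int (lookup \<mu> x))) \<longleftrightarrow> (\<forall>m. pcoef X g m \<noteq> 0 \<longrightarrow> P (sum m X))"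
proof (intro iffI allI impI ballI)
  fix m
  assume P: "\<forall>\<mu>\<in>keys g. P (\<Sum>x\<in>keys \<mu>. int (lookup \<mu> x))" and nz: "pcoef X g m \<noteq> 0"
  then have pos: "\<forall>x\<in>X. 0 \<le> m x" and k: "monom_of X m \<in> keys g"
    by (auto simp: pcoef_def in_keys_iff split: if_splits)
  have "(\<Sum>x\<in>keys (monom_of X m). int (lookup (monom_of X m) x)) = sum m X"
    using assms(1) pos by (intro sum.mono_neutral_cong_left) (auto simp: lookup_monom_of in_keys_iff split: if_splits)
  with P k show "P (sum m X)" by metis
next
  fix \<mu>
  assume P: "\<forall>m. pcoef X g m \<noteq> 0 \<longrightarrow> P (sum m X)" and \<mu>: "\<mu> \<in> keys g"
  then have sub: "keys \<mu> \<subseteq> X" using assms(2) by (auto simp: poly_in_def)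
  have "pcoef X g (\<lambda>x. int (lookup \<mu> x)) \<noteq> 0"
    using \<mu> lookup_eq_pcoef[OF assms(1) sub, of g] by (simp add: in_keys_iff)
  then have "P (\<Sum>x\<in>X. int (lookup \<mu> x))" using P by blast
  moreover have "(\<Sum>x\<in>X. int (lookup \<mu> x)) = (\<Sum>x\<in>keys \<mu>. int (lookup \<mu> x))"
    using assms(1) sub by (intro sum.mono_neutral_right) (auto simp: in_keys_iff)
  ultimately show "P (\<Sum>x\<in>keys \<mu>. int (lookup \<mu> x))" by simp
qed

lemma pcoef_degree_bound:
  assumes "finite X" "poly_in X g"
  obtains B where "\<And>m. pcoef X g m \<noteq> 0 \<Longrightarrow> sum m X \<le> B"
proof -
  define D where "D = (\<lambda>\<mu>. \<Sum>x\<in>keys \<mu>. int (lookup \<mu> x)) ` keys g"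
  have "finite D" by (simp add: D_def)
  then have "\<forall>\<mu>\<in>keys g. (\<Sum>x\<in>keys \<mu>. int (lookup \<mu> x)) \<le> Max D" by (auto simp: D_def)
  then show ?thesis using keys_degree_iff[OF assms, of "\<lambda>n. n \<le> Max D"] that by blast
qed

definition rename_monom :: "('x \<Rightarrow> 'y) \<Rightarrow> ('x \<Rightarrow>\<^sub>0 nat) \<Rightarrow> 'y \<Rightarrow>\<^sub>0 nat" where
  "rename_monom \<tau> \<mu> = (\<Sum>x\<in>keys \<mu>. single (\<tau> x) (lookup \<mu> x))"

lemma rename_alt:
  "rename \<tau> f = (\<Sum>\<mu>\<in>keys f. single (rename_monom \<tau> \<mu>) (lookup f \<mu>))"
  by (simp add: rename_def rename_monom_def)

lemma keys_rename_monom: "keys (rename_monom \<tau> \<mu>) \<subseteq> \<tau> ` keys \<mu>" unfolding rename_monom_def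
  by (rule order_trans[OF keys_sum]) (auto split: if_splits)

lemma poly_in_rename: "poly_in X f \<Longrightarrow> poly_in (\<tau> ` X) (rename \<tau> f)" unfolding poly_in_def
proof
  fix \<kappa> assume f: "\<forall>\<mu>\<in>keys f. keys \<mu> \<subseteq> X" and "\<kappa> \<in> keys (rename \<tau> f)"
  then obtain \<mu> where "\<mu> \<in> keys f" "\<kappa> = rename_monom \<tau> \<mu>"
    using keys_sum[of "\<lambda>\<mu>. single (rename_monom \<tau> \<mu>) (lookup f \<mu>)" "keys f"]
    unfolding rename_alt by (force split: if_splits)
  then show "keys \<kappa> \<subseteq> \<tau> ` X" using keys_rename_monom[of \<tau> \<mu>] f by blast
qed

lemma lookup_rename_monom:
  assumes "inj_on \<tau> X" "keys \<mu> \<subseteq> X" "x \<in> X"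
  shows "lookup (rename_monom \<tau> \<mu>) (\<tau> x) = lookup \<mu> x"
proof -
  have "lookup (rename_monom \<tau> \<mu>) (\<tau> x) = (\<Sum>z\<in>keys \<mu>. lookup \<mu> z when \<tau> z = \<tau> x)"
    by (simp add: rename_monom_def lookup_sum lookup_single)
  also have "\<dots> = (\<Sum>z\<in>keys \<mu>. if z = x then lookup \<mu> z else 0)"
    using assms by (intro sum.cong) (auto simp: when_def inj_on_eq_iff subset_iff)
  also have "\<dots> = lookup \<mu> x" by (simp add: in_keys_iff)
  finally show ?thesis .
qed

lemma pcoef_rename:
  assumes inj: "inj_on \<tau> X" and fin: "finite X" and f: "poly_in X f"
  shows "pcoef (\<tau> ` X) (rename \<tau> f) m = pcoef X f (m \<circ> \<tau>)"
proof (cases "\<forall>x\<in>X. 0 \<le> m (\<tau> x)")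
  case True
  have key: "rename_monom \<tau> \<mu> = monom_of (\<tau> ` X) m \<longleftrightarrow> \<mu> = monom_of X (m \<circ> \<tau>)"
    if \<mu>: "keys \<mu> \<subseteq> X" for \<mu>
  proof
    assume eq: "rename_monom \<tau> \<mu> = monom_of (\<tau> ` X) m"
    show "\<mu> = monom_of X (m \<circ> \<tau>)"
    proof (rule poly_mapping_eqI)
      fix x
      show "lookup \<mu> x = lookup (monom_of X (m \<circ> \<tau>)) x"
      proof (cases "x \<in> X")
        case True
        then show ?thesis
          using lookup_rename_monom[OF inj \<mu> True] fin unfolding eq by (simp add: lookup_monom_of)
      next
        case False
        then show ?thesis using \<mu> fin by (auto simp: lookup_monom_of in_keys_iff)
      qed
    qed
  next
    assume eq: "\<mu> = monom_of X (m \<circ> \<tau>)"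
    show "rename_monom \<tau> \<mu> = monom_of (\<tau> ` X) m"
    proof (rule poly_mapping_eqI)
      fix y
      show "lookup (rename_monom \<tau> \<mu>) y = lookup (monom_of (\<tau> ` X) m) y"
      proof (cases "y \<in> \<tau> ` X")
        case True
        then obtain x where "x \<in> X" "y = \<tau> x" by blast
        then show ?thesis using lookup_rename_monom[OF inj \<mu>] fin by (simp add: lookup_monom_of eq)
      next
        case False
        then have "y \<notin> keys (rename_monom \<tau> \<mu>)" using keys_rename_monom[of \<tau> \<mu>] \<mu> by blast
        then show ?thesis using False fin by (simp add: lookup_monom_of in_keys_iff)
      qed
    qed
  qed
  have "lookup (rename \<tau> f) (monom_of (\<tau> ` X) m)
      = (\<Sum>\<mu>\<in>keys f. lookup f \<mu> when rename_monom \<tau> \<mu> = monom_of (\<tau> ` X) m)"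
    by (simp add: rename_alt lookup_sum lookup_single)
  also have "\<dots> = (\<Sum>\<mu>\<in>keys f. if \<mu> = monom_of X (m \<circ> \<tau>) then lookup f \<mu> else 0)"
    using f by (intro sum.cong) (auto simp: when_def key poly_in_def)
  also have "\<dots> = lookup f (monom_of X (m \<circ> \<tau>))" by (simp add: in_keys_iff)
  finally show ?thesis using True by (simp add: pcoef_def)
next
  case False
  then show ?thesis by (auto simp: pcoef_def)
qed

lemma poly_eqI_rename:
  assumes "finite X" "poly_in X f" "poly_in X g" "\<And>m. pcoef X f m = pcoef X g m"
  shows "f = g" using pcoef_inj[OF assms(1-3)] assms(4) by blast

lemma diff_pows_add:
  assumes "bdd_support \<U> f" "bdd_support \<U> g" "\<And>x y. (x, y) \<in> set L \<Longrightarrow> precedes \<U> x y"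
  shows "diff_pows \<nu> L (\<lambda>m. f m + g m) = (\<lambda>m. diff_pows \<nu> L f m + diff_pows \<nu> L g m)"
  using diff_pows_sum[of "UNIV :: bool set" \<U> "\<lambda>b. if b then f else g" L \<nu>] assms
  by (simp add: UNIV_bool add.commute)

lemma Lam_zero: "0 \<in> Lam d" by (simp add: Lam_def rename_def)

section \<open>Symmetric polynomials and systems of one content\<close>

context correlators
begin

lemma colour_sym_vars_iff:
  "colour_sym (vars d) \<tau> \<longleftrightarrow> (\<exists>\<pi>. (\<forall>i. \<pi> i permutes {1..d i}) \<and> \<tau> = (\<lambda>(i, k). (i, \<pi> i k)))"
proof
  assume \<tau>: "colour_sym (vars d) \<tau>"
  define \<pi> where "\<pi> i k = snd (\<tau> (i, k))" for i k
  have eq: "\<tau> (i, k) = (i, \<pi> i k)" for i k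
    using colour_sym_fst[OF \<tau>, of "(i, k)"] by (simp add: \<pi>_def prod_eq_iff)
  have perm: "\<tau> permutes vars d" using \<tau> by (simp add: colour_sym_def)
  have "\<pi> i permutes {1..d i}" for i unfolding permutes_def
  proof (intro conjI allI impI)
    fix k assume "k \<notin> {1..d i}"
    then have "(i, k) \<notin> vars d" by (auto simp: vars_def)
    then show "\<pi> i k = k" using perm by (simp add: \<pi>_def permutes_not_in)
  next
    fix l
    obtain x where "\<tau> x = (i, l)" using permutes_surj[OF perm] by (metis surjD)
    then have "\<pi> i (snd x) = l" using eq[of "fst x" "snd x"] by simp
    moreover have "k = k'" if "\<pi> i k = l" "\<pi> i k' = l" for k k'
      using that eq[of i k] eq[of i k'] injD[OF permutes_inj[OF perm], of "(i, k)" "(i, k')"] by simp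
    ultimately show "\<exists>!k. \<pi> i k = l" by blast
  qed
  then show "\<exists>\<pi>. (\<forall>i. \<pi> i permutes {1..d i}) \<and> \<tau> = (\<lambda>(i, k). (i, \<pi> i k))" using eq by (intro exI[of _ \<pi>]) auto
next
  assume "\<exists>\<pi>. (\<forall>i. \<pi> i permutes {1..d i}) \<and> \<tau> = (\<lambda>(i, k). (i, \<pi> i k))"
  then obtain \<pi> where \<pi>: "\<And>i. \<pi> i permutes {1..d i}" and \<tau>: "\<tau> = (\<lambda>(i, k). (i, \<pi> i k))" by blast
  have "\<tau> permutes vars d" unfolding permutes_def
  proof (intro conjI allI impI)
    fix x assume "x \<notin> vars d"
    then show "\<tau> x = x" using permutes_not_in[OF \<pi>] by (cases x) (auto simp: \<tau> vars_def)
  next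
    fix y
    obtain k where k: "\<pi> (fst y) k = snd y" using permutes_surj[OF \<pi>] by (metis surjD)
    show "\<exists>!x. \<tau> x = y"
    proof (rule ex1I[of _ "(fst y, k)"])
      show "\<tau> (fst y, k) = y" using k by (simp add: \<tau>)
      fix x assume "\<tau> x = y"
      then have "fst x = fst y" "\<pi> (fst y) (snd x) = \<pi> (fst y) k" using k by (auto simp: \<tau> case_prod_unfold)
      then show "x = (fst y, k)" using permutes_inj[OF \<pi>] by (metis inj_eq prod.collapse)
    qed
  qed
  then show "colour_sym (vars d) \<tau>" by (auto simp: colour_sym_def \<tau> case_prod_unfold)
qed

lemma Lam_iff: "f \<in> Lam d \<longleftrightarrow> poly_in (vars d) f \<and> (\<forall>\<tau>. colour_sym (vars d) \<tau> \<longrightarrow> rename \<tau> f = f)"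
proof -
  have "{(i, k). k \<in> {1..d i}} = vars d" by (auto simp: vars_def)
  moreover have "(\<forall>\<tau>. colour_sym (vars d) \<tau> \<longrightarrow> rename \<tau> f = f) \<longleftrightarrow>
      (\<forall>\<pi>. (\<forall>i. \<pi> i permutes {1..d i}) \<longrightarrow> rename (\<lambda>(i, k). (i, \<pi> i k)) f = f)"
    unfolding colour_sym_vars_iff by blast
  ultimately show ?thesis unfolding Lam_def poly_in_def by (simp only: mem_Collect_eq)
qed

lemma colour_sym_image: "colour_sym X \<tau> \<Longrightarrow> \<tau> ` X = X" by (simp add: colour_sym_def permutes_image)

lemma Lam_iff_pcoef:
  assumes "finite (vars d)"
  shows "f \<in> Lam d \<longleftrightarrow> poly_in (vars d) f \<and>
    (\<forall>\<tau> m. colour_sym (vars d) \<tau> \<longrightarrow> pcoef (vars d) f (m \<circ> \<tau>) = pcoef (vars d) f m)"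
proof -
  have "rename \<tau> f = f \<longleftrightarrow> (\<forall>m. pcoef (vars d) f (m \<circ> \<tau>) = pcoef (vars d) f m)"
    if f: "poly_in (vars d) f" and \<tau>: "colour_sym (vars d) \<tau>" for \<tau>
  proof -
    have im: "\<tau> ` vars d = vars d" and inj: "inj_on \<tau> (vars d)"
      using colour_sym_image[OF \<tau>] colour_sym_inj[OF \<tau>] by (auto intro: inj_on_subset)
    have pr: "pcoef (vars d) (rename \<tau> f) m = pcoef (vars d) f (m \<circ> \<tau>)" for m
      using pcoef_rename[OF inj assms f, of m] by (simp only: im)
    have pin: "poly_in (vars d) (rename \<tau> f)" using poly_in_rename[OF f, of \<tau>] by (simp only: im)
    show ?thesis
    proof
      assume "rename \<tau> f = f" then show "\<forall>m. pcoef (vars d) f (m \<circ> \<tau>) = pcoef (vars d) f m" using pr by metis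
    next
      assume "\<forall>m. pcoef (vars d) f (m \<circ> \<tau>) = pcoef (vars d) f m"
      then show "rename \<tau> f = f" using pr by (intro poly_eqI_rename[OF assms pin f]) simp
    qed
  qed
  then show ?thesis unfolding Lam_iff by blast
qed

text \<open>The inverse of \<open>F\<close> in one degree: \<open>g\<close> divided by the product
  of the powers of differences, expanded in the region of each word.\<close>

definition pcorr :: "('v \<Rightarrow> nat) \<Rightarrow> 'v mpoly \<Rightarrow> 'v corr_fun" where
  "pcorr d g = correlator_of d (expansion (pcoef (vars d) g))"

lemma family_pcoef:
  assumes "finite (vars d)" "g \<in> Lam d"
  shows "family (vars d) (expansion (pcoef (vars d) g))" using assms(2) unfolding Lam_iff_pcoef[OF assms(1)]
  by (intro family_expansion pcoef_nonneg depends_on_pcoef) auto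

lemma is_system_pcorr:
  "finite (vars d) \<Longrightarrow> g \<in> Lam d \<Longrightarrow> is_system (pcorr d g)"
  unfolding pcorr_def by (intro is_system_correlator_of family_pcoef)

lemma pcorr_word:
  assumes "finite (vars d)" "g \<in> Lam d" "ordering (vars d) xs"
  shows "pcorr d g (word_of xs m) = expansion (pcoef (vars d) g) xs m"
  unfolding pcorr_def by (rule correlator_of_word[OF family_pcoef[OF assms(1,2)] assms(3)])

lemma pcorr_content: "content gs \<noteq> d \<Longrightarrow> pcorr d g gs = 0" unfolding pcorr_def by (rule correlator_of_content)

lemma exists_ordering: "finite X \<Longrightarrow> \<exists>xs. ordering X xs"
  unfolding ordering_def using finite_distinct_list by metis

lemma pcoef_from_corr:
  assumes "finite (vars d)" "g \<in> Lam d" "ordering (vars d) xs"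
  shows "pcoef (vars d) g = diff_pows nu (pairs xs) (\<lambda>m. pcorr d g (word_of xs m))"
proof -
  have "(\<lambda>m. pcorr d g (word_of xs m)) = expansion (pcoef (vars d) g) xs"
    by (simp add: pcorr_word[OF assms] fun_eq_iff)
  moreover have "diff_pows nu (pairs xs) (expansion (pcoef (vars d) g) xs) = pcoef (vars d) g"
    by (rule regular_part_expansion[OF _ assms(3)]) (rule pcoef_nonneg)
  ultimately show ?thesis by simp
qed

lemma pcorr_inj:
  assumes "finite (vars d)" "g \<in> Lam d" "h \<in> Lam d" "\<And>gs. content gs = d \<Longrightarrow> pcorr d g gs = pcorr d h gs"
  shows "g = h"
proof -
  obtain xs where xs: "ordering (vars d) xs" using exists_ordering[OF assms(1)] by blast
  have "pcoef (vars d) g = pcoef (vars d) h"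
    unfolding pcoef_from_corr[OF assms(1,2) xs] pcoef_from_corr[OF assms(1,3) xs]
    using assms(4) content_word_of[OF xs] by simp
  then show ?thesis using assms by (intro pcoef_inj[OF assms(1)]) (auto simp: Lam_iff)
qed

text \<open>Regularity and symmetry make the regular part a symmetric power series; the bound on
  \<open>total\<close> bounds its degree and turns it into a polynomial.\<close>

lemma system_poly:
  assumes sys: "is_system \<Phi>" and fin: "finite (vars d)"
    and bdd: "\<And>gs. content gs = d \<Longrightarrow> \<Phi> gs \<noteq> 0 \<Longrightarrow> total gs \<le> B"
  obtains g where "g \<in> Lam d" "\<And>gs. content gs = d \<Longrightarrow> \<Phi> gs = pcorr d g gs"
proof -
  obtain xs where xs: "ordering (vars d) xs" using exists_ordering[OF fin] by blast
  then have dist: "distinct xs" and set: "set xs = vars d" by (auto simp: ordering_def)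
  define f where "f = fam \<Phi>"
  have fm: "family (vars d) f" unfolding f_def by (rule system_family[OF sys])
  define G where "G = regular_part f xs"
  have Gnn: "0 \<le> m x" if "G m \<noteq> 0" "x \<in> vars d" for m x
    using regular_part_nonneg[OF fm xs] that by (simp add: G_def)
  have Gdep: "depends_on (vars d) G" unfolding G_def by (rule regular_part_depends[OF fm xs])
  have "sum m (vars d) - (\<Sum>(x, y)\<leftarrow>pairs xs. nu x y) \<in> {..B}" if "G m \<noteq> 0" for m
  proof (rule diff_pows_total[of "f xs"])
    show "sum m' (vars d) \<in> {..B}" if "f xs m' \<noteq> 0" for m'
      using bdd[of "word_of xs m'"] that content_word_of[OF xs] total_word_of[OF dist, of m'] set
      by (simp add: f_def fam_def)
    show "x \<in> vars d \<and> y \<in> vars d" if "(x, y) \<in> set (pairs xs)" for x y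
      using in_pairs_set[OF that] set by simp
    show "diff_pows nu (pairs xs) (f xs) m \<noteq> 0" using that by (simp add: G_def regular_part_def)
  qed (rule fin)
  then have Gb: "sum m (vars d) \<le> B + (\<Sum>(x, y)\<leftarrow>pairs xs. nu x y)" if "G m \<noteq> 0" for m
    using that by (smt (verit) atMost_iff)
  obtain g where g: "poly_in (vars d) g" "pcoef (vars d) g = G"
    using exists_poly[of "vars d" G "B + (\<Sum>(x, y)\<leftarrow>pairs xs. nu x y)"] fin Gnn Gdep Gb by blast
  have gL: "g \<in> Lam d"
    unfolding Lam_iff_pcoef[OF fin] g(2) using g(1) regular_part_sym[OF fm xs] by (simp add: G_def)
  have "\<Phi> gs = pcorr d g gs" if c: "content gs = d" for gs
  proof -
    obtain ys m where "ordering (vars (content gs)) ys" and ys2: "gs = word_of ys m"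
      by (rule word_representation)
    then have ys: "ordering (vars d) ys" unfolding c by blast
    have "pcorr d g gs = expansion (regular_part f ys) ys m"
      unfolding ys2 pcorr_word[OF fin gL ys] g(2) G_def regular_part_ordering[OF fm xs ys] ..
    also have "\<dots> = \<Phi> gs" unfolding expansion_regular_part[OF fm ys] by (simp add: f_def fam_def ys2)
    finally show ?thesis ..
  qed
  then show ?thesis using that gL by blast
qed

text \<open>Division by the product of differences lowers the degree by the charge. The converse
  passage, from words to coefficients, is \<open>degree_pcorr\<close>.\<close>

lemma total_pcorr:
  assumes "finite (vars d)" "g \<in> Lam d" and D: "\<And>m. pcoef (vars d) g m \<noteq> 0 \<Longrightarrow> sum m (vars d) \<in> D"
    and nz: "pcorr d g gs \<noteq> 0"
  shows "total gs + charge (map fst gs) \<in> D"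
proof -
  have c: "content gs = d" using nz pcorr_content by metis
  obtain xs m where "ordering (vars (content gs)) xs" and gs: "gs = word_of xs m"
    by (rule word_representation)
  then have xs: "ordering (vars d) xs" unfolding c by blast
  then have dist: "distinct xs" and set: "set xs = vars d" by (auto simp: ordering_def)
  have "sum m (vars d) - (\<Sum>(x, y)\<leftarrow>pairs xs. - nu x y) \<in> D"
  proof (rule diff_pows_total[of "pcoef (vars d) g"])
    show "x \<in> vars d \<and> y \<in> vars d" if "(x, y) \<in> set (pairs xs)" for x y
      using in_pairs_set[OF that] set by simp
    show "diff_pows (\<lambda>x y. - nu x y) (pairs xs) (pcoef (vars d) g) m \<noteq> 0"
      using nz pcorr_word[OF assms(1,2) xs] by (simp add: gs expansion_def)
  qed (use D assms(1) in auto)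
  moreover have "(\<Sum>(x, y)\<leftarrow>pairs xs. - nu x y) = - charge (map fst xs)"
    by (simp add: case_prod_unfold uminus_sum_list_map[unfolded comp_def, symmetric] flip: sum_pairs_nu)
  ultimately show ?thesis by (simp add: gs total_word_of[OF dist] set map_fst_word_of)
qed

lemma degree_pcorr:
  assumes "finite (vars d)" "g \<in> Lam d" "ordering (vars d) xs"
    and D: "\<And>gs. pcorr d g gs \<noteq> 0 \<Longrightarrow> total gs \<in> D" and nz: "pcoef (vars d) g m \<noteq> 0"
  shows "sum m (vars d) - charge (map fst xs) \<in> D"
proof -
  have dist: "distinct xs" and set: "set xs = vars d" using assms(3) by (auto simp: ordering_def)
  have "sum m (vars d) - (\<Sum>(x, y)\<leftarrow>pairs xs. nu x y) \<in> D"
  proof (rule diff_pows_total[of "\<lambda>m. pcorr d g (word_of xs m)"])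
    show "sum m' (vars d) \<in> D" if "pcorr d g (word_of xs m') \<noteq> 0" for m'
      using D[OF that] by (simp add: total_word_of[OF dist] set)
    show "x \<in> vars d \<and> y \<in> vars d" if "(x, y) \<in> set (pairs xs)" for x y
      using in_pairs_set[OF that] set by simp
    show "diff_pows nu (pairs xs) (\<lambda>m. pcorr d g (word_of xs m)) m \<noteq> 0"
      using nz pcoef_from_corr[OF assms(1-3)] by simp
  qed (rule assms(1))
  then show ?thesis by (simp add: sum_pairs_nu)
qed

text \<open>One representation of the word serves all polynomials, so linearity in \<open>g\<close>
  reduces to linearity of the expansion operators.\<close>

lemma pcorr_pointwise:
  assumes "finite (vars d)" "content gs = d"
  shows "\<exists>xs m. ordering (vars d) xs \<and> gs = word_of xs m \<and>
    (\<forall>g\<in>Lam d. pcorr d g gs = expansion (pcoef (vars d) g) xs m)"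
proof -
  obtain xs m where "ordering (vars (content gs)) xs" and gs: "gs = word_of xs m"
    by (rule word_representation)
  then have xs: "ordering (vars d) xs" unfolding assms(2) by blast
  then show ?thesis using gs pcorr_word[OF assms(1) _ xs] by blast
qed

lemma bdd_support_pcoef:
  assumes "set xs = X"
  shows "bdd_support (upsets xs) (pcoef X g)"
proof (rule bdd_support_nonneg[of _ X])
  show "0 \<le> m x" if "pcoef X g m \<noteq> 0" "x \<in> X" for m x using that by (rule pcoef_nonneg)
  show "U \<subseteq> X" if "U \<in> upsets xs" for U using upsets_subset[OF that] assms by simp
qed

lemma expansion_add:
  assumes "ordering X xs"
  shows "expansion (pcoef X (g + h)) xs m = expansion (pcoef X g) xs m + expansion (pcoef X h) xs m"
  unfolding expansion_def pcoef_add using assms by (subst diff_pows_add[of "upsets xs"])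
    (auto simp: ordering_def intro!: bdd_support_pcoef precedes_upsets)

lemma Lam_add: "finite (vars (d :: 'v \<Rightarrow> nat)) \<Longrightarrow> f \<in> Lam d \<Longrightarrow> g \<in> Lam d \<Longrightarrow> f + g \<in> Lam d"
  by (simp add: Lam_iff_pcoef pcoef_add poly_in_add)

lemma Lam_scale: "finite (vars (d :: 'v \<Rightarrow> nat)) \<Longrightarrow> f \<in> Lam d \<Longrightarrow> scaled c f \<in> Lam d"
  by (simp add: Lam_iff_pcoef pcoef_scale poly_in_scale)

lemma pcorr_add:
  assumes "finite (vars d)" "g \<in> Lam d" "h \<in> Lam d"
  shows "pcorr d (g + h) gs = pcorr d g gs + pcorr d h gs"
proof (cases "content gs = d")
  case True
  obtain xs m where xs: "ordering (vars d) xs" and gs: "gs = word_of xs m"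
    and ex: "\<forall>g\<in>Lam d. pcorr d g gs = expansion (pcoef (vars d) g) xs m"
    using pcorr_pointwise[OF assms(1) True] by blast
  show ?thesis using assms by (simp add: ex Lam_add expansion_add[OF xs])
qed (simp add: pcorr_content)

lemma pcorr_scale:
  assumes "finite (vars d)" "g \<in> Lam d"
  shows "pcorr d (scaled c g) gs = c * pcorr d g gs"
proof (cases "content gs = d")
  case True
  obtain xs m where xs: "ordering (vars d) xs" and gs: "gs = word_of xs m"
    and ex: "\<forall>g\<in>Lam d. pcorr d g gs = expansion (pcoef (vars d) g) xs m"
    using pcorr_pointwise[OF assms(1) True] by blast
  show ?thesis using assms by (simp add: ex Lam_scale expansion_def pcoef_scale diff_pows_scale)
qed (simp add: pcorr_content)

lemma pcorr_zero [simp]: "finite (vars d) \<Longrightarrow> pcorr d 0 gs = 0"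
proof -
  assume "finite (vars d)"
  moreover have "scaled (0) (0 :: 'v mpoly) = 0" by (rule poly_mapping_eqI) (simp add: lookup_scale)
  ultimately show ?thesis using pcorr_scale[of d 0 0 gs] by (simp add: Lam_zero)
qed

end

section \<open>Vector spaces and algebras over the rationals\<close>

lemma ratring_simps [simp]:
  "carrier ratring = UNIV" "mult ratring = (*)" "one ratring = 1" "zero ratring = 0" "add ratring = (+)"
  by (simp_all add: ratring_def)

lemma cring_ratring: "cring ratring"
proof (rule cringI)
  show "abelian_group ratring"
    by (rule abelian_groupI) (auto intro: exI[of _ "- _"] simp: add_ac intro!: bexI[of _ "- _"])
  show "Group.comm_monoid ratring" by (rule comm_monoidI) (auto simp: mult_ac)
qed (auto simp: algebra_simps)

locale rat_space =
  fixes M :: "(rat, 'b) module" (structure)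
  assumes space: "module ratring M"

sublocale rat_space \<subseteq> module ratring M by (rule space)

context rat_space
begin

lemma smult_zero_rat: "x \<in> carrier M \<Longrightarrow> 0 \<odot> x = \<zero>" using smult_l_null[of x] by simp

lemma smult_closed_rat [intro, simp]: "x \<in> carrier M \<Longrightarrow> c \<odot> x \<in> carrier M" using smult_closed by simp

lemma smult_add_rat: "x \<in> carrier M \<Longrightarrow> (a + b) \<odot> x = a \<odot> x \<oplus> b \<odot> x" using smult_l_distr[of a b x] by simp

lemma smult_assoc_rat: "x \<in> carrier M \<Longrightarrow> (a * b) \<odot> x = a \<odot> (b \<odot> x)" using smult_assoc1[of a b x] by simp

lemma smult_one_rat [simp]: "x \<in> carrier M \<Longrightarrow> 1 \<odot> x = x" using smult_one[of x] by simp

lemma smult_distr_rat: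
  "x \<in> carrier M \<Longrightarrow> y \<in> carrier M \<Longrightarrow> a \<odot> (x \<oplus> y) = a \<odot> x \<oplus> a \<odot> y" using smult_r_distr[of a x y] by simp

lemma neg_smult: "x \<in> carrier M \<Longrightarrow> x \<oplus> (-1) \<odot> x = \<zero>"
  using smult_add_rat[of x 1 "-1"] smult_zero_rat[of x] by simp

lemma a_inv_smult: "x \<in> carrier M \<Longrightarrow> \<ominus> x = (-1) \<odot> x"
  using neg_smult[of x] by (metis a_comm minus_equality smult_closed_rat)

lemma submodule_rat_I:
  assumes "H \<subseteq> carrier M" "\<zero> \<in> H" "\<And>x y. x \<in> H \<Longrightarrow> y \<in> H \<Longrightarrow> x \<oplus> y \<in> H"
    "\<And>c x. x \<in> H \<Longrightarrow> c \<odot> x \<in> H"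
  shows "submodule H ratring M" using assms by (intro submoduleI) (auto simp: a_inv_smult subset_iff)

lemma submodule_rat_D:
  assumes "submodule H ratring M"
  shows "H \<subseteq> carrier M" "\<zero> \<in> H" "\<And>x y. x \<in> H \<Longrightarrow> y \<in> H \<Longrightarrow> x \<oplus> y \<in> H"
    "\<And>c x. x \<in> H \<Longrightarrow> c \<odot> x \<in> H"
proof -
  note E = submoduleE[OF assms]
  show sub: "H \<subseteq> carrier M" by (rule E(1))
  show "\<And>x y. x \<in> H \<Longrightarrow> y \<in> H \<Longrightarrow> x \<oplus> y \<in> H" by (rule E(5))
  show sm: "\<And>c x. x \<in> H \<Longrightarrow> c \<odot> x \<in> H" using E(4) by simp
  obtain x where x: "x \<in> H" using E(2) by blast
  then have "0 \<odot> x \<in> H" by (rule sm)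
  then show "\<zero> \<in> H" using smult_zero_rat x sub by auto
qed

lemma submodule_Inter:
  assumes "\<W> \<noteq> {}" "\<And>W. W \<in> \<W> \<Longrightarrow> submodule W ratring M"
  shows "submodule (\<Inter>\<W>) ratring M"
proof (rule submodule_rat_I)
  obtain V where "V \<in> \<W>" using assms(1) by blast
  then show "\<Inter>\<W> \<subseteq> carrier M" using submodule_rat_D(1)[OF assms(2)] by blast
  show "\<zero> \<in> \<Inter>\<W>" using submodule_rat_D(2)[OF assms(2)] by blast
  show "x \<oplus> y \<in> \<Inter>\<W>" if "x \<in> \<Inter>\<W>" "y \<in> \<Inter>\<W>" for x y using submodule_rat_D(3)[OF assms(2)] that by blast
  show "c \<odot> x \<in> \<Inter>\<W>" if "x \<in> \<Inter>\<W>" for c x using submodule_rat_D(4)[OF assms(2)] that by blast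
qed

lemma lin_span_submodule:
  assumes "S \<subseteq> carrier M"
  shows "submodule (lin_span M S) ratring M"
  unfolding lin_span_def using assms carrier_is_submodule by (intro submodule_Inter) auto

lemma lin_span_superset: "S \<subseteq> lin_span M S" unfolding lin_span_def by blast

lemma lin_span_least: "submodule W ratring M \<Longrightarrow> S \<subseteq> W \<Longrightarrow> lin_span M S \<subseteq> W" unfolding lin_span_def by blast

definition linear_functional :: "('b \<Rightarrow> rat) \<Rightarrow> bool" where
  "linear_functional \<xi> \<longleftrightarrow> (\<forall>x\<in>carrier M. \<forall>y\<in>carrier M. \<xi> (x \<oplus> y) = \<xi> x + \<xi> y) \<and>
     (\<forall>c. \<forall>x\<in>carrier M. \<xi> (c \<odot> x) = c * \<xi> x)"

lemma linear_functional_zero: "linear_functional \<xi> \<Longrightarrow> \<xi> \<zero> = 0"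
  unfolding linear_functional_def by (metis mult_zero_left smult_zero_rat zero_closed)

lemma submodule_kernel:
  assumes "linear_functional \<xi>"
  shows "submodule {x \<in> carrier M. \<xi> x = 0} ratring M" using assms linear_functional_zero[OF assms]
  by (intro submodule_rat_I) (auto simp: linear_functional_def)

lemma linear_functional_span_zero:
  assumes "linear_functional \<xi>" "S \<subseteq> carrier M" "\<And>x. x \<in> S \<Longrightarrow> \<xi> x = 0" "x \<in> lin_span M S"
  shows "\<xi> x = 0" using lin_span_least[OF submodule_kernel[OF assms(1)], of S] assms by blast

end

locale rat_subspace = rat_space +
  fixes W assumes subspace: "submodule W ratring M"

sublocale rat_subspace \<subseteq> abelian_subgroup W M by (rule abelian_subgroupI3[OF additive_subgroup.intro])
    (use subspace submodule.axioms(1) abelian_group_axioms in auto)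

context rat_subspace
begin

abbreviation "quo \<equiv> quot_module M W"

lemmas subspaceD = submodule_rat_D[OF subspace]

lemma quot_simps:
  "carrier quo = a_rcosets W" "add quo = set_add M" "zero quo = W"
  "smult quo = (\<lambda>c X. \<Union>x\<in>X. W +> (c \<odot> x))" "mult quo = rcoset_mult M W"
  "one quo = W +> \<one>" by (simp_all add: quot_module_def)

lemma quot_carrier: "carrier quo = (\<lambda>x. W +> x) ` carrier M" unfolding quot_simps A_RCOSETS_def' by auto

lemma coset_iff: "y \<in> W +> x \<longleftrightarrow> (\<exists>w\<in>W. y = w \<oplus> x)" by (auto simp: a_r_coset_def')

lemma cosetE:
  assumes "y \<in> W +> x"
  obtains w where "w \<in> W" "y = w \<oplus> x" using assms unfolding coset_iff by (elim bexE) (rule that)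

lemma coset_eq_iff:
  assumes "x \<in> carrier M" "y \<in> carrier M"
  shows "W +> x = W +> y \<longleftrightarrow> (\<exists>w\<in>W. x = w \<oplus> y)"
proof
  assume "W +> x = W +> y"
  then have "x \<in> W +> y" using a_rcos_self[OF assms(1)] by simp
  then show "\<exists>w\<in>W. x = w \<oplus> y" by (auto simp: a_r_coset_def')
next
  assume "\<exists>w\<in>W. x = w \<oplus> y"
  then have "x \<in> W +> y" by (auto simp: a_r_coset_def')
  then show "W +> x = W +> y" using a_repr_independence[OF _ assms(2)] a_subgroup by simp
qed

lemma coset_zero: "W +> \<zero> = W" using subspaceD(1) by (rule a_coset_add_zero)

lemma coset_eq_self: "x \<in> carrier M \<Longrightarrow> W +> x = W \<longleftrightarrow> x \<in> W"
  using coset_eq_iff[of x "\<zero>"] subspaceD(1) by (auto simp: coset_zero)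

lemma quot_add:
  "x \<in> carrier M \<Longrightarrow> y \<in> carrier M \<Longrightarrow> (W +> x) \<oplus>\<^bsub>quo\<^esub> (W +> y) = W +> (x \<oplus> y)"
  by (simp add: quot_simps a_rcos_sum)

lemma quot_smult:
  assumes "x \<in> carrier M"
  shows "c \<odot>\<^bsub>quo\<^esub> (W +> x) = W +> (c \<odot> x)"
proof -
  have "W +> (c \<odot> y) = W +> (c \<odot> x)" if "y \<in> W +> x" for y
  proof -
    from that obtain w where w: "w \<in> W" "y = w \<oplus> x" by (rule cosetE)
    then have "c \<odot> y = c \<odot> w \<oplus> c \<odot> x" using subspaceD(1) assms by (auto simp: smult_distr_rat)
    moreover have "y \<in> carrier M" using w subspaceD(1) assms by auto
    ultimately show ?thesis using subspaceD(4)[OF w(1), of c] assms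
      by (subst coset_eq_iff) (blast intro: smult_closed_rat)+
  qed
  then show ?thesis using a_rcos_self[OF assms] unfolding quot_simps by blast
qed

lemma quot_zero: "\<zero>\<^bsub>quo\<^esub> = W +> \<zero>" by (simp add: quot_simps coset_zero)

lemma quot_module: "module ratring quo"
proof (rule moduleI)
  show "cring ratring" by (rule cring_ratring)
  show "abelian_group quo"
  proof (rule abelian_groupI)
    fix X assume "X \<in> carrier quo"
    then obtain x where x: "x \<in> carrier M" "X = W +> x" by (auto simp: quot_carrier)
    then have "(W +> (\<ominus> x)) \<oplus>\<^bsub>quo\<^esub> X = \<zero>\<^bsub>quo\<^esub>" by (simp add: quot_add quot_zero l_neg)
    then show "\<exists>Y\<in>carrier quo. Y \<oplus>\<^bsub>quo\<^esub> X = \<zero>\<^bsub>quo\<^esub>"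
      using x by (intro bexI[of _ "W +> (\<ominus> x)"]) (auto simp: quot_carrier)
  qed (auto simp: quot_carrier quot_add quot_zero a_ac)
qed (auto simp: quot_carrier quot_add quot_smult smult_distr_rat smult_add_rat smult_assoc_rat)

lemma quot_space: "rat_space quo" by (rule rat_space.intro[OF quot_module])

lemma functional_to_quot:
  assumes "linear_functional \<xi>" "\<And>x. x \<in> W \<Longrightarrow> \<xi> x = 0"
  obtains \<eta> where "rat_space.linear_functional quo \<eta>" "\<And>x. x \<in> carrier M \<Longrightarrow> \<eta> (W +> x) = \<xi> x"
    "\<And>X. X \<notin> carrier quo \<Longrightarrow> \<eta> X = 0"
proof -
  \<comment> \<open>Functionals in \<open>gdual\<close> vanish off the carrier, hence the default
    value 0.\<close>
  define \<eta> where "\<eta> X = (if X \<in> carrier quo then \<xi> (SOME x. x \<in> X) else 0)" for X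
  have \<eta>: "\<eta> (W +> x) = \<xi> x" if x: "x \<in> carrier M" for x
  proof -
    have "(SOME y. y \<in> W +> x) \<in> W +> x" using a_rcos_self[OF x] by (rule someI)
    then obtain w where w: "w \<in> W" "(SOME y. y \<in> W +> x) = w \<oplus> x" by (rule cosetE)
    then have "\<xi> (w \<oplus> x) = \<xi> x" using assms subspaceD(1) x by (auto simp: linear_functional_def)
    then show ?thesis using w x by (auto simp: \<eta>_def quot_carrier)
  qed
  have "rat_space.linear_functional quo \<eta>" unfolding rat_space.linear_functional_def[OF quot_space]
    using assms(1) by (auto simp: quot_carrier quot_add quot_smult \<eta> linear_functional_def)
  then show ?thesis using that \<eta> by (auto simp: \<eta>_def)
qed

lemma functional_from_quot:
  assumes "rat_space.linear_functional quo \<eta>"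
  shows "linear_functional (\<lambda>x. \<eta> (W +> x))"
  using assms unfolding rat_space.linear_functional_def[OF quot_space] linear_functional_def
  by (auto simp: quot_carrier simp flip: quot_add quot_smult)

end

locale rat_algebra = rat_space +
  assumes mult_closed: "x \<in> carrier M \<Longrightarrow> y \<in> carrier M \<Longrightarrow> x \<otimes> y \<in> carrier M"
    and mult_distr_l: "x \<in> carrier M \<Longrightarrow> y \<in> carrier M \<Longrightarrow> z \<in> carrier M \<Longrightarrow> (x \<oplus> y) \<otimes> z = x \<otimes> z \<oplus> y \<otimes> z"
    and mult_distr_r: "x \<in> carrier M \<Longrightarrow> y \<in> carrier M \<Longrightarrow> z \<in> carrier M \<Longrightarrow> z \<otimes> (x \<oplus> y) = z \<otimes> x \<oplus> z \<otimes> y"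
    and mult_smult_l: "x \<in> carrier M \<Longrightarrow> y \<in> carrier M \<Longrightarrow> (c \<odot> x) \<otimes> y = c \<odot> (x \<otimes> y)"
    and mult_smult_r: "x \<in> carrier M \<Longrightarrow> y \<in> carrier M \<Longrightarrow> x \<otimes> (c \<odot> y) = c \<odot> (x \<otimes> y)"
begin

definition two_sided :: "'a set \<Rightarrow> bool" where
  "two_sided W \<longleftrightarrow> submodule W ratring M \<and> (\<forall>a\<in>carrier M. \<forall>x\<in>W. a \<otimes> x \<in> W \<and> x \<otimes> a \<in> W)"

lemma ideal_gen_two_sided:
  assumes "S \<subseteq> carrier M"
  shows "two_sided (ideal_gen M S)"
proof -
  define \<W> where "\<W> = {W. submodule W ratring M \<and> S \<subseteq> W \<and> (\<forall>a\<in>carrier M. \<forall>x\<in>W. a \<otimes> x \<in> W \<and> x \<otimes> a \<in> W)}"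
  have "carrier M \<in> \<W>" using assms carrier_is_submodule mult_closed by (auto simp: \<W>_def)
  then have "\<W> \<noteq> {}" by blast
  then have "submodule (\<Inter>\<W>) ratring M" by (rule submodule_Inter) (simp add: \<W>_def)
  then show ?thesis unfolding two_sided_def ideal_gen_def \<W>_def by blast
qed

lemma ideal_gen_least: "two_sided W \<Longrightarrow> S \<subseteq> W \<Longrightarrow> ideal_gen M S \<subseteq> W"
  unfolding two_sided_def ideal_gen_def by blast

lemma ideal_gen_superset: "S \<subseteq> ideal_gen M S" unfolding ideal_gen_def by blast

end

locale rat_ideal = rat_algebra +
  fixes W assumes ideal: "two_sided W"

sublocale rat_ideal \<subseteq> rat_subspace M W
  by (rule rat_subspace.intro[OF rat_space_axioms rat_subspace_axioms.intro])
    (use ideal in \<open>simp add: two_sided_def\<close>)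

context rat_ideal
begin

lemma quot_mult:
  assumes "x \<in> carrier M" "y \<in> carrier M"
  shows "(W +> x) \<otimes>\<^bsub>quo\<^esub> (W +> y) = W +> (x \<otimes> y)"
proof -
  have "W +> (a \<otimes> b) = W +> (x \<otimes> y)" if ab: "a \<in> W +> x" "b \<in> W +> y" for a b
  proof -
    obtain v where v: "v \<in> W" "a = v \<oplus> x" using ab(1) by (rule cosetE)
    obtain w where w: "w \<in> W" "b = w \<oplus> y" using ab(2) by (rule cosetE)
    note [simp] = subsetD[OF subspaceD(1) v(1)] subsetD[OF subspaceD(1) w(1)] assms
    have ac: "a \<in> carrier M" "b \<in> carrier M" by (simp_all add: v w)
    have "a \<otimes> b = v \<otimes> b \<oplus> (x \<otimes> w \<oplus> x \<otimes> y)"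
      unfolding v(2) using ac by (simp add: mult_distr_l) (simp add: w(2) mult_distr_r)
    also have "\<dots> = (v \<otimes> b \<oplus> x \<otimes> w) \<oplus> x \<otimes> y" using ac by (simp add: a_assoc mult_closed)
    finally have eq: "a \<otimes> b = (v \<otimes> b \<oplus> x \<otimes> w) \<oplus> x \<otimes> y" .
    have "v \<otimes> b \<oplus> x \<otimes> w \<in> W"
      using ideal v(1) w(1) ac assms unfolding two_sided_def by (intro subspaceD(3)) auto
    then show ?thesis using eq ac assms by (subst coset_eq_iff) (blast intro: mult_closed)+
  qed
  then show ?thesis using a_rcos_self[OF assms(1)] a_rcos_self[OF assms(2)]
    unfolding quot_simps rcoset_mult_def by blast
qed

lemma quot_algebra: "rat_algebra quo"
proof -
  interpret q: rat_space quo by (rule quot_space)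
  show ?thesis by unfold_locales
      (auto simp: quot_carrier quot_mult quot_add quot_smult mult_closed mult_distr_l mult_distr_r
        mult_smult_l mult_smult_r)
qed

end

lemma left_act_coset:
  assumes "rat_algebra A" "submodule J ratring A" "\<And>x. x \<in> J \<Longrightarrow> u \<otimes>\<^bsub>A\<^esub> x \<in> J"
    and u: "u \<in> carrier A" and x: "x \<in> carrier A"
  shows "left_act A J u (J +>\<^bsub>A\<^esub> x) = J +>\<^bsub>A\<^esub> (u \<otimes>\<^bsub>A\<^esub> x)"
proof -
  interpret rat_algebra A by (rule assms(1))
  interpret J: rat_subspace A J
    by (rule rat_subspace.intro[OF rat_space_axioms rat_subspace_axioms.intro[OF assms(2)]])
  have "J +>\<^bsub>A\<^esub> (u \<otimes>\<^bsub>A\<^esub> y) = J +>\<^bsub>A\<^esub> (u \<otimes>\<^bsub>A\<^esub> x)" if "y \<in> J +>\<^bsub>A\<^esub> x" for y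
  proof -
    from that obtain w where w: "w \<in> J" "y = w \<oplus>\<^bsub>A\<^esub> x" by (rule J.cosetE)
    have wc: "w \<in> carrier A" using w J.subspaceD(1) by blast
    have "u \<otimes>\<^bsub>A\<^esub> y = u \<otimes>\<^bsub>A\<^esub> w \<oplus>\<^bsub>A\<^esub> u \<otimes>\<^bsub>A\<^esub> x" using wc u x by (simp add: w(2) mult_distr_r)
    then show ?thesis using assms(3)[OF w(1)] wc u x
      by (subst J.coset_eq_iff) (use w(2) in \<open>blast intro: mult_closed a_closed\<close>)+
  qed
  then show ?thesis using J.a_rcos_self[OF x] unfolding left_act_def by blast
qed

text \<open>A maximal subspace meeting \<open>W\<close> trivially is a complement of \<open>W\<close>.\<close>

lemma (in rat_subspace) complement:
  obtains C where "submodule C ratring M" "C \<inter> W = {\<zero>}"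
    "\<And>x. x \<in> carrier M \<Longrightarrow> \<exists>w\<in>W. \<exists>c\<in>C. x = w \<oplus> c"
proof -
  define \<A> where "\<A> = {C. submodule C ratring M \<and> C \<inter> W = {\<zero>}}"
  have "\<exists>C\<in>\<A>. \<forall>X\<in>\<A>. C \<subseteq> X \<longrightarrow> X = C"
  proof (rule subset_Zorn_nonempty)
    have "{\<zero>} \<in> \<A>" using subspaceD(2) by (auto simp: \<A>_def intro!: submodule_rat_I)
    then show "\<A> \<noteq> {}" by blast
  next
    fix \<C> assume ne: "\<C> \<noteq> {}" and "subset.chain \<A> \<C>"
    then have sub: "\<C> \<subseteq> \<A>" and chain: "\<And>X Y. X \<in> \<C> \<Longrightarrow> Y \<in> \<C> \<Longrightarrow> X \<subseteq> Y \<or> Y \<subseteq> X" by (auto simp: subset_chain_def)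
    have "submodule (\<Union>\<C>) ratring M"
    proof (rule submodule_rat_I)
      show "\<Union>\<C> \<subseteq> carrier M" using sub submodule_rat_D(1) by (auto simp: \<A>_def)
      show "\<zero> \<in> \<Union>\<C>" using ne sub submodule_rat_D(2) by (fastforce simp: \<A>_def)
      show "x \<oplus> y \<in> \<Union>\<C>" if xy: "x \<in> \<Union>\<C>" "y \<in> \<Union>\<C>" for x y
      proof -
        obtain X Y where XY: "X \<in> \<C>" "Y \<in> \<C>" "x \<in> X" "y \<in> Y" using xy by blast
        then obtain Z where Z: "Z \<in> \<C>" "x \<in> Z" "y \<in> Z" using chain[of X Y] by blast
        then have "submodule Z ratring M" using sub by (auto simp: \<A>_def)
        then show ?thesis using submodule_rat_D(3) Z by blast
      qed
      show "c \<odot> x \<in> \<Union>\<C>" if "x \<in> \<Union>\<C>" for c x using that sub submodule_rat_D(4) by (fastforce simp: \<A>_def)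
    qed
    moreover have "\<Union>\<C> \<inter> W = {\<zero>}" using sub ne by (auto simp: \<A>_def)
    ultimately show "\<Union>\<C> \<in> \<A>" by (simp add: \<A>_def)
  qed
  then obtain C where C: "submodule C ratring M" "C \<inter> W = {\<zero>}"
    and max: "\<And>X. submodule X ratring M \<Longrightarrow> X \<inter> W = {\<zero>} \<Longrightarrow> C \<subseteq> X \<Longrightarrow> X = C" by (auto simp: \<A>_def)
  note CD = submodule_rat_D[OF C(1)]
  have "\<exists>w\<in>W. \<exists>c\<in>C. x = w \<oplus> c" if x: "x \<in> carrier M" for x
  proof (cases "x \<in> C")
    case True
    then show ?thesis using x subspaceD(2) by (intro bexI[of _ "\<zero>"] bexI[of _ x]) auto
  next
    case False
    \<comment> \<open>If \<open>x\<close> is not in \<open>C\<close>, then by maximality the span of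
      \<open>C\<close> and \<open>x\<close> contains a nonzero vector of \<open>W\<close>. Its
      coefficient at \<open>x\<close> is nonzero, so it can be solved for \<open>x\<close>.\<close>
    define X where "X = {c \<oplus> t \<odot> x | c t. c \<in> C}"
    have subX: "submodule X ratring M"
    proof (rule submodule_rat_I)
      show "X \<subseteq> carrier M" using CD(1) x by (auto simp: X_def)
      show "\<zero> \<in> X" unfolding X_def
        using CD(2) x smult_zero_rat[OF x] by (auto intro!: exI[of _ "\<zero>"] exI[of _ "0::rat"])
      show "y \<oplus> z \<in> X" if yz: "y \<in> X" "z \<in> X" for y z
      proof -
        obtain a s b t where ab: "a \<in> C" "b \<in> C" "y = a \<oplus> s \<odot> x" "z = b \<oplus> t \<odot> x"
          using yz by (auto simp: X_def)
        then have "y \<oplus> z = (a \<oplus> b) \<oplus> (s + t) \<odot> x" using CD(1) x by (simp add: smult_add_rat subset_iff a_ac)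
        then show ?thesis using CD(3)[OF ab(1,2)] by (auto simp: X_def)
      qed
      show "c \<odot> y \<in> X" if y: "y \<in> X" for c y
      proof -
        obtain a s where a: "a \<in> C" "y = a \<oplus> s \<odot> x" using y by (auto simp: X_def)
        then have "c \<odot> y = c \<odot> a \<oplus> (c * s) \<odot> x"
          using CD(1) x by (simp add: smult_distr_rat smult_assoc_rat subset_iff)
        then show ?thesis using CD(4)[OF a(1)] by (auto simp: X_def)
      qed
    qed
    have CX: "C \<subseteq> X"
    proof
      fix c assume c: "c \<in> C"
      then have "c = c \<oplus> 0 \<odot> x" using CD(1) x by (auto simp: smult_zero_rat)
      then show "c \<in> X" using c by (auto simp: X_def)
    qed
    have xX: "x \<in> X" unfolding X_def using CD(2) x by (auto intro!: exI[of _ "\<zero>"] exI[of _ "1::rat"])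
    then have "X \<inter> W \<noteq> {\<zero>}" using max[OF subX _ CX] False by blast
    moreover have "\<zero> \<in> X \<inter> W" using submodule_rat_D(2)[OF subX] subspaceD(2) by blast
    ultimately obtain w where w: "w \<in> X" "w \<in> W" "w \<noteq> \<zero>" by blast
    then obtain c t where ct: "c \<in> C" "w = c \<oplus> t \<odot> x" by (auto simp: X_def)
    have cc: "c \<in> carrier M" using ct CD(1) by blast
    have "t \<noteq> 0"
    proof
      assume "t = 0"
      then have "w = c" using ct cc x by (simp add: smult_zero_rat)
      then show False using w ct C(2) by blast
    qed
    then have "x = (1 / t) \<odot> (t \<odot> x)" using x smult_assoc_rat[OF x, of "1 / t" t] by simp
    also have "t \<odot> x = w \<oplus> (-1) \<odot> c"
    proof -
      have "w \<oplus> (-1) \<odot> c = t \<odot> x \<oplus> (c \<oplus> (-1) \<odot> c)" using cc x by (simp add: ct(2) a_ac)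
      then show ?thesis using neg_smult[OF cc] x by simp
    qed
    also have "(1 / t) \<odot> (w \<oplus> (-1) \<odot> c) = (1 / t) \<odot> w \<oplus> (1 / t) \<odot> ((-1) \<odot> c)"
      using cc w(2) subspaceD(1) by (intro smult_distr_rat) auto
    finally show ?thesis using subspaceD(4)[OF w(2)] CD(4)[OF CD(4)[OF ct(1)]] by blast
  qed
  then show ?thesis using that C by blast
qed

text \<open>Projection along a complement of \<open>W\<close> extends \<open>\<eta>\<close>. This is
  the source of the surjectivity of the left vertical map.\<close>

lemma (in rat_subspace) extend_functional:
  assumes "\<And>x y. x \<in> W \<Longrightarrow> y \<in> W \<Longrightarrow> \<eta> (x \<oplus> y) = \<eta> x + \<eta> y"
    "\<And>c x. x \<in> W \<Longrightarrow> \<eta> (c \<odot> x) = c * \<eta> x"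
  obtains \<xi> where "linear_functional \<xi>" "\<And>x. x \<in> W \<Longrightarrow> \<xi> x = \<eta> x"
proof -
  obtain C where C: "submodule C ratring M" "C \<inter> W = {\<zero>}"
    and ex: "\<And>x. x \<in> carrier M \<Longrightarrow> \<exists>w\<in>W. \<exists>c\<in>C. x = w \<oplus> c" using complement by blast
  note CD = submodule_rat_D[OF C(1)]
  define \<xi> where "\<xi> x = \<eta> (SOME w. w \<in> W \<and> (\<exists>c\<in>C. x = w \<oplus> c))" for x
  have uniq: "w = w'" if "w \<in> W" "w' \<in> W" "c \<in> C" "c' \<in> C" "w \<oplus> c = w' \<oplus> c'" for w w' c c'
  proof -
    have car: "w \<in> carrier M" "w' \<in> carrier M" "c \<in> carrier M" "c' \<in> carrier M"
      using that subspaceD(1) CD(1) by auto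
    have "w \<ominus> w' = c' \<ominus> c"
    proof -
      have "w \<ominus> w' = (w \<oplus> c) \<oplus> (\<ominus> c) \<oplus> (\<ominus> w')" using car by (simp add: a_minus_def a_assoc r_neg)
      also have "\<dots> = (w' \<oplus> c') \<oplus> (\<ominus> c) \<oplus> (\<ominus> w')" by (simp add: that(5))
      also have "\<dots> = (w' \<oplus> (\<ominus> w')) \<oplus> (c' \<oplus> (\<ominus> c))" using car by (simp add: a_ac)
      finally show ?thesis using car by (simp add: a_minus_def r_neg)
    qed
    moreover have "w \<ominus> w' \<in> W" "c' \<ominus> c \<in> C"
      using that car subspaceD CD by (simp_all add: a_minus_def a_inv_smult)
    ultimately have "w \<ominus> w' = \<zero>" using C(2) by auto
    then have "(w \<ominus> w') \<oplus> w' = w'" using car by simp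
    then show ?thesis using car by (simp add: a_minus_def a_assoc l_neg)
  qed
  have \<xi>: "\<xi> (w \<oplus> c) = \<eta> w" if "w \<in> W" "c \<in> C" for w c
  proof -
    have "(SOME w'. w' \<in> W \<and> (\<exists>c'\<in>C. w \<oplus> c = w' \<oplus> c')) = w" by (rule some_equality) (use that uniq in blast)+
    then show ?thesis by (simp add: \<xi>_def)
  qed
  have "linear_functional \<xi>" unfolding linear_functional_def
  proof (intro conjI ballI allI)
    fix x y assume "x \<in> carrier M" "y \<in> carrier M"
    then obtain w c v e where xy: "w \<in> W" "c \<in> C" "x = w \<oplus> c" "v \<in> W" "e \<in> C" "y = v \<oplus> e" using ex by metis
    then have "x \<oplus> y = (w \<oplus> v) \<oplus> (c \<oplus> e)" using subspaceD(1) CD(1) by (simp add: subset_iff a_ac)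
    then show "\<xi> (x \<oplus> y) = \<xi> x + \<xi> y" using xy \<xi> assms(1) subspaceD(3) CD(3) by simp
  next
    fix t x assume "x \<in> carrier M"
    then obtain w c where x: "w \<in> W" "c \<in> C" "x = w \<oplus> c" using ex by metis
    then have "t \<odot> x = t \<odot> w \<oplus> t \<odot> c" using subspaceD(1) CD(1) by (simp add: subset_iff smult_distr_rat)
    then show "\<xi> (t \<odot> x) = t * \<xi> x" using x \<xi> assms(2) subspaceD(4) CD(4) by simp
  qed
  moreover have "\<xi> x = \<eta> x" if "x \<in> W" for x using \<xi>[OF that CD(2)] that subspaceD(1) by auto
  ultimately show ?thesis using that by blast
qed

section \<open>Linear extension from a basis, and free algebras\<close>

definition lext :: "('x \<Rightarrow> rat) \<Rightarrow> ('x \<Rightarrow>\<^sub>0 rat) \<Rightarrow> rat" where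
  "lext \<phi> p = (\<Sum>s\<in>keys p. lookup p s * \<phi> s)"

lemma lext_zero [simp]: "lext \<phi> 0 = 0" by (simp add: lext_def)

lemma lext_add: "lext \<phi> (p + q) = lext \<phi> p + lext \<phi> q"
  unfolding lext_def by (rule setsum_keys_plus_distrib) (simp_all add: distrib_right)

lemma lext_single [simp]: "lext \<phi> (single s c) = c * \<phi> s" by (simp add: lext_def)

lemma lext_sum: "lext \<phi> (\<Sum>i\<in>A. p i) = (\<Sum>i\<in>A. lext \<phi> (p i))"
  by (induction A rule: infinite_finite_induct) (simp_all add: lext_add)

lemma lext_uminus: "lext \<phi> (- p) = - lext \<phi> p" using lext_add[of \<phi> p "- p"] by simp

lemma lext_diff: "lext \<phi> (p - q) = lext \<phi> p - lext \<phi> q"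
  using lext_add[of \<phi> p "- q"] by (simp add: lext_uminus)

lemma keys_scale: "keys (scaled c p) \<subseteq> keys (p :: 'x \<Rightarrow>\<^sub>0 rat)" by (auto simp: in_keys_iff lookup_scale)

lemma lext_scale: "lext \<phi> (scaled c p) = c * lext \<phi> p"
proof -
  have "lext \<phi> (scaled c p) = (\<Sum>s\<in>keys p. lookup (scaled c p) s * \<phi> s)"
    unfolding lext_def by (rule sum.mono_neutral_left) (auto simp: in_keys_iff lookup_scale)
  then show ?thesis by (simp add: lext_def lookup_scale sum_distrib_left mult.assoc)
qed

lemma lext_cong: "(\<And>s. s \<in> keys p \<Longrightarrow> \<phi> s = \<psi> s) \<Longrightarrow> lext \<phi> p = lext \<psi> p" by (simp add: lext_def)

lemma lext_fun_zero [simp]: "lext (\<lambda>s. 0) p = 0" by (simp add: lext_def)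

lemma lext_fun_diff: "lext (\<lambda>s. \<phi> s - \<psi> s) p = lext \<phi> p - lext \<psi> p"
  by (simp add: lext_def sum_subtractf algebra_simps)

lemma lext_fun_scale: "lext (\<lambda>s. c * \<phi> s) p = c * lext \<phi> p"
  by (simp add: lext_def sum_distrib_left mult.left_commute)

definition pmul :: "('x \<Rightarrow> 'x \<Rightarrow> 'x) \<Rightarrow> ('x \<Rightarrow>\<^sub>0 rat) \<Rightarrow> ('x \<Rightarrow>\<^sub>0 rat) \<Rightarrow> 'x \<Rightarrow>\<^sub>0 rat" where
  "pmul f p q = (\<Sum>s\<in>keys p. \<Sum>t\<in>keys q. single (f s t) (lookup p s * lookup q t))"

lemma free_alg_simps [simp]:
  "carrier (free_alg f e S) = {p. keys p \<subseteq> S}"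
  "mult (free_alg f e S) = pmul f" "one (free_alg f e S) = single e 1"
  "zero (free_alg f e S) = 0" "add (free_alg f e S) = (+)"
  "smult (free_alg f e S) c = scaled c" by (simp_all add: free_alg_def pmul_def fun_eq_iff)

lemma lext_pmul: "lext \<phi> (pmul f p q) = lext (\<lambda>s. lext (\<lambda>t. \<phi> (f s t)) q) p"
  by (simp add: pmul_def lext_sum) (simp add: lext_def sum_distrib_left mult_ac)

text \<open>The coordinates of an element are values of such extensions, so these separate elements.
  Identities between products are then checked on nested sums by means of
  \<open>lext_pmul\<close>.\<close>

lemma eq_by_lext:
  assumes "\<And>\<phi>. lext \<phi> p = lext \<phi> q"
  shows "p = q"
proof (rule poly_mapping_eqI)
  fix k
  have "lext (\<lambda>s. if s = k then 1 else 0) r = lookup r k" for r :: "'a \<Rightarrow>\<^sub>0 rat"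
    by (simp add: lext_def in_keys_iff if_distrib[of "(*) _"] cong: if_cong)
  then show "lookup p k = lookup q k" using assms by metis
qed

lemma pmul_single [simp]: "pmul f (single s a) (single t b) = single (f s t) (a * b)"
  by (rule eq_by_lext) (simp add: lext_pmul)

lemma lext_fun_add: "lext (\<lambda>s. \<phi> s + \<psi> s) p = lext \<phi> p + lext \<psi> p"
  by (simp add: lext_def sum.distrib algebra_simps)

lemma pmul_add_left: "pmul f (p + q) r = pmul f p r + pmul f q r"
  by (rule eq_by_lext) (simp add: lext_pmul lext_add)

lemma pmul_add_right: "pmul f r (p + q) = pmul f r p + pmul f r q"
  by (rule eq_by_lext) (simp add: lext_pmul lext_add lext_fun_add)

lemma pmul_scale_left: "pmul f (scaled c p) r = scaled c (pmul f p r)"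
  by (rule eq_by_lext) (simp add: lext_pmul lext_scale)

lemma pmul_scale_right: "pmul f r (scaled c p) = scaled c (pmul f r p)"
  by (rule eq_by_lext) (simp add: lext_pmul lext_scale lext_fun_scale)

lemma pmul_assoc:
  assumes "\<And>s t u. f (f s t) u = f s (f t u)"
  shows "pmul f (pmul f p q) r = pmul f p (pmul f q r)" by (rule eq_by_lext) (simp add: lext_pmul assms)

lemma scale_add: "scaled c (p + q) = scaled c p + scaled (c::rat) q"
  by (rule poly_mapping_eqI) (simp add: lookup_scale lookup_add distrib_left)

lemma scale_add_left: "scaled (a + b) p = scaled a p + scaled (b::rat) p"
  by (rule poly_mapping_eqI) (simp add: lookup_scale lookup_add distrib_right)

lemma scale_scale: "scaled (a * b) p = scaled a (scaled (b::rat) p)"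
  by (rule poly_mapping_eqI) (simp add: lookup_scale mult.assoc)

lemma scale_one [simp]: "scaled (1::rat) p = p" by (rule poly_mapping_eqI) (simp add: lookup_scale)

lemma keys_pmul:
  assumes "keys p \<subseteq> S" "keys q \<subseteq> T" "\<And>s t. s \<in> S \<Longrightarrow> t \<in> T \<Longrightarrow> f s t \<in> R"
  shows "keys (pmul f p q) \<subseteq> R" unfolding pmul_def
  by (intro order_trans[OF keys_sum] UN_least) (use assms in \<open>auto split: if_splits\<close>)

lemma free_alg_space: "rat_space (free_alg f e S)"
proof (intro rat_space.intro moduleI cring_ratring)
  show "abelian_group (free_alg f e S)"
  proof (rule abelian_groupI)
    fix x assume "x \<in> carrier (free_alg f e S)"
    then show "\<exists>y\<in>carrier (free_alg f e S). y \<oplus>\<^bsub>free_alg f e S\<^esub> x = \<zero>\<^bsub>free_alg f e S\<^esub>"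
      by (intro bexI[of _ "- x"]) auto
  qed (use keys_add in \<open>fastforce simp: add_ac\<close>)+
qed (use order_trans[OF keys_scale] in \<open>auto simp: scale_add scale_add_left scale_scale dest!: subsetD[OF keys_scale]\<close>)

lemma free_alg_algebra:
  assumes "\<And>s t. s \<in> S \<Longrightarrow> t \<in> S \<Longrightarrow> f s t \<in> S"
  shows "rat_algebra (free_alg f e S)"
proof -
  interpret rat_space "free_alg f e S" by (rule free_alg_space)
  show ?thesis by unfold_locales (use keys_pmul[of _ S _ S f S] assms in
        \<open>auto simp: pmul_add_left pmul_add_right pmul_scale_left pmul_scale_right\<close>)
qed

lemma sum_singles: "p = (\<Sum>s\<in>keys p. single s (lookup p s :: rat))"
  by (rule eq_by_lext) (simp add: lext_sum, simp add: lext_def)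

lemma linear_functional_lext:
  assumes "rat_space.linear_functional (free_alg f e S) \<xi>" "keys p \<subseteq> S"
  shows "\<xi> p = lext (\<lambda>s. \<xi> (single s 1)) p"
proof -
  interpret rat_space "free_alg f e S" by (rule free_alg_space)
  have add: "\<xi> (x + y) = \<xi> x + \<xi> y" if "keys x \<subseteq> S" "keys y \<subseteq> S" for x y
    using assms(1) that by (simp add: linear_functional_def)
  have sc: "\<xi> (scaled c x) = c * \<xi> x" if "keys x \<subseteq> S" for c x
    using assms(1) that by (simp add: linear_functional_def)
  have zero: "\<xi> 0 = 0" using linear_functional_zero[OF assms(1)] by simp
  have "\<xi> (\<Sum>s\<in>A. single s (c s)) = (\<Sum>s\<in>A. c s * \<xi> (single s 1))"
    if "finite A" "A \<subseteq> S" for A c using that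
  proof (induction A rule: finite_induct)
    case (insert s A)
    have "keys (\<Sum>s\<in>A. single s (c s)) \<subseteq> S"
      by (rule order_trans[OF keys_sum]) (use insert.prems in \<open>auto split: if_splits\<close>)
    moreover have "keys (single s (c s)) \<subseteq> S" using insert.prems by simp
    moreover have "\<xi> (single s (c s)) = c s * \<xi> (single s 1)"
      using sc[of "single s 1" "c s"] insert.prems by simp
    ultimately show ?case using insert by (simp add: add)
  qed (simp add: zero)
  from this[OF finite_keys assms(2), of "lookup p"] show ?thesis
    by (simp add: sum_singles[symmetric] lext_def)
qed

lemma linear_functional_of_lext: "rat_space.linear_functional (free_alg f e S) (lext \<phi>)"
  unfolding rat_space.linear_functional_def[OF free_alg_space] by (simp add: lext_add lext_scale)

lemma minus_one_powi_minus: "(-1 :: rat) powi (- n) = (-1) powi n"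
proof -
  have "((-1) powi n) * ((-1) powi n) = (1::rat)" by (simp flip: power_int_mult_distrib)
  then have "inverse ((-1::rat) powi n) = (-1) powi n" by (rule inverse_unique)
  then show ?thesis by (simp add: power_int_minus)
qed

section \<open>Functionals on the principal free vertex algebra\<close>

locale sym_quiver =
  fixes Q :: "('v, 'a) pre_digraph"
  assumes symmetric_quiver: "symmetric_quiver Q"
begin

lemma finite_verts: "finite (verts Q)" and finite_arcs: "finite (arcs Q)"
  and wf: "a \<in> arcs Q \<Longrightarrow> tail Q a \<in> verts Q \<and> head Q a \<in> verts Q"
proof -
  interpret fin_digraph Q using symmetric_quiver by (simp add: symmetric_quiver_def)
  show "finite (verts Q)" "finite (arcs Q)" by simp_all
  show "a \<in> arcs Q \<Longrightarrow> tail Q a \<in> verts Q \<and> head Q a \<in> verts Q" by simp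
qed

lemma num_arrows_commute: "num_arrows Q i j = num_arrows Q j i"
proof (cases "i \<in> verts Q \<and> j \<in> verts Q")
  case False
  then have "{a \<in> arcs Q. tail Q a = i \<and> head Q a = j} = {}" "{a \<in> arcs Q. tail Q a = j \<and> head Q a = i} = {}"
    using wf by auto
  then show ?thesis by (simp only: num_arrows_def)
qed (use symmetric_quiver in \<open>simp add: symmetric_quiver_def\<close>)

lemma euler_form_arrows:
  "euler_form Q \<alpha> \<beta> = (\<Sum>i\<in>verts Q. \<alpha> i * \<beta> i) -
    (\<Sum>i\<in>verts Q. \<Sum>j\<in>verts Q. int (num_arrows Q i j) * (\<alpha> i * \<beta> j))"
proof -
  have "(\<Sum>a\<in>arcs Q. \<alpha> (tail Q a) * \<beta> (head Q a))
      = (\<Sum>p\<in>verts Q \<times> verts Q. \<Sum>a | a \<in> arcs Q \<and> (tail Q a, head Q a) = p. \<alpha> (tail Q a) * \<beta> (head Q a))"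
    by (rule sum.group[symmetric]) (use finite_verts finite_arcs wf in auto)
  also have "\<dots> = (\<Sum>(i, j)\<in>verts Q \<times> verts Q. int (num_arrows Q i j) * (\<alpha> i * \<beta> j))"
    by (rule sum.cong) (auto simp: num_arrows_def)
  finally show ?thesis by (simp add: euler_form_def sum.cartesian_product)
qed

lemma euler_form_commute: "euler_form Q \<alpha> \<beta> = euler_form Q \<beta> \<alpha>"
proof -
  have "(\<Sum>i\<in>verts Q. \<Sum>j\<in>verts Q. int (num_arrows Q i j) * (\<alpha> i * \<beta> j))
      = (\<Sum>i\<in>verts Q. \<Sum>j\<in>verts Q. int (num_arrows Q j i) * (\<alpha> j * \<beta> i))" by (rule sum.swap)
  then show ?thesis by (simp add: euler_form_arrows num_arrows_commute[of _ "_"] mult.commute)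
qed

lemma euler_form_add_left: "euler_form Q (\<alpha> + \<beta>) \<gamma> = euler_form Q \<alpha> \<gamma> + euler_form Q \<beta> \<gamma>"
  by (simp add: euler_form_def distrib_right sum.distrib)

lemma euler_form_add_right: "euler_form Q \<gamma> (\<alpha> + \<beta>) = euler_form Q \<gamma> \<alpha> + euler_form Q \<gamma> \<beta>"
  by (simp add: euler_form_def distrib_left sum.distrib)

lemma braid_sign_add_left: "braid_sign Q (\<alpha> + \<beta>) \<gamma> = braid_sign Q \<alpha> \<gamma> * braid_sign Q \<beta> \<gamma>"
  and braid_sign_add_right: "braid_sign Q \<gamma> (\<alpha> + \<beta>) = braid_sign Q \<gamma> \<alpha> * braid_sign Q \<gamma> \<beta>"
  by (simp_all add: braid_sign_def euler_form_add_left euler_form_add_right power_int_add)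

lemma braid_sign_commute: "braid_sign Q \<alpha> \<beta> = braid_sign Q \<beta> \<alpha>"
  by (simp add: braid_sign_def euler_form_commute[of \<alpha>])

lemma braid_sign_square [simp]: "braid_sign Q \<alpha> \<beta> * braid_sign Q \<alpha> \<beta> = 1"
  by (simp add: braid_sign_def flip: power_int_mult_distrib)

lemma NN_arrows: "NN Q i j = int (num_arrows Q i j) - (if i = j \<and> i \<in> verts Q then 1 else 0)"
proof -
  have "(\<Sum>a\<in>arcs Q. basis_vec i (tail Q a) * basis_vec j (head Q a))
      = (\<Sum>a\<in>arcs Q. if tail Q a = i \<and> head Q a = j then 1 else 0)"
    by (rule sum.cong) (auto simp: basis_vec_def)
  also have "\<dots> = int (num_arrows Q i j)"
    using finite_arcs by (simp add: num_arrows_def flip: sum.inter_filter)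
  finally have "(\<Sum>a\<in>arcs Q. basis_vec i (tail Q a) * basis_vec j (head Q a)) = int (num_arrows Q i j)" .
  moreover have "(\<Sum>k\<in>verts Q. basis_vec i k * basis_vec j k) = (\<Sum>k\<in>verts Q. if k = i then (if i = j then 1 else 0) else 0)"
    by (rule sum.cong) (auto simp: basis_vec_def)
  ultimately show ?thesis using finite_verts by (simp add: NN_def euler_form_def)
qed

end

sublocale sym_quiver \<subseteq> correlators "NN Q"
proof unfold_locales
  show "NN Q i j = NN Q j i" for i j using num_arrows_commute[of i j] by (auto simp: NN_arrows)
  show "- 1 \<le> NN Q i j" for i j by (simp add: NN_arrows)
  show "NN Q i j < 0 \<Longrightarrow> i = j" for i j by (simp add: NN_arrows split: if_splits)
qed

lemma (in sym_quiver) sgn_of_NN: "sgn_of (NN Q i j) = braid_sign Q (basis_vec i) (basis_vec j)"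
  by (simp add: sgn_of_def braid_sign_def NN_def minus_one_powi_minus)

section \<open>The Lie algebra acting on functions of words\<close>

context sym_quiver
begin

abbreviation "is_word gs \<equiv> set gs \<subseteq> symbols Q"

definition F where "F = free_nonassoc Q"
definition W where "W = word_alg Q"

lemma F_free: "F = free_alg Br undefined {t. set_bracketing t \<subseteq> symbols Q}"
  by (simp add: F_def free_nonassoc_def)

lemma F_simps [simp]:
  "mult F = pmul Br" "zero F = 0" "add F = (+)" "smult F c = scaled c" by (simp_all add: F_free)

lemma F_carrier: "p \<in> carrier F \<longleftrightarrow> (\<forall>t\<in>keys p. set_bracketing t \<subseteq> symbols Q)" by (auto simp: F_free)

lemma F_algebra: "rat_algebra F" unfolding F_free by (rule free_alg_algebra) auto

text \<open>Dual to left multiplication of words, and therefore a right action: for generators,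
  \<open>act t (act s \<Phi>)\<close> reads \<open>\<Phi>\<close> on words that begin with
  \<open>s\<close> followed by \<open>t\<close>. A bracket acts as the signed commutator.\<close>

fun act :: "('v \<times> int) bracketing \<Rightarrow> 'v corr_fun \<Rightarrow> 'v corr_fun" where
  "act (Gen g) \<Phi> w = \<Phi> (g # w)"
| "act (Br s t) \<Phi> w = act t (act s \<Phi>) w - braid_sign Q (ldeg s) (ldeg t) * act s (act t \<Phi>) w"

lemma act_lext: "act s (\<lambda>w. lext (\<lambda>x. \<Psi> x w) p) w = lext (\<lambda>x. act s (\<Psi> x) w) p"
proof (induction s arbitrary: \<Psi> w)
  case (Br s t)
  have "act s (\<lambda>w. lext (\<lambda>x. \<Psi> x w) p) = (\<lambda>w. lext (\<lambda>x. act s (\<Psi> x) w) p)"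
    "act t (\<lambda>w. lext (\<lambda>x. \<Psi> x w) p) = (\<lambda>w. lext (\<lambda>x. act t (\<Psi> x) w) p)" for \<Psi>
    using Br.IH by (simp_all add: fun_eq_iff)
  then show ?case by (simp add: lext_fun_diff lext_fun_scale)
qed simp

lemma act_diff_scale: "act s (\<lambda>w. \<Phi> w - c * \<Psi> w) w = act s \<Phi> w - c * act s \<Psi> w"
proof (induction s arbitrary: \<Phi> \<Psi> w)
  case (Br s t)
  have "act s (\<lambda>w. \<Phi> w - c * \<Psi> w) = (\<lambda>w. act s \<Phi> w - c * act s \<Psi> w)"
    "act t (\<lambda>w. \<Phi> w - c * \<Psi> w) = (\<lambda>w. act t \<Phi> w - c * act t \<Psi> w)" for \<Phi> \<Psi>
    using Br.IH by (simp_all add: fun_eq_iff)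
  then show ?case by (simp add: algebra_simps)
qed simp

lemma act_zero [simp]: "act s (\<lambda>w. 0) w = 0" using act_diff_scale[of s "\<lambda>w. 0" 1 "\<lambda>w. 0" w] by simp

text \<open>Kept apart from the vacuum condition: the relations of \<open>LL Q\<close> and
  \<open>UU Q\<close> act by zero on every local function, and each of the two properties is stable
  under the action by itself.\<close>

definition local_corr :: "'v corr_fun \<Rightarrow> bool" where
  "local_corr \<Phi> \<longleftrightarrow> (\<forall>us vs i j m n. (\<Sum>k\<le>NNplus Q i j. (-1) ^ k * of_nat (NNplus Q i j choose k) *
        (\<Phi> (pair_word us i m j n vs k)
          - braid_sign Q (basis_vec i) (basis_vec j) * \<Phi> (swap_word us i m j n vs k))) = 0)"

definition vacuum_corr :: "'v corr_fun \<Rightarrow> bool" where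
  "vacuum_corr \<Phi> \<longleftrightarrow> (\<forall>us i n. 0 \<le> n \<longrightarrow> \<Phi> (us @ [(i, n)]) = 0)"

lemma is_system_iff: "is_system \<Phi> \<longleftrightarrow> local_corr \<Phi> \<and> vacuum_corr \<Phi>"
  by (simp add: is_system_def local_corr_def vacuum_corr_def sgn_of_NN NNplus_def)

lemma local_corr_diff_scale:
  assumes "local_corr \<Phi>" "local_corr \<Psi>"
  shows "local_corr (\<lambda>w. \<Phi> w - c * \<Psi> w)" unfolding local_corr_def
proof (intro allI)
  fix us vs i j m n
  let ?c = "\<lambda>k. (-1) ^ k * of_nat (NNplus Q i j choose k) :: rat"
  let ?S = "\<lambda>\<Phi>. \<Sum>k\<le>NNplus Q i j. ?c k * (\<Phi> (pair_word us i m j n vs k)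
          - braid_sign Q (basis_vec i) (basis_vec j) * \<Phi> (swap_word us i m j n vs k))"
  have "?S (\<lambda>w. \<Phi> w - c * \<Psi> w) = ?S \<Phi> - c * ?S \<Psi>"
    unfolding sum_distrib_left sum_subtractf[symmetric] by (rule sum.cong) (auto simp: algebra_simps)
  also have "\<dots> = 0" using assms by (simp add: local_corr_def)
  finally show "?S (\<lambda>w. \<Phi> w - c * \<Psi> w) = 0" .
qed

lemma local_corr_prefix: "local_corr \<Phi> \<Longrightarrow> local_corr (\<lambda>w. \<Phi> (us @ w))"
  unfolding local_corr_def append_assoc[symmetric] by blast

lemma local_corr_act: "local_corr \<Phi> \<Longrightarrow> local_corr (act s \<Phi>)"
proof (induction s arbitrary: \<Phi>)
  case (Gen g)
  have "act (Gen g) \<Phi> = (\<lambda>w. \<Phi> ([g] @ w))" by (simp add: fun_eq_iff)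
  then show ?case using local_corr_prefix[OF Gen, of "[g]"] by simp
next
  case (Br s t)
  have "act (Br s t) \<Phi> = (\<lambda>w. act t (act s \<Phi>) w - braid_sign Q (ldeg s) (ldeg t) * act s (act t \<Phi>) w)"
    by (simp add: fun_eq_iff)
  then show ?case using Br by (simp add: local_corr_diff_scale)
qed

lemma vacuum_corr_act: "vacuum_corr \<Phi> \<Longrightarrow> vacuum_corr (act s \<Phi>)"
proof (induction s arbitrary: \<Phi>)
  case (Gen g)
  then show ?case unfolding vacuum_corr_def by (metis act.simps(1) append_Cons)
next
  case (Br s t)
  then show ?case by (simp add: vacuum_corr_def)
qed

lemma local_corr_lext:
  assumes "\<And>x. x \<in> keys p \<Longrightarrow> local_corr (\<Psi> x)"
  shows "local_corr (\<lambda>w. lext (\<lambda>x. \<Psi> x w) p)"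
proof -
  have "local_corr (\<lambda>w. \<Sum>x\<in>A. c x * \<Psi> x w)" if "finite A" "A \<subseteq> keys p" for A c using that
  proof (induction A rule: finite_induct)
    case empty
    then show ?case by (simp add: local_corr_def)
  next
    case (insert x A)
    have "local_corr (\<lambda>w. (\<Sum>x\<in>A. c x * \<Psi> x w) - (- c x) * \<Psi> x w)"
      using insert assms by (intro local_corr_diff_scale) auto
    then show ?case using insert by (simp add: add.commute)
  qed
  from this[OF finite_keys subset_refl, of "lookup p"] show ?thesis by (simp add: lext_def)
qed

lemma vacuum_corr_lext:
  assumes "\<And>x. x \<in> keys p \<Longrightarrow> vacuum_corr (\<Psi> x)"
  shows "vacuum_corr (\<lambda>w. lext (\<lambda>x. \<Psi> x w) p)" using assms by (simp add: vacuum_corr_def lext_def)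

definition pact :: "'v nonassoc \<Rightarrow> 'v corr_fun \<Rightarrow> 'v corr_fun" where
  "pact p \<Phi> w = lext (\<lambda>t. act t \<Phi> w) p"

lemma pact_diff_scale: "pact p (\<lambda>w. \<Phi> w - c * \<Psi> w) w = pact p \<Phi> w - c * pact p \<Psi> w"
  by (simp add: pact_def act_diff_scale lext_fun_diff lext_fun_scale)

lemma pact_lext: "pact p (\<lambda>w. lext (\<lambda>x. \<Psi> x w) q) w = lext (\<lambda>x. pact p (\<Psi> x) w) q"
  unfolding pact_def act_lext unfolding lext_def sum_distrib_left
  by (subst sum.swap) (simp add: mult.left_commute)

lemma pact_zero [simp]: "pact p (\<lambda>w. 0) w = 0" by (simp add: pact_def)

lemma local_corr_pact: "local_corr \<Phi> \<Longrightarrow> local_corr (pact p \<Phi>)"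
  unfolding pact_def by (rule local_corr_lext) (rule local_corr_act)

lemma vacuum_corr_pact: "vacuum_corr \<Phi> \<Longrightarrow> vacuum_corr (pact p \<Phi>)"
  unfolding pact_def by (rule vacuum_corr_lext) (rule vacuum_corr_act)

abbreviation comp :: "('v \<Rightarrow> int) \<Rightarrow> 'v nonassoc set" where
  "comp \<equiv> nonassoc_comp Q"

lemma comp_iff: "p \<in> comp \<alpha> \<longleftrightarrow> keys p \<subseteq> {t. set_bracketing t \<subseteq> symbols Q \<and> ldeg t = \<alpha>}"
  by (auto simp: nonassoc_comp_def free_nonassoc_def)

lemma compD: "p \<in> comp \<alpha> \<Longrightarrow> p \<in> carrier F" "p \<in> comp \<alpha> \<Longrightarrow> t \<in> keys p \<Longrightarrow> ldeg t = \<alpha>"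
  by (auto simp: nonassoc_comp_def F_def)

lemma comp_pmul: "a \<in> comp \<alpha> \<Longrightarrow> b \<in> comp \<beta> \<Longrightarrow> pmul Br a b \<in> comp (\<alpha> + \<beta>)"
  unfolding comp_iff by (erule keys_pmul, assumption) auto

lemma pact_pmul:
  assumes a: "a \<in> comp \<alpha>" and b: "b \<in> comp \<beta>"
  shows "pact (pmul Br a b) \<Phi> w = pact b (pact a \<Phi>) w - braid_sign Q \<alpha> \<beta> * pact a (pact b \<Phi>) w"
proof -
  have "pact (pmul Br a b) \<Phi> w
      = lext (\<lambda>s. lext (\<lambda>t. act t (act s \<Phi>) w - braid_sign Q \<alpha> \<beta> * act s (act t \<Phi>) w) b) a"
    unfolding pact_def lext_pmul using compD(2)[OF a] compD(2)[OF b] by (intro lext_cong) simp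
  also have "\<dots> = lext (\<lambda>s. pact b (act s \<Phi>) w) a - braid_sign Q \<alpha> \<beta> * lext (\<lambda>s. act s (pact b \<Phi>) w) a"
    by (simp add: lext_fun_diff lext_fun_scale pact_def[abs_def] act_lext)
  also have "lext (\<lambda>s. pact b (act s \<Phi>) w) a = pact b (pact a \<Phi>) w"
    using pact_lext[of b "\<lambda>s. act s \<Phi>" a w] by (simp add: pact_def[of a, abs_def])
  finally show ?thesis by (simp add: pact_def[of a])
qed

text \<open>The sign of a bracket depends on the degrees of its entries. Acting by zero in each
  degree separately is a condition stable under brackets, which is what makes
  \<open>annihilator\<close> a two-sided ideal.\<close>

definition hpact :: "('v \<Rightarrow> int) \<Rightarrow> 'v nonassoc \<Rightarrow> 'v corr_fun \<Rightarrow> 'v corr_fun" where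
  "hpact \<alpha> p \<Phi> w = lext (\<lambda>t. if ldeg t = \<alpha> then act t \<Phi> w else 0) p"

lemma hpact_homogeneous: "p \<in> comp \<alpha> \<Longrightarrow> hpact \<beta> p \<Phi> w = (if \<alpha> = \<beta> then pact p \<Phi> w else 0)"
  unfolding hpact_def pact_def using compD(2) by (auto simp: lext_def intro!: sum.cong sum.neutral)

lemma pact_hpact: "(\<And>\<alpha>. hpact \<alpha> p \<Phi> w = 0) \<Longrightarrow> pact p \<Phi> w = 0"
proof -
  assume 0: "\<And>\<alpha>. hpact \<alpha> p \<Phi> w = 0"
  define D where "D = ldeg ` keys p"
  have "pact p \<Phi> w = lext (\<lambda>t. \<Sum>\<alpha>\<in>D. if ldeg t = \<alpha> then act t \<Phi> w else 0) p"
    unfolding pact_def by (rule lext_cong) (simp add: D_def)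
  also have "\<dots> = (\<Sum>\<alpha>\<in>D. hpact \<alpha> p \<Phi> w)" unfolding hpact_def lext_def sum_distrib_left by (rule sum.swap)
  finally show ?thesis by (simp add: 0)
qed

definition annihilator :: "'v nonassoc set" where
  "annihilator = {p \<in> carrier F. \<forall>\<alpha> \<Phi> w. local_corr \<Phi> \<longrightarrow> hpact \<alpha> p \<Phi> w = 0}"

lemma annihilator_two_sided: "rat_algebra.two_sided F annihilator"
proof -
  interpret F: rat_algebra F by (rule F_algebra)
  have "submodule annihilator ratring F"
  proof (rule F.submodule_rat_I)
    show "x \<oplus>\<^bsub>F\<^esub> y \<in> annihilator" if "x \<in> annihilator" "y \<in> annihilator" for x y
      using that F.a_closed[of x y] by (simp add: annihilator_def hpact_def lext_add)
    show "c \<odot>\<^bsub>F\<^esub> x \<in> annihilator" if "x \<in> annihilator" for c x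
      using that F.smult_closed_rat[of x c] by (simp add: annihilator_def hpact_def lext_scale)
  qed (use F.zero_closed in \<open>auto simp: annihilator_def hpact_def\<close>)
  moreover have "pmul Br a x \<in> annihilator \<and> pmul Br x a \<in> annihilator"
    if a: "a \<in> carrier F" and x: "x \<in> annihilator" for a x
  proof -
    have xc: "x \<in> carrier F" and x0: "\<And>\<alpha> \<Phi> w. local_corr \<Phi> \<Longrightarrow> hpact \<alpha> x \<Phi> w = 0"
      using x by (auto simp: annihilator_def)
    \<comment> \<open>In a fixed degree \<open>\<gamma>\<close>, the bracket with \<open>s\<close>
      involves only the part of \<open>x\<close> in degree \<open>\<gamma> - ldeg s\<close>, on
      which the sign is constant.\<close>
    have split: "ldeg s + ldeg t = \<gamma> \<longleftrightarrow> ldeg t = \<gamma> - ldeg s" "ldeg t + ldeg s = \<gamma> \<longleftrightarrow> ldeg t = \<gamma> - ldeg s"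
      for s t and \<gamma> :: "'v \<Rightarrow> int" by (auto simp: fun_eq_iff algebra_simps)
    have 1: "hpact \<gamma> (pmul Br a x) \<Phi> w = 0" if \<Phi>: "local_corr \<Phi>" for \<gamma> \<Phi> w
    proof -
      have "lext (\<lambda>t. if ldeg (Br s t) = \<gamma> then act (Br s t) \<Phi> w else 0) x = 0" for s
      proof -
        have "lext (\<lambda>t. if ldeg (Br s t) = \<gamma> then act (Br s t) \<Phi> w else 0) x
          = hpact (\<gamma> - ldeg s) x (act s \<Phi>) w
            - braid_sign Q (ldeg s) (\<gamma> - ldeg s) * act s (\<lambda>w. hpact (\<gamma> - ldeg s) x \<Phi> w) w"
          unfolding hpact_def act_lext lext_fun_scale[symmetric] lext_fun_diff[symmetric]
          by (rule lext_cong) (simp add: split if_distrib[of "act s"] if_distribR)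
        then show ?thesis using x0 \<Phi> local_corr_act by simp
      qed
      then show ?thesis unfolding hpact_def lext_pmul by simp
    qed
    have 2: "hpact \<gamma> (pmul Br x a) \<Phi> w = 0" if \<Phi>: "local_corr \<Phi>" for \<gamma> \<Phi> w
    proof -
      have "lext (\<lambda>t. if ldeg (Br t s) = \<gamma> then act (Br t s) \<Phi> w else 0) x = 0" for s
      proof -
        have "lext (\<lambda>t. if ldeg (Br t s) = \<gamma> then act (Br t s) \<Phi> w else 0) x
          = act s (\<lambda>w. hpact (\<gamma> - ldeg s) x \<Phi> w) w
            - braid_sign Q (\<gamma> - ldeg s) (ldeg s) * hpact (\<gamma> - ldeg s) x (act s \<Phi>) w"
          unfolding hpact_def act_lext lext_fun_scale[symmetric] lext_fun_diff[symmetric]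
          by (rule lext_cong) (simp add: split if_distrib[of "act s"] if_distribR)
        then show ?thesis using x0 \<Phi> local_corr_act by simp
      qed
      moreover have "hpact \<gamma> (pmul Br x a) \<Phi> w
          = lext (\<lambda>s. lext (\<lambda>t. if ldeg (Br t s) = \<gamma> then act (Br t s) \<Phi> w else 0) x) a"
        unfolding hpact_def lext_pmul unfolding lext_def sum_distrib_left
        by (subst sum.swap) (simp add: mult.left_commute)
      ultimately show ?thesis by simp
    qed
    have "pmul Br a x \<in> carrier F" "pmul Br x a \<in> carrier F"
      using F.mult_closed[OF a xc] F.mult_closed[OF xc a] by simp_all
    then show ?thesis using 1 2 by (simp add: annihilator_def)
  qed
  ultimately show ?thesis by (simp add: F.two_sided_def)
qed

lemma comp_scale: "p \<in> comp \<alpha> \<Longrightarrow> scaled c p \<in> comp \<alpha>" unfolding comp_iff by (rule order_trans[OF keys_scale])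

lemma comp_add: "p \<in> comp \<alpha> \<Longrightarrow> q \<in> comp \<alpha> \<Longrightarrow> p + q \<in> comp \<alpha>"
  unfolding comp_iff by (rule order_trans[OF keys_add]) blast

lemma comp_diff: "p \<in> comp \<alpha> \<Longrightarrow> q \<in> comp \<alpha> \<Longrightarrow> p - q \<in> comp \<alpha>"
  unfolding comp_iff by (rule order_trans[OF keys_diff]) blast

lemma pact_add: "pact (p + q) \<Phi> w = pact p \<Phi> w + pact q \<Phi> w"
  and pact_diff: "pact (p - q) \<Phi> w = pact p \<Phi> w - pact q \<Phi> w"
  and pact_scale: "pact (scaled c p) \<Phi> w = c * pact p \<Phi> w"
  by (simp_all add: pact_def lext_add lext_diff lext_scale)

lemma lie_axioms_cases:
  assumes "p \<in> lie_axioms Q"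
  obtains a b \<alpha> \<beta> where "a \<in> comp \<alpha>" "b \<in> comp \<beta>"
      "p = pmul Br a b + scaled (braid_sign Q \<alpha> \<beta>) (pmul Br b a)"
    | a b c \<alpha> \<beta> \<gamma> where "a \<in> comp \<alpha>" "b \<in> comp \<beta>" "c \<in> comp \<gamma>"
      "p = pmul Br a (pmul Br b c) - pmul Br (pmul Br a b) c
        - scaled (braid_sign Q \<alpha> \<beta>) (pmul Br b (pmul Br a c))"
  using assms unfolding lie_axioms_def Let_def F_def[symmetric] F_simps by blast

lemma lie_axioms_annihilator:
  assumes "p \<in> lie_axioms Q"
  shows "p \<in> annihilator"
proof -
  have hom: "p \<in> annihilator" if "p \<in> comp \<delta>" "\<And>\<Phi> w. pact p \<Phi> w = 0" for \<delta>
    using that compD(1) by (auto simp: annihilator_def hpact_homogeneous)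
  from assms show ?thesis
  proof (cases rule: lie_axioms_cases)
    case (1 a b \<alpha> \<beta>)
    have "pmul Br b a \<in> comp (\<alpha> + \<beta>)" using comp_pmul[OF 1(2,1)] by (simp add: add.commute)
    then have "p \<in> comp (\<alpha> + \<beta>)" unfolding 1(3) by (intro comp_add comp_scale comp_pmul[OF 1(1,2)])
    moreover have "pact p \<Phi> w = 0" for \<Phi> w
      unfolding 1(3) pact_add pact_scale pact_pmul[OF 1(1,2)] pact_pmul[OF 1(2,1)] braid_sign_commute[of \<beta> \<alpha>]
      by (simp add: algebra_simps flip: mult.assoc)
    ultimately show ?thesis by (rule hom)
  next
    case (2 a b c \<alpha> \<beta> \<gamma>)
    have bc: "pmul Br b c \<in> comp (\<beta> + \<gamma>)" and ab: "pmul Br a b \<in> comp (\<alpha> + \<beta>)"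
      and ac: "pmul Br a c \<in> comp (\<alpha> + \<gamma>)" by (intro comp_pmul 2)+
    have "pmul Br a (pmul Br b c) \<in> comp (\<alpha> + \<beta> + \<gamma>)" "pmul Br (pmul Br a b) c \<in> comp (\<alpha> + \<beta> + \<gamma>)"
      "pmul Br b (pmul Br a c) \<in> comp (\<alpha> + \<beta> + \<gamma>)"
      using comp_pmul[OF 2(1) bc] comp_pmul[OF ab 2(3)] comp_pmul[OF 2(2) ac] by (simp_all add: add_ac)
    then have "p \<in> comp (\<alpha> + \<beta> + \<gamma>)" unfolding 2(4) by (intro comp_diff comp_scale)
    moreover have "pact p \<Phi> w = 0" for \<Phi> w
    proof -
      define x y z where "x = braid_sign Q \<alpha> \<beta>" and "y = braid_sign Q \<beta> \<gamma>" and "z = braid_sign Q \<alpha> \<gamma>"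
      have xx: "x * x = 1" by (simp add: x_def)
      have signs: "braid_sign Q \<alpha> (\<beta> + \<gamma>) = x * z" "braid_sign Q (\<alpha> + \<beta>) \<gamma> = z * y"
        "braid_sign Q \<beta> (\<alpha> + \<gamma>) = x * y"
        by (simp_all add: braid_sign_add_left braid_sign_add_right x_def y_def z_def braid_sign_commute[of \<beta> \<alpha>])
      have P: "pact (pmul Br b c) \<Psi> = (\<lambda>w. pact c (pact b \<Psi>) w - y * pact b (pact c \<Psi>) w)"
        "pact (pmul Br a b) \<Psi> = (\<lambda>w. pact b (pact a \<Psi>) w - x * pact a (pact b \<Psi>) w)"
        "pact (pmul Br a c) \<Psi> = (\<lambda>w. pact c (pact a \<Psi>) w - z * pact a (pact c \<Psi>) w)" for \<Psi>
        by (simp_all add: fun_eq_iff pact_pmul[OF 2(2,3)] pact_pmul[OF 2(1,2)] pact_pmul[OF 2(1,3)] x_def y_def z_def)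
      \<comment> \<open>Signs are multiplicative in the degrees. All terms of the Jacobi expression
        cancel, except those with the factor \<open>x * x - 1\<close>, where \<open>x\<close> is a
        sign.\<close>
      have "pact p \<Phi> w = (x * x - 1) * (y * (pact b (pact c (pact a \<Phi>)) w - z * pact b (pact a (pact c \<Phi>)) w))"
        unfolding 2(4) pact_diff pact_scale pact_pmul[OF 2(1) bc] pact_pmul[OF ab 2(3)] pact_pmul[OF 2(2) ac]
          signs P pact_diff_scale x_def[symmetric] by (simp add: algebra_simps)
      then show ?thesis by (simp add: xx)
    qed
    ultimately show ?thesis by (rule hom)
  qed
qed

lemma locality_cases:
  assumes "p \<in> locality_rels Q"
  obtains i j m n where "i \<in> verts Q" "j \<in> verts Q"
    "p = (\<Sum>k\<le>NNplus Q i j. single (Br (Gen (i, m - int k)) (Gen (j, n + int k)))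
          ((-1) ^ k * of_nat (NNplus Q i j choose k)))" using assms unfolding locality_rels_def by blast

lemma locality_rels_comp:
  assumes "p = (\<Sum>k\<le>NNplus Q i j. single (Br (Gen (i, m - int k)) (Gen (j, n + int k))) (c k))"
    "i \<in> verts Q" "j \<in> verts Q"
  shows "p \<in> comp (basis_vec i + basis_vec j)"
proof -
  have "keys p \<subseteq> range (\<lambda>k. Br (Gen (i, m - int k)) (Gen (j, n + int k)))"
    unfolding assms(1) by (rule order_trans[OF keys_sum]) (auto split: if_splits)
  then show ?thesis using assms(2,3) by (fastforce simp: nonassoc_comp_def free_nonassoc_def symbols_def)
qed

lemma locality_annihilator:
  assumes "p \<in> locality_rels Q"
  shows "p \<in> annihilator"
proof -
  obtain i j m n where ij: "i \<in> verts Q" "j \<in> verts Q"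
    and p: "p = (\<Sum>k\<le>NNplus Q i j. single (Br (Gen (i, m - int k)) (Gen (j, n + int k)))
          ((-1) ^ k * of_nat (NNplus Q i j choose k)))" by (rule locality_cases[OF assms])
  have c: "p \<in> comp (basis_vec i + basis_vec j)" by (rule locality_rels_comp[OF p ij])
  have "pact p \<Phi> w = 0" if \<Phi>: "local_corr \<Phi>" for \<Phi> w
  proof -
    have "pact p \<Phi> w = (\<Sum>k\<le>NNplus Q i j. (-1) ^ k * of_nat (NNplus Q i j choose k) *
        (\<Phi> ([] @ (i, m - int k) # (j, n + int k) # w)
          - braid_sign Q (basis_vec i) (basis_vec j) * \<Phi> ([] @ (j, n + int k) # (i, m - int k) # w)))"
      by (simp add: p pact_def lext_sum)
    also have "\<dots> = 0" using \<Phi> unfolding local_corr_def by blast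
    finally show ?thesis .
  qed
  then show ?thesis using compD(1)[OF c] by (auto simp: annihilator_def hpact_homogeneous[OF c])
qed

lemma relations_carrier: "lie_axioms Q \<union> locality_rels Q \<subseteq> carrier F"
  using lie_axioms_annihilator locality_annihilator unfolding annihilator_def by blast

lemma lie_ideal_two_sided: "rat_algebra.two_sided F (lie_ideal Q)" unfolding lie_ideal_def F_def[symmetric]
  by (rule rat_algebra.ideal_gen_two_sided[OF F_algebra relations_carrier])

lemma lie_ideal_annihilator: "lie_ideal Q \<subseteq> annihilator" unfolding lie_ideal_def F_def[symmetric]
  by (rule rat_algebra.ideal_gen_least[OF F_algebra annihilator_two_sided])
    (use lie_axioms_annihilator locality_annihilator in blast)

lemma pact_lie_ideal: "p \<in> lie_ideal Q \<Longrightarrow> local_corr \<Phi> \<Longrightarrow> pact p \<Phi> w = 0"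
  using lie_ideal_annihilator by (intro pact_hpact) (auto simp: annihilator_def)

lemma LL_ideal: "rat_ideal F (lie_ideal Q)"
  by (rule rat_ideal.intro[OF F_algebra rat_ideal_axioms.intro[OF lie_ideal_two_sided]])

lemma LL_quot: "LL Q = quot_module F (lie_ideal Q)" by (simp add: LL_def F_def)

end

section \<open>The enveloping algebra and its vacuum module\<close>

context sym_quiver
begin

interpretation F: rat_algebra F by (rule F_algebra)
interpretation L: rat_ideal F "lie_ideal Q" by (rule LL_ideal)

abbreviation lie_class :: "'v nonassoc \<Rightarrow> 'v lie" where
  "lie_class p \<equiv> lie_ideal Q +>\<^bsub>F\<^esub> p"

lemma LL_carrier: "carrier (LL Q) = lie_class ` carrier F" by (simp add: LL_quot L.quot_carrier)

lemma LL_add: "p \<in> carrier F \<Longrightarrow> q \<in> carrier F \<Longrightarrow> lie_class p \<oplus>\<^bsub>LL Q\<^esub> lie_class q = lie_class (p + q)"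
  using L.quot_add[of p q] by (simp add: LL_quot)

lemma LL_smult: "p \<in> carrier F \<Longrightarrow> c \<odot>\<^bsub>LL Q\<^esub> lie_class p = lie_class (scaled c p)"
  using L.quot_smult[of p c] by (simp add: LL_quot)

lemma LL_mult: "p \<in> carrier F \<Longrightarrow> q \<in> carrier F \<Longrightarrow> lie_class p \<otimes>\<^bsub>LL Q\<^esub> lie_class q = lie_class (pmul Br p q)"
  using L.quot_mult[of p q] by (simp add: LL_quot)

lemma single_F: "set_bracketing t \<subseteq> symbols Q \<Longrightarrow> single t c \<in> carrier F" by (simp add: F_carrier)

lemma LL_gen_class: "LL_gen Q g = lie_class (single (Gen g) 1)" by (simp add: LL_gen_def F_def)

lemma LL_gen_carrier: "g \<in> symbols Q \<Longrightarrow> LL_gen Q g \<in> carrier (LL Q)"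
  unfolding LL_gen_class LL_carrier by (intro imageI single_F) simp

abbreviation "LL_words \<equiv> lists (carrier (LL Q))"

lemma gens_lists: "is_word gs \<Longrightarrow> map (LL_gen Q) gs \<in> LL_words" by (induction gs) (simp_all add: LL_gen_carrier)

lemma LL_gen_comp: "g \<in> symbols Q \<Longrightarrow> LL_gen Q g \<in> LL_comp Q (basis_vec (fst g))"
  unfolding LL_gen_class LL_comp_def F_def[symmetric] by (intro imageI) (simp add: comp_iff)

lemma LL_comp_carrier: "LL_comp Q \<alpha> \<subseteq> carrier (LL Q)"
  unfolding LL_comp_def LL_carrier F_def[symmetric] using compD(1) by blast

definition lact :: "'v lie \<Rightarrow> 'v corr_fun \<Rightarrow> 'v corr_fun" where
  "lact X = pact (SOME p. p \<in> X)"

text \<open>Representatives of a class differ by an element of \<open>lie_ideal Q\<close>, which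
  acts by zero on local functions.\<close>

lemma lact_class:
  assumes p: "p \<in> carrier F" and \<Phi>: "local_corr \<Phi>"
  shows "lact (lie_class p) \<Phi> = pact p \<Phi>"
proof
  fix w
  have "(SOME q. q \<in> lie_class p) \<in> lie_class p" using L.a_rcos_self[OF p] by (rule someI)
  then obtain v where v: "v \<in> lie_ideal Q" "(SOME q. q \<in> lie_class p) = v \<oplus>\<^bsub>F\<^esub> p" by (rule L.cosetE)
  then show "lact (lie_class p) \<Phi> w = pact p \<Phi> w"
    using pact_lie_ideal[OF v(1) \<Phi>] by (simp add: lact_def pact_add)
qed

text \<open>With \<open>fold\<close> the first letter acts first, as a right action
  requires.\<close>

definition wact :: "'v lie list \<Rightarrow> 'v corr_fun \<Rightarrow> 'v corr_fun" where
  "wact ws = fold lact ws"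

lemma wact_simps [simp]: "wact [] \<Phi> = \<Phi>" "wact (X # ws) \<Phi> = wact ws (lact X \<Phi>)"
  "wact (us @ ws) \<Phi> = wact ws (wact us \<Phi>)" by (simp_all add: wact_def)

lemma local_corr_wact: "local_corr \<Phi> \<Longrightarrow> local_corr (wact ws \<Phi>)"
  by (induction ws arbitrary: \<Phi>) (auto simp: lact_def local_corr_pact)

lemma vacuum_corr_wact: "vacuum_corr \<Phi> \<Longrightarrow> vacuum_corr (wact ws \<Phi>)"
  by (induction ws arbitrary: \<Phi>) (auto simp: lact_def vacuum_corr_pact)

lemma wact_lext: "wact ws (\<lambda>w. lext (\<lambda>x. \<Psi> x w) q) w = lext (\<lambda>x. wact ws (\<Psi> x) w) q"
proof (induction ws arbitrary: \<Psi> w)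
  case (Cons X ws)
  have "lact X (\<lambda>w. lext (\<lambda>x. \<Psi> x w) q) = (\<lambda>w. lext (\<lambda>x. lact X (\<Psi> x) w) q)"
    by (simp add: lact_def fun_eq_iff pact_lext)
  then show ?case using Cons by simp
qed simp

definition uact :: "'v words \<Rightarrow> 'v corr_fun \<Rightarrow> 'v corr_fun" where
  "uact q \<Phi> w = lext (\<lambda>ws. wact ws \<Phi> w) q"

lemma wact_zero: "wact ws (\<lambda>w. 0) w = 0" using wact_lext[of ws "\<lambda>_ _. 0" 0 w] by simp

lemma W_free: "W = free_alg (@) [] (LL_words)" by (simp add: W_def word_alg_def)

lemma W_simps [simp]:
  "mult W = pmul (@)" "zero W = 0" "add W = (+)" "smult W c = scaled c"
  "one W = single [] 1" by (simp_all add: W_free)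

lemma W_carrier: "q \<in> carrier W \<longleftrightarrow> keys q \<subseteq> LL_words" by (simp add: W_free)

lemma W_algebra: "rat_algebra W" unfolding W_free by (rule free_alg_algebra) auto

lemma single_W: "ws \<in> LL_words \<Longrightarrow> single ws c \<in> carrier W" by (simp add: W_carrier)

lemma W_diff: "p \<in> carrier W \<Longrightarrow> q \<in> carrier W \<Longrightarrow> p - q \<in> carrier W"
  unfolding W_carrier using keys_diff[of p q] by blast

interpretation W: rat_algebra W by (rule W_algebra)

definition env_annihilator :: "'v words set" where
  "env_annihilator = {q \<in> carrier W. \<forall>\<Phi> w. local_corr \<Phi> \<longrightarrow> uact q \<Phi> w = 0}"

lemma env_annihilator_two_sided: "W.two_sided env_annihilator"
proof -
  have "submodule env_annihilator ratring W"
  proof (rule W.submodule_rat_I)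
    show "x \<oplus>\<^bsub>W\<^esub> y \<in> env_annihilator" if "x \<in> env_annihilator" "y \<in> env_annihilator" for x y
      using that W.a_closed[of x y] by (simp add: env_annihilator_def uact_def lext_add)
    show "c \<odot>\<^bsub>W\<^esub> x \<in> env_annihilator" if "x \<in> env_annihilator" for c x
      using that W.smult_closed_rat[of x c] by (simp add: env_annihilator_def uact_def lext_scale)
  qed (use W.zero_closed in \<open>auto simp: env_annihilator_def uact_def\<close>)
  moreover have "pmul (@) a x \<in> env_annihilator \<and> pmul (@) x a \<in> env_annihilator"
    if a: "a \<in> carrier W" and x: "x \<in> env_annihilator" for a x
  proof -
    have xc: "x \<in> carrier W" and x0: "\<And>\<Phi> w. local_corr \<Phi> \<Longrightarrow> uact x \<Phi> w = 0"
      using x by (auto simp: env_annihilator_def)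
    have "uact (pmul (@) a x) \<Phi> w = 0" if \<Phi>: "local_corr \<Phi>" for \<Phi> w
    proof -
      have "uact (pmul (@) a x) \<Phi> w = lext (\<lambda>s. uact x (wact s \<Phi>) w) a" by (simp add: uact_def lext_pmul)
      then show ?thesis using x0 local_corr_wact[OF \<Phi>] by simp
    qed
    moreover have "uact (pmul (@) x a) \<Phi> w = 0" if \<Phi>: "local_corr \<Phi>" for \<Phi> w
    proof -
      have "uact (pmul (@) x a) \<Phi> w = lext (\<lambda>t. wact t (\<lambda>w. uact x \<Phi> w) w) a"
        unfolding uact_def lext_pmul wact_lext unfolding lext_def sum_distrib_left
        by (subst sum.swap) (simp add: mult.left_commute)
      then show ?thesis using x0 \<Phi> by (simp add: wact_zero)
    qed
    ultimately show ?thesis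
      using W.mult_closed[OF a xc] W.mult_closed[OF xc a] by (simp add: env_annihilator_def)
  qed
  ultimately show ?thesis by (simp add: W.two_sided_def)
qed

definition env_rels :: "'v words set" where
  "env_rels = {single [x \<oplus>\<^bsub>LL Q\<^esub> y] 1 - single [x] 1 - single [y] 1
        | x y. x \<in> carrier (LL Q) \<and> y \<in> carrier (LL Q)} \<union>
     {single [c \<odot>\<^bsub>LL Q\<^esub> x] 1 - single [x] c | c x. x \<in> carrier (LL Q)} \<union>
     {single [a, b] 1 - single [b, a] (braid_sign Q \<alpha> \<beta>)
        - single [a \<otimes>\<^bsub>LL Q\<^esub> b] 1 | a b \<alpha> \<beta>. a \<in> LL_comp Q \<alpha> \<and> b \<in> LL_comp Q \<beta>}"

lemma env_ideal_gen: "env_ideal Q = ideal_gen W env_rels" by (simp add: env_ideal_def env_rels_def W_def)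

lemma LL_closed:
  "X \<in> carrier (LL Q) \<Longrightarrow> Y \<in> carrier (LL Q) \<Longrightarrow> X \<oplus>\<^bsub>LL Q\<^esub> Y \<in> carrier (LL Q)"
  "X \<in> carrier (LL Q) \<Longrightarrow> c \<odot>\<^bsub>LL Q\<^esub> X \<in> carrier (LL Q)"
  "X \<in> carrier (LL Q) \<Longrightarrow> Y \<in> carrier (LL Q) \<Longrightarrow> X \<otimes>\<^bsub>LL Q\<^esub> Y \<in> carrier (LL Q)"
proof -
  interpret LL: rat_algebra "LL Q" unfolding LL_quot by (rule L.quot_algebra)
  show "X \<in> carrier (LL Q) \<Longrightarrow> Y \<in> carrier (LL Q) \<Longrightarrow> X \<oplus>\<^bsub>LL Q\<^esub> Y \<in> carrier (LL Q)"
    "X \<in> carrier (LL Q) \<Longrightarrow> c \<odot>\<^bsub>LL Q\<^esub> X \<in> carrier (LL Q)"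
    "X \<in> carrier (LL Q) \<Longrightarrow> Y \<in> carrier (LL Q) \<Longrightarrow> X \<otimes>\<^bsub>LL Q\<^esub> Y \<in> carrier (LL Q)" by (auto intro: LL.mult_closed)
qed

lemma env_rels_annihilator: "env_rels \<subseteq> env_annihilator"
proof
  fix r assume "r \<in> env_rels"
  then consider x y where "x \<in> carrier (LL Q)" "y \<in> carrier (LL Q)"
      "r = single [x \<oplus>\<^bsub>LL Q\<^esub> y] 1 - single [x] 1 - single [y] 1"
    | c x where "x \<in> carrier (LL Q)" "r = single [c \<odot>\<^bsub>LL Q\<^esub> x] 1 - single [x] c"
    | a b \<alpha> \<beta> where "a \<in> LL_comp Q \<alpha>" "b \<in> LL_comp Q \<beta>"
      "r = single [a, b] 1 - single [b, a] (braid_sign Q \<alpha> \<beta>)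
        - single [a \<otimes>\<^bsub>LL Q\<^esub> b] 1" unfolding env_rels_def by blast
  then show "r \<in> env_annihilator"
  proof cases
    case (1 x y)
    then obtain p q where pq: "p \<in> carrier F" "q \<in> carrier F" "x = lie_class p" "y = lie_class q"
      by (auto simp: LL_carrier)
    have "p + q \<in> carrier F" using F.a_closed[OF pq(1,2)] by simp
    then have "uact r \<Phi> w = 0" if "local_corr \<Phi>" for \<Phi> w
      using that pq by (simp add: 1(3) uact_def lext_diff LL_add lact_class pact_add)
    moreover have "r \<in> carrier W" unfolding 1(3) using 1 LL_closed by (intro W_diff single_W) auto
    ultimately show ?thesis by (simp add: env_annihilator_def)
  next
    case (2 c x)
    then obtain p where p: "p \<in> carrier F" "x = lie_class p" by (auto simp: LL_carrier)
    have "scaled c p \<in> carrier F" using F.smult_closed_rat[OF p(1), of c] by simp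
    then have "uact r \<Phi> w = 0" if "local_corr \<Phi>" for \<Phi> w
      using that p by (simp add: 2(2) uact_def lext_diff LL_smult lact_class pact_scale)
    moreover have "r \<in> carrier W" unfolding 2(2) using 2 LL_closed by (intro W_diff single_W) auto
    ultimately show ?thesis by (simp add: env_annihilator_def)
  next
    case (3 a b \<alpha> \<beta>)
    then obtain p q where pq: "p \<in> comp \<alpha>" "q \<in> comp \<beta>" "a = lie_class p" "b = lie_class q"
      by (auto simp: LL_comp_def F_def)
    have F: "p \<in> carrier F" "q \<in> carrier F" "pmul Br p q \<in> carrier F" using compD(1) pq comp_pmul by blast+
    have "uact r \<Phi> w = 0" if "local_corr \<Phi>" for \<Phi> w using that pq F
      by (simp add: 3(3) uact_def lext_diff LL_mult lact_class local_corr_pact pact_pmul[OF pq(1,2)])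
    moreover have "r \<in> carrier W"
      unfolding 3(3) using subsetD[OF LL_comp_carrier 3(1)] subsetD[OF LL_comp_carrier 3(2)]
      by (intro W_diff single_W) (auto intro: LL_closed)
    ultimately show ?thesis by (simp add: env_annihilator_def)
  qed
qed

lemma env_rels_carrier: "env_rels \<subseteq> carrier W"
  using env_rels_annihilator unfolding env_annihilator_def by blast

lemma env_ideal_two_sided: "W.two_sided (env_ideal Q)"
  unfolding env_ideal_gen by (rule W.ideal_gen_two_sided[OF env_rels_carrier])

lemma env_ideal_annihilator: "env_ideal Q \<subseteq> env_annihilator"
  unfolding env_ideal_gen by (rule W.ideal_gen_least[OF env_annihilator_two_sided env_rels_annihilator])

interpretation E: rat_ideal W "env_ideal Q"
  by (rule rat_ideal.intro[OF W_algebra rat_ideal_axioms.intro[OF env_ideal_two_sided]])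

abbreviation env_class :: "'v words \<Rightarrow> 'v env" where
  "env_class q \<equiv> env_ideal Q +>\<^bsub>W\<^esub> q"

lemma UU_quot: "UU Q = E.quo" by (simp add: UU_def W_def)

lemma UU_algebra: "rat_algebra (UU Q)" unfolding UU_quot by (rule E.quot_algebra)

interpretation U: rat_algebra "UU Q" by (rule UU_algebra)

lemma UU_carrier: "carrier (UU Q) = env_class ` carrier W" by (simp add: UU_quot E.quot_carrier)

lemma UU_mult: "p \<in> carrier W \<Longrightarrow> q \<in> carrier W \<Longrightarrow> env_class p \<otimes>\<^bsub>UU Q\<^esub> env_class q = env_class (pmul (@) p q)"
  using E.quot_mult[of p q] by (simp add: UU_quot)

lemma UU_assoc:
  assumes "x \<in> carrier (UU Q)" "y \<in> carrier (UU Q)" "z \<in> carrier (UU Q)"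
  shows "(x \<otimes>\<^bsub>UU Q\<^esub> y) \<otimes>\<^bsub>UU Q\<^esub> z = x \<otimes>\<^bsub>UU Q\<^esub> (y \<otimes>\<^bsub>UU Q\<^esub> z)"
proof -
  obtain p q r where p: "p \<in> carrier W" "q \<in> carrier W" "r \<in> carrier W"
    "x = env_class p" "y = env_class q" "z = env_class r" using assms by (auto simp: UU_carrier)
  have "pmul (@) p q \<in> carrier W" "pmul (@) q r \<in> carrier W" using W.mult_closed p by auto
  then show ?thesis using p by (simp add: UU_mult pmul_assoc)
qed

lemma UU_gen_class: "UU_gen Q g = env_class (single [LL_gen Q g] 1)" by (simp add: UU_gen_def W_def)

lemma UU_gen_carrier: "g \<in> symbols Q \<Longrightarrow> UU_gen Q g \<in> carrier (UU Q)"
  unfolding UU_gen_class UU_carrier by (intro imageI single_W) (simp add: LL_gen_carrier)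

definition vac_gens :: "'v env set" where
  "vac_gens = {u \<otimes>\<^bsub>UU Q\<^esub> UU_gen Q (i, n) | u i n. u \<in> carrier (UU Q) \<and> i \<in> verts Q \<and> n \<ge> 0}"

lemma vac_ideal_span: "vac_ideal Q = lin_span (UU Q) vac_gens" by (simp add: vac_ideal_def vac_gens_def)

lemma vac_gens_carrier: "vac_gens \<subseteq> carrier (UU Q)"
  unfolding vac_gens_def by (auto intro!: U.mult_closed UU_gen_carrier simp: symbols_def)

interpretation V: rat_subspace "UU Q" "vac_ideal Q"
  by (rule rat_subspace.intro[OF U.rat_space_axioms rat_subspace_axioms.intro])
    (simp add: vac_ideal_span U.lin_span_submodule[OF vac_gens_carrier])

text \<open>The generating set is stable under left multiplication by associativity, and so is its
  span. The action of generators on \<open>PP Q\<close> is well defined because of this.\<close>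

lemma vac_ideal_left:
  assumes u: "u \<in> carrier (UU Q)" and x: "x \<in> vac_ideal Q"
  shows "u \<otimes>\<^bsub>UU Q\<^esub> x \<in> vac_ideal Q"
proof -
  define H where "H = {x \<in> carrier (UU Q). u \<otimes>\<^bsub>UU Q\<^esub> x \<in> vac_ideal Q}"
  have "submodule H ratring (UU Q)"
  proof (rule U.submodule_rat_I)
    have "u \<otimes>\<^bsub>UU Q\<^esub> \<zero>\<^bsub>UU Q\<^esub> = 0 \<odot>\<^bsub>UU Q\<^esub> (u \<otimes>\<^bsub>UU Q\<^esub> \<zero>\<^bsub>UU Q\<^esub>)"
      using U.mult_smult_r[of u "\<zero>\<^bsub>UU Q\<^esub>" 0] u U.smult_zero_rat[of "\<zero>\<^bsub>UU Q\<^esub>"] by simp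
    then have "u \<otimes>\<^bsub>UU Q\<^esub> \<zero>\<^bsub>UU Q\<^esub> = \<zero>\<^bsub>UU Q\<^esub>" using U.smult_zero_rat U.mult_closed[OF u U.zero_closed] by simp
    then show "\<zero>\<^bsub>UU Q\<^esub> \<in> H" using V.subspaceD(2) by (simp add: H_def)
    show "x \<oplus>\<^bsub>UU Q\<^esub> y \<in> H" if "x \<in> H" "y \<in> H" for x y
      using that V.subspaceD(3) u by (simp add: H_def U.mult_distr_r)
    show "c \<odot>\<^bsub>UU Q\<^esub> x \<in> H" if "x \<in> H" for c x using that V.subspaceD(4) u by (simp add: H_def U.mult_smult_r)
  qed (simp add: H_def)
  moreover have "vac_gens \<subseteq> H"
  proof
    fix x assume "x \<in> vac_gens"
    then obtain v i n where v: "x = v \<otimes>\<^bsub>UU Q\<^esub> UU_gen Q (i, n)" "v \<in> carrier (UU Q)" "i \<in> verts Q" "n \<ge> 0"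
      by (auto simp: vac_gens_def)
    have g: "UU_gen Q (i, n) \<in> carrier (UU Q)" using v by (intro UU_gen_carrier) (simp add: symbols_def)
    have "u \<otimes>\<^bsub>UU Q\<^esub> x = (u \<otimes>\<^bsub>UU Q\<^esub> v) \<otimes>\<^bsub>UU Q\<^esub> UU_gen Q (i, n)"
      unfolding v(1) by (rule UU_assoc[symmetric, OF u v(2) g])
    then have "u \<otimes>\<^bsub>UU Q\<^esub> x \<in> vac_gens" using v U.mult_closed[OF u v(2)] unfolding vac_gens_def by blast
    then show "x \<in> H"
      using \<open>x \<in> vac_gens\<close> vac_gens_carrier U.lin_span_superset vac_ideal_span by (auto simp: H_def)
  qed
  ultimately have "vac_ideal Q \<subseteq> H" unfolding vac_ideal_span by (rule U.lin_span_least)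
  then show ?thesis using x by (auto simp: H_def)
qed

lemma PP_quot: "PP Q = V.quo" by (simp add: PP_def)

definition proj :: "'v words \<Rightarrow> 'v pfva" where
  "proj q = vac_ideal Q +>\<^bsub>UU Q\<^esub> env_class q"

lemma PP_space: "rat_space (PP Q)" unfolding PP_quot by (rule V.quot_space)

lemma PP_carrier: "carrier (PP Q) = proj ` carrier W"
  by (auto simp: PP_quot V.quot_carrier UU_carrier proj_def)

lemma word_vec_proj:
  "is_word gs \<Longrightarrow> word_vec Q gs = proj (single (map (LL_gen Q) gs) 1)"
proof (induction gs)
  case Nil
  have "\<one>\<^bsub>UU Q\<^esub> = env_class (single [] 1)" by (simp add: UU_quot E.quot_simps)
  then show ?case by (simp add: word_vec_def vacuum_def proj_def)
next
  case (Cons g gs)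
  have mem: "single (map (LL_gen Q) gs) 1 \<in> carrier W"
    "single [LL_gen Q g] 1 \<in> carrier W"
    using gens_lists[of gs] LL_gen_carrier[of g] Cons.prems by (simp_all add: W_carrier)
  have "word_vec Q (g # gs) = left_act (UU Q) (vac_ideal Q) (UU_gen Q g)
      (vac_ideal Q +>\<^bsub>UU Q\<^esub> env_class (single (map (LL_gen Q) gs) 1))"
    using Cons by (simp add: word_vec_def proj_def)
  also have "\<dots> = vac_ideal Q +>\<^bsub>UU Q\<^esub> (UU_gen Q g \<otimes>\<^bsub>UU Q\<^esub> env_class (single (map (LL_gen Q) gs) 1))"
    by (rule left_act_coset[OF UU_algebra V.subspace vac_ideal_left])
      (use Cons.prems mem UU_gen_carrier in \<open>auto simp: UU_carrier\<close>)
  also have "\<dots> = proj (single (map (LL_gen Q) (g # gs)) 1)"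
    using mem by (simp add: UU_gen_class UU_mult proj_def)
  finally show ?case .
qed

lemma word_vec_carrier: "is_word gs \<Longrightarrow> word_vec Q gs \<in> carrier (PP Q)"
  unfolding word_vec_proj PP_carrier by (intro imageI single_W gens_lists)

abbreviation functional :: "('v pfva \<Rightarrow> rat) \<Rightarrow> bool" where
  "functional \<equiv> rat_space.linear_functional (PP Q)"

definition on_words :: "('v pfva \<Rightarrow> rat) \<Rightarrow> 'v lie list \<Rightarrow> rat" where
  "on_words \<xi> ws = \<xi> (proj (single ws 1))"

lemma functional_W: "functional \<xi> \<Longrightarrow> W.linear_functional (\<lambda>q. \<xi> (proj q))" unfolding proj_def PP_quot
  by (drule V.functional_from_quot, unfold UU_quot, drule E.functional_from_quot)

lemma functional_on_words:
  "functional \<xi> \<Longrightarrow> q \<in> carrier W \<Longrightarrow> \<xi> (proj q) = lext (on_words \<xi>) q" unfolding on_words_def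
  by (rule linear_functional_lext[OF functional_W[unfolded W_free]]) (simp_all add: W_carrier)

lemma proj_env_ideal:
  assumes "functional \<xi>" "q \<in> env_ideal Q"
  shows "\<xi> (proj q) = 0"
proof -
  have q: "q \<in> carrier W" using assms(2) E.subspaceD(1) by blast
  have "env_class q = \<zero>\<^bsub>UU Q\<^esub>" using E.coset_eq_self[OF q] assms(2) by (simp add: UU_quot E.quot_simps)
  then have "proj q = \<zero>\<^bsub>PP Q\<^esub>" by (simp add: proj_def PP_quot V.quot_zero)
  then show ?thesis using rat_space.linear_functional_zero[OF PP_space assms(1)] by simp
qed

text \<open>The ideal is two-sided, so a relation may be placed between arbitrary words.\<close>

lemma on_words_env:
  assumes \<xi>: "functional \<xi>" and r: "r \<in> env_ideal Q"
    and UV: "us \<in> LL_words" "vs \<in> LL_words"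
  shows "lext (\<lambda>ws. on_words \<xi> (us @ ws @ vs)) r = 0"
proof -
  define q where "q = pmul (@) (single us 1) (pmul (@) r (single vs 1))"
  have "q \<in> env_ideal Q" using env_ideal_two_sided r single_W[OF UV(1)] single_W[OF UV(2)]
    by (simp add: W.two_sided_def q_def)
  then have "lext (on_words \<xi>) q = 0"
    using proj_env_ideal[OF \<xi>, of q] functional_on_words[OF \<xi>, of q] subsetD[OF E.subspaceD(1), of q] by simp
  then show ?thesis by (simp add: q_def lext_pmul)
qed

lemma env_rels_ideal: "r \<in> env_rels \<Longrightarrow> r \<in> env_ideal Q"
  unfolding env_ideal_gen using W.ideal_gen_superset by blast

lemma on_words_linear:
  assumes \<xi>: "functional \<xi>" and UV: "us \<in> LL_words" "vs \<in> LL_words"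
  shows "X \<in> carrier (LL Q) \<Longrightarrow> Y \<in> carrier (LL Q) \<Longrightarrow>
      on_words \<xi> (us @ [X \<oplus>\<^bsub>LL Q\<^esub> Y] @ vs) = on_words \<xi> (us @ [X] @ vs) + on_words \<xi> (us @ [Y] @ vs)"
    and "X \<in> carrier (LL Q) \<Longrightarrow> on_words \<xi> (us @ [c \<odot>\<^bsub>LL Q\<^esub> X] @ vs) = c * on_words \<xi> (us @ [X] @ vs)"
    and "X \<in> LL_comp Q \<alpha> \<Longrightarrow> Y \<in> LL_comp Q \<beta> \<Longrightarrow> on_words \<xi> (us @ [X \<otimes>\<^bsub>LL Q\<^esub> Y] @ vs)
      = on_words \<xi> (us @ [X, Y] @ vs) - braid_sign Q \<alpha> \<beta> * on_words \<xi> (us @ [Y, X] @ vs)"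
proof -
  note E = on_words_env[OF \<xi> env_rels_ideal UV]
  { assume "X \<in> carrier (LL Q)" "Y \<in> carrier (LL Q)"
    then have "single [X \<oplus>\<^bsub>LL Q\<^esub> Y] 1 - single [X] 1 - single [Y] 1 \<in> env_rels"
      unfolding env_rels_def by blast
    from E[OF this] show "on_words \<xi> (us @ [X \<oplus>\<^bsub>LL Q\<^esub> Y] @ vs) = on_words \<xi> (us @ [X] @ vs) + on_words \<xi> (us @ [Y] @ vs)"
      by (simp add: lext_diff) }
  { assume "X \<in> carrier (LL Q)"
    then have "single [c \<odot>\<^bsub>LL Q\<^esub> X] 1 - single [X] c \<in> env_rels" unfolding env_rels_def by blast
    from E[OF this] show "on_words \<xi> (us @ [c \<odot>\<^bsub>LL Q\<^esub> X] @ vs) = c * on_words \<xi> (us @ [X] @ vs)"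
      by (simp add: lext_diff) }
  { assume "X \<in> LL_comp Q \<alpha>" "Y \<in> LL_comp Q \<beta>"
    then have "single [X, Y] 1 - single [Y, X] (braid_sign Q \<alpha> \<beta>)
        - single [X \<otimes>\<^bsub>LL Q\<^esub> Y] 1 \<in> env_rels" unfolding env_rels_def by blast
    from E[OF this] show "on_words \<xi> (us @ [X \<otimes>\<^bsub>LL Q\<^esub> Y] @ vs)
        = on_words \<xi> (us @ [X, Y] @ vs) - braid_sign Q \<alpha> \<beta> * on_words \<xi> (us @ [Y, X] @ vs)"
      by (simp add: lext_diff) }
qed

lemma on_words_class:
  assumes \<xi>: "functional \<xi>" and UV: "us \<in> LL_words" "vs \<in> LL_words"
    and p: "p \<in> carrier F"
  shows "on_words \<xi> (us @ [lie_class p] @ vs) = lext (\<lambda>t. on_words \<xi> (us @ [lie_class (single t 1)] @ vs)) p"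
    (is "?\<psi> p = _")
proof (rule linear_functional_lext)
  have "lie_class x \<in> carrier (LL Q)" if "x \<in> carrier F" for x using that by (simp add: LL_carrier)
  then have "F.linear_functional ?\<psi>" unfolding F.linear_functional_def
    using on_words_linear(1,2)[OF \<xi> UV] by (simp flip: LL_add LL_smult)
  then show "rat_space.linear_functional (free_alg Br undefined {t. set_bracketing t \<subseteq> symbols Q}) ?\<psi>"
    by (simp add: F_free)
  show "keys p \<subseteq> {t. set_bracketing t \<subseteq> symbols Q}" using p by (auto simp: F_carrier)
qed

lemma on_words_lie_ideal:
  assumes \<xi>: "functional \<xi>" and UV: "us \<in> LL_words" "vs \<in> LL_words"
    and p: "p \<in> lie_ideal Q"
  shows "on_words \<xi> (us @ [lie_class p] @ vs) = 0"
proof -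
  have pF: "p \<in> carrier F" using p L.subspaceD(1) by blast
  have "lie_class p = lie_class 0" using L.coset_eq_self[OF pF] p L.coset_zero by simp
  then show ?thesis using on_words_class[OF \<xi> UV, of 0] F.zero_closed by simp
qed

text \<open>Words with letters outside the quiver get the value 0, because \<open>is_system\<close>
  ranges over all letters.\<close>

definition corr :: "('v pfva \<Rightarrow> rat) \<Rightarrow> 'v corr_fun" where
  "corr \<xi> gs = (if is_word gs then \<xi> (word_vec Q gs) else 0)"

lemma corr_on_words: "is_word gs \<Longrightarrow> corr \<xi> gs = on_words \<xi> (map (LL_gen Q) gs)"
  by (simp add: corr_def word_vec_proj on_words_def)

lemma LL_gen_mult:
  assumes "g \<in> symbols Q" "h \<in> symbols Q"
  shows "LL_gen Q g \<otimes>\<^bsub>LL Q\<^esub> LL_gen Q h = lie_class (single (Br (Gen g) (Gen h)) 1)"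
  unfolding LL_gen_class using assms by (subst LL_mult) (auto intro!: single_F)

text \<open>A word ending in a non-negative mode lies in the left ideal. A locality relation is an
  element of \<open>lie_ideal Q\<close>, hence vanishes between any two words, and the commutator
  relation of \<open>UU Q\<close> writes it out in modes.\<close>

theorem system_of_functional:
  assumes \<xi>: "functional \<xi>"
  shows "is_system (corr \<xi>)" unfolding is_system_iff
proof
  show "vacuum_corr (corr \<xi>)" unfolding vacuum_corr_def
  proof (intro allI impI)
    fix us i and n :: int assume n: "0 \<le> n"
    show "corr \<xi> (us @ [(i, n)]) = 0"
    proof (cases "set (us @ [(i, n)]) \<subseteq> symbols Q")
      case True
      define q where "q = single (map (LL_gen Q) us) (1::rat)"
      have q: "q \<in> carrier W" unfolding q_def using True by (intro single_W gens_lists) simp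
      have g: "single [LL_gen Q (i, n)] 1 \<in> carrier W" using True LL_gen_carrier by (intro single_W) auto
      have "env_class q \<otimes>\<^bsub>UU Q\<^esub> UU_gen Q (i, n) \<in> vac_gens"
        using q True n unfolding vac_gens_def UU_carrier symbols_def by auto
      then have "env_class q \<otimes>\<^bsub>UU Q\<^esub> UU_gen Q (i, n) \<in> vac_ideal Q"
        unfolding vac_ideal_span using U.lin_span_superset by blast
      moreover have "env_class q \<otimes>\<^bsub>UU Q\<^esub> UU_gen Q (i, n) = env_class (single (map (LL_gen Q) (us @ [(i, n)])) 1)"
        using q g by (simp add: UU_gen_class UU_mult) (simp add: q_def)
      ultimately have "env_class (single (map (LL_gen Q) (us @ [(i, n)])) 1) \<in> vac_ideal Q" by simp
      then have "proj (single (map (LL_gen Q) (us @ [(i, n)])) 1) = \<zero>\<^bsub>PP Q\<^esub>"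
        unfolding proj_def PP_quot V.quot_simps using V.coset_eq_self V.subspaceD(1) by blast
      then have "word_vec Q (us @ [(i, n)]) = \<zero>\<^bsub>PP Q\<^esub>" using word_vec_proj[OF True] by simp
      then show ?thesis using rat_space.linear_functional_zero[OF PP_space \<xi>] by (simp add: corr_def)
    qed (simp only: corr_def if_False)
  qed
  show "local_corr (corr \<xi>)" unfolding local_corr_def
  proof (intro allI)
    fix us vs i j m n
    show "(\<Sum>k\<le>NNplus Q i j. (-1) ^ k * of_nat (NNplus Q i j choose k) * (corr \<xi> (pair_word us i m j n vs k)
          - braid_sign Q (basis_vec i) (basis_vec j) * corr \<xi> (swap_word us i m j n vs k))) = 0"
      (is "?S = 0")
    proof (cases "is_word us \<and> is_word vs \<and> i \<in> verts Q \<and> j \<in> verts Q")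
      case True
      define U V where "U = map (LL_gen Q) us" and "V = map (LL_gen Q) vs"
      have UV: "U \<in> LL_words" "V \<in> LL_words"
        unfolding U_def V_def using gens_lists[of us] gens_lists[of vs] True by simp_all
      define t where "t k = Br (Gen (i, m - int k)) (Gen (j, n + int k))" for k
      define p where "p = (\<Sum>k\<le>NNplus Q i j. single (t k) ((-1) ^ k * of_nat (NNplus Q i j choose k) :: rat))"
      have "p \<in> locality_rels Q" unfolding p_def t_def locality_rels_def using True by blast
      then have pl: "p \<in> lie_ideal Q"
        unfolding lie_ideal_def F_def[symmetric] using F.ideal_gen_superset by blast
      have summand: "corr \<xi> (pair_word us i m j n vs k)
          - braid_sign Q (basis_vec i) (basis_vec j) * corr \<xi> (swap_word us i m j n vs k)
          = on_words \<xi> (U @ [lie_class (single (t k) 1)] @ V)" for k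
      proof -
        have sym: "(i, m - int k) \<in> symbols Q" "(j, n + int k) \<in> symbols Q"
          using True by (auto simp: symbols_def)
        show ?thesis unfolding t_def LL_gen_mult[OF sym, symmetric]
          using on_words_linear(3)[OF \<xi> UV LL_gen_comp[OF sym(1)] LL_gen_comp[OF sym(2)]] True sym
          by (simp add: corr_on_words U_def V_def)
      qed
      have "?S = on_words \<xi> (U @ [lie_class p] @ V)"
        unfolding summand using on_words_class[OF \<xi> UV, of p] pl L.subspaceD(1) by (auto simp: p_def lext_sum)
      then show ?thesis using on_words_lie_ideal[OF \<xi> UV pl] by simp
    next
      case False
      \<comment> \<open>A letter outside the quiver occurs in every word of the relation, so all
        terms are 0.\<close>
      have "\<not> set (pair_word us i m j n vs k) \<subseteq> symbols Q"
        "\<not> set (swap_word us i m j n vs k) \<subseteq> symbols Q" for k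
        using False unfolding symbols_def by simp_all blast+
      then have "corr \<xi> (pair_word us i m j n vs k) = 0"
        "corr \<xi> (swap_word us i m j n vs k) = 0" for k by (simp_all only: corr_def if_False)
      then show ?thesis by simp
    qed
  qed
qed

text \<open>A bracket unfolds into two products of smaller brackets. The factors are replaced by
  generators one after the other while the remaining one stands in the context, which is why the
  contexts are general.\<close>

lemma on_words_bracketing:
  assumes \<xi>: "functional \<xi>" and UV: "us \<in> LL_words" "vs \<in> LL_words"
    and t: "set_bracketing t \<subseteq> symbols Q"
    and gens: "\<And>gs. is_word gs \<Longrightarrow> on_words \<xi> (us @ map (LL_gen Q) gs @ vs) = 0"
  shows "on_words \<xi> (us @ [lie_class (single t 1)] @ vs) = 0" using UV t gens
proof (induction t arbitrary: us vs)
  case (Gen g)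
  then show ?case using Gen.prems(4)[of "[g]"] by (simp add: LL_gen_class)
next
  case (Br s t)
  have st: "set_bracketing s \<subseteq> symbols Q" "set_bracketing t \<subseteq> symbols Q" using Br.prems(3) by auto
  define X Y where "X = lie_class (single s 1)" and "Y = lie_class (single t 1)"
  have XY: "X \<in> LL_comp Q (ldeg s)" "Y \<in> LL_comp Q (ldeg t)"
    unfolding X_def Y_def LL_comp_def F_def[symmetric] using st by (auto intro!: imageI simp: comp_iff)
  then have c: "X \<in> carrier (LL Q)" "Y \<in> carrier (LL Q)" using LL_comp_carrier by blast+
  have eq: "lie_class (single (Br s t) 1) = X \<otimes>\<^bsub>LL Q\<^esub> Y"
    unfolding X_def Y_def using st by (subst LL_mult) (auto intro!: single_F)
  have one: "on_words \<xi> (us @ [X, Y] @ vs) = 0"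
  proof -
    have "on_words \<xi> (us @ [X] @ (Y # vs)) = 0" unfolding X_def
    proof (rule Br.IH(1))
      show "on_words \<xi> (us @ map (LL_gen Q) gs @ Y # vs) = 0" if gs: "is_word gs" for gs
      proof -
        have "on_words \<xi> ((us @ map (LL_gen Q) gs) @ [Y] @ vs) = 0" unfolding Y_def
        proof (rule Br.IH(2))
          show "us @ map (LL_gen Q) gs \<in> LL_words" using Br.prems(1) gens_lists[OF gs] by simp
          show "on_words \<xi> ((us @ map (LL_gen Q) gs) @ map (LL_gen Q) hs @ vs) = 0" if "is_word hs" for hs
            using Br.prems(4)[of "gs @ hs"] gs that by simp
        qed (use Br.prems st in auto)
        then show ?thesis by simp
      qed
    qed (use Br.prems st c in auto)
    then show ?thesis by simp
  qed
  have two: "on_words \<xi> (us @ [Y, X] @ vs) = 0"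
  proof -
    have "on_words \<xi> (us @ [Y] @ (X # vs)) = 0" unfolding Y_def
    proof (rule Br.IH(2))
      show "on_words \<xi> (us @ map (LL_gen Q) gs @ X # vs) = 0" if gs: "is_word gs" for gs
      proof -
        have "on_words \<xi> ((us @ map (LL_gen Q) gs) @ [X] @ vs) = 0" unfolding X_def
        proof (rule Br.IH(1))
          show "us @ map (LL_gen Q) gs \<in> LL_words" using Br.prems(1) gens_lists[OF gs] by simp
          show "on_words \<xi> ((us @ map (LL_gen Q) gs) @ map (LL_gen Q) hs @ vs) = 0" if "is_word hs" for hs
            using Br.prems(4)[of "gs @ hs"] gs that by simp
        qed (use Br.prems st in auto)
        then show ?thesis by simp
      qed
    qed (use Br.prems st c in auto)
    then show ?thesis by simp
  qed
  show ?case unfolding eq on_words_linear(3)[OF \<xi> Br.prems(1,2) XY] one two by simp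
qed

text \<open>The vectors \<open>word_vec Q gs\<close> span \<open>PP Q\<close>: letters of a word
  over \<open>LL Q\<close> are turned into generators from left to right, behind a prefix that
  already consists of generators.\<close>

theorem functional_zero:
  assumes \<xi>: "functional \<xi>" and zero: "\<And>gs. is_word gs \<Longrightarrow> \<xi> (word_vec Q gs) = 0"
    and x: "x \<in> carrier (PP Q)"
  shows "\<xi> x = 0"
proof -
  have "on_words \<xi> (map (LL_gen Q) gs @ ws) = 0" if "is_word gs" "ws \<in> LL_words" for ws gs using that
  proof (induction ws arbitrary: gs)
    case Nil
    then show ?case using zero[of gs] word_vec_proj[of gs] by (simp add: on_words_def)
  next
    case (Cons X ws)
    then have ws: "ws \<in> LL_words" and X: "X \<in> carrier (LL Q)" by auto
    obtain p where p: "p \<in> carrier F" "X = lie_class p" using X by (auto simp: LL_carrier)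
    have "on_words \<xi> (map (LL_gen Q) gs @ [lie_class (single t 1)] @ ws) = 0"
      if "t \<in> keys p" for t
    proof (rule on_words_bracketing[OF \<xi> gens_lists[OF Cons.prems(1)] ws])
      show "set_bracketing t \<subseteq> symbols Q" using p(1) that by (auto simp: F_carrier)
      show "on_words \<xi> (map (LL_gen Q) gs @ map (LL_gen Q) hs @ ws) = 0" if "is_word hs" for hs
        using Cons.IH[of "gs @ hs"] ws Cons.prems(1) that by simp
    qed
    then have "on_words \<xi> (map (LL_gen Q) gs @ [X] @ ws) = 0"
      unfolding p(2) on_words_class[OF \<xi> gens_lists[OF Cons.prems(1)] ws p(1)] by (simp add: lext_def)
    then show ?case by simp
  qed
  then have "on_words \<xi> ws = 0" if "ws \<in> LL_words" for ws
    using that by (metis append_Nil empty_set empty_subsetI list.map_disc_iff)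
  moreover obtain q where q: "q \<in> carrier W" "x = proj q" using x by (auto simp: PP_carrier)
  ultimately have "lext (on_words \<xi>) q = lext (\<lambda>_. 0) q" by (intro lext_cong) (auto simp: W_carrier)
  then show ?thesis using functional_on_words[OF \<xi> q(1)] by (simp add: q(2))
qed

text \<open>Evaluation at the empty word after the action on \<open>\<Phi>\<close> is linear on the
  free algebra. Locality lets it descend to \<open>UU Q\<close>, and the vacuum condition to
  \<open>PP Q\<close>.\<close>

theorem functional_of_system:
  assumes sys: "is_system \<Phi>"
  obtains \<xi> where "functional \<xi>" "\<And>x. x \<notin> carrier (PP Q) \<Longrightarrow> \<xi> x = 0"
    "\<And>gs. is_word gs \<Longrightarrow> \<xi> (word_vec Q gs) = \<Phi> gs"
proof -
  have loc: "local_corr \<Phi>" and vac: "vacuum_corr \<Phi>" using sys by (auto simp: is_system_iff)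
  define \<omega> where "\<omega> q = uact q \<Phi> []" for q
  have "W.linear_functional \<omega>" using linear_functional_of_lext[of "(@)" "[]" "LL_words" "\<lambda>ws. wact ws \<Phi> []"]
    by (simp add: W_free \<omega>_def[abs_def] uact_def[abs_def])
  moreover have "\<omega> q = 0" if "q \<in> env_ideal Q" for q
    using env_ideal_annihilator that loc by (auto simp: \<omega>_def env_annihilator_def)
  ultimately obtain \<eta> where \<eta>: "U.linear_functional \<eta>" "\<And>q. q \<in> carrier W \<Longrightarrow> \<eta> (env_class q) = \<omega> q"
    using E.functional_to_quot[of \<omega>] unfolding UU_quot by blast
  have "\<eta> x = 0" if "x \<in> vac_ideal Q" for x
  proof (rule U.linear_functional_span_zero[OF \<eta>(1) vac_gens_carrier])
    fix x assume "x \<in> vac_gens"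
    then obtain q i n where x: "x = env_class q \<otimes>\<^bsub>UU Q\<^esub> UU_gen Q (i, n)" "q \<in> carrier W" "i \<in> verts Q" "n \<ge> 0"
      by (auto simp: vac_gens_def UU_carrier)
    have sym: "(i, n) \<in> symbols Q" using x by (simp add: symbols_def)
    have g: "single [LL_gen Q (i, n)] 1 \<in> carrier W" using LL_gen_carrier[OF sym] by (intro single_W) simp
    have qg: "pmul (@) q (single [LL_gen Q (i, n)] 1) \<in> carrier W" using W.mult_closed[OF x(2) g] by simp
    have "\<eta> x = \<omega> (pmul (@) q (single [LL_gen Q (i, n)] 1))"
      unfolding x(1) UU_gen_class UU_mult[OF x(2) g] by (rule \<eta>(2)[OF qg])
    \<comment> \<open>The rightmost factor \<open>i(n)\<close> acts last, so evaluation at the empty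
      word becomes evaluation at a one-letter word, to which the vacuum condition applies.\<close>
    also have "\<dots> = lext (\<lambda>ws. lact (LL_gen Q (i, n)) (wact ws \<Phi>) []) q"
      by (simp add: \<omega>_def uact_def lext_pmul)
    also have "\<dots> = lext (\<lambda>ws. wact ws \<Phi> ([] @ [(i, n)])) q" unfolding LL_gen_class using sym
      by (simp add: lact_class local_corr_wact[OF loc] single_F pact_def)
    also have "\<dots> = 0" using vacuum_corr_wact[OF vac] x(4) by (simp only: vacuum_corr_def lext_fun_zero)
    finally show "\<eta> x = 0" .
  qed (use that vac_ideal_span in simp)
  then obtain \<xi> where \<xi>: "functional \<xi>" "\<And>u. u \<in> carrier (UU Q) \<Longrightarrow> \<xi> (vac_ideal Q +>\<^bsub>UU Q\<^esub> u) = \<eta> u"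
    "\<And>x. x \<notin> carrier (PP Q) \<Longrightarrow> \<xi> x = 0" using V.functional_to_quot[OF \<eta>(1)] unfolding PP_quot by blast
  \<comment> \<open>Each acting generator becomes a letter of the argument, in the original
    order.\<close>
  have w: "wact (map (LL_gen Q) gs) \<Psi> [] = \<Psi> gs" if "is_word gs" "local_corr \<Psi>" for gs \<Psi> using that
  proof (induction gs arbitrary: \<Psi>)
    case (Cons g gs)
    have "lact (LL_gen Q g) \<Psi> = (\<lambda>w. \<Psi> ([g] @ w))" unfolding LL_gen_class using Cons.prems
      by (simp add: lact_class single_F pact_def fun_eq_iff)
    then show ?case using Cons local_corr_prefix[OF Cons.prems(2), of "[g]"] by simp
  qed simp
  have "\<xi> (word_vec Q gs) = \<Phi> gs" if gs: "is_word gs" for gs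
  proof -
    have m: "single (map (LL_gen Q) gs) 1 \<in> carrier W" by (rule single_W[OF gens_lists[OF gs]])
    have "\<xi> (word_vec Q gs) = \<omega> (single (map (LL_gen Q) gs) 1)"
      unfolding word_vec_proj[OF gs] proj_def using \<xi>(2) \<eta>(2)[OF m] m by (simp add: UU_carrier)
    then show ?thesis using w[OF gs loc] by (simp add: \<omega>_def uact_def)
  qed
  then show ?thesis using that \<xi> by blast
qed

end

section \<open>Expansions of rational functions\<close>

lemma powi_minus_one: "(a :: 'f :: field) powi (- 1) = inverse a" by (simp add: power_int_def)

lemma lookup_times_sum:
  fixes p q :: "('x \<Rightarrow>\<^sub>0 nat) \<Rightarrow>\<^sub>0 rat"
  shows "lookup (p * q) \<rho> = (\<Sum>\<mu>\<in>keys p. \<Sum>\<kappa>\<in>keys q. (lookup p \<mu> * lookup q \<kappa> :: rat) when \<mu> + \<kappa> = \<rho>)"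
proof -
  have "p * q = (\<Sum>\<mu>\<in>keys p. single \<mu> (lookup p \<mu>)) *
      (\<Sum>\<kappa>\<in>keys q. single \<kappa> (lookup q \<kappa>))" using sum_singles[of p] sum_singles[of q] by simp
  also have "\<dots> = (\<Sum>\<mu>\<in>keys p. \<Sum>\<kappa>\<in>keys q.
      single (\<mu> + \<kappa>) (lookup p \<mu> * lookup q \<kappa>))" by (simp add: sum_product mult_single)
  finally show ?thesis by (simp add: lookup_sum lookup_single)
qed

lemma poly_in_times:
  assumes "poly_in X p" "poly_in X q"
  shows "poly_in X (p * q)" unfolding poly_in_def
proof
  fix \<rho> assume "\<rho> \<in> keys (p * q)"
  then obtain \<mu> \<kappa> where "\<mu> \<in> keys p" "\<kappa> \<in> keys q" "\<rho> = \<mu> + \<kappa>" using keys_mult[of p q] by blast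
  then show "keys \<rho> \<subseteq> X" using assms keys_add[of \<mu> \<kappa>] unfolding poly_in_def by blast
qed

text \<open>A monomial in two disjoint sets of variables splits uniquely, so only one pair of
  monomials contributes.\<close>

lemma pcoef_times_disjoint:
  assumes p: "poly_in A p" and q: "poly_in B q" and AB: "A \<inter> B = {}" "finite A" "finite B"
  shows "pcoef (A \<union> B) (p * q) m = pcoef A p m * pcoef B q m"
proof (cases "\<forall>x\<in>A \<union> B. 0 \<le> m x")
  case True
  have dec: "\<mu> + \<kappa> = monom_of (A \<union> B) m \<longleftrightarrow> \<mu> = monom_of A m \<and> \<kappa> = monom_of B m"
    if k: "keys \<mu> \<subseteq> A" "keys \<kappa> \<subseteq> B" for \<mu> \<kappa>
  proof
    assume eq: "\<mu> + \<kappa> = monom_of (A \<union> B) m"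
    have l: "lookup \<mu> x + lookup \<kappa> x = (if x \<in> A \<union> B then nat (m x) else 0)" for x
      using arg_cong[OF eq, of "\<lambda>r. lookup r x"] AB by (simp add: lookup_add lookup_monom_of)
    have dj: "x \<in> A \<Longrightarrow> x \<notin> B" "x \<in> B \<Longrightarrow> x \<notin> A" for x using AB(1) by blast+
    have z: "x \<notin> A \<Longrightarrow> lookup \<mu> x = 0" "x \<notin> B \<Longrightarrow> lookup \<kappa> x = 0" for x using k by (auto simp: in_keys_iff)
    show "\<mu> = monom_of A m \<and> \<kappa> = monom_of B m"
    proof (intro conjI poly_mapping_eqI)
      fix x
      show "lookup \<mu> x = lookup (monom_of A m) x"
        using l[of x] z[of x] dj[of x] AB(2,3) by (cases "x \<in> A") (auto simp: lookup_monom_of)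
      show "lookup \<kappa> x = lookup (monom_of B m) x"
        using l[of x] z[of x] dj[of x] AB(2,3) by (cases "x \<in> B") (auto simp: lookup_monom_of)
    qed
  next
    assume "\<mu> = monom_of A m \<and> \<kappa> = monom_of B m"
    then show "\<mu> + \<kappa> = monom_of (A \<union> B) m" using AB by (simp add: monom_of_def sum.union_disjoint)
  qed
  have "lookup (p * q) (monom_of (A \<union> B) m) = (\<Sum>\<mu>\<in>keys p. \<Sum>\<kappa>\<in>keys q.
        (if \<mu> = monom_of A m then lookup p \<mu> else 0) *
        (if \<kappa> = monom_of B m then lookup q \<kappa> else 0))" unfolding lookup_times_sum
  proof (intro sum.cong refl)
    fix \<mu> \<kappa> assume "\<mu> \<in> keys p" "\<kappa> \<in> keys q"
    then have "keys \<mu> \<subseteq> A" "keys \<kappa> \<subseteq> B" using p q by (auto simp: poly_in_def)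
    then show "(lookup p \<mu> * lookup q \<kappa> when \<mu> + \<kappa> = monom_of (A \<union> B) m)
      = (if \<mu> = monom_of A m then lookup p \<mu> else 0) *
        (if \<kappa> = monom_of B m then lookup q \<kappa> else 0)" by (simp add: dec when_def)
  qed
  also have "\<dots> = lookup p (monom_of A m) * lookup q (monom_of B m)"
    unfolding sum_product[symmetric] by (simp add: in_keys_iff)
  finally show ?thesis using True by (simp add: pcoef_def)
next
  case False
  then have "pcoef (A \<union> B) (p * q) m = 0" by (simp only: pcoef_def if_False)
  moreover have "pcoef A p m = 0 \<or> pcoef B q m = 0"
    using False pcoef_nonneg[of A p m] pcoef_nonneg[of B q m] by blast
  ultimately show ?thesis by auto
qed

lemma poly_in_var: "x \<in> X \<Longrightarrow> poly_in X (var x)" by (simp add: poly_in_def var_def)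

lemma pcoef_times_var:
  assumes "finite X" "x \<in> X" "poly_in X p"
  shows "pcoef X (p * var x) m = pcoef X p (m(x := m x - 1))"
proof (cases "\<forall>y\<in>X. 0 \<le> m y")
  case True
  show ?thesis
  proof (cases "m x = 0")
    case m0: True
    have "lookup (p * var x) (monom_of X m) = 0"
    proof -
      have "\<mu> + single x 1 \<noteq> monom_of X m" for \<mu>
      proof
        assume "\<mu> + single x 1 = monom_of X m"
        then have "lookup (\<mu> + single x 1) x = lookup (monom_of X m) x" by simp
        then show False using assms(1,2) m0 by (simp add: lookup_add lookup_monom_of)
      qed
      then show ?thesis by (simp add: lookup_times_sum var_def when_def)
    qed
    moreover have "pcoef X p (m(x := m x - 1)) = 0"
      using pcoef_nonneg[of X p "m(x := m x - 1)" x] assms(2) m0 by fastforce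
    ultimately show ?thesis by (simp add: pcoef_def)
  next
    case False
    then have mx: "1 \<le> m x" using True assms(2) by force
    have "\<mu> + single x 1 = monom_of X m \<longleftrightarrow> \<mu> = monom_of X (m(x := m x - 1))" for \<mu>
    proof -
      have "monom_of X m = monom_of X (m(x := m x - 1)) + single x 1" by (rule poly_mapping_eqI)
          (use assms(1,2) mx in \<open>auto simp: lookup_add lookup_monom_of lookup_single when_def\<close>)
      then show ?thesis by simp
    qed
    then have "lookup (p * var x) (monom_of X m)
        = (\<Sum>\<mu>\<in>keys p. if \<mu> = monom_of X (m(x := m x - 1)) then lookup p \<mu> else 0)"
      by (simp add: lookup_times_sum var_def when_def)
    also have "\<dots> = lookup p (monom_of X (m(x := m x - 1)))" by (simp add: in_keys_iff)
    finally show ?thesis using True mx by (simp add: pcoef_def)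
  qed
next
  case False
  then obtain y where y: "y \<in> X" "m y < 0" by force
  have "pcoef X (p * var x) m = 0" using pcoef_nonneg[of X "p * var x" m y] y by fastforce
  moreover have "pcoef X p (m(x := m x - 1)) = 0"
    using pcoef_nonneg[of X p "m(x := m x - 1)" y] y by (auto split: if_splits) (smt (verit))+
  ultimately show ?thesis by simp
qed

lemma diff_power_one:
  assumes "x \<noteq> y"
  shows "diff_power x y 1 f m = f (m(x := m x - 1)) - f (m(y := m y - 1))"
proof -
  have "m + shift_vec x y 1 0 = m(x := m x - 1)" "m + shift_vec x y 1 (Suc 0) = m(y := m y - 1)"
    using assms by (auto simp: fun_eq_iff shift_vec_def)
  then show ?thesis using diff_power_nat[of x y 1 f m] by simp
qed

lemma pcoef_times_diff:
  assumes "finite X" "x \<in> X" "y \<in> X" "x \<noteq> y" "poly_in X p"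
  shows "pcoef X (p * (var x - var y)) = diff_power x y 1 (pcoef X p)"
  unfolding right_diff_distrib pcoef_diff using assms by (simp add: fun_eq_iff diff_power_one pcoef_times_var)

lemma poly_in_uminus: "poly_in X p \<Longrightarrow> poly_in X (- p)" by (simp add: poly_in_def)

lemma poly_in_diff: "poly_in X p \<Longrightarrow> poly_in X q \<Longrightarrow> poly_in X (p - q)"
  using poly_in_add[OF _ poly_in_uminus, of X p q] by simp

lemma poly_in_var_diff: "x \<in> X \<Longrightarrow> y \<in> X \<Longrightarrow> poly_in X (var x - var y)" by (intro poly_in_diff poly_in_var)

lemma poly_in_one [simp]: "poly_in X 1" by (simp add: poly_in_def)

definition diffs :: "(('v \<times> nat) \<times> ('v \<times> nat)) list \<Rightarrow> 'v::linorder mpoly" where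
  "diffs L = prod_list (map (\<lambda>(x, y). var x - var y) L)"

lemma diffs_simps [simp]: "diffs [] = 1" "diffs ((x, y) # L) = (var x - var y) * diffs L"
  "diffs (L @ L') = diffs L * diffs L'" by (simp_all add: diffs_def)

abbreviation "ones \<equiv> (\<lambda>_ _. 1 :: int)"

lemma pcoef_times_diffs:
  assumes "finite X" "\<And>x y. (x, y) \<in> set L \<Longrightarrow> x \<in> X \<and> y \<in> X \<and> x \<noteq> y" "poly_in X p"
  shows "pcoef X (p * diffs L) = diff_pows ones L (pcoef X p) \<and> poly_in X (p * diffs L)" using assms(2)
proof (induction L)
  case (Cons xy L)
  obtain x y where xy: "xy = (x, y)" by (cases xy)
  have IH: "pcoef X (p * diffs L) = diff_pows ones L (pcoef X p)" "poly_in X (p * diffs L)"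
    using Cons by (meson list.set_intros(2))+
  have m: "x \<in> X" "y \<in> X" "x \<noteq> y" using Cons.prems[of x y] xy by auto
  have eq: "p * diffs (xy # L) = p * diffs L * (var x - var y)" by (simp add: xy mult_ac)
  show ?case
    unfolding eq using pcoef_times_diff[OF assms(1) m IH(2)] poly_in_times[OF IH(2) poly_in_var_diff[OF m(1,2)]]
    by (simp add: xy IH(1))
qed (simp add: assms(3))

lemma var_diff_nonzero: "x \<noteq> y \<Longrightarrow> var x - var y \<noteq> 0"
proof
  assume "x \<noteq> y" "var x - var y = 0"
  then have "lookup (var x) (single x 1) = lookup (var y) (single x 1)" by simp
  moreover have "single y (1::nat) \<noteq> single x 1"
    using \<open>x \<noteq> y\<close> by (metis keys_single singleton_inject zero_neq_one)
  ultimately show False by (simp add: var_def lookup_single when_def)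
qed

lemma diffs_nonzero: "(\<And>x y. (x, y) \<in> set L \<Longrightarrow> x \<noteq> y) \<Longrightarrow> diffs L \<noteq> 0"
proof (induction L)
  case (Cons xy L)
  obtain x y where xy: "xy = (x, y)" by (cases xy)
  have "x \<noteq> y" "diffs L \<noteq> 0" using Cons.prems[of x y] Cons by (auto simp: xy)
  then show ?case using var_diff_nonzero[of x y] by (simp add: xy)
qed simp

lemma Fract_one_mult: "Fract (a * b) 1 = Fract a 1 * Fract b 1"
  and Fract_one_add: "Fract (a + b) 1 = Fract a 1 + Fract b 1"
  and Fract_one_uminus: "Fract (- a) 1 = - Fract a 1" by simp_all

lemma Fract_one_inj: "Fract a 1 = Fract b 1 \<longleftrightarrow> a = (b :: 'a::idom)" by (simp add: eq_fract)

text \<open>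
  The function \<open>f\<close> is the expansion of the rational function \<open>q\<close> in the region given by the order
  \<open>xs\<close>; the denominators are products of differences of variables.
\<close>

definition represents ::
  "('v::linorder \<times> nat) list \<Rightarrow> 'v mpoly fract \<Rightarrow> ('v \<times> nat) distr \<Rightarrow> bool" where
  "represents xs q f \<longleftrightarrow> bdd_support (upsets xs) f \<and> (\<exists>L p. set L \<subseteq> set (pairs xs) \<and> poly_in (set xs) p \<and>
        q * Fract (diffs L) 1 = Fract p 1 \<and> diff_pows ones L f = pcoef (set xs) p)"

lemma pairs_facts:
  assumes "distinct xs" "set L \<subseteq> set (pairs xs)" "(x, y) \<in> set L"
  shows "x \<in> set xs \<and> y \<in> set xs \<and> x \<noteq> y" "precedes (upsets xs) x y"
  using assms in_pairs_set[of x y xs] pairs_neq[of xs x y] precedes_upsets[of xs x y] by blast+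

lemma bdd_support_poly: "bdd_support (upsets xs) (pcoef (set xs) p)"
proof (rule bdd_support_nonneg[of _ "set xs"])
  show "0 \<le> m x" if "pcoef (set xs) p m \<noteq> 0" "x \<in> set xs" for m x using that by (rule pcoef_nonneg)
qed (rule upsets_subset)

lemma represents_poly: "poly_in (set xs) p \<Longrightarrow> represents xs (Fract p 1) (pcoef (set xs) p)"
  unfolding represents_def by (intro conjI bdd_support_poly exI[of _ "[]"] exI[of _ p]) (auto simp: One_fract_def[symmetric])

text \<open>Both fractions are extended to the product of their denominators.\<close>

lemma represents_add:
  assumes dist: "distinct xs" and "represents xs q f" "represents xs r g"
  shows "represents xs (q + r) (\<lambda>m. f m + g m)"
proof -
  obtain L p where f: "bdd_support (upsets xs) f" "set L \<subseteq> set (pairs xs)" "poly_in (set xs) p"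
    "q * Fract (diffs L) 1 = Fract p 1" "diff_pows ones L f = pcoef (set xs) p"
    using assms(2) unfolding represents_def by blast
  obtain K s where g: "bdd_support (upsets xs) g" "set K \<subseteq> set (pairs xs)" "poly_in (set xs) s"
    "r * Fract (diffs K) 1 = Fract s 1" "diff_pows ones K g = pcoef (set xs) s"
    using assms(3) unfolding represents_def by blast
  have LK: "set (L @ K) \<subseteq> set (pairs xs)" using f(2) g(2) by simp
  note pLK = pairs_facts[OF dist LK] and pL = pairs_facts[OF dist f(2)] and pK = pairs_facts[OF dist g(2)]
  have "diff_pows ones (L @ K) f = diff_pows ones (K @ L) f"
    by (rule diff_pows_mset[OF _ f(1) pLK(2)]) (auto simp: union_commute)
  also have "\<dots> = pcoef (set xs) (p * diffs K)"
    using pcoef_times_diffs[OF finite_set pK(1) f(3)] by (simp add: diff_pows_append f(5))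
  finally have F: "diff_pows ones (L @ K) f = pcoef (set xs) (p * diffs K)" .
  have G: "diff_pows ones (L @ K) g = pcoef (set xs) (s * diffs L)"
    using pcoef_times_diffs[OF finite_set pL(1) g(3)] by (simp add: diff_pows_append g(5))
  have "diff_pows ones (L @ K) (\<lambda>m. f m + g m) = pcoef (set xs) (p * diffs K + s * diffs L)"
    by (subst diff_pows_add[OF f(1) g(1) pLK(2)]) (simp_all add: F G pcoef_add)
  moreover have "poly_in (set xs) (p * diffs K + s * diffs L)"
    using pcoef_times_diffs[OF finite_set pK(1) f(3)] pcoef_times_diffs[OF finite_set pL(1) g(3)]
    by (simp add: poly_in_add)
  moreover have "(q + r) * Fract (diffs (L @ K)) 1 = Fract (p * diffs K + s * diffs L) 1"
    unfolding Fract_one_add Fract_one_mult diffs_simps f(4)[symmetric] g(4)[symmetric]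
    by (simp only: algebra_simps)
  ultimately show ?thesis unfolding represents_def using bdd_support_add[OF f(1) g(1)] LK by blast
qed

lemma represents_zero: "represents xs 0 (\<lambda>m. 0)"
  using represents_poly[of xs 0] by (simp add: Zero_fract_def[symmetric])

lemma represents_sum:
  assumes "distinct xs" "\<And>i. i \<in> A \<Longrightarrow> represents xs (q i) (f i)"
  shows "represents xs (\<Sum>i\<in>A. q i) (\<lambda>m. \<Sum>i\<in>A. f i m)" using assms(2)
  by (induction A rule: infinite_finite_induct) (simp_all add: represents_zero represents_add[OF assms(1)])

lemma represents_uminus:
  assumes "represents xs q f"
  shows "represents xs (- q) (\<lambda>m. - f m)"
proof -
  obtain L p where f: "bdd_support (upsets xs) f" "set L \<subseteq> set (pairs xs)" "poly_in (set xs) p"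
    "q * Fract (diffs L) 1 = Fract p 1" "diff_pows ones L f = pcoef (set xs) p"
    using assms unfolding represents_def by blast
  have "pcoef (set xs) (- p) = (\<lambda>m. - pcoef (set xs) p m)" using pcoef_diff[of "set xs" 0 p] by simp
  then have "diff_pows ones L (\<lambda>m. - f m) = pcoef (set xs) (- p)"
    using diff_pows_scale[of ones L "-1" f] f(5) by simp
  moreover have "- q * Fract (diffs L) 1 = Fract (- p) 1"
    using f(4) by (simp only: Fract_one_uminus mult_minus_left)
  moreover have "bdd_support (upsets xs) (\<lambda>m. - f m)" using bdd_support_scale[OF f(1), of "-1"] by simp
  ultimately show ?thesis unfolding represents_def using f(2) poly_in_uminus[OF f(3)] by blast
qed

lemma represents_diff_one:
  assumes dist: "distinct xs" and xy: "(x, y) \<in> set (pairs xs)" and "represents xs q f"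
  shows "represents xs (Fract (var x - var y) 1 * q) (diff_power x y 1 f)"
proof -
  obtain L p where f: "bdd_support (upsets xs) f" "set L \<subseteq> set (pairs xs)" "poly_in (set xs) p"
    "q * Fract (diffs L) 1 = Fract p 1" "diff_pows ones L f = pcoef (set xs) p"
    using assms(3) unfolding represents_def by blast
  note pL = pairs_facts[OF dist f(2)]
  have p: "x \<in> set xs" "y \<in> set xs" "x \<noteq> y" and prec: "precedes (upsets xs) x y"
    using pairs_facts[OF dist subset_refl xy] by auto
  have "diff_pows ones L (diff_power x y 1 f) = diff_power x y 1 (pcoef (set xs) p)"
    using diff_power_diff_pows_commute[of "upsets xs" f L x y 1 ones] f(1,5) pL(2) prec by simp
  also have "\<dots> = pcoef (set xs) (p * (var x - var y))" using pcoef_times_diff[OF finite_set p f(3)] by simp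
  finally have "diff_pows ones L (diff_power x y 1 f) = pcoef (set xs) (p * (var x - var y))" .
  moreover have "Fract (var x - var y) 1 * q * Fract (diffs L) 1 = Fract (p * (var x - var y)) 1"
    unfolding Fract_one_mult f(4)[symmetric] by (simp only: mult_ac)
  moreover have "poly_in (set xs) (p * (var x - var y))" by (intro poly_in_times f(3) poly_in_var_diff p)
  ultimately show ?thesis unfolding represents_def using f(2) bdd_support_diff_power[OF f(1) prec] by blast
qed

text \<open>The difference joins the denominator, and multiplication by it undoes the expansion of
  its inverse.\<close>

lemma represents_diff_inverse:
  assumes dist: "distinct xs" and xy: "(x, y) \<in> set (pairs xs)" and "represents xs q f"
  shows "represents xs (inverse (Fract (var x - var y) 1) * q) (diff_power x y (-1) f)"
proof -
  obtain L p where f: "bdd_support (upsets xs) f" "set L \<subseteq> set (pairs xs)" "poly_in (set xs) p"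
    "q * Fract (diffs L) 1 = Fract p 1" "diff_pows ones L f = pcoef (set xs) p"
    using assms(3) unfolding represents_def by blast
  note pL = pairs_facts[OF dist f(2)]
  have p: "x \<in> set xs" "y \<in> set xs" "x \<noteq> y" and prec: "precedes (upsets xs) x y"
    using pairs_facts[OF dist subset_refl xy] by auto
  have b: "bdd_support (upsets xs) (diff_pows ones L f)" by (rule bdd_support_diff_pows[OF f(1) pL(2)])
  have "diff_pows ones ((x, y) # L) (diff_power x y (-1) f)
      = diff_power x y 1 (diff_power x y (-1) (diff_pows ones L f))"
    using diff_power_diff_pows_commute[of "upsets xs" f L x y "-1" ones] f(1) pL(2) prec by simp
  also have "\<dots> = pcoef (set xs) p" by (subst diff_power_diff_power[OF b prec]) (simp add: f(5))
  finally have 1: "diff_pows ones ((x, y) # L) (diff_power x y (-1) f) = pcoef (set xs) p" .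
  have "Fract (var x - var y) 1 \<noteq> 0"
    using var_diff_nonzero[OF p(3)] Fract_one_inj[of "var x - var y" 0] by (simp add: Zero_fract_def)
  then have "inverse (Fract (var x - var y) 1) * Fract (var x - var y) 1 = 1" by (rule left_inverse)
  moreover have "inverse (Fract (var x - var y) 1) * q * Fract (diffs ((x, y) # L)) 1
      = (inverse (Fract (var x - var y) 1) * Fract (var x - var y) 1) * (q * Fract (diffs L) 1)"
    unfolding diffs_simps Fract_one_mult by (simp only: mult_ac)
  ultimately have "inverse (Fract (var x - var y) 1) * q * Fract (diffs ((x, y) # L)) 1 = Fract p 1"
    by (simp only: f(4) mult_1)
  then show ?thesis unfolding represents_def using f(2,3) xy bdd_support_diff_power[OF f(1) prec] 1
    by (intro conjI exI[of _ "(x, y) # L"] exI[of _ p]) auto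
qed

text \<open>From -1 upwards an exponent is either a single inverse or a natural power, which is
  built from single factors.\<close>

lemma represents_diff_power:
  assumes dist: "distinct xs" and xy: "(x, y) \<in> set (pairs xs)" and f: "represents xs q f" and "-1 \<le> n"
  shows "represents xs (Fract (var x - var y) 1 powi n * q) (diff_power x y n f)"
proof (cases "n = -1")
  case True
  then show ?thesis using represents_diff_inverse[OF dist xy f] by (simp only: powi_minus_one)
next
  case False
  then have "0 \<le> n" using assms(4) by linarith
  then obtain k where n: "n = int k" by (metis zero_le_imp_eq_int)
  have prec: "precedes (upsets xs) x y" using pairs_facts[OF dist subset_refl xy] by auto
  have "represents xs (Fract (var x - var y) 1 ^ k * q) (diff_power x y (int k) f)"
  proof (induction k)
    case (Suc k)
    have "diff_power x y 1 (diff_power x y (int k) f) = diff_power x y (int (Suc k)) f"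
      using f by (subst diff_power_diff_power[OF _ prec]) (auto simp: represents_def)
    then show ?case using represents_diff_one[OF dist xy Suc.IH] by (simp only: power_Suc mult.assoc)
  qed (simp add: f)
  then show ?thesis by (simp add: n)
qed

text \<open>Clearing denominators gives an identity of polynomials, and the denominator, a product
  of differences of distinct variables, is nonzero. This will identify a shuffle sum with a
  polynomial.\<close>

lemma represents_unique:
  assumes dist: "distinct xs" and h: "poly_in (set xs) h" and rep: "represents xs q (pcoef (set xs) h)"
  shows "q = Fract h 1"
proof -
  obtain L p where f: "set L \<subseteq> set (pairs xs)" "poly_in (set xs) p"
    "q * Fract (diffs L) 1 = Fract p 1" "diff_pows ones L (pcoef (set xs) h) = pcoef (set xs) p"
    using rep unfolding represents_def by blast
  note pL = pairs_facts[OF dist f(1)]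
  have "pcoef (set xs) (h * diffs L) = pcoef (set xs) p" "poly_in (set xs) (h * diffs L)"
    using pcoef_times_diffs[OF finite_set pL(1) h] f(4) by auto
  then have "h * diffs L = p" using f(2) by (intro pcoef_inj[of "set xs"]) auto
  then have "q * Fract (diffs L) 1 = Fract h 1 * Fract (diffs L) 1"
    using f(3) by (simp only: Fract_one_mult[symmetric])
  moreover have "Fract (diffs L) 1 \<noteq> 0"
    using diffs_nonzero[of L] pL(1) Fract_one_inj[of "diffs L" 0] by (auto simp: Zero_fract_def)
  ultimately show ?thesis by (simp only: mult_cancel_right) simp
qed

section \<open>The shuffle product\<close>

lemma strict_mono_on_image_unique:
  fixes f g :: "nat \<Rightarrow> nat"
  assumes "strict_mono_on {a..b} f" "strict_mono_on {a..b} g" "f ` {a..b} = g ` {a..b}" "k \<in> {a..b}"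
  shows "f k = g k" using assms(4)
proof (induction k rule: less_induct)
  case (less k)
  have step: "\<not> p k < q k"
    if p: "strict_mono_on {a..b} p" and q: "strict_mono_on {a..b} q" and im: "p ` {a..b} = q ` {a..b}"
      and IH: "\<And>j. j < k \<Longrightarrow> j \<in> {a..b} \<Longrightarrow> p j = q j" for p q :: "nat \<Rightarrow> nat"
  proof
    assume lt: "p k < q k"
    have "p k \<in> q ` {a..b}" using im less.prems by blast
    then obtain j where j: "j \<in> {a..b}" "p k = q j" by blast
    have "j < k"
    proof (rule ccontr)
      assume "\<not> j < k"
      then have "q k \<le> q j" using strict_mono_onD[OF q less.prems j(1)] by (cases "j = k") auto
      then show False using lt j(2) by simp
    qed
    then have "p j < p k" using strict_mono_onD[OF p j(1) less.prems] by simp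
    then show False using IH[OF \<open>j < k\<close> j(1)] j(2) by simp
  qed
  show ?case using step[OF assms(1,2,3)] step[OF assms(2,1) assms(3)[symmetric]] less.IH
    by (metis linorder_less_linear)
qed

lemma exists_increasing_bij:
  fixes S :: "nat set"
  assumes "finite S"
  obtains h where "bij_betw h {1..card S} S" "strict_mono_on {1..card S} h"
proof -
  obtain g where g: "bij_betw g {..<card S} S" "strict_mono_on {..<card S} g"
    by (rule ex_bij_betw_strict_mono_card[OF assms])
  have "bij_betw (\<lambda>k. k - 1) {1..card S} {..<card S}" by (rule bij_betw_byWitness[of _ Suc]) auto
  then have "bij_betw (g \<circ> (\<lambda>k. k - 1)) {1..card S} S" using g(1) by (rule bij_betw_trans)
  moreover have "strict_mono_on {1..card S} (g \<circ> (\<lambda>k. k - 1))"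
  proof (rule strict_mono_onI)
    fix r s assume "r \<in> {1..card S}" "s \<in> {1..card S}" "r < s"
    then show "(g \<circ> (\<lambda>k. k - 1)) r < (g \<circ> (\<lambda>k. k - 1)) s"
      using strict_mono_onD[OF g(2), of "r - 1" "s - 1"] by simp
  qed
  ultimately show ?thesis by (rule that)
qed

section \<open>Shuffles as choices of the left variables\<close>

definition left_emb :: "'v shuffle \<Rightarrow> 'v \<times> nat \<Rightarrow> 'v \<times> nat" where
  "left_emb \<pi> = (\<lambda>(i, k). (i, \<pi> i k))"

definition right_emb :: "('v \<Rightarrow> nat) \<Rightarrow> 'v shuffle \<Rightarrow> 'v \<times> nat \<Rightarrow> 'v \<times> nat" where
  "right_emb d \<pi> = (\<lambda>(i, k). (i, \<pi> i (d i + k)))"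

definition left_vars :: "('v \<Rightarrow> nat) \<Rightarrow> 'v shuffle \<Rightarrow> ('v \<times> nat) set" where
  "left_vars d \<pi> = left_emb \<pi> ` vars d"

definition right_vars :: "('v \<Rightarrow> nat) \<Rightarrow> ('v \<Rightarrow> nat) \<Rightarrow> 'v shuffle \<Rightarrow> ('v \<times> nat) set" where
  "right_vars d e \<pi> = right_emb d \<pi> ` vars e"

lemma fst_emb [simp]: "fst (left_emb \<pi> x) = fst x" "fst (right_emb d \<pi> x) = fst x"
  by (auto simp: left_emb_def right_emb_def case_prod_unfold)

lemma shuffleD:
  assumes "\<pi> \<in> shuffles_of d e"
  shows "\<pi> i permutes {1..d i + e i}" "strict_mono_on {1..d i} (\<pi> i)"
    "strict_mono_on {d i + 1..d i + e i} (\<pi> i)" using assms unfolding shuffles_of_def by auto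

lemma inj_emb:
  assumes "\<And>i. inj (\<pi> i)"
  shows "inj (left_emb \<pi>)" "inj (right_emb d \<pi>)"
  using assms by (auto simp: left_emb_def right_emb_def intro!: injI dest: injD)
    (metis add_left_cancel injD)

lemma shuffle_inj: "\<pi> \<in> shuffles_of d e \<Longrightarrow> inj (\<pi> i)" by (rule permutes_inj[OF shuffleD(1)])

lemma left_vars_iff: "(i, l) \<in> left_vars d \<pi> \<longleftrightarrow> l \<in> \<pi> i ` {1..d i}"
  by (auto simp: left_vars_def left_emb_def vars_def image_iff)

lemma right_vars_iff: "(i, l) \<in> right_vars d e \<pi> \<longleftrightarrow> l \<in> \<pi> i ` {d i + 1..d i + e i}"
proof
  assume "(i, l) \<in> right_vars d e \<pi>"
  then show "l \<in> \<pi> i ` {d i + 1..d i + e i}" by (auto simp: right_vars_def right_emb_def vars_def)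
next
  assume "l \<in> \<pi> i ` {d i + 1..d i + e i}"
  then obtain k where k: "d i + 1 \<le> k" "k \<le> d i + e i" "l = \<pi> i k" by auto
  then have "(i, k - d i) \<in> vars e" "right_emb d \<pi> (i, k - d i) = (i, l)"
    by (auto simp: vars_def right_emb_def)
  then show "(i, l) \<in> right_vars d e \<pi>" unfolding right_vars_def by force
qed

lemma shuffle_partition:
  assumes "\<pi> \<in> shuffles_of d e"
  shows "left_vars d \<pi> \<union> right_vars d e \<pi> = vars (d + e)" "left_vars d \<pi> \<inter> right_vars d e \<pi> = {}"
proof -
  have un: "\<pi> i ` {1..d i} \<union> \<pi> i ` {d i + 1..d i + e i} = {1..d i + e i}" for i
  proof -
    have "{1..d i} \<union> {d i + 1..d i + e i} = {1..d i + e i}" by auto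
    then show ?thesis using permutes_image[OF shuffleD(1)[OF assms]] by (metis image_Un)
  qed
  have dis: "\<pi> i ` {1..d i} \<inter> \<pi> i ` {d i + 1..d i + e i} = {}" for i
    using shuffle_inj[OF assms, of i] by (auto simp: inj_eq)
  show "left_vars d \<pi> \<union> right_vars d e \<pi> = vars (d + e)"
  proof (rule Set.set_eqI)
    fix x :: "'a \<times> nat"
    obtain i l where x: "x = (i, l)" by (cases x)
    have "x \<in> left_vars d \<pi> \<union> right_vars d e \<pi> \<longleftrightarrow> l \<in> \<pi> i ` {1..d i} \<union> \<pi> i ` {d i + 1..d i + e i}"
      by (simp add: x left_vars_iff right_vars_iff)
    also have "\<dots> \<longleftrightarrow> x \<in> vars (d + e)" unfolding un by (simp add: x vars_def)
    finally show "x \<in> left_vars d \<pi> \<union> right_vars d e \<pi> \<longleftrightarrow> x \<in> vars (d + e)" .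
  qed
  show "left_vars d \<pi> \<inter> right_vars d e \<pi> = {}"
  proof (rule ccontr)
    assume "left_vars d \<pi> \<inter> right_vars d e \<pi> \<noteq> {}"
    then obtain i l where "(i, l) \<in> left_vars d \<pi>" "(i, l) \<in> right_vars d e \<pi>" by auto
    then show False using dis[of i] unfolding left_vars_iff right_vars_iff by blast
  qed
qed

text \<open>An increasing map is determined by its image, and the image of the right block is the
  complement of that of the left block.\<close>

lemma shuffle_unique:
  assumes \<pi>: "\<pi> \<in> shuffles_of d e" and \<rho>: "\<rho> \<in> shuffles_of d e" and eq: "left_vars d \<pi> = left_vars d \<rho>"
  shows "\<pi> = \<rho>"
proof (intro ext)
  fix i k
  have L: "\<pi> i ` {1..d i} = \<rho> i ` {1..d i}"
    using eq left_vars_iff[of i _ d \<pi>] left_vars_iff[of i _ d \<rho>] by blast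
  have "right_vars d e \<pi> = right_vars d e \<rho>" using shuffle_partition[OF \<pi>] shuffle_partition[OF \<rho>] eq by blast
  then have R: "\<pi> i ` {d i + 1..d i + e i} = \<rho> i ` {d i + 1..d i + e i}"
    using right_vars_iff[of i _ d e \<pi>] right_vars_iff[of i _ d e \<rho>] by blast
  consider "k \<in> {1..d i}" | "k \<in> {d i + 1..d i + e i}" | "k \<notin> {1..d i + e i}" by force
  then show "\<pi> i k = \<rho> i k"
  proof cases
    case 1 then show ?thesis by (rule strict_mono_on_image_unique[OF shuffleD(2)[OF \<pi>] shuffleD(2)[OF \<rho>] L])
  next
    case 2 then show ?thesis by (rule strict_mono_on_image_unique[OF shuffleD(3)[OF \<pi>] shuffleD(3)[OF \<rho>] R])
  next
    case 3 then show ?thesis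
      using permutes_not_in[OF shuffleD(1)[OF \<pi>] 3] permutes_not_in[OF shuffleD(1)[OF \<rho>] 3] by simp
  qed
qed

lemma shuffle_exists:
  assumes "\<And>i. S i \<subseteq> {1..d i + e i}" "\<And>i. card (S i) = d i"
  shows "\<exists>\<pi>\<in>shuffles_of d e. \<forall>i. \<pi> i ` {1..d i} = S i"
proof -
  have "\<exists>p. p permutes {1..d i + e i} \<and> strict_mono_on {1..d i} p \<and>
     strict_mono_on {d i + 1..d i + e i} p \<and> p ` {1..d i} = S i" for i
  proof -
    define T where "T = {1..d i + e i} - S i"
    have fin: "finite (S i)" "finite T" using finite_subset[OF assms(1)] by (auto simp: T_def)
    have cardT: "card T = e i" using assms fin by (simp add: T_def card_Diff_subset)
    obtain h where h: "bij_betw h {1..d i} (S i)" "strict_mono_on {1..d i} h"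
      using exists_increasing_bij[OF fin(1)] assms(2) by metis
    obtain g where g: "bij_betw g {1..e i} T" "strict_mono_on {1..e i} g"
      using exists_increasing_bij[OF fin(2)] cardT by metis
    define p where "p k = (if k \<in> {1..d i} then h k else if k \<in> {d i + 1..d i + e i} then g (k - d i) else k)" for k
    have "bij_betw (\<lambda>k. k - d i) {d i + 1..d i + e i} {1..e i}"
      by (rule bij_betw_byWitness[of _ "\<lambda>k. d i + k"]) auto
    then have "bij_betw (g \<circ> (\<lambda>k. k - d i)) {d i + 1..d i + e i} T" using g(1) by (rule bij_betw_trans)
    then have p2: "bij_betw p {d i + 1..d i + e i} T"
      by (rule bij_betw_cong[THEN iffD1, rotated]) (auto simp: p_def)
    have p1: "bij_betw p {1..d i} (S i)" by (rule bij_betw_cong[THEN iffD1, OF _ h(1)]) (auto simp: p_def)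
    have "bij_betw p ({1..d i} \<union> {d i + 1..d i + e i}) (S i \<union> T)"
      by (rule bij_betw_combine[OF p1 p2]) (auto simp: T_def)
    moreover have "{1..d i} \<union> {d i + 1..d i + e i} = {1..d i + e i}" by auto
    moreover have "S i \<union> T = {1..d i + e i}" using assms(1) by (auto simp: T_def)
    ultimately have "bij_betw p {1..d i + e i} {1..d i + e i}" by simp
    then have "p permutes {1..d i + e i}" by (rule bij_imp_permutes) (auto simp: p_def)
    moreover have "strict_mono_on {1..d i} p" using h(2) by (auto simp: strict_mono_on_def p_def)
    moreover have "strict_mono_on {d i + 1..d i + e i} p"
    proof (rule strict_mono_onI)
      fix r s assume "r \<in> {d i + 1..d i + e i}" "s \<in> {d i + 1..d i + e i}" "r < s"
      then show "p r < p s" using strict_mono_onD[OF g(2), of "r - d i" "s - d i"] by (simp add: p_def)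
    qed
    moreover have "p ` {1..d i} = S i" using p1 by (simp add: bij_betw_def)
    ultimately show ?thesis by blast
  qed
  then obtain p where "\<And>i. p i permutes {1..d i + e i} \<and> strict_mono_on {1..d i} (p i) \<and>
     strict_mono_on {d i + 1..d i + e i} (p i) \<and> p i ` {1..d i} = S i" by metis
  then show ?thesis by (intro bexI[of _ p]) (auto simp: shuffles_of_def)
qed

lemma finite_shuffles:
  assumes "finite {i. d i + e i \<noteq> 0}"
  shows "finite (shuffles_of d e)"
proof (rule finite_subset)
  define I where "I = {i. d i + e i \<noteq> 0}"
  show "shuffles_of d e \<subseteq> (\<lambda>f i. if i \<in> I then f i else id) ` (PiE I (\<lambda>i. {p. p permutes {1..d i + e i}}))"
  proof
    fix \<pi> assume \<pi>: "\<pi> \<in> shuffles_of d e"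
    have "\<pi> i = id" if "i \<notin> I" for i using shuffleD(1)[OF \<pi>, of i] that by (simp add: I_def)
    then have "\<pi> = (\<lambda>i. if i \<in> I then restrict \<pi> I i else id)" by (auto simp: fun_eq_iff)
    moreover have "restrict \<pi> I \<in> PiE I (\<lambda>i. {p. p permutes {1..d i + e i}})" using shuffleD(1)[OF \<pi>] by auto
    ultimately show "\<pi> \<in> (\<lambda>f i. if i \<in> I then f i else id) ` (PiE I (\<lambda>i. {p. p permutes {1..d i + e i}}))"
      by blast
  qed
  show "finite ((\<lambda>f i. if i \<in> I then f i else id) ` (PiE I (\<lambda>i. {p. p permutes {1..d i + e i}})))"
    using assms by (intro finite_imageI finite_PiE) (auto simp: I_def finite_permutations)
qed

text \<open>Every mixed pair occurs exactly once in \<open>pairs xs\<close>, in one of two orders,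
  and either order contributes the same factor.\<close>

lemma prod_list_pairs_split:
  fixes c :: "'x \<Rightarrow> 'x \<Rightarrow> 'f::comm_monoid_mult"
  assumes "distinct xs" "A \<inter> B = {}"
  shows "prod_list (map (\<lambda>(x, y). if x \<in> A \<and> y \<in> B then c x y else if x \<in> B \<and> y \<in> A then c y x else 1) (pairs xs))
    = (\<Prod>a\<in>A \<inter> set xs. \<Prod>b\<in>B \<inter> set xs. c a b)" using assms(1)
proof (induction xs)
  case (Cons x xs)
  have x: "x \<notin> set xs" and dist: "distinct xs" using Cons.prems by auto
  define w where "w = (\<lambda>(x, y). if x \<in> A \<and> y \<in> B then c x y else if x \<in> B \<and> y \<in> A then c y x else 1)"
  have "prod_list (map w (pairs (x # xs))) = (\<Prod>y\<in>set xs. w (x, y)) * (\<Prod>a\<in>A \<inter> set xs. \<Prod>b\<in>B \<inter> set xs. c a b)"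
    using Cons.IH[OF dist] prod.distinct_set_conv_list[OF dist, of "\<lambda>y. w (x, y)"]
    by (simp add: w_def[symmetric] comp_def)
  also have "\<dots> = (\<Prod>a\<in>A \<inter> set (x # xs). \<Prod>b\<in>B \<inter> set (x # xs). c a b)"
  proof -
    consider "x \<in> A" | "x \<in> B" | "x \<notin> A" "x \<notin> B" by blast
    then show ?thesis
    proof cases
      case 1
      then have xB: "x \<notin> B" using assms(2) by blast
      have "(\<Prod>y\<in>set xs. w (x, y)) = (\<Prod>y\<in>set xs. if y \<in> B then c x y else 1)"
        using 1 xB by (intro prod.cong refl) (simp add: w_def)
      also have "\<dots> = (\<Prod>b\<in>B \<inter> set xs. c x b)" by (simp add: prod.If_cases Int_commute)
      finally have "(\<Prod>y\<in>set xs. w (x, y)) = (\<Prod>b\<in>B \<inter> set xs. c x b)" .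
      moreover have "A \<inter> set (x # xs) = insert x (A \<inter> set xs)" "B \<inter> set (x # xs) = B \<inter> set xs"
        using 1 xB by auto
      ultimately show ?thesis using x by simp
    next
      case 2
      then have xA: "x \<notin> A" using assms(2) by blast
      have "(\<Prod>y\<in>set xs. w (x, y)) = (\<Prod>y\<in>set xs. if y \<in> A then c y x else 1)"
        using 2 xA by (intro prod.cong refl) (simp add: w_def)
      also have "\<dots> = (\<Prod>a\<in>A \<inter> set xs. c a x)" by (simp add: prod.If_cases Int_commute)
      finally have w: "(\<Prod>y\<in>set xs. w (x, y)) = (\<Prod>a\<in>A \<inter> set xs. c a x)" .
      have AB: "A \<inter> set (x # xs) = A \<inter> set xs" "B \<inter> set (x # xs) = insert x (B \<inter> set xs)" using 2 xA by auto
      show ?thesis unfolding w AB using x by (simp add: prod.distrib)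
    next
      case 3
      then have "(\<Prod>y\<in>set xs. w (x, y)) = 1" by (simp add: w_def)
      moreover have "A \<inter> set (x # xs) = A \<inter> set xs" "B \<inter> set (x # xs) = B \<inter> set xs" using 3 by auto
      ultimately show ?thesis by simp
    qed
  qed
  finally show ?case by (simp add: w_def)
qed simp

lemma uminus_powi: "(- u) powi n = (if even n then u powi n else - (u powi n) :: 'f::field)"
  by (simp add: power_int_minus_left)

lemma sgn_of_cases: "sgn_of n = (if even n then 1 else -1)" unfolding sgn_of_def by (simp add: uminus_powi)

locale lin_sym_quiver = sym_quiver Q for Q :: "('v::linorder, 'a) pre_digraph"
begin

text \<open>Two injections with the same image differ by a permutation of the variables that
  preserves colours, and \<open>f\<close> is symmetric under it.\<close>

lemma colour_preserving_symmetric: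
  fixes \<alpha> \<beta> :: "'v \<times> nat \<Rightarrow> 'v \<times> nat"
  assumes fin: "finite (vars d)" and f: "f \<in> Lam d" and inj: "inj_on \<alpha> (vars d)" "inj_on \<beta> (vars d)"
    and im: "\<alpha> ` vars d = \<beta> ` vars d" and col: "\<And>x. fst (\<alpha> x) = fst x" "\<And>x. fst (\<beta> x) = fst x"
  shows "pcoef (vars d) f (m \<circ> \<alpha>) = pcoef (vars d) f (m \<circ> \<beta>)"
proof -
  define \<rho> where "\<rho> x = (if x \<in> vars d then inv_into (vars d) \<beta> (\<alpha> x) else x)" for x
  have \<beta>\<rho>: "\<beta> (\<rho> x) = \<alpha> x" "\<rho> x \<in> vars d" if "x \<in> vars d" for x
  proof -
    have "\<alpha> x \<in> \<beta> ` vars d" using that im by blast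
    then show "\<beta> (\<rho> x) = \<alpha> x" "\<rho> x \<in> vars d" using that by (simp_all add: \<rho>_def f_inv_into_f inv_into_into)
  qed
  have "inj_on \<rho> (vars d)" using \<beta>\<rho> inj(1) by (metis inj_on_def)
  moreover have "\<rho> ` vars d \<subseteq> vars d" using \<beta>\<rho>(2) by blast
  ultimately have "bij_betw \<rho> (vars d) (vars d)" using fin by (metis bij_betw_def endo_inj_surj)
  then have "\<rho> permutes vars d" by (rule bij_imp_permutes) (simp add: \<rho>_def)
  moreover have "fst (\<rho> x) = fst x" for x
    using \<beta>\<rho>(1)[of x] col by (cases "x \<in> vars d") (metis, simp add: \<rho>_def)
  ultimately have "colour_sym (vars d) \<rho>" unfolding colour_sym_def by blast
  then have "pcoef (vars d) f ((m \<circ> \<beta>) \<circ> \<rho>) = pcoef (vars d) f (m \<circ> \<beta>)"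
    using f unfolding Lam_iff_pcoef[OF fin] by blast
  moreover have "pcoef (vars d) f ((m \<circ> \<beta>) \<circ> \<rho>) = pcoef (vars d) f (m \<circ> \<alpha>)"
    using depends_on_pcoef[of "vars d" f] \<beta>\<rho>(1) unfolding depends_on_def by simp
  ultimately show ?thesis by simp
qed

end

section \<open>Correlation functions of a shuffle product\<close>

locale shuffle_data = lin_sym_quiver Q for Q :: "('v::linorder, 'a) pre_digraph" +
  fixes d e :: "'v \<Rightarrow> nat" and f g :: "'v mpoly"
  assumes fin: "finite {i. d i \<noteq> 0}" "finite {i. e i \<noteq> 0}" and f: "f \<in> Lam d" and g: "g \<in> Lam e"
begin

abbreviation "X \<equiv> vars (d + e)"
abbreviation "LV \<equiv> left_vars d"
abbreviation "RV \<equiv> right_vars d e"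
abbreviation "Sh \<equiv> shuffles_of d e"

lemma finX: "finite X" "finite (vars d)" "finite (vars e)" "finite {i. d i + e i \<noteq> 0}"
proof -
  show 1: "finite {i. d i + e i \<noteq> 0}" by (rule finite_subset[OF _ finite_UnI[OF fin]]) auto
  then show "finite X" by (intro finite_vars) simp
  show "finite (vars d)" "finite (vars e)" using fin by (simp_all add: finite_vars)
qed

lemma finSh: "finite Sh" by (rule finite_shuffles[OF finX(4)])

definition prod_term :: "'v shuffle \<Rightarrow> ('v \<times> nat) distr" where
  "prod_term \<pi> m = pcoef (vars d) f (m \<circ> left_emb \<pi>) * pcoef (vars e) g (m \<circ> right_emb d \<pi>)"

text \<open>The kernel \<open>K\<close> carries the powers of differences of the mixed pairs. When
  the product is divided by the powers for all pairs, these cancel up to sign, and only pairs on one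
  side remain in the denominator.\<close>

definition unmixed :: "'v shuffle \<Rightarrow> 'v \<times> nat \<Rightarrow> 'v \<times> nat \<Rightarrow> int" where
  "unmixed \<pi> x y = (if (x \<in> LV \<pi>) = (y \<in> LV \<pi>) then nu x y else 0)"

abbreviation mixed_exp :: "'v shuffle \<Rightarrow> ('v \<times> nat) list \<Rightarrow> ('v \<times> nat) distr" where
  "mixed_exp \<pi> xs \<equiv> diff_pows (\<lambda>x y. - unmixed \<pi> x y) (pairs xs) (prod_term \<pi>)"

text \<open>\<open>K\<close> has the factors right minus left, the denominator has earlier minus
  later; they are opposite exactly when the left variable comes first.\<close>

definition mix_sign :: "'v shuffle \<Rightarrow> ('v \<times> nat) \<times> ('v \<times> nat) \<Rightarrow> rat" where
  "mix_sign \<pi> = (\<lambda>(x, y). if x \<in> LV \<pi> \<and> y \<notin> LV \<pi> then sgn_of (nu x y) else 1)"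

definition shuffle_sign :: "'v shuffle \<Rightarrow> ('v \<times> nat) list \<Rightarrow> rat" where
  "shuffle_sign \<pi> xs = prod_list (map (mix_sign \<pi>) (pairs xs))"

definition shuffle_fam :: "('v \<times> nat) list \<Rightarrow> ('v \<times> nat) distr" where
  "shuffle_fam xs m = (\<Sum>\<pi>\<in>Sh. shuffle_sign \<pi> xs * mixed_exp \<pi> xs m)"

lemma emb_inj: "\<pi> \<in> Sh \<Longrightarrow> inj (left_emb \<pi>)" "\<pi> \<in> Sh \<Longrightarrow> inj (right_emb d \<pi>)"
  using inj_emb[of \<pi>] shuffle_inj[of \<pi> d e] by auto

lemma prod_term_nonneg:
  assumes "\<pi> \<in> Sh" "prod_term \<pi> m \<noteq> 0" "x \<in> X"
  shows "0 \<le> m x"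
proof -
  have "x \<in> LV \<pi> \<or> x \<in> RV \<pi>" using shuffle_partition(1)[OF assms(1)] assms(3) by blast
  then show ?thesis
  proof
    assume "x \<in> LV \<pi>"
    then obtain y where "y \<in> vars d" "x = left_emb \<pi> y" by (auto simp: left_vars_def)
    then show ?thesis using assms(2) pcoef_nonneg[of "vars d" f "m \<circ> left_emb \<pi>" y] by (auto simp: prod_term_def)
  next
    assume "x \<in> RV \<pi>"
    then obtain y where "y \<in> vars e" "x = right_emb d \<pi> y" by (auto simp: right_vars_def)
    then show ?thesis using assms(2) pcoef_nonneg[of "vars e" g "m \<circ> right_emb d \<pi>" y] by (auto simp: prod_term_def)
  qed
qed

lemma prod_term_depends:
  assumes "\<pi> \<in> Sh" "\<And>x. x \<in> X \<Longrightarrow> m x = m' x"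
  shows "prod_term \<pi> m = prod_term \<pi> m'"
proof -
  have "left_emb \<pi> y \<in> X" if "y \<in> vars d" for y
    using shuffle_partition(1)[OF assms(1)] that by (auto simp: left_vars_def)
  moreover have "right_emb d \<pi> y \<in> X" if "y \<in> vars e" for y
    using shuffle_partition(1)[OF assms(1)] that by (auto simp: right_vars_def)
  ultimately have "pcoef (vars d) f (m \<circ> left_emb \<pi>) = pcoef (vars d) f (m' \<circ> left_emb \<pi>)"
    "pcoef (vars e) g (m \<circ> right_emb d \<pi>) = pcoef (vars e) g (m' \<circ> right_emb d \<pi>)"
    using assms(2) depends_on_pcoef[of "vars d" f] depends_on_pcoef[of "vars e" g]
    unfolding depends_on_def by simp_all
  then show ?thesis by (simp add: prod_term_def)
qed

lemma bounded_prod_term: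
  assumes "\<pi> \<in> Sh" "set xs = X"
  shows "bdd_support (upsets xs) (prod_term \<pi>)"
proof (rule bdd_support_nonneg[of _ X])
  show "0 \<le> m x" if "prod_term \<pi> m \<noteq> 0" "x \<in> X" for m x using prod_term_nonneg[OF assms(1) that] .
  show "U \<subseteq> X" if "U \<in> upsets xs" for U using upsets_subset[OF that] assms(2) by simp
qed

lemma ordering_precedes: "ordering Y xs \<Longrightarrow> (x, y) \<in> set (pairs xs) \<Longrightarrow> precedes (upsets xs) x y"
  unfolding ordering_def by (rule precedes_upsets) blast+

lemma unmixed_commute: "unmixed \<pi> x y = unmixed \<pi> y x" by (auto simp: unmixed_def nu_commute)

lemma shuffle_sign_swap:
  "shuffle_sign \<pi> (us @ x # y # vs) * mix_sign \<pi> (y, x) = shuffle_sign \<pi> (us @ y # x # vs) * mix_sign \<pi> (x, y)"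
proof -
  have P: "prod_list (map (mix_sign \<pi>) L) = prod_mset (image_mset (mix_sign \<pi>) (mset L))" for L
    by (induction L) auto
  have "shuffle_sign \<pi> (us @ x # y # vs) = mix_sign \<pi> (x, y) * prod_list (map (mix_sign \<pi>) (swap_rest us x y vs))"
    unfolding shuffle_sign_def P mset_pairs_swap_rest by simp
  moreover have "shuffle_sign \<pi> (us @ y # x # vs) = mix_sign \<pi> (y, x) * prod_list (map (mix_sign \<pi>) (swap_rest us x y vs))"
    unfolding shuffle_sign_def P mset_pairs_swap_rest' by simp
  ultimately have "shuffle_sign \<pi> (us @ x # y # vs) = mix_sign \<pi> (x, y) * prod_list (map (mix_sign \<pi>) (swap_rest us x y vs))"
    "shuffle_sign \<pi> (us @ y # x # vs) = mix_sign \<pi> (y, x) * prod_list (map (mix_sign \<pi>) (swap_rest us x y vs))"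
    by blast+
  then show ?thesis by simp
qed

text \<open>Composition with \<open>\<tau>\<close> could destroy monotonicity. So
  \<open>\<tau>\<close> acts on shuffles through their sets of left variables, which determine
  them.\<close>

lemma shuffle_reindex:
  assumes \<tau>: "colour_sym X \<tau>"
  obtains \<phi> where "bij_betw \<phi> Sh Sh" "\<And>\<pi>. \<pi> \<in> Sh \<Longrightarrow> LV (\<phi> \<pi>) = \<tau> ` LV \<pi>"
proof -
  have inj\<tau>: "inj \<tau>" by (rule colour_sym_inj[OF \<tau>])
  have ex: "\<exists>\<rho>\<in>Sh. LV \<rho> = \<tau> ` LV \<pi>" if \<pi>: "\<pi> \<in> Sh" for \<pi>
  proof -
    define S where "S i = {l. (i, l) \<in> \<tau> ` LV \<pi>}" for i
    have "\<tau> ` LV \<pi> \<subseteq> X" using colour_sym_image[OF \<tau>] shuffle_partition(1)[OF \<pi>] by blast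
    then have sub: "S i \<subseteq> {1..d i + e i}" for i by (auto simp: S_def vars_def)
    have "card (S i) = d i" for i
    proof -
      have "Pair i ` S i = (\<tau> \<circ> left_emb \<pi>) ` Pair i ` {1..d i}"
      proof (intro equalityI subsetI)
        fix y assume "y \<in> Pair i ` S i"
        then obtain l where l: "y = (i, l)" "(i, l) \<in> \<tau> ` LV \<pi>" unfolding S_def by blast
        have y: "fst y = i" "y \<in> \<tau> ` LV \<pi>" using l by (simp, blast)
        from y(2) obtain x where x: "x \<in> vars d" "y = \<tau> (left_emb \<pi> x)" unfolding left_vars_def by blast
        then have "fst x = i" using y(1) colour_sym_fst[OF \<tau>] by simp
        then show "y \<in> (\<tau> \<circ> left_emb \<pi>) ` Pair i ` {1..d i}" using x by (auto simp: vars_def image_iff)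
      next
        fix y assume "y \<in> (\<tau> \<circ> left_emb \<pi>) ` Pair i ` {1..d i}"
        then obtain k where k: "k \<in> {1..d i}" "y = \<tau> (left_emb \<pi> (i, k))" by auto
        then have "fst y = i" using colour_sym_fst[OF \<tau>] by simp
        moreover have "y \<in> \<tau> ` LV \<pi>" using k by (auto simp: left_vars_def vars_def)
        ultimately show "y \<in> Pair i ` S i" by (cases y) (auto simp: S_def)
      qed
      moreover have "inj_on (\<tau> \<circ> left_emb \<pi>) (Pair i ` {1..d i})"
        using inj_compose[OF inj\<tau> emb_inj(1)[OF \<pi>]] by (rule inj_on_subset) simp
      ultimately have "card (Pair i ` S i) = card (Pair i ` {1..d i})" by (simp only: card_image)
      then show ?thesis by (simp add: card_image inj_on_def)
    qed
    then obtain \<rho> where \<rho>: "\<rho> \<in> Sh" "\<And>i. \<rho> i ` {1..d i} = S i" using shuffle_exists[of S d e] sub by blast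
    have "LV \<rho> = \<tau> ` LV \<pi>"
    proof (rule Set.set_eqI)
      fix x :: "'v \<times> nat"
      obtain i l where "x = (i, l)" by (cases x)
      then show "x \<in> LV \<rho> \<longleftrightarrow> x \<in> \<tau> ` LV \<pi>" using left_vars_iff[of i l d \<rho>] \<rho>(2)[of i] by (simp add: S_def)
    qed
    then show ?thesis using \<rho>(1) by blast
  qed
  then obtain \<phi> where \<phi>: "\<And>\<pi>. \<pi> \<in> Sh \<Longrightarrow> \<phi> \<pi> \<in> Sh \<and> LV (\<phi> \<pi>) = \<tau> ` LV \<pi>" by metis
  have "inj_on \<phi> Sh"
  proof (rule inj_onI)
    fix \<pi> \<rho> assume *: "\<pi> \<in> Sh" "\<rho> \<in> Sh" "\<phi> \<pi> = \<phi> \<rho>"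
    then have "\<tau> ` LV \<pi> = \<tau> ` LV \<rho>" using \<phi> by metis
    then have "LV \<pi> = LV \<rho>" using inj_image_eq_iff[OF inj\<tau>] by blast
    then show "\<pi> = \<rho>" using shuffle_unique * by blast
  qed
  moreover have "\<phi> ` Sh \<subseteq> Sh" using \<phi> by blast
  ultimately have "bij_betw \<phi> Sh Sh" using finSh by (metis bij_betw_def endo_inj_surj)
  then show ?thesis using that \<phi> by blast
qed

text \<open>Both shuffles occupy the same variables after renaming, possibly in a different order;
  the symmetry of \<open>f\<close> and \<open>g\<close> absorbs the difference.\<close>

lemma prod_term_reindex:
  assumes \<tau>: "colour_sym X \<tau>" and \<pi>: "\<pi> \<in> Sh" and \<rho>: "\<rho> \<in> Sh" and LV: "LV \<rho> = \<tau> ` LV \<pi>"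
  shows "prod_term \<rho> m = prod_term \<pi> (m \<circ> \<tau>)"
proof -
  have inj\<tau>: "inj \<tau>" by (rule colour_sym_inj[OF \<tau>])
  have RV: "RV \<rho> = \<tau> ` RV \<pi>"
  proof -
    have "RV \<rho> = X - LV \<rho>" "RV \<pi> = X - LV \<pi>" using shuffle_partition[OF \<rho>] shuffle_partition[OF \<pi>] by blast+
    then show ?thesis using colour_sym_image[OF \<tau>] image_set_diff[OF inj\<tau>, of X "LV \<pi>"] LV by simp
  qed
  have "pcoef (vars d) f (m \<circ> left_emb \<rho>) = pcoef (vars d) f (m \<circ> (\<tau> \<circ> left_emb \<pi>))"
    by (rule colour_preserving_symmetric[OF finX(2) f])
      (use LV emb_inj[OF \<rho>] inj_compose[OF inj\<tau> emb_inj(1)[OF \<pi>]] colour_sym_fst[OF \<tau>] in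
        \<open>auto simp: left_vars_def image_comp intro: inj_on_subset\<close>)
  moreover have "pcoef (vars e) g (m \<circ> right_emb d \<rho>) = pcoef (vars e) g (m \<circ> (\<tau> \<circ> right_emb d \<pi>))"
    by (rule colour_preserving_symmetric[OF finX(3) g])
      (use RV emb_inj[OF \<rho>] inj_compose[OF inj\<tau> emb_inj(2)[OF \<pi>]] colour_sym_fst[OF \<tau>] in
        \<open>auto simp: right_vars_def image_comp intro: inj_on_subset\<close>)
  ultimately show ?thesis by (simp add: prod_term_def o_assoc)
qed

lemma shuffle_fam_family: "family X shuffle_fam" unfolding family_def
proof (intro conjI allI impI)
  fix xs assume ord: "ordering X xs"
  then have dist: "distinct xs" and set: "set xs = X" by (auto simp: ordering_def)
  have b: "bdd_support (upsets xs) (mixed_exp \<pi> xs)"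
    if "\<pi> \<in> Sh" for \<pi>
    by (rule bdd_support_diff_pows[OF bounded_prod_term[OF that set] ordering_precedes[OF ord]])
  show "bdd_support (upsets xs) (shuffle_fam xs)"
    unfolding shuffle_fam_def by (intro bdd_support_sum bdd_support_scale b)
  show "depends_on X (shuffle_fam xs)" unfolding depends_on_def shuffle_fam_def
  proof (intro allI impI sum.cong refl arg_cong2[where f = "(*)"])
    fix m m' :: "'v \<times> nat \<Rightarrow> int" and \<pi> assume "\<forall>x\<in>X. m x = m' x" "\<pi> \<in> Sh"
    then show "mixed_exp \<pi> xs m = mixed_exp \<pi> xs m'" by (intro diff_pows_cong_on[of X] prod_term_depends) auto
  qed
  show "0 \<le> m (last xs)" if ne: "xs \<noteq> []" and nzf: "shuffle_fam xs m \<noteq> 0" for m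
  proof -
    obtain \<pi> where \<pi>: "\<pi> \<in> Sh" and nz: "mixed_exp \<pi> xs m \<noteq> 0" using nzf unfolding shuffle_fam_def
      by (metis (no_types, lifting) mult_zero_right sum.not_neutral_contains_not_neutral)
    have "last xs \<in> X" using ne set last_in_set by metis
    then show ?thesis by (intro diff_pows_lower[OF _ _ nz])
        (use prod_term_nonneg[OF \<pi>] pairs_not_last[OF dist] in blast)+
  qed
  fix \<tau> m assume \<tau>: "colour_sym X \<tau>"
  obtain \<phi> where \<phi>: "bij_betw \<phi> Sh Sh" "\<And>\<pi>. \<pi> \<in> Sh \<Longrightarrow> LV (\<phi> \<pi>) = \<tau> ` LV \<pi>" using shuffle_reindex[OF \<tau>] by blast
  have inj\<tau>: "inj \<tau>" by (rule colour_sym_inj[OF \<tau>])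
  have "shuffle_fam (map \<tau> xs) m = (\<Sum>\<pi>\<in>Sh. shuffle_sign (\<phi> \<pi>) (map \<tau> xs) * mixed_exp (\<phi> \<pi>) (map \<tau> xs) m)"
    unfolding shuffle_fam_def by (rule sum.reindex_bij_betw[OF \<phi>(1), symmetric])
  also have "\<dots> = shuffle_fam xs (m \<circ> \<tau>)" unfolding shuffle_fam_def
  proof (rule sum.cong[OF refl])
    fix \<pi> assume \<pi>: "\<pi> \<in> Sh"
    have \<phi>\<pi>: "\<phi> \<pi> \<in> Sh" using \<phi>(1) \<pi> by (auto simp: bij_betw_def)
    have mem: "\<tau> x \<in> LV (\<phi> \<pi>) \<longleftrightarrow> x \<in> LV \<pi>" for x unfolding \<phi>(2)[OF \<pi>] by (simp add: inj_image_mem_iff[OF inj\<tau>])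
    have "shuffle_sign (\<phi> \<pi>) (map \<tau> xs) = shuffle_sign \<pi> xs" unfolding shuffle_sign_def pairs_map map_map
      by (intro arg_cong[where f = prod_list] map_cong refl)
        (auto simp: mix_sign_def mem nu_colour_sym[OF \<tau>])
    moreover have "mixed_exp (\<phi> \<pi>) (map \<tau> xs) m = mixed_exp \<pi> xs (m \<circ> \<tau>)"
    proof -
      have "prod_term (\<phi> \<pi>) = (\<lambda>m. prod_term \<pi> (m \<circ> \<tau>))"
        using prod_term_reindex[OF \<tau> \<pi> \<phi>\<pi> \<phi>(2)[OF \<pi>]] by (rule ext)
      moreover have "diff_pows (\<lambda>x y. - unmixed (\<phi> \<pi>) x y) (map (map_prod \<tau> \<tau>) (pairs xs)) (\<lambda>m. prod_term \<pi> (m \<circ> \<tau>))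
        = (\<lambda>m. mixed_exp \<pi> xs (m \<circ> \<tau>))" by (rule diff_pows_rename[OF inj\<tau>])
          (simp add: unmixed_def mem nu_colour_sym[OF \<tau>])
      ultimately show ?thesis by (simp add: pairs_map)
    qed
    ultimately show "shuffle_sign (\<phi> \<pi>) (map \<tau> xs) * mixed_exp (\<phi> \<pi>) (map \<tau> xs) m
      = shuffle_sign \<pi> xs * mixed_exp \<pi> xs (m \<circ> \<tau>)" by simp
  qed
  finally show "shuffle_fam (map \<tau> xs) m = shuffle_fam xs (m \<circ> \<tau>)" .
next
  fix us x y vs m assume ord: "ordering X (us @ x # y # vs)"
  define xs ys where "xs = us @ x # y # vs" and "ys = us @ y # x # vs"
  have ordx: "ordering X xs" using ord by (simp add: xs_def)
  have ordy: "ordering X ys" using ordering_swap[OF ord] by (simp add: ys_def)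
  have set: "set xs = X" "set ys = X" using ordx ordy by (auto simp: ordering_def)
  define T where "T zs \<pi> = mixed_exp \<pi> zs" for zs \<pi>
  have pxy: "(x, y) \<in> set (pairs xs)"
    using mset_eq_setD[OF mset_pairs_swap_rest[of us x y vs]] by (simp add: xs_def)
  define n where "n = nat (max (nu x y) 0)"
  have n: "max (nu x y) 0 = int n" by (simp add: n_def)
  have sumP: "diff_power x y (int n) (shuffle_fam zs) m = (\<Sum>\<pi>\<in>Sh. shuffle_sign \<pi> zs * diff_power x y (int n) (T zs \<pi>) m)" for zs
  proof -
    have "diff_power x y (int n) (shuffle_fam zs) m = (\<Sum>r\<le>n. \<Sum>\<pi>\<in>Sh. shuffle_sign \<pi> zs *
        ((-1) ^ r * of_nat (n choose r) * T zs \<pi> (m + shift_vec x y (int n) r)))"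
      unfolding diff_power_nat shuffle_fam_def T_def sum_distrib_left by (simp only: mult_ac)
    also have "\<dots> = (\<Sum>\<pi>\<in>Sh. shuffle_sign \<pi> zs * diff_power x y (int n) (T zs \<pi>) m)"
      unfolding diff_power_nat sum_distrib_left by (rule sum.swap)
    finally show ?thesis .
  qed
  have "diff_power x y (int n) (shuffle_fam xs) m = sgn_of (nu x y) * diff_power x y (int n) (shuffle_fam ys) m"
    unfolding sumP sum_distrib_left
  proof (rule sum.cong[OF refl])
    fix \<pi> assume \<pi>: "\<pi> \<in> Sh"
    have sw: "diff_power x y (max (unmixed \<pi> x y) 0) (T xs \<pi>)
        = (\<lambda>m. sgn_of (unmixed \<pi> x y) * diff_power x y (max (unmixed \<pi> x y) 0) (T ys \<pi>) m)"
      unfolding T_def xs_def ys_def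
    proof (rule diff_pows_swap[OF _ ord unmixed_commute])
      show "0 \<le> m z" if "prod_term \<pi> m \<noteq> 0" "z \<in> X" for m z using prod_term_nonneg[OF \<pi> that] .
      show "- 1 \<le> unmixed \<pi> x y" using N_lower[of "fst x" "fst y"] by (simp add: unmixed_def nu_def)
    qed
    show "shuffle_sign \<pi> xs * diff_power x y (int n) (T xs \<pi>) m
        = sgn_of (nu x y) * (shuffle_sign \<pi> ys * diff_power x y (int n) (T ys \<pi>) m)"
    \<comment> \<open>A pair on one side behaves as in any expansion. A mixed pair is absent from
      the denominator, so the expansion does not notice the swap and the sign of locality comes from
      \<open>shuffle_sign\<close>.\<close>
    proof (cases "(x \<in> LV \<pi>) = (y \<in> LV \<pi>)")
      case True
      then have "shuffle_sign \<pi> xs = shuffle_sign \<pi> ys"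
        using shuffle_sign_swap[of \<pi> us x y vs] by (auto simp: mix_sign_def xs_def ys_def)
      then show ?thesis using sw True by (simp add: unmixed_def n fun_eq_iff)
    next
      case False
      then have "T xs \<pi> = T ys \<pi>" using sw by (simp add: unmixed_def sgn_of_def)
      moreover have "shuffle_sign \<pi> xs = sgn_of (nu x y) * shuffle_sign \<pi> ys"
      proof (cases "x \<in> LV \<pi>")
        case True
        then show ?thesis using False shuffle_sign_swap[of \<pi> us x y vs]
          by (simp add: mix_sign_def xs_def ys_def)
      next
        case x: False
        then have "shuffle_sign \<pi> xs * sgn_of (nu x y) = shuffle_sign \<pi> ys"
          using False shuffle_sign_swap[of \<pi> us x y vs] nu_commute[of y x]
          by (simp add: mix_sign_def xs_def ys_def)
        then have "sgn_of (nu x y) * shuffle_sign \<pi> ys = shuffle_sign \<pi> xs * (sgn_of (nu x y) * sgn_of (nu x y))"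
          by (metis mult.assoc mult.commute)
        then show ?thesis by simp
      qed
      ultimately show ?thesis by simp
    qed
  qed
  then show "diff_power x y (max (nu x y) 0) (shuffle_fam (us @ x # y # vs)) m
      = sgn_of (nu x y) * diff_power x y (max (nu x y) 0) (shuffle_fam (us @ y # x # vs)) m"
    by (simp add: n xs_def ys_def)
qed

end

lemma length_pairs: "length (pairs xs) \<le> length xs * length xs" by (induction xs) auto

context shuffle_data
begin

lemma prod_term_degree:
  obtains B where "\<And>\<pi> m. \<pi> \<in> Sh \<Longrightarrow> prod_term \<pi> m \<noteq> 0 \<Longrightarrow> sum m X \<le> B"
proof -
  obtain B1 where B1: "\<And>m. pcoef (vars d) f m \<noteq> 0 \<Longrightarrow> sum m (vars d) \<le> B1"
    using pcoef_degree_bound[OF finX(2)] f Lam_iff by metis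
  obtain B2 where B2: "\<And>m. pcoef (vars e) g m \<noteq> 0 \<Longrightarrow> sum m (vars e) \<le> B2"
    using pcoef_degree_bound[OF finX(3)] g Lam_iff by metis
  have "sum m X \<le> B1 + B2" if \<pi>: "\<pi> \<in> Sh" and nz: "prod_term \<pi> m \<noteq> 0" for \<pi> m
  proof -
    have fin: "finite (LV \<pi>)" "finite (RV \<pi>)" using finX by (simp_all add: left_vars_def right_vars_def)
    have "sum m X = sum m (LV \<pi>) + sum m (RV \<pi>)"
      using sum.union_disjoint[OF fin shuffle_partition(2)[OF \<pi>]] shuffle_partition(1)[OF \<pi>] by simp
    also have "sum m (LV \<pi>) = sum (m \<circ> left_emb \<pi>) (vars d)"
      unfolding left_vars_def by (rule sum.reindex) (use emb_inj[OF \<pi>] in \<open>auto intro: inj_on_subset\<close>)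
    also have "sum m (RV \<pi>) = sum (m \<circ> right_emb d \<pi>) (vars e)"
      unfolding right_vars_def by (rule sum.reindex) (use emb_inj[OF \<pi>] in \<open>auto intro: inj_on_subset\<close>)
    finally show ?thesis using B1[of "m \<circ> left_emb \<pi>"] B2[of "m \<circ> right_emb d \<pi>"] nz
      unfolding prod_term_def mult_eq_0_iff de_Morgan_disj by linarith
  qed
  then show ?thesis using that by blast
qed

lemma shuffle_fam_degree:
  obtains B where "\<And>xs m. ordering X xs \<Longrightarrow> shuffle_fam xs m \<noteq> 0 \<Longrightarrow> sum m X \<le> B"
proof -
  obtain B where B: "\<And>\<pi> m. \<pi> \<in> Sh \<Longrightarrow> prod_term \<pi> m \<noteq> 0 \<Longrightarrow> sum m X \<le> B" using prod_term_degree by blast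
  have "sum m X \<le> B + int (card X * card X)"
    if ord: "ordering X xs" and nz: "shuffle_fam xs m \<noteq> 0" for xs m
  proof -
    obtain \<pi> where \<pi>: "\<pi> \<in> Sh" and nz: "mixed_exp \<pi> xs m \<noteq> 0" using nz unfolding shuffle_fam_def
      by (metis (no_types, lifting) mult_zero_right sum.not_neutral_contains_not_neutral)
    have "sum m X - (\<Sum>(x, y)\<leftarrow>pairs xs. - unmixed \<pi> x y) \<in> {..B}"
    proof (rule diff_pows_total[OF _ finX(1) _ nz])
      show "x \<in> X \<and> y \<in> X" if "(x, y) \<in> set (pairs xs)" for x y
        using in_pairs_set[OF that] ord by (simp add: ordering_def)
    qed (use B[OF \<pi>] in simp)
    \<comment> \<open>The exponents are at least -1, so each pair raises the degree by at most
      1.\<close>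
    moreover have "(\<Sum>(x, y)\<leftarrow>L. - unmixed \<pi> x y) \<le> int (length L)" for L
    proof (induction L)
      case (Cons p L)
      have "- unmixed \<pi> (fst p) (snd p) \<le> 1"
        using N_lower[of "fst (fst p)" "fst (snd p)"] by (simp add: unmixed_def nu_def)
      then show ?case using Cons.IH by (simp add: case_prod_beta)
    qed simp
    moreover have "int (length (pairs xs)) \<le> int (card X * card X)"
      using length_pairs[of xs] distinct_card[of xs] ord unfolding ordering_def of_nat_le_iff by metis
    ultimately show ?thesis by (smt (verit) atMost_iff)
  qed
  then show ?thesis using that by blast
qed

text \<open>The sum over shuffles is a family of bounded degree and therefore comes from a
  polynomial. So a candidate for the product exists before any rational function is
  considered.\<close>

lemma shuffle_poly:
  obtains h where "h \<in> Lam (d + e)"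
    "\<And>xs m. ordering X xs \<Longrightarrow> expansion (pcoef X h) xs m = shuffle_fam xs m"
proof -
  let ?\<Phi> = "correlator_of (d + e) shuffle_fam"
  obtain B where B: "\<And>xs m. ordering X xs \<Longrightarrow> shuffle_fam xs m \<noteq> 0 \<Longrightarrow> sum m X \<le> B"
    using shuffle_fam_degree by blast
  have "total gs \<le> B" if cont: "content gs = d + e" and nz: "?\<Phi> gs \<noteq> 0" for gs
  proof -
    obtain xs m where xs: "ordering X xs" "gs = word_of xs m"
      using word_representation[of gs thesis] unfolding cont by blast
    then have "shuffle_fam xs m \<noteq> 0" using nz correlator_of_word[OF shuffle_fam_family] by simp
    then show ?thesis using B[OF xs(1)] total_word_of[of xs m] xs by (simp add: ordering_def)
  qed
  then obtain h where h: "h \<in> Lam (d + e)" "\<And>gs. content gs = d + e \<Longrightarrow> ?\<Phi> gs = pcorr (d + e) h gs"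
    using system_poly[OF is_system_correlator_of[OF shuffle_fam_family] finX(1)] by metis
  have "expansion (pcoef X h) xs m = shuffle_fam xs m" if "ordering X xs" for xs m
    using h(2)[of "word_of xs m"] content_word_of[OF that] pcorr_word[OF finX(1) h(1) that]
      correlator_of_word[OF shuffle_fam_family that] by simp
  then show ?thesis using that h(1) by blast
qed

definition shuffled :: "'v shuffle \<Rightarrow> 'v mpoly" where
  "shuffled \<pi> = rename (left_emb \<pi>) f * rename (right_emb d \<pi>) g"

lemma shuffled:
  assumes "\<pi> \<in> Sh"
  shows "poly_in X (shuffled \<pi>)" "pcoef X (shuffled \<pi>) = prod_term \<pi>"
proof -
  have fg: "poly_in (vars d) f" "poly_in (vars e) g" using f g Lam_iff by blast+
  have p: "poly_in (LV \<pi>) (rename (left_emb \<pi>) f)" "poly_in (RV \<pi>) (rename (right_emb d \<pi>) g)"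
    unfolding left_vars_def right_vars_def by (rule poly_in_rename, rule fg)+
  have X: "X = LV \<pi> \<union> RV \<pi>" using shuffle_partition(1)[OF assms] by simp
  show "poly_in X (shuffled \<pi>)"
    unfolding X shuffled_def by (intro poly_in_times poly_in_mono[OF p(1)] poly_in_mono[OF p(2)]) auto
  show "pcoef X (shuffled \<pi>) = prod_term \<pi>"
  proof
    fix m
    have "pcoef X (shuffled \<pi>) m = pcoef (LV \<pi>) (rename (left_emb \<pi>) f) m * pcoef (RV \<pi>) (rename (right_emb d \<pi>) g) m"
      unfolding X shuffled_def by (rule pcoef_times_disjoint[OF p shuffle_partition(2)[OF assms]])
        (use finX in \<open>simp_all add: left_vars_def right_vars_def\<close>)
    also have "\<dots> = prod_term \<pi> m" unfolding prod_term_def left_vars_def right_vars_def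
      using pcoef_rename[OF inj_on_subset[OF emb_inj(1)[OF assms] subset_UNIV] finX(2) fg(1)]
        pcoef_rename[OF inj_on_subset[OF emb_inj(2)[OF assms] subset_UNIV] finX(3) fg(2)] by simp
    finally show "pcoef X (shuffled \<pi>) m = prod_term \<pi> m" .
  qed
qed

definition mixed_factor :: "'v shuffle \<Rightarrow> 'v \<times> nat \<Rightarrow> 'v \<times> nat \<Rightarrow> 'v mpoly fract" where
  "mixed_factor \<pi> x y = (if x \<in> LV \<pi> \<and> y \<in> RV \<pi> then Fract (var y - var x) 1 powi nu x y
     else if x \<in> RV \<pi> \<and> y \<in> LV \<pi> then Fract (var x - var y) 1 powi nu x y else 1)"

text \<open>The mixed factors of \<open>K\<close> are multiplied in one pair at a time. Where a
  factor of \<open>K\<close> is opposite to the difference in the order of the list, reversing it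
  gives the sign.\<close>

lemma represents_mixed:
  assumes ord: "ordering X xs" and \<pi>: "\<pi> \<in> Sh"
  shows "set L \<subseteq> set (pairs xs) \<Longrightarrow>
    represents xs (prod_list (map (\<lambda>(x, y). mixed_factor \<pi> x y) L) * Fract (shuffled \<pi>) 1)
      (\<lambda>m. prod_list (map (mix_sign \<pi>) L) * diff_pows (\<lambda>x y. nu x y - unmixed \<pi> x y) L (prod_term \<pi>) m)"
proof (induction L)
  case Nil
  then show ?case using represents_poly[of xs "shuffled \<pi>"] shuffled[OF \<pi>] ord by (simp add: ordering_def)
next
  case (Cons p L)
  obtain x y where p: "p = (x, y)" by (cases p)
  have xy: "(x, y) \<in> set (pairs xs)" using Cons.prems p by simp
  then have mem: "x \<in> X" "y \<in> X" using in_pairs_set[OF xy] ord by (auto simp: ordering_def)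
  have dist: "distinct xs" using ord by (simp add: ordering_def)
  define q where "q = prod_list (map (\<lambda>(x, y). mixed_factor \<pi> x y) L) * Fract (shuffled \<pi>) 1"
  define h where "h = (\<lambda>m. prod_list (map (mix_sign \<pi>) L) * diff_pows (\<lambda>x y. nu x y - unmixed \<pi> x y) L (prod_term \<pi>) m)"
  have IH: "represents xs q h" unfolding q_def h_def using Cons by simp
  have step: "represents xs (mixed_factor \<pi> x y * q)
     (\<lambda>m. mix_sign \<pi> (x, y) * diff_power x y (nu x y - unmixed \<pi> x y) h m)"
  proof -
    have iff: "z \<in> RV \<pi> \<longleftrightarrow> z \<notin> LV \<pi>" if "z \<in> X" for z using shuffle_partition[OF \<pi>] that by blast
    have "- 1 \<le> nu x y" using N_lower[of "fst x" "fst y"] by (simp add: nu_def)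
    then have R: "represents xs (Fract (var x - var y) 1 powi nu x y * q) (diff_power x y (nu x y) h)"
      by (rule represents_diff_power[OF dist xy IH])
    have swap: "Fract (var y - var x) 1 = - Fract (var x - var y) 1"
      by (simp add: Fract_one_uminus[symmetric])
    consider "x \<in> LV \<pi>" "y \<notin> LV \<pi>" | "x \<notin> LV \<pi>" "y \<in> LV \<pi>" | "(x \<in> LV \<pi>) = (y \<in> LV \<pi>)" by blast
    then show ?thesis
    proof cases
      case 1
      define u where "u = Fract (var x - var y) 1"
      have "mixed_factor \<pi> x y = (- u) powi nu x y"
        using 1 iff[OF mem(2)] by (simp add: mixed_factor_def swap u_def[symmetric])
      then have m: "mixed_factor \<pi> x y = (if even (nu x y) then u powi nu x y else - (u powi nu x y))"
        by (simp only: uminus_powi)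
      have s: "mix_sign \<pi> (x, y) = (if even (nu x y) then 1 else - 1)" "nu x y - unmixed \<pi> x y = nu x y"
        using 1 by (simp_all add: mix_sign_def unmixed_def sgn_of_cases)
      show ?thesis unfolding m s using R[folded u_def] represents_uminus[OF R[folded u_def]]
        by (cases "even (nu x y)") simp_all
    next
      case 2
      then have "mixed_factor \<pi> x y = Fract (var x - var y) 1 powi nu x y"
        using iff[OF mem(1)] by (simp add: mixed_factor_def)
      then show ?thesis using R 2 by (simp add: mix_sign_def unmixed_def)
    next
      case 3
      then have "mixed_factor \<pi> x y = 1" using iff[OF mem(1)] iff[OF mem(2)] by (simp add: mixed_factor_def)
      then show ?thesis using IH 3 by (simp add: mix_sign_def unmixed_def)
    qed
  qed
  show ?case using step unfolding q_def h_def p diff_power_scale by (simp add: mult.assoc)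
qed

lemma prod_mixed_factor:
  assumes "ordering X xs" "\<pi> \<in> Sh"
  shows "prod_list (map (\<lambda>(x, y). mixed_factor \<pi> x y) (pairs xs))
    = (\<Prod>x\<in>LV \<pi>. \<Prod>y\<in>RV \<pi>. Fract (var y - var x) 1 powi nu x y)"
proof -
  have "LV \<pi> \<inter> set xs = LV \<pi>" "RV \<pi> \<inter> set xs = RV \<pi>"
    using assms shuffle_partition(1)[OF assms(2)] by (auto simp: ordering_def)
  then show ?thesis
    using prod_list_pairs_split[of xs "LV \<pi>" "RV \<pi>" "\<lambda>x y. Fract (var y - var x) 1 powi nu x y"]
      shuffle_partition(2)[OF assms(2)] assms(1)
    by (simp add: mixed_factor_def[abs_def] ordering_def nu_commute cong: if_cong)
qed

lemma kernel_prod: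
  assumes "d \<in> dimvecs Q" "e \<in> dimvecs Q" "\<pi> \<in> Sh"
  shows "shuffle_kernel Q d e \<pi> = (\<Prod>x\<in>LV \<pi>. \<Prod>y\<in>RV \<pi>. Fract (var y - var x) 1 powi nu x y)"
proof -
  have vars: "vars d' = Sigma (verts Q) (\<lambda>i. {1..d' i})" if "d' \<in> dimvecs Q" for d'
    using that unfolding vars_def dimvecs_def by force
  have split: "(\<Prod>x\<in>vars d'. p x) = (\<Prod>i\<in>verts Q. \<Prod>k\<in>{1..d' i}. p (i, k))"
    if "d' \<in> dimvecs Q" for d' and p :: "'v \<times> nat \<Rightarrow> 'v mpoly fract"
    using prod.Sigma[OF finite_verts, of "\<lambda>i. {1..d' i}" "\<lambda>i k. p (i, k)"] by (simp add: vars[OF that])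
  define c where "c = (\<lambda>x y. Fract (var y - var x) 1 powi nu x y :: 'v mpoly fract)"
  have "(\<Prod>x\<in>LV \<pi>. \<Prod>y\<in>RV \<pi>. c x y) = (\<Prod>x\<in>vars d. \<Prod>y\<in>vars e. c (left_emb \<pi> x) (right_emb d \<pi> y))"
    unfolding left_vars_def right_vars_def using emb_inj[OF assms(3)]
    by (subst prod.reindex, blast intro: inj_on_subset, subst prod.reindex, blast intro: inj_on_subset, simp)
  also have "\<dots> = (\<Prod>i\<in>verts Q. \<Prod>k\<in>{1..d i}. \<Prod>j\<in>verts Q. \<Prod>l\<in>{1..e j}. c (left_emb \<pi> (i, k)) (right_emb d \<pi> (j, l)))"
    by (simp only: split[OF assms(1)] split[OF assms(2)])
  also have "\<dots> = (\<Prod>i\<in>verts Q. \<Prod>j\<in>verts Q. \<Prod>k\<in>{1..d i}. \<Prod>l\<in>{1..e j}. c (left_emb \<pi> (i, k)) (right_emb d \<pi> (j, l)))"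
    by (intro prod.cong refl prod.swap)
  also have "\<dots> = shuffle_kernel Q d e \<pi>"
    unfolding shuffle_kernel_def by (simp add: c_def nu_def NN_def left_emb_def right_emb_def)
  finally show ?thesis by (simp add: c_def)
qed

text \<open>Multiplied by all differences, the family becomes \<open>h\<close>, while its terms
  become expansions of the summands of the shuffle sum. A rational function that expands to a
  polynomial equals it, which also justifies the description in \<open>shuffle_prod\<close>.\<close>

lemma shuffle_prod_eq:
  assumes de: "d \<in> dimvecs Q" "e \<in> dimvecs Q" and h: "h \<in> Lam (d + e)"
    and exp: "\<And>xs m. ordering X xs \<Longrightarrow> expansion (pcoef X h) xs m = shuffle_fam xs m"
  shows "shuffle_prod Q d e f g = h"
proof -
  obtain xs where ord: "ordering X xs" using exists_ordering[OF finX(1)] by blast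
  have dist: "distinct xs" and set: "set xs = X" using ord by (auto simp: ordering_def)
  have pX: "poly_in X h" using h Lam_iff by blast
  have "pcoef X h = diff_pows nu (pairs xs) (expansion (pcoef X h) xs)"
    by (rule regular_part_expansion[symmetric, OF _ ord]) (rule pcoef_nonneg)
  also have "expansion (pcoef X h) xs = shuffle_fam xs" using exp[OF ord] by (rule ext)
  also have "diff_pows nu (pairs xs) (shuffle_fam xs)
      = (\<lambda>m. \<Sum>\<pi>\<in>Sh. shuffle_sign \<pi> xs * diff_pows (\<lambda>x y. nu x y - unmixed \<pi> x y) (pairs xs) (prod_term \<pi>) m)"
  proof -
    have prec: "precedes (upsets xs) x y" if "(x, y) \<in> set (pairs xs)" for x y
      using ordering_precedes[OF ord that] .
    have b: "bdd_support (upsets xs) (prod_term \<pi>)" if "\<pi> \<in> Sh" for \<pi> by (rule bounded_prod_term[OF that set])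
    have "diff_pows nu (pairs xs) (shuffle_fam xs) = (\<lambda>m. \<Sum>\<pi>\<in>Sh. diff_pows nu (pairs xs)
        (\<lambda>m. shuffle_sign \<pi> xs * mixed_exp \<pi> xs m) m)" unfolding shuffle_fam_def
      by (rule diff_pows_sum[where \<U> = "upsets xs"])
        (intro bdd_support_scale bdd_support_diff_pows b prec | assumption)+
    also have "\<dots> = (\<lambda>m. \<Sum>\<pi>\<in>Sh. shuffle_sign \<pi> xs * diff_pows (\<lambda>x y. nu x y - unmixed \<pi> x y) (pairs xs) (prod_term \<pi>) m)"
    proof (intro ext sum.cong refl)
      fix m \<pi> assume \<pi>: "\<pi> \<in> Sh"
      have "diff_pows nu (pairs xs) (mixed_exp \<pi> xs)
          = diff_pows (\<lambda>x y. nu x y + - unmixed \<pi> x y) (pairs xs) (prod_term \<pi>)"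
        by (rule diff_pows_diff_pows[OF b[OF \<pi>]]) (rule prec)
      then show "diff_pows nu (pairs xs) (\<lambda>m. shuffle_sign \<pi> xs * mixed_exp \<pi> xs m) m
        = shuffle_sign \<pi> xs * diff_pows (\<lambda>x y. nu x y - unmixed \<pi> x y) (pairs xs) (prod_term \<pi>) m"
        by (simp add: diff_pows_scale)
    qed
    finally show ?thesis .
  qed
  finally have coef: "pcoef X h = (\<lambda>m. \<Sum>\<pi>\<in>Sh. shuffle_sign \<pi> xs *
      diff_pows (\<lambda>x y. nu x y - unmixed \<pi> x y) (pairs xs) (prod_term \<pi>) m)" .
  have "represents xs (\<Sum>\<pi>\<in>Sh. shuffle_kernel Q d e \<pi> * Fract (shuffled \<pi>) 1) (pcoef X h)" unfolding coef
  proof (rule represents_sum[OF dist])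
    fix \<pi> assume \<pi>: "\<pi> \<in> Sh"
    show "represents xs (shuffle_kernel Q d e \<pi> * Fract (shuffled \<pi>) 1) (\<lambda>m. shuffle_sign \<pi> xs *
      diff_pows (\<lambda>x y. nu x y - unmixed \<pi> x y) (pairs xs) (prod_term \<pi>) m)"
      using represents_mixed[OF ord \<pi> order.refl]
      unfolding prod_mixed_factor[OF ord \<pi>] kernel_prod[OF de \<pi>] shuffle_sign_def .
  qed
  then have "(\<Sum>\<pi>\<in>Sh. shuffle_kernel Q d e \<pi> * Fract (shuffled \<pi>) 1) = Fract h 1"
    using represents_unique[OF dist, of h] pX by (simp add: set)
  moreover have "(\<Sum>\<pi>\<in>Sh. shuffle_kernel Q d e \<pi> * Fract (shuffled \<pi>) 1) = shuffle_sum Q d e f g"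
    unfolding shuffle_sum_def shuffled_def left_emb_def right_emb_def Fract_one_mult
    by (intro sum.cong refl) (simp add: mult_ac)
  ultimately have eq: "Fract h 1 = shuffle_sum Q d e f g" by simp
  show ?thesis unfolding shuffle_prod_def by (rule the_equality) (use eq Fract_one_inj in metis)+
qed

lemma filter_LV:
  assumes ord: "ordering X xs" and \<pi>: "\<pi> \<in> Sh"
  shows "ordering (LV \<pi>) (filter (\<lambda>x. x \<in> LV \<pi>) xs)" "ordering (RV \<pi>) (filter (\<lambda>x. x \<notin> LV \<pi>) xs)"
  using shuffle_partition[OF \<pi>] ord by (auto simp: ordering_def)

text \<open>The embedded variables are renamed back to \<open>vars c\<close>; colours, and with them
  the exponents and the word, do not change.\<close>

lemma expansion_emb:
  assumes inj: "inj \<alpha>" and col: "\<And>x. fst (\<alpha> x) = fst x" and p: "p \<in> Lam c" and fin: "finite (vars c)"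
    and ord: "ordering (\<alpha> ` vars c) zs"
  shows "diff_pows (\<lambda>x y. - nu x y) (pairs zs) (\<lambda>m. pcoef (vars c) p (m \<circ> \<alpha>)) m = pcorr c p (word_of zs m)"
proof -
  define ys where "ys = map (inv_into (vars c) \<alpha>) zs"
  have "map \<alpha> ys = zs"
    unfolding ys_def map_map using ord by (intro map_idI) (auto simp: ordering_def f_inv_into_f)
  moreover have "set ys \<subseteq> vars c" using ord by (auto simp: ys_def ordering_def inv_into_into)
  ultimately have ys: "zs = map \<alpha> ys" "set ys \<subseteq> vars c" by simp_all
  have "\<alpha> ` set ys = \<alpha> ` vars c" using ord ys by (auto simp: ordering_def)
  then have ordy: "ordering (vars c) ys"
    using ord ys(1) inj_image_eq_iff[OF inj] by (simp add: ordering_def distinct_map)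
  have "diff_pows (\<lambda>x y. - nu x y) (map (map_prod \<alpha> \<alpha>) (pairs ys)) (\<lambda>m. pcoef (vars c) p (m \<circ> \<alpha>))
    = (\<lambda>m. diff_pows (\<lambda>x y. - nu x y) (pairs ys) (pcoef (vars c) p) (m \<circ> \<alpha>))"
    by (rule diff_pows_rename[OF inj]) (simp add: nu_def col)
  moreover have "word_of ys (m \<circ> \<alpha>) = word_of zs m" by (simp add: word_of_def ys(1) col)
  ultimately show ?thesis
    using pcorr_word[OF fin p ordy, of "m \<circ> \<alpha>"] by (simp add: ys(1) pairs_map expansion_def)
qed

text \<open>With exponent 0 on mixed pairs each term factors into a function of the left variables
  and one of the right variables; these are the correlation functions on a subword and on its
  complement.\<close>

lemma shuffle_fam_words:
  assumes ord: "ordering X xs"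
  shows "shuffle_fam xs m = (\<Sum>\<pi>\<in>Sh. shuffle_sign \<pi> xs *
    (pcorr d f (word_of (filter (\<lambda>x. x \<in> LV \<pi>) xs) m) * pcorr e g (word_of (filter (\<lambda>x. x \<notin> LV \<pi>) xs) m)))"
  unfolding shuffle_fam_def
proof (rule sum.cong[OF refl])
  fix \<pi> assume \<pi>: "\<pi> \<in> Sh"
  have set: "set xs = X" using ord by (simp add: ordering_def)
  note part = shuffle_partition[OF \<pi>]
  define ff where "ff m = pcoef (vars d) f (m \<circ> left_emb \<pi>)" for m
  define gg where "gg m = pcoef (vars e) g (m \<circ> right_emb d \<pi>)" for m
  have "diff_pows (\<lambda>x y. - unmixed \<pi> x y) (pairs xs) (\<lambda>m. ff m * gg m)
    = (\<lambda>m. diff_pows (\<lambda>x y. - nu x y) (filter (\<lambda>(x, y). x \<in> LV \<pi> \<and> y \<in> LV \<pi>) (pairs xs)) ff m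
        * diff_pows (\<lambda>x y. - nu x y) (filter (\<lambda>(x, y). x \<in> RV \<pi> \<and> y \<in> RV \<pi>) (pairs xs)) gg m)"
  proof (rule diff_pows_product[OF _ _ part(2)])
    show "ff m = ff m'" if "\<And>x. x \<in> LV \<pi> \<Longrightarrow> m x = m' x" for m m'
      using depends_on_pcoef[of "vars d" f] that unfolding depends_on_def ff_def left_vars_def by simp
    show "gg m = gg m'" if "\<And>x. x \<in> RV \<pi> \<Longrightarrow> m x = m' x" for m m'
      using depends_on_pcoef[of "vars e" g] that unfolding depends_on_def gg_def right_vars_def by simp
    show "x \<in> LV \<pi> \<union> RV \<pi> \<and> y \<in> LV \<pi> \<union> RV \<pi>" if "(x, y) \<in> set (pairs xs)" for x y
      using in_pairs_set[OF that] part(1) set by simp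
  qed (simp add: unmixed_def)
  moreover have "filter (\<lambda>(x, y). x \<in> LV \<pi> \<and> y \<in> LV \<pi>) (pairs xs) = pairs (filter (\<lambda>x. x \<in> LV \<pi>) xs)"
    by (simp add: pairs_filter)
  moreover have "filter (\<lambda>(x, y). x \<in> RV \<pi> \<and> y \<in> RV \<pi>) (pairs xs) = pairs (filter (\<lambda>x. x \<notin> LV \<pi>) xs)"
  proof -
    have "filter (\<lambda>x. x \<in> RV \<pi>) xs = filter (\<lambda>x. x \<notin> LV \<pi>) xs"
      using part set by (intro filter_cong refl) blast
    then show ?thesis by (simp add: pairs_filter[symmetric])
  qed
  moreover have "diff_pows (\<lambda>x y. - nu x y) (pairs (filter (\<lambda>x. x \<in> LV \<pi>) xs)) ff m
      = pcorr d f (word_of (filter (\<lambda>x. x \<in> LV \<pi>) xs) m)" unfolding ff_def using filter_LV(1)[OF ord \<pi>]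
    by (intro expansion_emb emb_inj[OF \<pi>] f finX) (simp_all add: left_vars_def)
  moreover have "diff_pows (\<lambda>x y. - nu x y) (pairs (filter (\<lambda>x. x \<notin> LV \<pi>) xs)) gg m
      = pcorr e g (word_of (filter (\<lambda>x. x \<notin> LV \<pi>) xs) m)" unfolding gg_def using filter_LV(2)[OF ord \<pi>]
    by (intro expansion_emb emb_inj[OF \<pi>] g finX) (simp_all add: right_vars_def)
  ultimately show "shuffle_sign \<pi> xs * mixed_exp \<pi> xs m
    = shuffle_sign \<pi> xs * (pcorr d f (word_of (filter (\<lambda>x. x \<in> LV \<pi>) xs) m) *
        pcorr e g (word_of (filter (\<lambda>x. x \<notin> LV \<pi>) xs) m))" by (simp add: prod_term_def[abs_def] ff_def gg_def)
qed

theorem shuffle_prod_corr: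
  assumes "d \<in> dimvecs Q" "e \<in> dimvecs Q"
  shows "shuffle_prod Q d e f g \<in> Lam (d + e)"
    and "ordering X xs \<Longrightarrow> pcorr (d + e) (shuffle_prod Q d e f g) (word_of xs m) = (\<Sum>\<pi>\<in>Sh. shuffle_sign \<pi> xs *
    (pcorr d f (word_of (filter (\<lambda>x. x \<in> LV \<pi>) xs) m) * pcorr e g (word_of (filter (\<lambda>x. x \<notin> LV \<pi>) xs) m)))"
proof -
  obtain h where h: "h \<in> Lam (d + e)"
    "\<And>xs m. ordering X xs \<Longrightarrow> expansion (pcoef X h) xs m = shuffle_fam xs m" using shuffle_poly by blast
  have eq: "shuffle_prod Q d e f g = h" by (rule shuffle_prod_eq[OF assms h])
  show "shuffle_prod Q d e f g \<in> Lam (d + e)" using h(1) eq by simp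
  show "pcorr (d + e) (shuffle_prod Q d e f g) (word_of xs m) = (\<Sum>\<pi>\<in>Sh. shuffle_sign \<pi> xs *
    (pcorr d f (word_of (filter (\<lambda>x. x \<in> LV \<pi>) xs) m) * pcorr e g (word_of (filter (\<lambda>x. x \<notin> LV \<pi>) xs) m)))"
    if ord: "ordering X xs"
    using pcorr_word[OF finX(1) h(1) ord] h(2)[OF ord] shuffle_fam_words[OF ord] eq by simp
qed

end

lemma scale_zero [simp]: "scaled c (0 :: 'x \<Rightarrow>\<^sub>0 rat) = 0" by (rule poly_mapping_eqI) (simp add: lookup_scale)

section \<open>The isomorphism with the cohomological Hall algebra\<close>

lemma lookup_scale_scale:
  "lookup (Poly_Mapping.map (scaled c) h) d = scaled (c::rat) (lookup h d)"
  by (rule poly_mapping_eqI) (simp add: Poly_Mapping.map.rep_eq when_def)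

lemma (in correlators) is_system_lin:
  assumes "is_system \<Phi>" "is_system \<Psi>"
  shows "is_system (\<lambda>gs. \<Phi> gs + c * \<Psi> gs)"
proof -
  have "b * (x1 + c * y1 - s * (x2 + c * y2)) = b * (x1 - s * x2) + c * (b * (y1 - s * y2))"
    for b x1 y1 s x2 y2 :: rat by (simp add: algebra_simps)
  then show ?thesis using assms unfolding is_system_def by (simp add: sum.distrib sum_distrib_left[symmetric])
qed

lemma (in correlators) is_system_zero: "is_system (\<lambda>gs. 0)" unfolding is_system_def by simp

lemma (in correlators) is_system_sum:
  assumes "\<And>i. i \<in> A \<Longrightarrow> is_system (\<Phi> i)"
  shows "is_system (\<lambda>gs. \<Sum>i\<in>A. \<Phi> i gs)" using assms
proof (induction A rule: infinite_finite_induct)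
  case (insert i A)
  then show ?case using is_system_lin[of "\<lambda>gs. \<Sum>i\<in>A. \<Phi> i gs" "\<Phi> i" 1] by (simp add: add.commute)
qed (simp_all add: is_system_zero)

context sym_quiver
begin

definition diag :: "('v \<times> int) list \<Rightarrow> int" where
  "diag gs = (\<Sum>g\<leftarrow>gs. NN Q (fst g) (fst g))"

text \<open>From \<open>-2 (\<chi>(e_i,e_i)/2 - n - 1) = NN Q i i + 2 (n + 1)\<close>, summed over
  the letters.\<close>

definition hdeg :: "('v \<times> int) list \<Rightarrow> int" where
  "hdeg gs = diag gs - 2 * total gs"

definition grade :: "('v \<times> int) list \<Rightarrow> ('v \<Rightarrow> int) \<times> int" where
  "grade gs = (ldim (content gs), hdeg gs)"

lemma sum_basis_vec: "(\<Sum>g\<leftarrow>gs. basis_vec (fst g)) = ldim (content gs)"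
  by (induction gs) (auto simp: ldim_def content_Cons basis_vec_def fun_eq_iff)

lemma hdeg_weight: "of_int n = - 2 * (\<Sum>g\<leftarrow>gs. weight Q g) \<longleftrightarrow> n = hdeg gs"
proof -
  have "- 2 * (\<Sum>g\<leftarrow>gs. weight Q g) = of_int (hdeg gs)"
    by (induction gs) (auto simp: hdeg_def diag_def total_def weight_def NN_def algebra_simps split: prod.split)
  then show ?thesis by (simp only: of_int_eq_iff)
qed

lemma mset_content: "content gs = content hs \<Longrightarrow> mset (map fst gs) = mset (map fst hs)"
  unfolding content_def by (rule multiset_eqI) (simp only: count_mset)

lemma diag_cong:
  assumes "content gs = content hs"
  shows "diag gs = diag hs"
proof -
  have "diag gs = sum_mset (image_mset (\<lambda>i. NN Q i i) (mset (map fst gs)))" for gs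
    unfolding diag_def sum_mset_sum_list[symmetric] by (simp add: comp_def image_mset.compositionality)
  then show ?thesis using mset_content[OF assms] by simp
qed

lemma grade_cong: "content gs = content hs \<Longrightarrow> total gs = total hs \<Longrightarrow> grade gs = grade hs"
  using diag_cong[of gs hs] by (simp add: grade_def hdeg_def)

lemma euler_form_basis_sum: "euler_form Q (basis_vec i) (ldim (content gs)) = - (\<Sum>g\<leftarrow>gs. NN Q i (fst g))"
proof (induction gs)
  case Nil
  then show ?case by (simp add: ldim_def euler_form_def)
next
  case (Cons g gs)
  have "ldim (content (g # gs)) = basis_vec (fst g) + ldim (content gs)"
    by (simp add: sum_basis_vec[symmetric])
  then show ?case using Cons.IH by (simp only: euler_form_add_right) (simp add: NN_def)
qed

text \<open>\<open>-\<chi>(d,d)\<close> sums \<open>NN Q\<close> over all ordered pairs of letters: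
  the diagonal once and each pair of positions twice. In particular the charge depends only on the
  content.\<close>

lemma two_charge: "2 * charge (map fst gs) = - euler_form Q (ldim (content gs)) (ldim (content gs)) - diag gs"
proof (induction gs)
  case Nil
  then show ?case by (simp add: charge_def diag_def ldim_def euler_form_def)
next
  case (Cons g gs)
  have eq: "ldim (content (g # gs)) = basis_vec (fst g) + ldim (content gs)"
    by (simp add: sum_basis_vec[symmetric])
  have "charge (map fst (g # gs)) = (\<Sum>h\<leftarrow>gs. NN Q (fst g) (fst h)) + charge (map fst gs)"
    by (simp add: charge_def comp_def)
  moreover have "euler_form Q (ldim (content (g # gs))) (ldim (content (g # gs)))
      = - NN Q (fst g) (fst g) - 2 * (\<Sum>h\<leftarrow>gs. NN Q (fst g) (fst h)) + euler_form Q (ldim (content gs)) (ldim (content gs))"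
    unfolding eq euler_form_add_left euler_form_add_right
    using euler_form_basis_sum[of "fst g" gs] euler_form_commute[of "ldim (content gs)" "basis_vec (fst g)"]
    by (simp add: NN_def)
  ultimately show ?case using Cons.IH by (simp add: diag_def)
qed

text \<open>The degree count behind \<open>F\<close>: \<open>total + charge\<close> is the
  polynomial degree, the 2 is the degree of a variable, \<open>\<chi>(d,d)\<close> the shift in
  \<open>HH Q\<close>, and the sign that of the graded dual.\<close>

lemma hdeg_charge:
  "- hdeg gs = 2 * (total gs + charge (map fst gs)) + euler_form Q (ldim (content gs)) (ldim (content gs))"
  using two_charge[of gs] by (simp add: hdeg_def)

lemma content_dimvecs: "content gs \<in> dimvecs Q \<longleftrightarrow> is_word gs"
proof -
  have "content gs i = 0 \<longleftrightarrow> i \<notin> fst ` set gs" for i by (simp add: content_def count_list_0_iff)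
  then show ?thesis unfolding dimvecs_def symbols_def by force
qed

lemma finite_dimvec: "d \<in> dimvecs Q \<Longrightarrow> finite {i. d i \<noteq> 0}"
  by (rule finite_subset[OF _ finite_verts]) (auto simp: dimvecs_def)

lemma finite_vars_Q: "d \<in> dimvecs Q \<Longrightarrow> finite (vars d)" by (rule finite_vars[OF finite_dimvec])

lemma finite_vars_content: "finite (vars (content (gs :: ('v \<times> int) list)))"
  by (rule finite_vars[OF finite_content])

lemma PP_piece_words:
  "PP_piece Q \<alpha> n = lin_span (PP Q) {word_vec Q gs | gs. is_word gs \<and> grade gs = (\<alpha>, n)}"
  unfolding PP_piece_def sum_basis_vec hdeg_weight grade_def
  by (rule arg_cong[where f = "lin_span (PP Q)"]) auto

lemma corr_nonzero: "corr \<xi> gs \<noteq> 0 \<longleftrightarrow> is_word gs \<and> \<xi> (word_vec Q gs) \<noteq> 0" by (simp add: corr_def)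

lemma piece_nonzero:
  assumes "functional \<xi>"
  shows "(\<exists>x\<in>PP_piece Q \<alpha> n. \<xi> x \<noteq> 0) \<longleftrightarrow> (\<exists>gs. corr \<xi> gs \<noteq> 0 \<and> grade gs = (\<alpha>, n))"
proof -
  interpret rat_space "PP Q" by (rule PP_space)
  show ?thesis
  proof
    assume "\<exists>x\<in>PP_piece Q \<alpha> n. \<xi> x \<noteq> 0"
    then show "\<exists>gs. corr \<xi> gs \<noteq> 0 \<and> grade gs = (\<alpha>, n)"
      using linear_functional_span_zero[OF assms, of "{word_vec Q gs | gs. is_word gs \<and> grade gs = (\<alpha>, n)}"]
        word_vec_carrier unfolding PP_piece_words corr_nonzero by blast
  next
    assume "\<exists>gs. corr \<xi> gs \<noteq> 0 \<and> grade gs = (\<alpha>, n)"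
    then show "\<exists>x\<in>PP_piece Q \<alpha> n. \<xi> x \<noteq> 0"
      using lin_span_superset[of "{word_vec Q gs | gs. is_word gs \<and> grade gs = (\<alpha>, n)}"]
      unfolding PP_piece_words corr_nonzero by blast
  qed
qed

abbreviation "PPdual \<equiv> gdual (PP Q) (PP_piece Q)"
abbreviation "PPdual_piece \<equiv> gdual_piece (PP Q) (PP_piece Q)"

lemma gdual_simps [simp]:
  "add (gdual M A) = (+)" "zero (gdual M A) = 0" "smult (gdual M A) c \<xi> = (\<lambda>x. c * \<xi> x)"
  for A :: "'l \<Rightarrow> int \<Rightarrow> 'b set" by (simp_all add: gdual_def)

lemma PPdual_carrier:
  "\<xi> \<in> carrier PPdual \<longleftrightarrow> (\<forall>x. x \<notin> carrier (PP Q) \<longrightarrow> \<xi> x = 0) \<and> functional \<xi> \<and>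
     finite (grade ` {gs. corr \<xi> gs \<noteq> 0})"
proof -
  have "{(\<alpha>, n). \<exists>x\<in>PP_piece Q \<alpha> n. \<xi> x \<noteq> 0} = grade ` {gs. corr \<xi> gs \<noteq> 0}" if "functional \<xi>"
    unfolding piece_nonzero[OF that] by (auto intro: rev_image_eqI)
  then show ?thesis unfolding gdual_def rat_space.linear_functional_def[OF PP_space] by auto
qed

lemma PPdual_piece_iff:
  "\<xi> \<in> PPdual_piece \<alpha> n \<longleftrightarrow> \<xi> \<in> carrier PPdual \<and> (\<forall>gs. corr \<xi> gs \<noteq> 0 \<longrightarrow> grade gs = (\<alpha>, - n))"
proof -
  have "(\<forall>\<beta> m. (\<beta>, m) \<noteq> (\<alpha>, - n) \<longrightarrow> (\<forall>x\<in>PP_piece Q \<beta> m. \<xi> x = 0)) \<longleftrightarrow>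
      (\<forall>gs. corr \<xi> gs \<noteq> 0 \<longrightarrow> grade gs = (\<alpha>, - n))" if "\<xi> \<in> carrier PPdual"
  proof -
    have \<xi>: "functional \<xi>" using that PPdual_carrier by blast
    have "(\<forall>\<beta> m. (\<beta>, m) \<noteq> (\<alpha>, - n) \<longrightarrow> \<not> (\<exists>x\<in>PP_piece Q \<beta> m. \<xi> x \<noteq> 0)) \<longleftrightarrow>
      (\<forall>gs. corr \<xi> gs \<noteq> 0 \<longrightarrow> grade gs = (\<alpha>, - n))" unfolding piece_nonzero[OF \<xi>] by (metis surj_pair)
    then show ?thesis by blast
  qed
  then show ?thesis unfolding gdual_piece_def by blast
qed

lemma PPdual_comp:
  assumes "\<xi> \<in> gdual_comp (PP Q) (PP_piece Q) \<alpha>"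
  shows "\<xi> \<in> carrier PPdual" "corr \<xi> gs \<noteq> 0 \<Longrightarrow> ldim (content gs) = \<alpha>"
proof -
  show \<xi>: "\<xi> \<in> carrier PPdual" using assms by (simp add: gdual_comp_def)
  have f: "functional \<xi>" using \<xi> PPdual_carrier by blast
  show "ldim (content gs) = \<alpha>" if "corr \<xi> gs \<noteq> 0"
    using piece_nonzero[OF f, of "fst (grade gs)" "snd (grade gs)"] that assms
    unfolding gdual_comp_def by (fastforce simp: grade_def)
qed

lemma corr_add: "corr (\<xi> + \<eta>) gs = corr \<xi> gs + corr \<eta> gs"
  and corr_scale: "corr (\<lambda>x. c * \<xi> x) gs = c * corr \<xi> gs" by (simp_all add: corr_def)

lemma PPdual_add:
  assumes "\<xi> \<in> carrier PPdual" "\<eta> \<in> carrier PPdual"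
  shows "\<xi> + \<eta> \<in> carrier PPdual"
proof -
  have "finite (grade ` {gs. corr (\<xi> + \<eta>) gs \<noteq> 0})"
    by (rule finite_subset[of _ "grade ` {gs. corr \<xi> gs \<noteq> 0} \<union> grade ` {gs. corr \<eta> gs \<noteq> 0}"])
      (use assms corr_add[of \<xi> \<eta>] in \<open>auto simp: PPdual_carrier\<close>)
  then show ?thesis
    using assms by (simp add: PPdual_carrier rat_space.linear_functional_def[OF PP_space] distrib_left)
qed

lemma PPdual_scale:
  assumes "\<xi> \<in> carrier PPdual"
  shows "(\<lambda>x. c * \<xi> x) \<in> carrier PPdual"
proof -
  have "finite (grade ` {gs. corr (\<lambda>x. c * \<xi> x) gs \<noteq> 0})"
    by (rule finite_subset[of _ "grade ` {gs. corr \<xi> gs \<noteq> 0}"])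
      (use assms corr_scale[of c \<xi>] in \<open>auto simp: PPdual_carrier\<close>)
  then show ?thesis
    using assms by (simp add: PPdual_carrier rat_space.linear_functional_def[OF PP_space] algebra_simps)
qed

lemma PPdual_eqI:
  assumes "\<xi> \<in> carrier PPdual" "\<eta> \<in> carrier PPdual" "corr \<xi> = corr \<eta>"
  shows "\<xi> = \<eta>"
proof
  fix x
  have d: "\<xi> + (\<lambda>x. (-1) * \<eta> x) \<in> carrier PPdual" by (intro PPdual_add PPdual_scale assms)
  show "\<xi> x = \<eta> x"
  proof (cases "x \<in> carrier (PP Q)")
    case True
    have "(\<xi> + (\<lambda>x. (-1) * \<eta> x)) x = 0"
    proof (rule functional_zero[OF _ _ True])
      show "functional (\<xi> + (\<lambda>x. (-1) * \<eta> x))" using d PPdual_carrier by blast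
      show "(\<xi> + (\<lambda>x. (-1) * \<eta> x)) (word_vec Q gs) = 0" if "is_word gs" for gs
        using fun_cong[OF assms(3), of gs] that by (simp add: corr_def)
    qed
    then show ?thesis by simp
  next
    case False
    then show ?thesis using assms by (simp add: PPdual_carrier)
  qed
qed

lemma PPdual_of_system:
  assumes sys: "is_system \<Phi>" and supp: "\<And>gs. \<Phi> gs \<noteq> 0 \<Longrightarrow> is_word gs"
    and fin: "finite (grade ` {gs. \<Phi> gs \<noteq> 0})"
  obtains \<xi> where "\<xi> \<in> carrier PPdual" "corr \<xi> = \<Phi>"
proof -
  obtain \<xi> where \<xi>: "functional \<xi>" "\<And>x. x \<notin> carrier (PP Q) \<Longrightarrow> \<xi> x = 0"
    "\<And>gs. is_word gs \<Longrightarrow> \<xi> (word_vec Q gs) = \<Phi> gs" using functional_of_system[OF sys] by blast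
  have "corr \<xi> = \<Phi>" using \<xi>(3) supp by (fastforce simp: corr_def)
  then show ?thesis using that[of \<xi>] \<xi>(1,2) fin by (simp add: PPdual_carrier)
qed

end

context lin_sym_quiver
begin

lemma HH_simps [simp]:
  "add (HH Q) = (+)" "zero (HH Q) = 0" "smult (HH Q) c = Poly_Mapping.map (scaled c)"
  by (simp_all add: HH_def)

lemma HH_carrier:
  "h \<in> carrier (HH Q) \<longleftrightarrow> (\<forall>d. lookup h d \<in> Lam d \<and> (d \<notin> dimvecs Q \<longrightarrow> lookup h d = 0))"
proof -
  have "h \<in> carrier (HH Q) \<longleftrightarrow> (\<forall>d. lookup h d \<noteq> 0 \<longrightarrow> d \<in> dimvecs Q \<and> lookup h d \<in> Lam d)"
    by (auto simp: HH_def in_keys_iff)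
  then show ?thesis using Lam_zero by metis
qed

lemma HH_space: "rat_space (HH Q)"
proof (intro rat_space.intro moduleI cring_ratring)
  have closed: "x + y \<in> carrier (HH Q)" if "x \<in> carrier (HH Q)" "y \<in> carrier (HH Q)" for x y
    unfolding HH_carrier lookup_add
  proof (intro allI conjI impI)
    fix d
    show "lookup x d + lookup y d \<in> Lam d"
      using that Lam_add[OF finite_vars_Q] Lam_zero by (cases "d \<in> dimvecs Q") (simp_all add: HH_carrier)
  qed (use that in \<open>simp_all add: HH_carrier\<close>)
  have scale: "Poly_Mapping.map (scaled c) x \<in> carrier (HH Q)" if "x \<in> carrier (HH Q)" for c x
    unfolding HH_carrier lookup_scale_scale
  proof (intro allI conjI impI)
    fix d
    show "scaled c (lookup x d) \<in> Lam d" using that Lam_scale[OF finite_vars_Q] Lam_zero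
      by (cases "d \<in> dimvecs Q") (simp_all add: HH_carrier)
  qed (use that in \<open>simp_all add: HH_carrier\<close>)
  show "abelian_group (HH Q)"
  proof (rule abelian_groupI)
    fix x assume x: "x \<in> carrier (HH Q)"
    have "Poly_Mapping.map (scaled (-1)) x = - x"
      by (rule poly_mapping_eqI, rule poly_mapping_eqI) (simp add: lookup_scale_scale lookup_scale)
    then show "\<exists>y\<in>carrier (HH Q). y \<oplus>\<^bsub>HH Q\<^esub> x = \<zero>\<^bsub>HH Q\<^esub>"
      using scale[OF x, of "-1"] by (intro bexI[of _ "- x"]) simp_all
  qed (use closed in \<open>auto simp: add_ac HH_carrier Lam_zero\<close>)
  fix a b x y assume x: "x \<in> carrier (HH Q)" and "y \<in> carrier (HH Q)"
  show "a \<odot>\<^bsub>HH Q\<^esub> x \<in> carrier (HH Q)" using scale[OF x] by simp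
  show "(a \<oplus>\<^bsub>ratring\<^esub> b) \<odot>\<^bsub>HH Q\<^esub> x = a \<odot>\<^bsub>HH Q\<^esub> x \<oplus>\<^bsub>HH Q\<^esub> b \<odot>\<^bsub>HH Q\<^esub> x"
    by (rule poly_mapping_eqI) (simp add: lookup_scale_scale lookup_add scale_add_left)
  show "a \<odot>\<^bsub>HH Q\<^esub> (x \<oplus>\<^bsub>HH Q\<^esub> y) = a \<odot>\<^bsub>HH Q\<^esub> x \<oplus>\<^bsub>HH Q\<^esub> a \<odot>\<^bsub>HH Q\<^esub> y"
    by (rule poly_mapping_eqI) (simp add: lookup_scale_scale lookup_add scale_add)
  show "(a \<otimes>\<^bsub>ratring\<^esub> b) \<odot>\<^bsub>HH Q\<^esub> x = a \<odot>\<^bsub>HH Q\<^esub> (b \<odot>\<^bsub>HH Q\<^esub> x)"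
    by (rule poly_mapping_eqI) (simp add: lookup_scale_scale scale_scale)
  show "\<one>\<^bsub>ratring\<^esub> \<odot>\<^bsub>HH Q\<^esub> x = x" by (rule poly_mapping_eqI) (simp add: lookup_scale_scale)
qed

definition coha_corr :: "'v coha \<Rightarrow> 'v corr_fun" where
  "coha_corr h gs = pcorr (content gs) (lookup h (content gs)) gs"

lemma coha_corr_add: "h \<in> carrier (HH Q) \<Longrightarrow> k \<in> carrier (HH Q) \<Longrightarrow>
      coha_corr (h + k) gs = coha_corr h gs + coha_corr k gs"
  and coha_corr_scale: "h \<in> carrier (HH Q) \<Longrightarrow>
    coha_corr (Poly_Mapping.map (scaled c) h) gs = c * coha_corr h gs"
  by (simp_all add: coha_corr_def finite_vars_content HH_carrier lookup_add lookup_scale_scale pcorr_add pcorr_scale)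

lemma coha_corr_zero [simp]: "coha_corr 0 gs = 0" by (simp add: coha_corr_def finite_vars_content)

lemma coha_corr_nonzero:
  assumes "coha_corr h gs \<noteq> 0"
  shows "lookup h (content gs) \<noteq> 0" using assms by (auto simp: coha_corr_def finite_vars_content)

lemma coha_corr_symbols: "h \<in> carrier (HH Q) \<Longrightarrow> coha_corr h gs \<noteq> 0 \<Longrightarrow> is_word gs"
  using coha_corr_nonzero[of h gs] content_dimvecs[of gs] by (auto simp: HH_carrier)

lemma is_system_coha_corr:
  assumes "h \<in> carrier (HH Q)"
  shows "is_system (coha_corr h)"
proof -
  have "coha_corr h = (\<lambda>gs. \<Sum>d\<in>keys h. pcorr d (lookup h d) gs)"
  proof
    fix gs
    have "(\<Sum>d\<in>keys h. pcorr d (lookup h d) gs) = (\<Sum>d\<in>keys h. if d = content gs then coha_corr h gs else 0)"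
      by (intro sum.cong refl) (auto simp: coha_corr_def pcorr_content)
    then show "coha_corr h gs = (\<Sum>d\<in>keys h. pcorr d (lookup h d) gs)"
      using coha_corr_nonzero[of h gs] by (auto simp: in_keys_iff)
  qed
  moreover have "is_system (pcorr d (lookup h d))" if "d \<in> keys h" for d
    using assms that by (intro is_system_pcorr finite_vars_Q) (auto simp: HH_carrier in_keys_iff)
  ultimately show ?thesis using is_system_sum[of "keys h"] by simp
qed

lemma finite_grade_coha_corr:
  assumes "h \<in> carrier (HH Q)"
  shows "finite (grade ` {gs. coha_corr h gs \<noteq> 0})"
proof -
  have "finite (grade ` {gs. content gs = d \<and> coha_corr h gs \<noteq> 0})" if "d \<in> dimvecs Q" for d
  proof -
    have g: "lookup h d \<in> Lam d" using assms by (simp add: HH_carrier)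
    have fin: "finite (vars d)" by (rule finite_vars_Q[OF that])
    obtain B where B: "\<And>m. pcoef (vars d) (lookup h d) m \<noteq> 0 \<Longrightarrow> sum m (vars d) \<le> B"
      using pcoef_degree_bound[OF fin] g Lam_iff by metis
    \<comment> \<open>A polynomial has finitely many degrees, and by \<open>hdeg_charge\<close> they
      determine the cohomological degrees of its words.\<close>
    have "grade gs \<in> {ldim d} \<times> (\<lambda>k. - (2 * k + euler_form Q (ldim d) (ldim d))) ` {0..B}"
      if gs: "content gs = d" "coha_corr h gs \<noteq> 0" for gs
    proof -
      have "total gs + charge (map fst gs) \<in> {0..B}"
      proof (rule total_pcorr[OF fin g])
        show "sum m (vars d) \<in> {0..B}" if "pcoef (vars d) (lookup h d) m \<noteq> 0" for m
          using B[OF that] sum_nonneg[of "vars d" m] pcoef_nonneg[OF that] by simp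
        show "pcorr d (lookup h d) gs \<noteq> 0" using gs by (simp add: coha_corr_def)
      qed
      moreover have "hdeg gs = - (2 * (total gs + charge (map fst gs)) + euler_form Q (ldim d) (ldim d))"
        using hdeg_charge[of gs] gs(1) by simp
      ultimately have "hdeg gs \<in> (\<lambda>k. - (2 * k + euler_form Q (ldim d) (ldim d))) ` {0..B}"
        by (rule rev_image_eqI)
      then show ?thesis using gs(1) by (simp only: grade_def mem_Times_iff fst_conv snd_conv) simp
    qed
    then have "grade ` {gs. content gs = d \<and> coha_corr h gs \<noteq> 0}
        \<subseteq> {ldim d} \<times> (\<lambda>k. - (2 * k + euler_form Q (ldim d) (ldim d))) ` {0..B}" by blast
    then show ?thesis
      by (rule finite_subset) (intro finite_cartesian_product finite_imageI finite_atLeastAtMost_int finite.intros)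
  qed
  then have "finite (\<Union>d\<in>keys h. grade ` {gs. content gs = d \<and> coha_corr h gs \<noteq> 0})"
    using assms by (auto simp: HH_carrier in_keys_iff)
  then show ?thesis
    by (rule rev_finite_subset) (use coha_corr_nonzero in \<open>unfold in_keys_iff[symmetric], blast\<close>)
qed

lemma coha_corr_inj:
  assumes "h \<in> carrier (HH Q)" "k \<in> carrier (HH Q)" "coha_corr h = coha_corr k"
  shows "h = k"
proof (rule poly_mapping_eqI)
  fix d
  show "lookup h d = lookup k d"
  proof (cases "d \<in> dimvecs Q")
    case True
    show ?thesis
    proof (rule pcorr_inj[OF finite_vars_Q[OF True]])
      show "pcorr d (lookup h d) gs = pcorr d (lookup k d) gs"
        if "content gs = d" for gs using fun_cong[OF assms(3), of gs] that by (simp add: coha_corr_def)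
    qed (use assms in \<open>simp_all add: HH_carrier\<close>)
  qed (use assms in \<open>simp add: HH_carrier\<close>)
qed

lemma ldim_inj: "ldim d = ldim e \<Longrightarrow> d = e" by (simp add: ldim_def fun_eq_iff)

lemma coha_of_PPdual:
  assumes \<xi>: "\<xi> \<in> carrier PPdual"
  obtains h where "h \<in> carrier (HH Q)" "coha_corr h = corr \<xi>"
proof -
  define C where "C = content ` {gs. corr \<xi> gs \<noteq> 0}"
  have f: "functional \<xi>" and fin: "finite (grade ` {gs. corr \<xi> gs \<noteq> 0})" using \<xi> PPdual_carrier by blast+
  have "ldim ` C = fst ` grade ` {gs. corr \<xi> gs \<noteq> 0}" by (auto simp: C_def grade_def image_iff)
  then have "finite (ldim ` C)" using finite_imageI[OF fin, of fst] by (simp only:)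
  then have finC: "finite C" by (rule finite_imageD) (auto intro: inj_onI ldim_inj)
  have CQ: "C \<subseteq> dimvecs Q" using corr_nonzero content_dimvecs by (auto simp: C_def)
  \<comment> \<open>Finitely many graded parts bound \<open>hdeg\<close> from below, hence
    \<open>total\<close> from above on each content; this is the bound that
    \<open>system_poly\<close> asks for.\<close>
  have "bdd_below (snd ` grade ` {gs. corr \<xi> gs \<noteq> 0})" by (intro bdd_below_finite) (rule finite_imageI[OF fin])
  then obtain l where l: "\<And>gs. corr \<xi> gs \<noteq> 0 \<Longrightarrow> l \<le> hdeg gs" unfolding bdd_below_def by (auto simp: grade_def)
  have "\<exists>g. g \<in> Lam d \<and> (\<forall>gs. content gs = d \<longrightarrow> corr \<xi> gs = pcorr d g gs)" if d: "d \<in> C" for d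
  proof -
    obtain gs0 where gs0: "content gs0 = d" using d by (auto simp: C_def)
    have "total gs \<le> \<bar>diag gs0 - l\<bar>" if "content gs = d" "corr \<xi> gs \<noteq> 0" for gs
      using l[OF that(2)] diag_cong[of gs gs0] that(1) gs0 by (simp add: hdeg_def)
    then show ?thesis
      using system_poly[OF system_of_functional[OF f] finite_vars_Q, of d] d CQ by (metis subsetD)
  qed
  then obtain g where g: "\<And>d. d \<in> C \<Longrightarrow> g d \<in> Lam d"
    "\<And>d gs. d \<in> C \<Longrightarrow> content gs = d \<Longrightarrow> corr \<xi> gs = pcorr d (g d) gs" by metis
  define h where "h = (\<Sum>d\<in>C. single d (g d))"
  have h: "lookup h d = (if d \<in> C then g d else 0)" for d
    using finC by (simp add: h_def lookup_sum lookup_single when_def)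
  have "h \<in> carrier (HH Q)" using g(1) CQ by (auto simp: HH_carrier h Lam_zero)
  moreover have "coha_corr h gs = corr \<xi> gs" for gs
  proof (cases "content gs \<in> C")
    case True
    then show ?thesis using g(2)[OF True refl] by (simp only: coha_corr_def h if_True)
  next
    case False
    then have "corr \<xi> gs = 0" by (auto simp: C_def)
    then show ?thesis using False by (simp add: coha_corr_def h finite_vars_content)
  qed
  ultimately show ?thesis using that by (metis ext)
qed

lemma PPdual_of_coha:
  assumes "h \<in> carrier (HH Q)"
  obtains \<xi> where "\<xi> \<in> carrier PPdual" "corr \<xi> = coha_corr h"
  using PPdual_of_system[OF is_system_coha_corr[OF assms] coha_corr_symbols[OF assms] finite_grade_coha_corr[OF assms]]
  by blast

text \<open>One exact degree as the set \<open>D\<close> in \<open>total_pcorr\<close> and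
  \<open>degree_pcorr\<close> gives the two directions.\<close>

lemma HH_piece_corr:
  "h \<in> HH_piece Q \<alpha> n \<longleftrightarrow> h \<in> carrier (HH Q) \<and> (\<forall>gs. coha_corr h gs \<noteq> 0 \<longrightarrow> grade gs = (\<alpha>, - n))"
proof (intro iffI conjI)
  assume h: "h \<in> HH_piece Q \<alpha> n"
  show hc: "h \<in> carrier (HH Q)" using h by (simp add: HH_piece_def)
  show "\<forall>gs. coha_corr h gs \<noteq> 0 \<longrightarrow> grade gs = (\<alpha>, - n)"
  proof (intro allI impI)
    fix gs assume nz: "coha_corr h gs \<noteq> 0"
    define d where "d = content gs"
    define g where "g = lookup h d"
    have "d \<in> keys h" using coha_corr_nonzero[OF nz] by (simp add: d_def in_keys_iff)
    then have \<alpha>: "ldim d = \<alpha>" and g: "g \<in> Lam_piece d (n - euler_form Q (ldim d) (ldim d))"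
      using h by (auto simp: HH_piece_def g_def)
    have gL: "g \<in> Lam d" using g by (simp add: Lam_piece_def)
    have fin: "finite (vars d)" by (simp add: d_def finite_vars_content)
    have "total gs + charge (map fst gs) \<in> {k. 2 * k = n - euler_form Q (ldim d) (ldim d)}"
    proof (rule total_pcorr[OF fin gL])
      show "sum m (vars d) \<in> {k. 2 * k = n - euler_form Q (ldim d) (ldim d)}" if "pcoef (vars d) g m \<noteq> 0" for m
        using keys_degree_iff[OF fin, of g "\<lambda>k. 2 * k = n - euler_form Q (ldim d) (ldim d)"] g gL that
        by (auto simp: Lam_piece_def Lam_iff)
      show "pcorr d g gs \<noteq> 0" using nz by (simp add: coha_corr_def d_def g_def)
    qed
    then show "grade gs = (\<alpha>, - n)" using hdeg_charge[of gs] \<alpha> by (simp add: grade_def d_def)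
  qed
next
  assume *: "h \<in> carrier (HH Q) \<and> (\<forall>gs. coha_corr h gs \<noteq> 0 \<longrightarrow> grade gs = (\<alpha>, - n))"
  show "h \<in> HH_piece Q \<alpha> n" unfolding HH_piece_def
  proof (intro CollectI conjI ballI)
    fix d assume "d \<in> keys h"
    define g where "g = lookup h d"
    have g0: "g \<noteq> 0" and d: "d \<in> dimvecs Q" and gL: "g \<in> Lam d"
      using \<open>d \<in> _\<close> * by (auto simp: g_def HH_carrier in_keys_iff)
    have fin: "finite (vars d)" by (rule finite_vars_Q[OF d])
    have corr: "coha_corr h gs = pcorr d g gs" if "content gs = d" for gs
      using that by (simp add: coha_corr_def g_def)
    obtain gs where gs: "content gs = d" "pcorr d g gs \<noteq> 0" using pcorr_inj[OF fin gL Lam_zero] g0 fin by auto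
    then show "ldim d = \<alpha>" using * corr[of gs] by (auto simp: grade_def)
    obtain xs where ord: "ordering (vars d) xs" using exists_ordering[OF fin] by blast
    have deg: "2 * sum m (vars d) = n - euler_form Q (ldim d) (ldim d)" if nz: "pcoef (vars d) g m \<noteq> 0" for m
    proof -
      define c where "c = charge (map fst xs)"
      have "sum m (vars d) - c \<in> {k. 2 * (k + c) = n - euler_form Q (ldim d) (ldim d)}" unfolding c_def
      proof (rule degree_pcorr[OF fin gL ord _ nz])
        fix gs assume nz: "pcorr d g gs \<noteq> 0"
        then have cont: "content gs = d" using pcorr_content by blast
        have "content (word_of xs m) = content gs" using content_word_of[OF ord] cont by simp
        then have "charge (map fst gs) = charge (map fst xs)"
          using two_charge[of gs] two_charge[of "word_of xs m"] diag_cong[of gs "word_of xs m"]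
          by (simp add: map_fst_word_of)
        moreover have "hdeg gs = - n" using * corr[OF cont] nz by (simp add: grade_def)
        ultimately show "total gs \<in> {k. 2 * (k + charge (map fst xs)) = n - euler_form Q (ldim d) (ldim d)}"
          using hdeg_charge[of gs] cont by simp
      qed
      then show ?thesis by simp
    qed
    show "lookup h d \<in> Lam_piece d (n - euler_form Q (ldim d) (ldim d))"
      using keys_degree_iff[OF fin, of g "\<lambda>k. 2 * k = n - euler_form Q (ldim d) (ldim d)"] gL deg
      by (auto simp: Lam_piece_def Lam_iff g_def[symmetric])
  qed (use * in simp)
qed

definition coha_of :: "('v pfva \<Rightarrow> rat) \<Rightarrow> 'v coha" where
  "coha_of \<xi> = (THE h. h \<in> carrier (HH Q) \<and> coha_corr h = corr \<xi>)"

lemma coha_of: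
  assumes "\<xi> \<in> carrier PPdual"
  shows "coha_of \<xi> \<in> carrier (HH Q)" "coha_corr (coha_of \<xi>) = corr \<xi>"
proof -
  have "\<exists>!h. h \<in> carrier (HH Q) \<and> coha_corr h = corr \<xi>" using coha_of_PPdual[OF assms] coha_corr_inj by metis
  from theI'[OF this] show "coha_of \<xi> \<in> carrier (HH Q)" "coha_corr (coha_of \<xi>) = corr \<xi>"
    unfolding coha_of_def by blast+
qed

lemma lin_map_coha_of: "lin_map PPdual (HH Q) coha_of"
proof -
  interpret H: rat_space "HH Q" by (rule HH_space)
  show ?thesis unfolding lin_map_def
  proof (intro conjI ballI allI)
    show "coha_of \<in> carrier PPdual \<rightarrow> carrier (HH Q)" using coha_of(1) by blast
    fix \<xi> assume \<xi>: "\<xi> \<in> carrier PPdual"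
    have sc: "smult (HH Q) c (coha_of \<xi>) \<in> carrier (HH Q)" for c
      by (rule H.smult_closed_rat) (rule coha_of(1)[OF \<xi>])
    show "coha_of (c \<odot>\<^bsub>PPdual\<^esub> \<xi>) = c \<odot>\<^bsub>HH Q\<^esub> coha_of \<xi>" for c
    proof (rule coha_corr_inj)
      show "coha_corr (coha_of (c \<odot>\<^bsub>PPdual\<^esub> \<xi>)) = coha_corr (c \<odot>\<^bsub>HH Q\<^esub> coha_of \<xi>)"
        using coha_of[OF PPdual_scale[OF \<xi>, of c]] coha_of[OF \<xi>] corr_scale[of c \<xi>]
          coha_corr_scale[of "coha_of \<xi>" c] by (simp add: fun_eq_iff)
    qed (use coha_of(1)[OF PPdual_scale[OF \<xi>]] sc in simp_all)
    fix \<eta> assume \<eta>: "\<eta> \<in> carrier PPdual"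
    have ad: "add (HH Q) (coha_of \<xi>) (coha_of \<eta>) \<in> carrier (HH Q)" by (intro H.a_closed coha_of(1) \<xi> \<eta>)
    show "coha_of (\<xi> \<oplus>\<^bsub>PPdual\<^esub> \<eta>) = coha_of \<xi> \<oplus>\<^bsub>HH Q\<^esub> coha_of \<eta>"
    proof (rule coha_corr_inj)
      show "coha_corr (coha_of (\<xi> \<oplus>\<^bsub>PPdual\<^esub> \<eta>)) = coha_corr (coha_of \<xi> \<oplus>\<^bsub>HH Q\<^esub> coha_of \<eta>)"
        using coha_of[OF PPdual_add[OF \<xi> \<eta>]] coha_of[OF \<xi>] coha_of[OF \<eta>] corr_add[of \<xi> \<eta>]
          coha_corr_add[of "coha_of \<xi>" "coha_of \<eta>"] by (simp add: fun_eq_iff)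
    qed (use coha_of(1)[OF PPdual_add[OF \<xi> \<eta>]] ad in simp_all)
  qed
qed

lemma graded_iso_coha_of:
  "graded_iso PPdual (PPdual_piece) (HH Q) (HH_piece Q) coha_of" unfolding graded_iso_def
proof (intro conjI allI lin_map_coha_of)
  have surj: "\<exists>\<xi>. \<xi> \<in> carrier PPdual \<and> coha_of \<xi> = h \<and> corr \<xi> = coha_corr h" if h: "h \<in> carrier (HH Q)" for h
  proof -
    obtain \<xi> where \<xi>: "\<xi> \<in> carrier PPdual" "corr \<xi> = coha_corr h" using PPdual_of_coha[OF h] by blast
    then have "coha_of \<xi> = h" using coha_of[OF \<xi>(1)] coha_corr_inj h by metis
    then show ?thesis using \<xi> by blast
  qed
  have "inj_on coha_of (carrier PPdual)"
  proof (rule inj_onI)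
    fix \<xi> \<eta> assume *: "\<xi> \<in> carrier PPdual" "\<eta> \<in> carrier PPdual" "coha_of \<xi> = coha_of \<eta>"
    have "corr \<xi> = corr \<eta>" using coha_of(2)[OF *(1)] coha_of(2)[OF *(2)] *(3) by simp
    then show "\<xi> = \<eta>" by (rule PPdual_eqI[OF *(1,2)])
  qed
  then show "bij_betw coha_of (carrier PPdual) (carrier (HH Q))"
    unfolding bij_betw_def using surj coha_of(1) by blast
  fix \<alpha> n
  show "coha_of ` PPdual_piece \<alpha> n = HH_piece Q \<alpha> n"
  proof (intro equalityI subsetI)
    fix h assume "h \<in> coha_of ` PPdual_piece \<alpha> n"
    then show "h \<in> HH_piece Q \<alpha> n" using coha_of by (auto simp: PPdual_piece_iff HH_piece_corr)
  next
    fix h assume h: "h \<in> HH_piece Q \<alpha> n"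
    then obtain \<xi> where "\<xi> \<in> carrier PPdual" "coha_of \<xi> = h" "corr \<xi> = coha_corr h"
      using surj HH_piece_corr by blast
    then show "h \<in> coha_of ` PPdual_piece \<alpha> n" using h by (auto simp: PPdual_piece_iff HH_piece_corr)
  qed
qed

end

section \<open>The formula for F\<close>

lemma mset_pairs_nth:
  "mset (map (\<lambda>(k, l). (xs ! k, xs ! l)) [(k, l). l \<leftarrow> [0..<length xs], k \<leftarrow> [0..<l]]) = mset (pairs xs)"
proof (induction xs rule: rev_induct)
  case (snoc x xs)
  let ?P = "[(k, l). l \<leftarrow> [0..<length xs], k \<leftarrow> [0..<l]]"
  have 1: "map (\<lambda>(k, l). ((xs @ [x]) ! k, (xs @ [x]) ! l)) ?P = map (\<lambda>(k, l). (xs ! k, xs ! l)) ?P"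
    by (rule map_cong) (auto simp: nth_append)
  have 2: "map (\<lambda>k. ((xs @ [x]) ! k, x)) [0..<length xs] = map (\<lambda>y. (y, x)) xs"
    by (rule nth_equalityI) (simp_all add: nth_append)
  have 3: "mset (List.product xs [x]) = mset (map (\<lambda>y. (y, x)) xs)" by (induction xs) auto
  have "mset (map (\<lambda>(k, l). ((xs @ [x]) ! k, (xs @ [x]) ! l)) [(k, l). l \<leftarrow> [0..<length (xs @ [x])], k \<leftarrow> [0..<l]])
      = mset (map (\<lambda>(k, l). ((xs @ [x]) ! k, (xs @ [x]) ! l)) ?P) + mset (map (\<lambda>k. ((xs @ [x]) ! k, x)) [0..<length xs])"
    by (simp add: comp_def)
  also have "\<dots> = mset (pairs xs) + mset (map (\<lambda>y. (y, x)) xs)" unfolding 1 2 snoc.IH ..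
  also have "\<dots> = mset (pairs (xs @ [x]))" unfolding mset_pairs_append 3 by simp
  finally show ?case .
qed simp

lemma mult_diff_power_map:
  assumes "distinct xs" "k < l" "l < length xs"
  shows "mult_diff_power k l N g (map m xs) = diff_power (xs ! k) (xs ! l) N (\<lambda>m. g (map m xs)) m"
proof -
  have "(map m xs)[k := map m xs ! k - N + int r, l := map m xs ! l - int r]
      = map (m + shift_vec (xs ! k) (xs ! l) N r) xs" for r
  proof (rule nth_equalityI)
    fix i assume i: "i < length ((map m xs)[k := map m xs ! k - N + int r, l := map m xs ! l - int r])"
    have "xs ! i = xs ! k \<longleftrightarrow> i = k" "xs ! i = xs ! l \<longleftrightarrow> i = l"
      using nth_eq_iff_index_eq[OF assms(1)] i assms by auto
    then show "(map m xs)[k := map m xs ! k - N + int r, l := map m xs ! l - int r] ! i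
      = map (m + shift_vec (xs ! k) (xs ! l) N r) xs ! i"
      using i assms by (auto simp: nth_list_update shift_vec_def)
  qed simp
  then show ?thesis by (simp add: mult_diff_power_def diff_power_def diff_coeff_def)
qed

context lin_sym_quiver
begin

lemma ordering_var_list:
  assumes "d \<in> dimvecs Q"
  shows "ordering (vars d) (var_list Q d)"
proof -
  have "distinct (concat (map (\<lambda>j. map (\<lambda>k. (j, k)) [1..<d j + 1]) is))" if "distinct is" for "is" :: "'v list"
    using that by (induction "is") (auto simp: distinct_map inj_on_def)
  moreover have "set (var_list Q d) = vars d"
    using assms finite_verts by (force simp: var_list_def vars_def dimvecs_def)
  ultimately show ?thesis by (simp add: ordering_def var_list_def)
qed

lemma F_series_map:
  assumes "distinct (var_list Q d)"
  shows "F_series Q d \<xi> (map m (var_list Q d))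
    = diff_pows nu (map (\<lambda>(k, l). (var_list Q d ! k, var_list Q d ! l))
        [(k, l). l \<leftarrow> [0..<length (var_list Q d)], k \<leftarrow> [0..<l]])
      (\<lambda>m. correlator Q (map fst (var_list Q d)) \<xi> (map m (var_list Q d))) m"
proof -
  define xs where "xs = var_list Q d"
  have *: "foldr (\<lambda>(k, l). mult_diff_power k l (NN Q (map fst xs ! k) (map fst xs ! l))) L g (map m xs)
    = diff_pows nu (map (\<lambda>(k, l). (xs ! k, xs ! l)) L) (\<lambda>m. g (map m xs)) m"
    if "\<And>k l. (k, l) \<in> set L \<Longrightarrow> k < l \<and> l < length xs" for L g m using that
  proof (induction L arbitrary: m)
    case (Cons p L)
    obtain k l where p: "p = (k, l)" by (cases p)
    have kl: "k < l" "l < length xs" using Cons.prems[of k l] p by auto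
    define g' where "g' = foldr (\<lambda>(k, l). mult_diff_power k l (NN Q (map fst xs ! k) (map fst xs ! l))) L g"
    have "(\<lambda>m. g' (map m xs)) = diff_pows nu (map (\<lambda>(k, l). (xs ! k, xs ! l)) L) (\<lambda>m. g (map m xs))"
      unfolding g'_def by (intro ext Cons.IH Cons.prems) simp
    moreover have "NN Q (map fst xs ! k) (map fst xs ! l) = nu (xs ! k) (xs ! l)"
      using kl by (simp add: nu_def)
    ultimately show ?case using mult_diff_power_map[OF _ kl, of "nu (xs ! k) (xs ! l)" g' m] assms
      by (simp add: p g'_def xs_def)
  qed simp
  show ?thesis unfolding F_series_def Let_def xs_def[symmetric] length_map by (rule *) auto
qed

lemma poly_series_map:
  assumes "distinct xs"
  shows "poly_series xs g (map m xs) = pcoef (set xs) g m"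
proof -
  have "(\<Sum>k<length xs. single (xs ! k) (nat (map m xs ! k))) = (\<Sum>x\<in>set xs. single x (nat (m x)))"
    using sum.reindex_bij_betw[OF bij_betw_nth[OF assms refl refl], of "\<lambda>x. single x (nat (m x))"] by simp
  then show ?thesis by (simp add: poly_series_def pcoef_def monom_of_def)
qed

lemma is_F_coha_of: "is_F Q coha_of" unfolding is_F_def
proof (intro ballI conjI allI impI)
  fix d \<xi> assume d: "d \<in> dimvecs Q" and \<xi>: "\<xi> \<in> gdual_comp (PP Q) (PP_piece Q) (ldim d)"
  note \<xi>c = PPdual_comp(1)[OF \<xi>]
  note h = coha_of[OF \<xi>c]
  show "keys (coha_of \<xi>) \<subseteq> {d}"
  proof
    fix e assume "e \<in> keys (coha_of \<xi>)"
    then have nz: "lookup (coha_of \<xi>) e \<noteq> 0" by (simp add: in_keys_iff)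
    then have e: "e \<in> dimvecs Q" and L: "lookup (coha_of \<xi>) e \<in> Lam e" using h(1) by (auto simp: HH_carrier)
    have fin: "finite (vars e)" by (rule finite_vars_Q[OF e])
    obtain gs where gs: "content gs = e" "pcorr e (lookup (coha_of \<xi>) e) gs \<noteq> 0"
      using pcorr_inj[OF fin L Lam_zero] nz fin by auto
    then have "corr \<xi> gs \<noteq> 0" using fun_cong[OF h(2), of gs] by (simp add: coha_corr_def)
    then show "e \<in> {d}" using PPdual_comp(2)[OF \<xi>] gs(1) ldim_inj by blast
  qed
  fix ms :: "int list" assume len: "length ms = length (var_list Q d)"
  define xs where "xs = var_list Q d"
  have ord: "ordering (vars d) xs" using ordering_var_list[OF d] by (simp add: xs_def)
  then have dist: "distinct xs" and set: "set xs = vars d" by (auto simp: ordering_def)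
  \<comment> \<open>The variables are distinct, so a list of exponents is the same as a function on
    them.\<close>
  obtain m where m: "ms = map m xs"
  proof -
    have "ms = map (\<lambda>x. ms ! (THE i. i < length xs \<and> xs ! i = x)) xs"
    proof (rule nth_equalityI)
      fix i assume "i < length ms"
      then have i: "i < length xs" using len by (simp add: xs_def)
      have "(THE j. j < length xs \<and> xs ! j = xs ! i) = i"
        using nth_eq_iff_index_eq[OF dist] i by (intro the_equality) auto
      then show "ms ! i = map (\<lambda>x. ms ! (THE i. i < length xs \<and> xs ! i = x)) xs ! i" using i by simp
    qed (use len in \<open>simp add: xs_def\<close>)
    then show thesis by (rule that)
  qed
  define g where "g = lookup (coha_of \<xi>) d"
  have g: "g \<in> Lam d" using h(1) by (simp add: g_def HH_carrier)
  have corr: "correlator Q (map fst xs) \<xi> (map m xs) = pcorr d g (word_of xs m)" for m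
  proof -
    have w: "word_of xs m = zip (map fst xs) (map (\<lambda>a. - a - 1) (map m xs))"
      by (simp add: word_of_def zip_map_map zip_same_conv_map comp_def)
    have cont: "content (word_of xs m) = d" by (rule content_word_of[OF ord])
    then have "set (word_of xs m) \<subseteq> symbols Q" using content_dimvecs d by metis
    then have "corr \<xi> (word_of xs m) = correlator Q (map fst xs) \<xi> (map m xs)"
      by (simp add: corr_def correlator_def w)
    then show ?thesis using fun_cong[OF h(2), of "word_of xs m"] cont by (simp add: coha_corr_def g_def)
  qed
  have "F_series Q d \<xi> (map m xs) = diff_pows nu (map (\<lambda>(k, l). (xs ! k, xs ! l))
      [(k, l). l \<leftarrow> [0..<length xs], k \<leftarrow> [0..<l]]) (\<lambda>m. pcorr d g (word_of xs m)) m"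
    using F_series_map[of d \<xi> m] dist by (simp add: xs_def[symmetric] corr)
  \<comment> \<open>\<open>F_series\<close> sorts the factors by their later position,
    \<open>pairs\<close> by the earlier one; bounded support makes the order immaterial.\<close>
  also have "\<dots> = diff_pows nu (pairs xs) (\<lambda>m. pcorr d g (word_of xs m)) m"
  proof (rule fun_cong[where x = m], rule diff_pows_mset[OF mset_pairs_nth])
    show "bdd_support (upsets xs) (\<lambda>m. pcorr d g (word_of xs m))"
      using familyD(1)[OF family_pcoef[OF finite_vars_Q[OF d] g] ord]
        pcorr_word[OF finite_vars_Q[OF d] g ord] by (simp add: fun_eq_iff[symmetric])
    show "precedes (upsets xs) x y" if "(x, y) \<in> set (map (\<lambda>(k, l). (xs ! k, xs ! l))
      [(k, l). l \<leftarrow> [0..<length xs], k \<leftarrow> [0..<l]])" for x y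
      using that mset_eq_setD[OF mset_pairs_nth[of xs]] by (intro precedes_upsets[OF dist]) simp
  qed
  also have "\<dots> = pcoef (vars d) g m" using pcoef_from_corr[OF finite_vars_Q[OF d] g ord] by simp
  also have "\<dots> = poly_series xs g (map m xs)" using poly_series_map[OF dist, of g m] set by simp
  finally show "poly_series (var_list Q d) (lookup (coha_of \<xi>) d) ms = F_series Q d \<xi> ms"
    unfolding m by (simp add: xs_def g_def)
qed

end

section \<open>The framed quotient\<close>

text \<open>
  A vector space of functions on which finitely many functionals separate has dual bases consisting of
  points and functions. The functions are indexed by \<open>V\<close>, so that no subspace of a carrier is needed.
\<close>

lemma dual_points:
  fixes ev :: "'b \<Rightarrow> 's \<Rightarrow> rat" and \<kappa> :: "'k \<Rightarrow> 'b \<Rightarrow> rat"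
  assumes "finite K" and "\<And>u v c. u \<in> V \<Longrightarrow> v \<in> V \<Longrightarrow>
      \<exists>w\<in>V. (\<forall>s. ev w s = ev u s + c * ev v s) \<and> (\<forall>k. \<kappa> k w = \<kappa> k u + c * \<kappa> k v)"
    and "\<And>v s. v \<in> V \<Longrightarrow> (\<And>k. k \<in> K \<Longrightarrow> \<kappa> k v = 0) \<Longrightarrow> ev v s = 0"
  shows "\<exists>ps. (\<forall>p\<in>set ps. snd p \<in> V) \<and> (\<forall>v\<in>V. \<forall>s. ev v s = (\<Sum>p\<leftarrow>ps. ev v (fst p) * ev (snd p) s))" using assms
proof (induction K arbitrary: V rule: finite_induct)
  case empty
  then show ?case by (intro exI[of _ "[]"]) simp
next
  case (insert k K)
  show ?case
  proof (cases "\<forall>v\<in>V. (\<forall>k\<in>K. \<kappa> k v = 0) \<longrightarrow> (\<forall>s. ev v s = 0)")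
    case True
    show ?thesis by (rule insert.IH[OF insert.prems(1)]) (use True in blast)+
  next
    case False
    then obtain v0 t where v0: "v0 \<in> V" "\<And>k. k \<in> K \<Longrightarrow> \<kappa> k v0 = 0" and t: "ev v0 t \<noteq> 0" by blast
    have k0: "\<kappa> k v0 \<noteq> 0" using insert.prems(2)[OF v0(1)] v0(2) t by blast
    \<comment> \<open>On functions vanishing at \<open>t\<close> the functionals in \<open>K\<close>
      suffice: a multiple of \<open>v0\<close> can be added to make \<open>\<kappa> k\<close> vanish
      as well, and the value at \<open>t\<close> forces the multiple to be 0.\<close>
    define V' where "V' = {v \<in> V. ev v t = 0}"
    have "\<exists>ps. (\<forall>p\<in>set ps. snd p \<in> V') \<and> (\<forall>v\<in>V'. \<forall>s. ev v s = (\<Sum>p\<leftarrow>ps. ev v (fst p) * ev (snd p) s))"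
    proof (rule insert.IH)
      fix u v c assume "u \<in> V'" "v \<in> V'"
      then show "\<exists>w\<in>V'. (\<forall>s. ev w s = ev u s + c * ev v s) \<and> (\<forall>k. \<kappa> k w = \<kappa> k u + c * \<kappa> k v)"
        using insert.prems(1)[of u v c] by (auto simp: V'_def)
    next
      fix v s assume v: "v \<in> V'" and zero: "\<And>k. k \<in> K \<Longrightarrow> \<kappa> k v = 0"
      define c where "c = - (\<kappa> k v / \<kappa> k v0)"
      obtain w where w: "w \<in> V" "\<And>s. ev w s = ev v s + c * ev v0 s" "\<And>k. \<kappa> k w = \<kappa> k v + c * \<kappa> k v0"
        using insert.prems(1)[of v v0 c] v v0(1) by (auto simp: V'_def)
      have "\<kappa> k' w = 0" if "k' \<in> insert k K" for k' using that w(3) zero v0(2) k0 by (auto simp: c_def)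
      then have 0: "ev w s = 0" for s using insert.prems(2)[OF w(1)] by blast
      then have "c = 0" using w(2)[of t] v t by (simp add: V'_def)
      then show "ev v s = 0" using w(2)[of s] 0 by simp
    qed
    then obtain ps where ps: "\<And>p. p \<in> set ps \<Longrightarrow> snd p \<in> V'"
      "\<And>v s. v \<in> V' \<Longrightarrow> ev v s = (\<Sum>p\<leftarrow>ps. ev v (fst p) * ev (snd p) s)" by blast
    have "\<exists>w\<in>V. \<forall>s. ev w s = ev v0 s - (\<Sum>p\<leftarrow>qs. ev v0 (fst p) * ev (snd p) s)" if "set qs \<subseteq> set ps" for qs
      using that
    proof (induction qs)
      case Nil
      then show ?case using v0(1) by auto
    next
      case (Cons q qs)
      then obtain w where "w \<in> V"
        and w: "\<And>s. ev w s = ev v0 s - (\<Sum>p\<leftarrow>qs. ev v0 (fst p) * ev (snd p) s)" by auto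
      moreover have "snd q \<in> V" using ps(1)[of q] Cons.prems by (simp add: V'_def)
      ultimately obtain w' where "w' \<in> V" "\<And>s. ev w' s = ev w s + - ev v0 (fst q) * ev (snd q) s"
        using insert.prems(1)[of w "snd q" "- ev v0 (fst q)"] by blast
      then show ?case using w by (intro bexI[of _ w']) simp_all
    qed
    then obtain w0 where w0: "w0 \<in> V" "\<And>s. ev w0 s = ev v0 s - (\<Sum>p\<leftarrow>ps. ev v0 (fst p) * ev (snd p) s)" by blast
    \<comment> \<open>The new basis function is \<open>w0 / ev v0 t\<close>, written as
      \<open>w0 + (1 / ev v0 t - 1) w0\<close> since the hypothesis provides sums of this
      form.\<close>
    obtain w1 where w1: "w1 \<in> V" "\<And>s. ev w1 s = ev w0 s + (1 / ev v0 t - 1) * ev w0 s"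
      using insert.prems(1)[OF w0(1) w0(1)] by blast
    have "ev v s = (\<Sum>p\<leftarrow>(t, w1) # ps. ev v (fst p) * ev (snd p) s)" if v: "v \<in> V" for v s
    proof -
      define c where "c = - (ev v t / ev v0 t)"
      obtain w where w: "w \<in> V" "\<And>s. ev w s = ev v s + c * ev v0 s"
        using insert.prems(1)[OF v v0(1), of c] by blast
      then have "w \<in> V'" using t by (simp add: V'_def c_def)
      then have "ev v s + c * ev v0 s = (\<Sum>p\<leftarrow>ps. (ev v (fst p) + c * ev v0 (fst p)) * ev (snd p) s)"
        using ps(2)[of w s] w(2) by simp
      also have "\<dots> = (\<Sum>p\<leftarrow>ps. ev v (fst p) * ev (snd p) s) + c * (\<Sum>p\<leftarrow>ps. ev v0 (fst p) * ev (snd p) s)"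
        by (simp add: sum_list_addf[symmetric] sum_list_const_mult[symmetric] algebra_simps)
      finally have "ev v s = (\<Sum>p\<leftarrow>ps. ev v (fst p) * ev (snd p) s) - c * ev w0 s"
        using arg_cong[OF w0(2)[of s], of "(*) c"] unfolding right_diff_distrib by linarith
      moreover have "- c * ev w0 s = ev v t * ev w1 s" using w1(2)[of s] t by (simp add: c_def field_simps)
      ultimately show ?thesis by simp
    qed
    moreover have "\<forall>p\<in>set ((t, w1) # ps). snd p \<in> V" using w1(1) ps(1) by (auto simp: V'_def)
    ultimately show ?thesis by blast
  qed
qed

lemma pcoef_times_var_power:
  assumes "finite X" "x \<in> X" "poly_in X p"
  shows "pcoef X (p * var x ^ n) m = pcoef X p (m(x := m x - int n)) \<and> poly_in X (p * var x ^ n)"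
proof (induction n arbitrary: m)
  case 0
  then show ?case using assms(3) by simp
next
  case (Suc n)
  have p: "poly_in X (p * var x ^ n)" using Suc by blast
  have eq: "p * var x ^ Suc n = (p * var x ^ n) * var x" by (simp add: mult_ac)
  have "pcoef X (p * var x ^ n * var x) m = pcoef X (p * var x ^ n) (m(x := m x - 1))"
    by (rule pcoef_times_var[OF assms(1,2) p])
  also have "\<dots> = pcoef X p ((m(x := m x - 1))(x := (m(x := m x - 1)) x - int n))" using Suc by blast
  also have "(m(x := m x - 1))(x := (m(x := m x - 1)) x - int n) = m(x := m x - int (Suc n))"
    by (simp only: fun_upd_upd) (simp add: algebra_simps)
  finally show ?case unfolding eq using poly_in_times[OF p poly_in_var[OF assms(2)]] by blast
qed

lemma pcoef_times_prod_var:
  assumes "finite X" "Y \<subseteq> X" "poly_in X p"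
  shows "pcoef X (p * (\<Prod>x\<in>Y. var x ^ c x)) m = pcoef X p (\<lambda>x. if x \<in> Y then m x - int (c x) else m x)
    \<and> poly_in X (p * (\<Prod>x\<in>Y. var x ^ c x))" using finite_subset[OF assms(2,1)] assms(2)
proof (induction Y arbitrary: m rule: finite_induct)
  case empty
  then show ?case using assms(3) by simp
next
  case (insert y Y)
  define q where "q = p * (\<Prod>x\<in>Y. var x ^ c x)"
  have eq: "p * (\<Prod>x\<in>insert y Y. var x ^ c x) = q * var y ^ c y" using insert.hyps by (simp add: q_def mult_ac)
  have q: "poly_in X q" and IH: "pcoef X q m = pcoef X p (\<lambda>x. if x \<in> Y then m x - int (c x) else m x)" for m
    using insert by (auto simp: q_def)
  have "(\<lambda>x. if x \<in> Y then (m(y := m y - int (c y))) x - int (c x) else (m(y := m y - int (c y))) x)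
      = (\<lambda>x. if x \<in> insert y Y then m x - int (c x) else m x)" using insert.hyps by (auto simp: fun_eq_iff)
  then show ?case unfolding eq using pcoef_times_var_power[OF assms(1) _ q, of y "c y" m] insert.prems
    by (simp add: IH)
qed

lemma diff_pows_translate:
  "diff_pows \<nu> L (\<lambda>m. f (\<lambda>x. m x - c x)) = (\<lambda>m. diff_pows \<nu> L f (\<lambda>x. m x - c x))"
proof (induction L)
  case (Cons p L)
  obtain x y where p: "p = (x, y)" by (cases p)
  have "(\<lambda>z. (m + shift_vec x y n r) z - c z) = (\<lambda>z. m z - c z) + shift_vec x y n r" for m n r
    by (simp add: fun_eq_iff)
  then show ?case unfolding p diff_pows_Cons Cons.IH by (intro ext) (simp only: diff_power_def)
qed simp

lemma card_fst_eq_count_list: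
  "distinct xs \<Longrightarrow> card {l. (i, l) \<in> set xs} = count_list (map fst xs) i"
proof (induction xs)
  case (Cons x xs)
  have fin: "finite {l. (i, l) \<in> set xs}" by (rule finite_surj[of "set xs" _ snd]) (force simp: image_iff)+
  show ?case
  proof (cases "fst x = i")
    case True
    then have "{l. (i, l) \<in> set (x # xs)} = insert (snd x) {l. (i, l) \<in> set xs}" by (cases x) auto
    moreover have "snd x \<notin> {l. (i, l) \<in> set xs}" using Cons.prems True by (cases x) auto
    ultimately show ?thesis using Cons True fin by simp
  next
    case False
    then have "{l. (i, l) \<in> set (x # xs)} = {l. (i, l) \<in> set xs}" by (cases x) auto
    then show ?thesis using Cons False by simp
  qed
qed simp

lemma card_vars_content: "card (vars (content gs)) = length gs"
proof -
  obtain xs m where xs: "ordering (vars (content gs)) xs" "gs = word_of xs m" by (rule word_representation)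
  then have "length gs = length xs" by (simp add: word_of_def)
  then show ?thesis using xs(1) distinct_card by (metis ordering_def)
qed

definition framed :: "('v \<Rightarrow> nat) \<Rightarrow> ('v \<times> int) set" where
  "framed w = {(i, n). - int (w i) \<le> n}"

definition raise_word :: "('v \<Rightarrow> int) \<Rightarrow> ('v \<times> int) list \<Rightarrow> ('v \<times> int) list" where
  "raise_word c gs = map (\<lambda>g. (fst g, snd g + c (fst g))) gs"

abbreviation "framed_word w gs \<equiv> set gs \<subseteq> framed w"
abbreviation "lower_word w \<equiv> raise_word (\<lambda>i. - int (w i))"

lemma raise_word_simps [simp]:
  "raise_word c [] = []" "raise_word c (g # gs) = (fst g, snd g + c (fst g)) # raise_word c gs"
  "raise_word c (gs @ hs) = raise_word c gs @ raise_word c hs" "length (raise_word c gs) = length gs"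
  by (simp_all add: raise_word_def)

lemma content_raise_word [simp]: "content (raise_word c gs) = content gs"
  by (simp add: content_def raise_word_def comp_def)

lemma raise_word_inverse: "(\<And>i. c i + c' i = 0) \<Longrightarrow> raise_word c (raise_word c' gs) = gs"
  by (induction gs) (simp_all add: add.assoc add.commute[of "c' _"])

context lin_sym_quiver
begin

lemma vars_Sigma: "d \<in> dimvecs Q \<Longrightarrow> vars d = Sigma (verts Q) (\<lambda>i. {1..d i})"
  unfolding vars_def dimvecs_def by force

lemma euler_class_prod:
  assumes "d \<in> dimvecs Q"
  shows "euler_class Q w d = (\<Prod>x\<in>vars d. var x ^ w (fst x))"
proof -
  have "(\<Prod>x\<in>Sigma (verts Q) (\<lambda>i. {1..d i}). var x ^ w (fst x))
      = (\<Prod>i\<in>verts Q. \<Prod>k\<in>{1..d i}. var (i, k) ^ w i :: 'v mpoly)"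
    using prod.Sigma[OF finite_verts, of "\<lambda>i. {1..d i}" "\<lambda>i k. var (i, k) ^ w i"]
    by (simp add: case_prod_unfold)
  then show ?thesis unfolding euler_class_def vars_Sigma[OF assms] by simp
qed

lemma pcoef_euler_class:
  assumes "d \<in> dimvecs Q" "poly_in (vars d) f"
  shows "pcoef (vars d) (euler_class Q w d * f) m = pcoef (vars d) f (\<lambda>x. m x - int (w (fst x)))"
    "poly_in (vars d) (euler_class Q w d * f)"
proof -
  have eq: "euler_class Q w d * f = f * (\<Prod>x\<in>vars d. var x ^ w (fst x))"
    by (simp add: euler_class_prod[OF assms(1)] mult.commute)
  note P = pcoef_times_prod_var[OF finite_vars_Q[OF assms(1)] order.refl assms(2), of "\<lambda>x. w (fst x)"]
  show "poly_in (vars d) (euler_class Q w d * f)" unfolding eq using P by blast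
  have "pcoef (vars d) f (\<lambda>x. if x \<in> vars d then m x - int (w (fst x)) else m x)
      = pcoef (vars d) f (\<lambda>x. m x - int (w (fst x)))"
    using depends_on_pcoef[of "vars d" f] unfolding depends_on_def by simp
  then show "pcoef (vars d) (euler_class Q w d * f) m = pcoef (vars d) f (\<lambda>x. m x - int (w (fst x)))"
    unfolding eq using P by simp
qed

lemma euler_class_Lam:
  assumes "d \<in> dimvecs Q" "f \<in> Lam d"
  shows "euler_class Q w d * f \<in> Lam d"
proof -
  have f: "poly_in (vars d) f"
    and sym: "\<And>\<tau> m. colour_sym (vars d) \<tau> \<Longrightarrow> pcoef (vars d) f (m \<circ> \<tau>) = pcoef (vars d) f m"
    using assms(2) unfolding Lam_iff_pcoef[OF finite_vars_Q[OF assms(1)]] by blast+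
  have "pcoef (vars d) f (\<lambda>x. (m \<circ> \<tau>) x - int (w (fst x))) = pcoef (vars d) f (\<lambda>x. m x - int (w (fst x)))"
    if "colour_sym (vars d) \<tau>" for \<tau> m
    using sym[OF that, of "\<lambda>x. m x - int (w (fst x))"] colour_sym_fst[OF that] by (simp add: comp_def)
  then show ?thesis unfolding Lam_iff_pcoef[OF finite_vars_Q[OF assms(1)]]
    using pcoef_euler_class[OF assms(1) f] by simp
qed

text \<open>Multiplication by \<open>x^w\<close> lowers by \<open>w\<close> the exponents at which
  \<open>f\<close> is read, and \<open>n = -m - 1\<close> turns this into raised modes.\<close>

lemma pcorr_euler_class:
  assumes d: "d \<in> dimvecs Q" and f: "f \<in> Lam d"
  shows "pcorr d (euler_class Q w d * f) gs = pcorr d f (raise_word (\<lambda>i. int (w i)) gs)"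
proof (cases "content gs = d")
  case True
  then obtain xs m where xs: "ordering (vars d) xs" and gs: "gs = word_of xs m"
    using word_representation[of gs] by metis
  have r: "raise_word (\<lambda>i. int (w i)) gs = word_of xs (\<lambda>x. m x - int (w (fst x)))"
    by (simp add: gs raise_word_def word_of_def)
  have fp: "poly_in (vars d) f" using f Lam_iff by blast
  show ?thesis unfolding r unfolding gs pcorr_word[OF finite_vars_Q[OF d] euler_class_Lam[OF d f] xs]
      pcorr_word[OF finite_vars_Q[OF d] f xs] expansion_def pcoef_euler_class(1)[OF d fp, abs_def]
    by (simp only: diff_pows_translate[of _ _ "pcoef (vars d) f"])
next
  case False
  then show ?thesis by (simp add: pcorr_content)
qed

text \<open>A last mode \<open>n \<ge> -w\<close> is raised to a non-negative one, where the vacuum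
  condition gives 0.\<close>

lemma pcorr_euler_class_last:
  assumes d: "d \<in> dimvecs Q" and f: "f \<in> Lam d"
    and nz: "pcorr d (euler_class Q w d * f) (gs @ [g]) \<noteq> 0"
  shows "g \<notin> framed w"
proof
  assume "g \<in> framed w"
  then have "0 \<le> snd g + int (w (fst g))" by (auto simp: framed_def)
  then have "pcorr d f (raise_word (\<lambda>i. int (w i)) gs @ [(fst g, snd g + int (w (fst g)))]) = 0"
    using is_system_pcorr[OF finite_vars_Q[OF d] f] unfolding is_system_def by blast
  then show False using nz by (simp add: pcorr_euler_class[OF d f])
qed

text \<open>
  The subword on which the right factor is evaluated cannot end in \<open>b\<close>, so by its length it is \<open>a\<close>;
  no letter of the left factor precedes it, hence there is no sign.
\<close>

lemma prefix_product:
  assumes d: "d \<in> dimvecs Q" and e: "e \<in> dimvecs Q" "e \<noteq> 0" and \<eta>: "\<eta> \<in> Lam d" and u: "u \<in> Lam e"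
    and b: "framed_word w b" and len: "length a \<le> card (vars e)"
  shows "pcorr (d + e) (shuffle_prod Q d e \<eta> (euler_class Q w e * u)) (a @ b)
    = (if content a = e then pcorr d \<eta> b * pcorr e (euler_class Q w e * u) a else 0)"
proof (cases "content (a @ b) = d + e")
  case False
  then have "content a = e \<Longrightarrow> content b \<noteq> d" by (metis content_append add.commute)
  then show ?thesis using pcorr_content[OF False] pcorr_content[of b d \<eta>] by simp
next
  case True
  define \<zeta> where "\<zeta> = euler_class Q w e * u"
  have \<zeta>: "\<zeta> \<in> Lam e" unfolding \<zeta>_def by (rule euler_class_Lam[OF e(1) u])
  interpret S: shuffle_data Q d e \<eta> \<zeta> by unfold_locales (use finite_dimvec d e \<eta> \<zeta> in auto)
  obtain xs m where xs: "ordering (vars (d + e)) xs" and ab: "a @ b = word_of xs m"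
    using word_representation[of "a @ b"] True by metis
  have dist: "distinct xs" and set: "set xs = vars (d + e)" using xs by (auto simp: ordering_def)
  define xa xb where "xa = take (length a) xs" and "xb = drop (length a) xs"
  have xab: "xs = xa @ xb" by (simp add: xa_def xb_def)
  have a: "word_of xa m = a"
    using arg_cong[OF ab, of "take (length a)"] by (simp add: xa_def word_of_def take_map)
  have wb: "word_of xb m = b"
    using arg_cong[OF ab, of "drop (length a)"] by (simp add: xb_def word_of_def drop_map)
  have lena: "length xa = length a" using arg_cong[OF a, of length] by (simp add: word_of_def)
  define T where "T \<pi> = S.shuffle_sign \<pi> xs * (pcorr d \<eta> (word_of (filter (\<lambda>x. x \<in> left_vars d \<pi>) xs) m) *
      pcorr e \<zeta> (word_of (filter (\<lambda>x. x \<notin> left_vars d \<pi>) xs) m))" for \<pi>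
  have sum: "pcorr (d + e) (shuffle_prod Q d e \<eta> \<zeta>) (a @ b) = (\<Sum>\<pi>\<in>shuffles_of d e. T \<pi>)"
    unfolding ab T_def using S.shuffle_prod_corr(2)[OF d e(1) xs] by simp
  have key: "left_vars d \<pi> = set xb \<and> content a = e" if \<pi>: "\<pi> \<in> shuffles_of d e" and nz: "T \<pi> \<noteq> 0" for \<pi>
  proof -
    define zs where "zs = filter (\<lambda>x. x \<notin> left_vars d \<pi>) xs"
    have nzz: "pcorr e \<zeta> (word_of zs m) \<noteq> 0" using nz by (simp add: T_def zs_def)
    then have cont: "content (word_of zs m) = e" using pcorr_content by blast
    then have "zs \<noteq> []" using e(2) by auto
    have zs: "zs = filter (\<lambda>x. x \<notin> left_vars d \<pi>) xa @ filter (\<lambda>x. x \<notin> left_vars d \<pi>) xb"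
      by (simp add: zs_def xab)
    have fb: "filter (\<lambda>x. x \<notin> left_vars d \<pi>) xb = []"
    proof (rule ccontr)
      assume ne: "filter (\<lambda>x. x \<notin> left_vars d \<pi>) xb \<noteq> []"
      obtain ys z where ys: "filter (\<lambda>x. x \<notin> left_vars d \<pi>) xb = ys @ [z]" using ne rev_exhaust by blast
      then have "z \<in> set xb" by (metis filter_is_subset in_set_conv_decomp subsetD)
      then have "(fst z, - m z - 1) \<in> set b" unfolding wb[symmetric] word_of_def by auto
      then have "(fst z, - m z - 1) \<in> framed w" using b by blast
      moreover have "(fst z, - m z - 1) \<notin> framed w"
        using nzz pcorr_euler_class_last[OF e(1) u, of w "word_of (filter (\<lambda>x. x \<notin> left_vars d \<pi>) xa @ ys) m"]
        unfolding zs ys \<zeta>_def by simp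
      ultimately show False by blast
    qed
    have "ordering (right_vars d e \<pi>) zs" unfolding zs_def by (rule S.filter_LV(2)[OF xs \<pi>])
    then have "length zs = card (right_vars d e \<pi>)" using distinct_card by (metis ordering_def)
    also have "\<dots> = card (vars e)"
      unfolding right_vars_def by (rule card_image) (use S.emb_inj(2)[OF \<pi>] in \<open>auto intro: inj_on_subset\<close>)
    finally have "length xa \<le> length (filter (\<lambda>x. x \<notin> left_vars d \<pi>) xa)" using len zs fb lena by simp
    then have fa: "\<forall>x\<in>set xa. x \<notin> left_vars d \<pi>"
      using length_filter_less[of _ xa "\<lambda>x. x \<notin> left_vars d \<pi>"] by (meson not_less)
    then have "zs = xa" using zs fb by simp
    then have "content a = e" using cont a by simp
    moreover have "left_vars d \<pi> = set xb"
      using fa fb shuffle_partition(1)[OF \<pi>] set by (auto simp: xab filter_empty_conv)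
    ultimately show ?thesis by blast
  qed
  show ?thesis
  proof (cases "content a = e")
    case False
    then have "T \<pi> = 0" if "\<pi> \<in> shuffles_of d e" for \<pi> using key[OF that] by blast
    then show ?thesis using sum False by (simp add: \<zeta>_def)
  next
    case cont: True
    have contb: "content b = d"
    proof -
      have "e + content b = e + d" using True cont by (simp add: content_append add.commute)
      then show ?thesis by (simp add: fun_eq_iff)
    qed
    \<comment> \<open>Conversely, since \<open>content b = d\<close>, there is a shuffle whose left
      variables are those of \<open>b\<close>; by \<open>key\<close> it is the only one that
      contributes.\<close>
    define S where "S i = {l. (i, l) \<in> set xb}" for i
    have "S i \<subseteq> {1..d i + e i}" for i
    proof
      fix l assume "l \<in> S i"
      then have "(i, l) \<in> vars (d + e)" using set unfolding S_def xab by auto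
      then show "l \<in> {1..d i + e i}" by (simp add: vars_def)
    qed
    moreover have "card (S i) = d i" for i using card_fst_eq_count_list[of xb i] dist contb
      by (simp add: S_def xab content_def wb[symmetric] map_fst_word_of fun_eq_iff)
    ultimately obtain \<pi> where \<pi>: "\<pi> \<in> shuffles_of d e" "\<And>i. \<pi> i ` {1..d i} = S i"
      using shuffle_exists[of S d e] by blast
    have LV: "left_vars d \<pi> = set xb"
    proof (rule Set.set_eqI)
      fix x :: "'v \<times> nat"
      obtain i l where "x = (i, l)" by (cases x)
      then show "x \<in> left_vars d \<pi> \<longleftrightarrow> x \<in> set xb"
        using left_vars_iff[of i l d \<pi>] \<pi>(2)[of i] by (simp add: S_def)
    qed
    have "(\<Sum>\<pi>\<in>shuffles_of d e. T \<pi>) = (\<Sum>\<pi>\<in>{\<pi>}. T \<pi>)"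
    proof (rule sum.mono_neutral_right)
      show "finite (shuffles_of d e)" by (rule S.finSh)
      show "\<forall>\<rho>\<in>shuffles_of d e - {\<pi>}. T \<rho> = 0" using key shuffle_unique[OF _ \<pi>(1)] LV by blast
    qed (use \<pi>(1) in simp)
    moreover have "S.shuffle_sign \<pi> xs = 1"
    proof -
      have "S.mix_sign \<pi> p = 1" if "p \<in> set (pairs xs)" for p
      proof -
        have "p \<in> set (pairs xa) \<union> set (pairs xb) \<union> set xa \<times> set xb"
          using that mset_pairs_append[of xa xb] by (metis set_mset_mset set_mset_union set_product xab)
        moreover have "set xa \<inter> set xb = {}" using dist xab by auto
        ultimately show ?thesis
          unfolding S.mix_sign_def LV using in_pairs_set[of "fst p" "snd p"] by (cases p) fastforce
      qed
      then have "map (S.mix_sign \<pi>) (pairs xs) = map (\<lambda>_. 1) (pairs xs)" by simp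
      then show ?thesis unfolding S.shuffle_sign_def by (simp only:) (simp add: map_replicate_const)
    qed
    moreover have "filter (\<lambda>x. x \<in> set xb) xs = xb" "filter (\<lambda>x. x \<notin> set xb) xs = xa"
      using dist unfolding xab by (auto simp: filter_empty_conv filter_id_conv)
    ultimately show ?thesis using sum cont a wb LV by (simp add: T_def \<zeta>_def)
  qed
qed

end

lemma shuffle_prod_zero: "shuffle_prod Q d e 0 g = 0" "shuffle_prod Q d e f 0 = 0"
proof -
  have "shuffle_sum Q d e 0 g = Fract 0 1" "shuffle_sum Q d e f 0 = Fract 0 1"
    by (simp_all add: shuffle_sum_def rename_def Zero_fract_def[symmetric])
  then show "shuffle_prod Q d e 0 g = 0" "shuffle_prod Q d e f 0 = 0"
    unfolding shuffle_prod_def by (simp_all only: Fract_one_inj the_eq_trivial)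
qed

context lin_sym_quiver
begin

lemma shuffle_prod_Lam:
  assumes "d \<in> dimvecs Q" "e \<in> dimvecs Q" "f \<in> Lam d" "g \<in> Lam e"
  shows "shuffle_prod Q d e f g \<in> Lam (d + e)"
proof -
  interpret shuffle_data Q d e f g by unfold_locales (use finite_dimvec assms in auto)
  show ?thesis by (rule shuffle_prod_corr(1)[OF assms(1,2)])
qed

lemma dimvecs_add: "d \<in> dimvecs Q \<Longrightarrow> e \<in> dimvecs Q \<Longrightarrow> d + e \<in> dimvecs Q" by (simp add: dimvecs_def)

lemma single_carrier: "d \<in> dimvecs Q \<Longrightarrow> g \<in> Lam d \<Longrightarrow> single d g \<in> carrier (HH Q)"
  by (auto simp: HH_carrier lookup_single when_def Lam_zero)

lemma HH_mult_single:
  "single d f \<otimes>\<^bsub>HH Q\<^esub> single e g = single (d + e) (shuffle_prod Q d e f g)"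
  by (simp add: HH_def shuffle_prod_zero)

lemma coha_corr_single: "finite (vars d) \<Longrightarrow> coha_corr (single d g) gs = pcorr d g gs"
  by (auto simp: coha_corr_def lookup_single when_def finite_vars_content pcorr_content)

text \<open>The image under \<open>F\<close> of the functionals that vanish on
  \<open>QQ_space Q w\<close>, that is, of the kernel of restriction.\<close>

definition framed_zero :: "('v \<Rightarrow> nat) \<Rightarrow> 'v coha set" where
  "framed_zero w = {h \<in> carrier (HH Q). \<forall>gs. framed_word w gs \<longrightarrow> coha_corr h gs = 0}"

lemma framed_zero_submodule: "submodule (framed_zero w) ratring (HH Q)"
proof -
  interpret H: rat_space "HH Q" by (rule HH_space)
  show ?thesis
  proof (rule H.submodule_rat_I)
    show "\<zero>\<^bsub>HH Q\<^esub> \<in> framed_zero w" using H.zero_closed by (simp add: framed_zero_def)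
    show "x \<oplus>\<^bsub>HH Q\<^esub> y \<in> framed_zero w" if "x \<in> framed_zero w" "y \<in> framed_zero w" for x y
      using that H.a_closed[of x y] by (auto simp: framed_zero_def coha_corr_add)
    show "c \<odot>\<^bsub>HH Q\<^esub> x \<in> framed_zero w" if "x \<in> framed_zero w" for c x
      using that H.smult_closed_rat[of x c] by (auto simp: framed_zero_def coha_corr_scale)
  qed (auto simp: framed_zero_def)
qed

definition MM_gens :: "('v \<Rightarrow> nat) \<Rightarrow> 'v coha set" where
  "MM_gens w = {h \<otimes>\<^bsub>HH Q\<^esub> single d (euler_class Q w d * f) | h d f.
        h \<in> carrier (HH Q) \<and> d \<in> dimvecs Q \<and> d \<noteq> 0 \<and> f \<in> Lam d}"

lemma MM_ideal_span: "MM_ideal Q w = lin_span (HH Q) (MM_gens w)" by (simp add: MM_ideal_def MM_gens_def)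

lemma MM_gens_framed_zero: "MM_gens w \<subseteq> framed_zero w"
proof
  fix x assume "x \<in> MM_gens w"
  then obtain h e f where x: "x = h \<otimes>\<^bsub>HH Q\<^esub> single e (euler_class Q w e * f)"
    and h: "h \<in> carrier (HH Q)" and e: "e \<in> dimvecs Q" "e \<noteq> 0" and f: "f \<in> Lam e"
    unfolding MM_gens_def by blast
  interpret H: rat_space "HH Q" by (rule HH_space)
  note Z = H.submodule_rat_D[OF framed_zero_submodule[of w]]
  have part: "single (d + e) (shuffle_prod Q d e (lookup h d) (euler_class Q w e * f)) \<in> framed_zero w"
    if "d \<in> keys h" for d
  proof -
    have d: "d \<in> dimvecs Q" "lookup h d \<in> Lam d" using h that by (auto simp: HH_carrier in_keys_iff)
    \<comment> \<open>The case of an empty prefix, whose content 0 differs from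
      \<open>e\<close>.\<close>
    have "pcorr (d + e) (shuffle_prod Q d e (lookup h d) (euler_class Q w e * f)) gs = 0"
      if "framed_word w gs" for gs using prefix_product[OF d(1) e d(2) f that, of "[]"] e(2) by simp
    then show ?thesis
      using single_carrier[OF dimvecs_add[OF d(1) e(1)] shuffle_prod_Lam[OF d(1) e(1) d(2) euler_class_Lam[OF e(1) f]]]
        finite_vars_Q[OF dimvecs_add[OF d(1) e(1)]] by (simp add: framed_zero_def coha_corr_single)
  qed
  define T where "T d = single (d + e) (shuffle_prod Q d e (lookup h d) (euler_class Q w e * f))" for d
  have "x = sum T (keys h)" unfolding x T_def by (simp add: HH_def shuffle_prod_zero)
  moreover have "sum T A \<in> framed_zero w" if "A \<subseteq> keys h" for A using finite_subset[OF that finite_keys] that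
  proof (induction A rule: finite_induct)
    case (insert a A)
    then show ?case using Z(3)[OF part[of a]] by (simp add: T_def[symmetric])
  qed (use Z(2) in simp)
  ultimately show "x \<in> framed_zero w" by auto
qed

lemma MM_ideal_submodule: "submodule (MM_ideal Q w) ratring (HH Q)"
proof -
  interpret H: rat_space "HH Q" by (rule HH_space)
  show ?thesis unfolding MM_ideal_span using MM_gens_framed_zero
    by (intro H.lin_span_submodule) (auto simp: framed_zero_def)
qed

lemma MM_ideal_framed_zero: "MM_ideal Q w \<subseteq> framed_zero w"
proof -
  interpret H: rat_space "HH Q" by (rule HH_space)
  show ?thesis unfolding MM_ideal_span by (rule H.lin_span_least[OF framed_zero_submodule MM_gens_framed_zero])
qed

lemma MM_ideal_product:
  assumes "d \<in> dimvecs Q" "e \<in> dimvecs Q" "e \<noteq> 0" "\<eta> \<in> Lam d" "u \<in> Lam e"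
  shows "single (d + e) (shuffle_prod Q d e \<eta> (euler_class Q w e * u)) \<in> MM_ideal Q w"
proof -
  interpret H: rat_space "HH Q" by (rule HH_space)
  have "single (d + e) (shuffle_prod Q d e \<eta> (euler_class Q w e * u)) \<in> MM_gens w"
    unfolding HH_mult_single[symmetric] MM_gens_def using assms single_carrier by blast
  then show ?thesis unfolding MM_ideal_span using H.lin_span_superset by blast
qed

lemma charge_cong:
  fixes gs hs :: "('v \<times> int) list"
  assumes "content gs = content hs"
  shows "charge (map fst gs) = charge (map fst hs)"
  using two_charge[of gs] two_charge[of hs] diag_cong[OF assms] assms by simp

lemma charge_content:
  assumes "finite (vars d)"
  obtains C where "\<And>gs :: ('v \<times> int) list. content gs = d \<Longrightarrow> charge (map fst gs) = C"
proof -
  obtain xs where xs: "ordering (vars d) xs" using exists_ordering[OF assms] by blast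
  have "charge (map fst gs) = charge (map fst (word_of xs (\<lambda>_. 0)))" if "content gs = d" for gs :: "('v \<times> int) list"
    using charge_cong[of gs "word_of xs (\<lambda>_. 0)"] content_word_of[OF xs] that by metis
  then show ?thesis using that by blast
qed

lemma pcorr_total_bound:
  assumes "finite (vars d)" "g \<in> Lam d"
  obtains B where "\<And>gs. pcorr d g gs \<noteq> 0 \<Longrightarrow> total gs \<le> B"
proof -
  obtain B where B: "\<And>m. pcoef (vars d) g m \<noteq> 0 \<Longrightarrow> sum m (vars d) \<le> B"
    using pcoef_degree_bound[OF assms(1)] assms(2) Lam_iff by metis
  obtain C where C: "\<And>gs :: ('v \<times> int) list. content gs = d \<Longrightarrow> charge (map fst gs) = C"
    using charge_content[OF assms(1)] by blast
  have "total gs \<le> B - C" if nz: "pcorr d g gs \<noteq> 0" for gs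
  proof -
    have "total gs + charge (map fst gs) \<in> {..B}" by (rule total_pcorr[OF assms _ nz]) (simp add: B)
    moreover have "content gs = d" using nz pcorr_content by blast
    ultimately show ?thesis using C by simp
  qed
  then show ?thesis using that by blast
qed

text \<open>Lowering modes by \<open>w\<close> corresponds to division by \<open>e^w\<close>: a last
  mode \<open>n \<ge> 0\<close> becomes one of \<open>X_w\<close>, so the hypothesis is the vacuum
  condition of the lowered function.\<close>

lemma is_system_lowered:
  assumes sys: "is_system \<Phi>" and vac: "\<And>us g. g \<in> framed w \<Longrightarrow> \<Phi> (lower_word w us @ g # b) = 0"
  shows "is_system (\<lambda>gs. \<Phi> (lower_word w gs @ b))" unfolding is_system_def
proof (intro conjI allI impI)
  fix us vs i j m n
  define us' vs' where "us' = lower_word w us" and "vs' = lower_word w vs @ b"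
  have "m - int k + - int (w i) = (m - int (w i)) - int k" "n + int k + - int (w j) = (n - int (w j)) + int k" for k
    by simp_all
  then show "(\<Sum>k\<le>nat (max (NN Q i j) 0). (-1) ^ k * of_nat (nat (max (NN Q i j) 0) choose k) *
        (\<Phi> (lower_word w (pair_word us i m j n vs k) @ b)
          - sgn_of (NN Q i j) * \<Phi> (lower_word w (swap_word us i m j n vs k) @ b))) = 0"
    using sys unfolding is_system_def raise_word_simps append_assoc append_Cons us'_def[symmetric] vs'_def[symmetric]
      fst_conv snd_conv by presburger
next
  fix us i and n :: int assume "0 \<le> n"
  then show "\<Phi> (lower_word w (us @ [(i, n)]) @ b) = 0"
    using vac[of "(i, n - int (w i))" us] by (simp add: framed_def)
qed

lemma total_lower_word: "total (lower_word w gs) \<ge> total gs" by (induction gs) (auto simp: total_def)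

end

section \<open>The induction on the length of the prefix\<close>

context lin_sym_quiver
begin

lemma card_vars_dimvec_pos:
  fixes e :: "'v \<Rightarrow> nat"
  shows "1 \<le> card (vars e) \<Longrightarrow> e \<noteq> 0"
proof
  assume "1 \<le> card (vars e)" "e = 0"
  moreover have "vars (0 :: 'v \<Rightarrow> nat) = {}" by (auto simp: vars_def)
  ultimately show False by simp
qed

text \<open>One step of the induction. From \<open>1 \<le> c\<close> the right factors of the
  corrections have nonzero dimension vectors, as the ideal requires.\<close>

context
  fixes w :: "'v \<Rightarrow> nat" and D :: "'v \<Rightarrow> nat" and G :: "'v mpoly" and c :: nat
  assumes D: "D \<in> dimvecs Q" and G: "G \<in> Lam D" and c: "1 \<le> c"
    and kill: "\<And>a b. length a < c \<Longrightarrow> framed_word w b \<Longrightarrow> pcorr D G (a @ b) = 0"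
begin

lemma finD: "finite (vars D)" by (rule finite_vars_Q[OF D])

text \<open>If a prefix ends in a letter of \<open>X_w\<close>, this letter can be counted to
  \<open>b\<close> and the rest is shorter than \<open>c\<close>; so the function of the prefix
  vanishes there and is divisible by \<open>e^w\<close>. The bound \<open>B\<close> must not depend
  on \<open>b\<close>: \<open>total\<close> is bounded above for \<open>G\<close>, and below on
  \<open>b\<close> by the charge, which depends only on \<open>d\<close>.\<close>

lemma prefix_functional:
  assumes d: "d \<in> dimvecs Q" and e: "e \<in> dimvecs Q" and de: "D = d + e" and ce: "card (vars e) = c"
  obtains B where "\<And>b. framed_word w b \<Longrightarrow> content b = d \<Longrightarrow>
    \<exists>u\<in>Lam e. (\<forall>m. pcoef (vars e) u m \<noteq> 0 \<longrightarrow> sum m (vars e) \<le> B) \<and>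
      (\<forall>a. pcorr D G (a @ b) = pcorr e (euler_class Q w e * u) a)"
proof -
  have fin: "finite (vars d)" "finite (vars e)" using d e finite_vars_Q by auto
  obtain B where B: "\<And>gs. pcorr D G gs \<noteq> 0 \<Longrightarrow> total gs \<le> B" using pcorr_total_bound[OF finD G] by blast
  obtain Cd where Cd: "\<And>gs :: ('v \<times> int) list. content gs = d \<Longrightarrow> charge (map fst gs) = Cd"
    using charge_content[OF fin(1)] by blast
  obtain ys where ys: "ordering (vars e) ys" using exists_ordering[OF fin(2)] by blast
  have "\<exists>u\<in>Lam e. (\<forall>m. pcoef (vars e) u m \<noteq> 0 \<longrightarrow> sum m (vars e) \<le> B + Cd + charge (map fst ys)) \<and>
      (\<forall>a. pcorr D G (a @ b) = pcorr e (euler_class Q w e * u) a)"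
    if b: "framed_word w b" and contb: "content b = d" for b
  proof -
    define \<Psi> where "\<Psi> gs = pcorr D G (lower_word w gs @ b)" for gs
    note sysG = is_system_pcorr[OF finD G]
    have cont: "content gs = e" if "pcorr D G (gs @ b) \<noteq> 0" for gs
    proof -
      have "content (gs @ b) = D" using that pcorr_content by blast
      then have "content gs + d = e + d" by (simp add: content_append contb de add.commute)
      then show ?thesis by (simp add: fun_eq_iff)
    qed
    have sys: "is_system \<Psi>" unfolding \<Psi>_def
    proof (rule is_system_lowered[OF sysG], rule ccontr)
      fix us g assume g: "g \<in> framed w"
        and nz: "pcorr D G (lower_word w us @ g # b) \<noteq> 0"
      then have "content (lower_word w us @ [g]) = e" using cont[of "lower_word w us @ [g]"] by simp
      then have "length (lower_word w us @ [g]) = c"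
        using card_vars_content[of "lower_word w us @ [g]"] ce by simp
      then have "length (lower_word w us) < c" by simp
      from kill[OF this, of "g # b"] show False using g b nz by simp
    qed
    have tot: "total gs \<le> B + Cd" if "\<Psi> gs \<noteq> 0" for gs
    proof -
      have "pcorr D G (lower_word w gs @ b) \<noteq> 0" using that by (simp add: \<Psi>_def)
      then have "total (lower_word w gs) + total b \<le> B"
        "- charge (map fst b) \<le> total b" using B[of "lower_word w gs @ b"]
          system_bound[OF system_prefix[OF sysG, of "lower_word w gs"], of b] by simp_all
      then show ?thesis using Cd[OF contb] total_lower_word[of gs w] by simp
    qed
    obtain u where u: "u \<in> Lam e" "\<And>gs. content gs = e \<Longrightarrow> \<Psi> gs = pcorr e u gs"
      using system_poly[OF sys fin(2), of "B + Cd"] tot by blast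
    have "pcorr D G (a @ b) = pcorr e (euler_class Q w e * u) a" for a
    proof (cases "content a = e")
      case True
      have "lower_word w (raise_word (\<lambda>i. int (w i)) a) = a" by (rule raise_word_inverse) simp
      then show ?thesis using u(2)[of "raise_word (\<lambda>i. int (w i)) a"] True
        by (simp add: pcorr_euler_class[OF e u(1)] \<Psi>_def)
    next
      case False
      then show ?thesis using cont[of a] by (auto simp: pcorr_content)
    qed
    moreover have "sum m (vars e) \<le> B + Cd + charge (map fst ys)" if nz: "pcoef (vars e) u m \<noteq> 0" for m
    proof -
      have "sum m (vars e) - charge (map fst ys) \<in> {..B + Cd}"
      proof (rule degree_pcorr[OF fin(2) u(1) ys _ nz])
        fix gs assume nz: "pcorr e u gs \<noteq> 0"
        then have "content gs = e" using pcorr_content by blast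
        then show "total gs \<in> {..B + Cd}" using tot[of gs] u(2)[of gs] nz by simp
      qed
      then show ?thesis by simp
    qed
    ultimately show ?thesis using u(1) by blast
  qed
  then show ?thesis using that by blast
qed

text \<open>Equality is demanded only for prefixes of length at most \<open>c\<close>; longer ones
  are left to later steps of the induction.\<close>

definition correctable :: "(('v \<times> int) list \<Rightarrow> 'v corr_fun) \<Rightarrow> bool" where
  "correctable f \<longleftrightarrow> (\<exists>R\<in>Lam D. single D R \<in> MM_ideal Q w \<and>
     (\<forall>a b. length a \<le> c \<longrightarrow> framed_word w b \<longrightarrow> pcorr D R (a @ b) = f a b))"

lemma correctable_zero: "correctable (\<lambda>a b. 0)"
  unfolding correctable_def using rat_space.submodule_rat_D(2)[OF HH_space MM_ideal_submodule]
  by (intro bexI[of _ 0]) (simp_all add: Lam_zero finD)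

lemma correctable_add:
  assumes "correctable f" "correctable g"
    and fg: "\<And>a b. length a \<le> c \<Longrightarrow> framed_word w b \<Longrightarrow> h a b = f a b + g a b"
  shows "correctable h"
proof -
  obtain R R' where R: "R \<in> Lam D" "single D R \<in> MM_ideal Q w"
      "\<And>a b. length a \<le> c \<Longrightarrow> framed_word w b \<Longrightarrow> pcorr D R (a @ b) = f a b"
    and R': "R' \<in> Lam D" "single D R' \<in> MM_ideal Q w"
      "\<And>a b. length a \<le> c \<Longrightarrow> framed_word w b \<Longrightarrow> pcorr D R' (a @ b) = g a b"
    using assms(1,2) unfolding correctable_def by blast
  have "single D (R + R') \<in> MM_ideal Q w"
    using rat_space.submodule_rat_D(3)[OF HH_space MM_ideal_submodule R(2) R'(2)] by (simp add: single_add)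
  then show ?thesis
    unfolding correctable_def using Lam_add[OF finD R(1) R'(1)] pcorr_add[OF finD R(1) R'(1)] R(3) R'(3) fg
    by (intro bexI[of _ "R + R'"]) auto
qed

text \<open>The functions \<open>a \<mapsto> G(a b)\<close> lie in a finite-dimensional space, so
  dual points \<open>t_p\<close> and functions \<open>u_p\<close> give \<open>G(a b)\<close> as the
  sum of \<open>G(t_p b)\<close> times the value of \<open>e^w u_p\<close> on \<open>a\<close>. Each
  \<open>b \<mapsto> G(t_p b)\<close> belongs to a polynomial \<open>\<eta>_p\<close>, and the
  products of \<open>\<eta>_p\<close> with \<open>e^w u_p\<close> form the correction.\<close>

lemma prefix_correction:
  assumes d: "d \<in> dimvecs Q" and e: "e \<in> dimvecs Q" and de: "D = d + e" and ce: "card (vars e) = c"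
  shows "correctable (\<lambda>a b. if content a = e then pcorr D G (a @ b) else 0)"
proof -
  have fin: "finite (vars d)" "finite (vars e)" using d e finite_vars_Q by auto
  have e0: "e \<noteq> 0" by (rule card_vars_dimvec_pos) (use c ce in simp)
  obtain B where B: "\<And>b. framed_word w b \<Longrightarrow> content b = d \<Longrightarrow>
    \<exists>u\<in>Lam e. (\<forall>m. pcoef (vars e) u m \<noteq> 0 \<longrightarrow> sum m (vars e) \<le> B) \<and>
      (\<forall>a. pcorr D G (a @ b) = pcorr e (euler_class Q w e * u) a)"
    using prefix_functional[OF d e de ce] by blast
  define V where "V = {u \<in> Lam e. \<forall>m. pcoef (vars e) u m \<noteq> 0 \<longrightarrow> sum m (vars e) \<le> B}"
  define L where "L u a = pcorr e (euler_class Q w e * u) a" for u a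
  \<comment> \<open>A finite box containing all non-negative exponents of degree at most
    \<open>B\<close>; the coefficients there determine an element of \<open>V\<close>.\<close>
  define K :: "('v \<times> nat \<Rightarrow> int) set" where
    "K = {m. \<forall>x. (x \<in> vars e \<longrightarrow> m x \<in> {0..B}) \<and> (x \<notin> vars e \<longrightarrow> m x = 0)}"
  have "\<exists>ps. (\<forall>p\<in>set ps. snd p \<in> V) \<and> (\<forall>v\<in>V. \<forall>s. L v s = (\<Sum>p\<leftarrow>ps. L v (fst p) * L (snd p) s))"
  proof (rule dual_points[where K = K and \<kappa> = "\<lambda>m u. pcoef (vars e) u m"])
    show "finite K" unfolding K_def by (rule finite_set_of_finite_funs[OF fin(2)]) simp
  next
    fix u v r assume "u \<in> V" "v \<in> V"
    then have uv: "u \<in> Lam e" "v \<in> Lam e" and deg: "\<And>m. pcoef (vars e) u m \<noteq> 0 \<Longrightarrow> sum m (vars e) \<le> B"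
      "\<And>m. pcoef (vars e) v m \<noteq> 0 \<Longrightarrow> sum m (vars e) \<le> B" by (auto simp: V_def)
    define x where "x = u + scaled r v"
    have rv: "scaled r v \<in> Lam e" by (rule Lam_scale[OF fin(2) uv(2)])
    have x: "x \<in> Lam e" unfolding x_def by (rule Lam_add[OF fin(2) uv(1) rv])
    have px: "pcoef (vars e) x m = pcoef (vars e) u m + r * pcoef (vars e) v m" for m
      by (simp add: x_def pcoef_add pcoef_scale)
    have "sum m (vars e) \<le> B" if "pcoef (vars e) x m \<noteq> 0" for m
      using deg(1)[of m] deg(2)[of m] px[of m] that by (cases "pcoef (vars e) u m = 0") simp_all
    then have "x \<in> V" using x by (simp add: V_def)
    moreover have "L x s = L u s + r * L v s" for s
      unfolding L_def pcorr_euler_class[OF e x] pcorr_euler_class[OF e uv(1)] pcorr_euler_class[OF e uv(2)]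
      using pcorr_add[OF fin(2) uv(1) rv] pcorr_scale[OF fin(2) uv(2)] by (simp add: x_def)
    ultimately show "\<exists>x\<in>V. (\<forall>s. L x s = L u s + r * L v s) \<and>
        (\<forall>m. pcoef (vars e) x m = pcoef (vars e) u m + r * pcoef (vars e) v m)" using px by blast
  next
    fix v s assume v: "v \<in> V" and zero: "\<And>m. m \<in> K \<Longrightarrow> pcoef (vars e) v m = 0"
    have "pcoef (vars e) v m = 0" for m
    proof (rule ccontr)
      assume nz: "pcoef (vars e) v m \<noteq> 0"
      define m' where "m' x = (if x \<in> vars e then m x else 0)" for x
      have eq: "pcoef (vars e) v m' = pcoef (vars e) v m"
        using depends_on_pcoef[of "vars e" v] unfolding depends_on_def m'_def by simp
      have pos: "0 \<le> m x" if "x \<in> vars e" for x using pcoef_nonneg[OF nz that] .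
      have "m x \<le> B" if "x \<in> vars e" for x
        using member_le_sum[OF that _ fin(2), of m] pos v nz by (force simp: V_def)
      then have "m' \<in> K" using pos by (simp add: K_def m'_def)
      then show False using zero eq nz by simp
    qed
    then have "v = 0" using pcoef_inj[OF fin(2), of v 0] v by (auto simp: V_def Lam_iff fun_eq_iff)
    then show "L v s = 0" by (simp add: L_def fin(2))
  qed
  then obtain ps where ps: "\<And>p. p \<in> set ps \<Longrightarrow> snd p \<in> V"
    and rep: "\<And>v s. v \<in> V \<Longrightarrow> L v s = (\<Sum>p\<leftarrow>ps. L v (fst p) * L (snd p) s)" by blast
  \<comment> \<open>With the prefix \<open>t\<close> held fixed, \<open>G\<close> still gives a
    system of bounded degree, hence a polynomial on words of content \<open>d\<close>.\<close>
  have "\<exists>\<eta>\<in>Lam d. \<forall>b. content b = d \<longrightarrow> pcorr D G (t @ b) = pcorr d \<eta> b" for t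
  proof -
    obtain B' where B': "\<And>gs. pcorr D G gs \<noteq> 0 \<Longrightarrow> total gs \<le> B'" using pcorr_total_bound[OF finD G] by blast
    have "total b \<le> B' - total t" if "pcorr D G (t @ b) \<noteq> 0" for b using B'[OF that] by simp
    then show ?thesis using system_poly[OF system_prefix[OF is_system_pcorr[OF finD G], of t] fin(1)] by metis
  qed
  then obtain \<eta> where \<eta>: "\<And>t. \<eta> t \<in> Lam d"
    "\<And>t b. content b = d \<Longrightarrow> pcorr D G (t @ b) = pcorr d (\<eta> t) b" by metis
  have "correctable (\<lambda>a b. if content a = e then \<Sum>p\<leftarrow>qs. pcorr d (\<eta> (fst p)) b * L (snd p) a else 0)"
    if "\<And>p. p \<in> set qs \<Longrightarrow> snd p \<in> V" for qs using that
  proof (induction qs)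
    case Nil
    show ?case by (rule correctable_add[OF correctable_zero correctable_zero]) simp
  next
    case (Cons q qs)
    have u: "snd q \<in> Lam e" using Cons.prems[of q] by (simp add: V_def)
    define R where "R = shuffle_prod Q d e (\<eta> (fst q)) (euler_class Q w e * snd q)"
    have "R \<in> Lam D" "single D R \<in> MM_ideal Q w" unfolding R_def de
      by (rule shuffle_prod_Lam[OF d e \<eta>(1) euler_class_Lam[OF e u]], rule MM_ideal_product[OF d e e0 \<eta>(1) u])
    moreover have "pcorr D R (a @ b) = (if content a = e then pcorr d (\<eta> (fst q)) b * L (snd q) a else 0)"
      if "length a \<le> c" "framed_word w b" for a b
      using prefix_product[OF d e e0 \<eta>(1) u that(2), of a] that(1) ce by (simp add: R_def de L_def)
    ultimately have "correctable (\<lambda>a b. if content a = e then pcorr d (\<eta> (fst q)) b * L (snd q) a else 0)"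
      unfolding correctable_def by blast
    then show ?case by (rule correctable_add[OF _ Cons.IH]) (use Cons.prems in auto)
  qed
  note corr = this[of ps, OF ps]
  have "(\<Sum>p\<leftarrow>ps. pcorr d (\<eta> (fst p)) b * L (snd p) a) = pcorr D G (a @ b)"
    if b: "framed_word w b" and a: "content a = e" for a b
  proof (cases "content b = d")
    case True
    obtain v where v: "v \<in> V" "\<And>a. pcorr D G (a @ b) = L v a" using B[OF b True] by (auto simp: V_def L_def)
    have "(\<Sum>p\<leftarrow>ps. pcorr d (\<eta> (fst p)) b * L (snd p) a) = (\<Sum>p\<leftarrow>ps. L v (fst p) * L (snd p) a)"
      by (simp only: \<eta>(2)[OF True, symmetric] v(2))
    then show ?thesis unfolding v(2) rep[OF v(1), of a] .
  next
    case False
    have "content (a @ b) \<noteq> D"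
    proof
      assume "content (a @ b) = D"
      then have "e + content b = e + d" by (simp add: content_append a de add.commute)
      then show False using False by (simp add: fun_eq_iff)
    qed
    then show ?thesis using False by (simp add: pcorr_content)
  qed
  then show ?thesis by (intro correctable_add[OF corr correctable_zero]) auto
qed

text \<open>Corrections for different prefix contents \<open>e\<close> do not interfere, as each
  vanishes on the prefixes considered whose content is not \<open>e\<close>. They are added up over
  the finitely many \<open>e\<close>.\<close>

lemma next_prefix_length:
  obtains R where "R \<in> Lam D" "single D R \<in> MM_ideal Q w"
    "\<And>a b. length a \<le> c \<Longrightarrow> framed_word w b \<Longrightarrow> pcorr D R (a @ b) = pcorr D G (a @ b)"
proof -
  define E where "E = {e. (\<forall>i. e i \<le> D i) \<and> card (vars e) = c}"
  have "finite {e. \<forall>i. (i \<in> verts Q \<longrightarrow> e i \<in> {..sum D (verts Q)}) \<and> (i \<notin> verts Q \<longrightarrow> e i = 0)}"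
    by (rule finite_set_of_finite_funs[OF finite_verts]) simp
  moreover have "E \<subseteq> {e. \<forall>i. (i \<in> verts Q \<longrightarrow> e i \<in> {..sum D (verts Q)}) \<and> (i \<notin> verts Q \<longrightarrow> e i = 0)}"
  proof (intro subsetI CollectI allI conjI impI)
    fix e i assume e: "e \<in> E"
    then have le: "e i \<le> D i" by (simp add: E_def)
    show "e i \<in> {..sum D (verts Q)}" if "i \<in> verts Q"
      using le member_le_sum[OF that _ finite_verts, of D] by simp
    show "e i = 0" if "i \<notin> verts Q" using le D that by (simp add: dimvecs_def)
  qed
  ultimately have finE: "finite E" by (rule rev_finite_subset)
  have step: "correctable (\<lambda>a b. if content a = e then pcorr D G (a @ b) else 0)" if "e \<in> E" for e
  proof (rule prefix_correction[of "\<lambda>i. D i - e i"])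
    have le: "e i \<le> D i" for i using that by (simp add: E_def)
    show "(\<lambda>i. D i - e i) \<in> dimvecs Q" using D by (simp add: dimvecs_def)
    show "e \<in> dimvecs Q" using D le by (simp add: dimvecs_def) (metis le_zero_eq)
    show "D = (\<lambda>i. D i - e i) + e" using le by (simp add: fun_eq_iff)
    show "card (vars e) = c" using that by (simp add: E_def)
  qed
  have "correctable (\<lambda>a b. if content a \<in> E' then pcorr D G (a @ b) else 0)" if "E' \<subseteq> E" for E'
    using finite_subset[OF that finE] that
  proof (induction E' rule: finite_induct)
    case empty
    show ?case by (rule correctable_add[OF correctable_zero correctable_zero]) simp
  next
    case (insert e E')
    then show ?case by (intro correctable_add[OF step[of e] insert.IH]) auto
  qed
  from this[OF order.refl] obtain R where R: "R \<in> Lam D" "single D R \<in> MM_ideal Q w"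
    "\<And>a b. length a \<le> c \<Longrightarrow> framed_word w b \<Longrightarrow>
       pcorr D R (a @ b) = (if content a \<in> E then pcorr D G (a @ b) else 0)"
    unfolding correctable_def by blast
  \<comment> \<open>A content outside \<open>E\<close> belongs to a shorter prefix, where
    \<open>G\<close> vanishes by assumption, or is not bounded by \<open>D\<close>, so that no word
    of content \<open>D\<close> begins this way.\<close>
  have "pcorr D G (a @ b) = 0" if len: "length a \<le> c" and b: "framed_word w b" and E: "content a \<notin> E" for a b
  proof (cases "length a < c")
    case True
    then show ?thesis using kill b by blast
  next
    case False
    then have "card (vars (content a)) = c" using len card_vars_content[of a] by simp
    then obtain i where "\<not> content a i \<le> D i" using E by (auto simp: E_def)
    then have "content (a @ b) \<noteq> D" by (auto simp: content_append)
    then show ?thesis by (rule pcorr_content)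
  qed
  then show ?thesis using that R by metis
qed

end

text \<open>Words of content \<open>D\<close> have \<open>card (vars D)\<close> letters. Once
  \<open>c\<close> exceeds this number, each of them is itself a prefix on which \<open>G\<close>
  vanishes, with \<open>b\<close> empty, and \<open>G = 0\<close>.\<close>

lemma framed_zero_component:
  assumes D: "D \<in> dimvecs Q"
  shows "G \<in> Lam D \<Longrightarrow> 1 \<le> c \<Longrightarrow> (\<And>a b. length a < c \<Longrightarrow> framed_word w b \<Longrightarrow> pcorr D G (a @ b) = 0) \<Longrightarrow>
    single D G \<in> MM_ideal Q w"
proof (induction "card (vars D) + 1 - c" arbitrary: G c rule: less_induct)
  case less
  interpret H: rat_space "HH Q" by (rule HH_space)
  note I = H.submodule_rat_D[OF MM_ideal_submodule[of w]]
  have fin: "finite (vars D)" by (rule finite_vars_Q[OF D])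
  show ?case
  proof (cases "card (vars D) < c")
    case True
    have "G = 0"
    proof (rule pcorr_inj[OF fin less.prems(1) Lam_zero])
      fix gs assume "content gs = D"
      then have "length gs < c" using card_vars_content[of gs] True by simp
      then show "pcorr D G gs = pcorr D 0 gs" using less.prems(3)[of gs "[]"] fin by simp
    qed
    then show ?thesis using I(2) by simp
  next
    case False
    obtain R where R: "R \<in> Lam D" "single D R \<in> MM_ideal Q w"
      "\<And>a b. length a \<le> c \<Longrightarrow> framed_word w b \<Longrightarrow> pcorr D R (a @ b) = pcorr D G (a @ b)"
      using next_prefix_length[OF D less.prems] by blast
    define G' where "G' = G + scaled (-1) R"
    have sR: "scaled (-1) R \<in> Lam D" by (rule Lam_scale[OF fin R(1)])
    have "single D G' \<in> MM_ideal Q w"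
    proof (rule less.hyps)
      show "card (vars D) + 1 - Suc c < card (vars D) + 1 - c" using False by simp
      show "G' \<in> Lam D" unfolding G'_def by (rule Lam_add[OF fin less.prems(1) sR])
      show "pcorr D G' (a @ b) = 0" if "length a < Suc c" "framed_word w b" for a b
        unfolding G'_def pcorr_add[OF fin less.prems(1) sR] pcorr_scale[OF fin R(1)]
        using R(3)[of a b] that by simp
    qed simp
    moreover have "single D G = single D G' + single D R"
    proof -
      have "G = G' + R" by (rule poly_mapping_eqI) (simp add: G'_def lookup_add lookup_scale)
      then show ?thesis by (simp add: single_add)
    qed
    ultimately show ?thesis using I(3) R(2) by simp
  qed
qed

theorem MM_ideal_eq: "MM_ideal Q w = framed_zero w"
proof (intro equalityI MM_ideal_framed_zero subsetI)
  fix h assume "h \<in> framed_zero w"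
  then have h: "h \<in> carrier (HH Q)" and zero: "\<And>gs. framed_word w gs \<Longrightarrow> coha_corr h gs = 0"
    by (auto simp: framed_zero_def)
  interpret H: rat_space "HH Q" by (rule HH_space)
  note I = H.submodule_rat_D[OF MM_ideal_submodule[of w]]
  have comp: "single d (lookup h d) \<in> MM_ideal Q w" if "d \<in> keys h" for d
  \<comment> \<open>\<open>c = 1\<close> leaves only the empty prefix, for which the condition is
    vanishing on words over \<open>X_w\<close>.\<close>
  proof (rule framed_zero_component[where c = 1])
    show "d \<in> dimvecs Q" "lookup h d \<in> Lam d" using h that by (auto simp: HH_carrier in_keys_iff)
    show "pcorr d (lookup h d) (a @ b) = 0" if "length a < 1" "framed_word w b" for a b
      using zero[OF that(2)] that(1) by (cases "content b = d") (auto simp: coha_corr_def pcorr_content)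
  qed simp
  have "(\<Sum>d\<in>A. single d (lookup h d)) \<in> MM_ideal Q w"
    if "A \<subseteq> keys h" for A using finite_subset[OF that finite_keys] that
  proof (induction A rule: finite_induct)
    case (insert a A)
    then show ?case using I(3)[OF comp[of a]] by simp
  qed (use I(2) in simp)
  from this[OF order.refl] have "(\<Sum>d\<in>keys h. single d (lookup h d)) \<in> MM_ideal Q w" .
  also have "(\<Sum>d\<in>keys h. single d (lookup h d)) = h"
    by (rule poly_mapping_eqI) (simp add: lookup_sum lookup_single when_def in_keys_iff)
  finally show "h \<in> MM_ideal Q w" .
qed

end

section \<open>The restriction map and the bottom isomorphism\<close>

context lin_sym_quiver
begin

abbreviation "QQdual w \<equiv> gdual (QQ Q w) (QQ_piece Q w)"

definition framed_vecs :: "('v \<Rightarrow> nat) \<Rightarrow> 'v pfva set" where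
  "framed_vecs w = {word_vec Q gs | gs. is_word gs \<and> framed_word w gs}"

lemma QQ_space_span: "QQ_space Q w = lin_span (PP Q) (framed_vecs w)"
proof -
  have "set gs \<subseteq> {(i, n). i \<in> verts Q \<and> n \<ge> - int (w i)} \<longleftrightarrow> is_word gs \<and> framed_word w gs"
    for gs :: "('v \<times> int) list" by (auto simp: symbols_def framed_def)
  then show ?thesis unfolding QQ_space_def framed_vecs_def by (simp only:)
qed

lemma framed_vecs_carrier: "framed_vecs w \<subseteq> carrier (PP Q)"
  using word_vec_carrier by (auto simp: framed_vecs_def)

lemma QQ_space_submodule: "submodule (QQ_space Q w) ratring (PP Q)"
  unfolding QQ_space_span by (rule rat_space.lin_span_submodule[OF PP_space framed_vecs_carrier])

lemma word_vec_QQ_piece: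
  assumes "is_word gs" "framed_word w gs"
  shows "word_vec Q gs \<in> QQ_space Q w" "word_vec Q gs \<in> QQ_piece Q w (ldim (content gs)) (hdeg gs)"
proof -
  show 1: "word_vec Q gs \<in> QQ_space Q w"
    unfolding QQ_space_span using rat_space.lin_span_superset[OF PP_space, of "framed_vecs w"] assms
    by (auto simp: framed_vecs_def)
  have "word_vec Q gs \<in> PP_piece Q (ldim (content gs)) (hdeg gs)" unfolding PP_piece_words
    using rat_space.lin_span_superset[OF PP_space,
        of "{word_vec Q hs | hs. is_word hs \<and> grade hs = (ldim (content gs), hdeg gs)}"] assms(1)
    by (auto simp: grade_def)
  then show "word_vec Q gs \<in> QQ_piece Q w (ldim (content gs)) (hdeg gs)" using 1 by (simp add: QQ_piece_def)
qed

lemma QQ_simps: "carrier (QQ Q w) = QQ_space Q w" "add (QQ Q w) = add (PP Q)" "smult (QQ Q w) = smult (PP Q)"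
  by (simp_all add: QQ_def)

lemma QQdual_carrier:
  "\<eta> \<in> carrier (QQdual w) \<longleftrightarrow> (\<forall>x. x \<notin> QQ_space Q w \<longrightarrow> \<eta> x = 0) \<and>
     (\<forall>x\<in>QQ_space Q w. \<forall>y\<in>QQ_space Q w. \<eta> (x \<oplus>\<^bsub>PP Q\<^esub> y) = \<eta> x + \<eta> y) \<and>
     (\<forall>c. \<forall>x\<in>QQ_space Q w. \<eta> (c \<odot>\<^bsub>PP Q\<^esub> x) = c * \<eta> x) \<and>
     finite {(\<alpha>, n). \<exists>x\<in>QQ_piece Q w \<alpha> n. \<eta> x \<noteq> 0}" by (simp add: gdual_def QQ_simps)

lemma dual_restrict_carrier:
  assumes \<xi>: "\<xi> \<in> carrier PPdual"
  shows "dual_restrict Q w \<xi> \<in> carrier (QQdual w)" unfolding QQdual_carrier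
proof (intro conjI ballI allI impI)
  note W = rat_space.submodule_rat_D[OF PP_space QQ_space_submodule[of w]]
  have f: "functional \<xi>" using \<xi> PPdual_carrier by blast
  show "dual_restrict Q w \<xi> (x \<oplus>\<^bsub>PP Q\<^esub> y) = dual_restrict Q w \<xi> x + dual_restrict Q w \<xi> y"
    if "x \<in> QQ_space Q w" "y \<in> QQ_space Q w" for x y
    using f subsetD[OF W(1) that(1)] subsetD[OF W(1) that(2)] W(3)[OF that] that
    unfolding rat_space.linear_functional_def[OF PP_space] by (simp add: dual_restrict_def)
  show "dual_restrict Q w \<xi> (c \<odot>\<^bsub>PP Q\<^esub> x) = c * dual_restrict Q w \<xi> x" if "x \<in> QQ_space Q w" for c x
    using f subsetD[OF W(1) that] W(4)[OF that] that
    unfolding rat_space.linear_functional_def[OF PP_space] by (simp add: dual_restrict_def)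
  have "finite {(\<alpha>, n). \<exists>x\<in>PP_piece Q \<alpha> n. \<xi> x \<noteq> 0}" using \<xi> by (simp add: gdual_def)
  then show "finite {(\<alpha>, n). \<exists>x\<in>QQ_piece Q w \<alpha> n. dual_restrict Q w \<xi> x \<noteq> 0}"
    by (rule rev_finite_subset) (auto simp: QQ_piece_def dual_restrict_def)
qed (simp add: dual_restrict_def)

lemma dual_restrict_add: "dual_restrict Q w (\<xi> + \<eta>) = dual_restrict Q w \<xi> + dual_restrict Q w \<eta>"
  and dual_restrict_scale: "dual_restrict Q w (\<lambda>x. c * \<xi> x) = (\<lambda>x. c * dual_restrict Q w \<xi> x)"
  by (auto simp: dual_restrict_def)

lemma lin_map_dual_restrict: "lin_map PPdual (QQdual w) (dual_restrict Q w)"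
  unfolding lin_map_def using dual_restrict_carrier by (auto simp: dual_restrict_add dual_restrict_scale)

text \<open>An extension along an arbitrary complement ignores the grading and may be nonzero in
  infinitely many degrees. Its system is therefore cut down to the grades in which
  \<open>\<eta>\<close> lives; on \<open>QQ_space Q w\<close> nothing changes, since this space is
  spanned by graded words.\<close>

lemma framed_extension:
  assumes \<eta>: "\<eta> \<in> carrier (QQdual w)"
  obtains \<xi> where "\<xi> \<in> carrier PPdual" "dual_restrict Q w \<xi> = \<eta>"
    "\<And>gs. corr \<xi> gs \<noteq> 0 \<Longrightarrow> \<exists>x\<in>QQ_piece Q w (ldim (content gs)) (hdeg gs). \<eta> x \<noteq> 0"
proof -
  interpret W: rat_subspace "PP Q" "QQ_space Q w"
    by (intro rat_subspace.intro PP_space rat_subspace_axioms.intro QQ_space_submodule)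
  obtain \<xi>0 where \<xi>0: "functional \<xi>0" "\<And>x. x \<in> QQ_space Q w \<Longrightarrow> \<xi>0 x = \<eta> x"
    using W.extend_functional[of \<eta>] \<eta> unfolding QQdual_carrier by blast
  define S where "S = {(\<alpha>, n). \<exists>x\<in>QQ_piece Q w \<alpha> n. \<eta> x \<noteq> 0}"
  have S: "grade gs \<in> S \<longleftrightarrow> (\<exists>x\<in>QQ_piece Q w (ldim (content gs)) (hdeg gs). \<eta> x \<noteq> 0)" for gs
    by (simp add: S_def grade_def)
  have finS: "finite S" using \<eta> unfolding QQdual_carrier S_def by blast
  \<comment> \<open>\<open>system_restrict\<close> selects by content and total; by
    \<open>grade_cong\<close> these two determine the grade.\<close>
  define P where "P c t \<longleftrightarrow> (\<exists>gs. content gs = c \<and> total gs = t \<and> grade gs \<in> S)" for c t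
  have P: "P (content gs) (total gs) \<longleftrightarrow> grade gs \<in> S" for gs using grade_cong unfolding P_def by metis
  define \<Phi> where "\<Phi> gs = (if P (content gs) (total gs) then corr \<xi>0 gs else 0)" for gs
  have "is_system \<Phi>" unfolding \<Phi>_def by (rule system_restrict[OF system_of_functional[OF \<xi>0(1)]])
  moreover have "is_word gs" if "\<Phi> gs \<noteq> 0" for gs
    using that corr_nonzero[of \<xi>0 gs] by (auto simp: \<Phi>_def split: if_splits)
  moreover have "finite (grade ` {gs. \<Phi> gs \<noteq> 0})" by (rule finite_subset[OF _ finS]) (auto simp: \<Phi>_def P)
  ultimately obtain \<xi> where \<xi>: "\<xi> \<in> carrier PPdual" "corr \<xi> = \<Phi>" using PPdual_of_system by blast
  have f: "functional \<xi>" using \<xi>(1) PPdual_carrier by blast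
  have eq: "\<xi> x = \<eta> x" if "x \<in> QQ_space Q w" for x
  proof -
    have "(\<lambda>x. \<xi> x - \<xi>0 x) x = 0"
    proof (rule W.linear_functional_span_zero[OF _ framed_vecs_carrier])
      show "functional (\<lambda>x. \<xi> x - \<xi>0 x)"
        using f \<xi>0(1) unfolding rat_space.linear_functional_def[OF PP_space] by (simp add: algebra_simps)
      show "x \<in> lin_span (PP Q) (framed_vecs w)" using that by (simp add: QQ_space_span)
      fix y assume "y \<in> framed_vecs w"
      then obtain gs where y: "y = word_vec Q gs" and gs: "is_word gs" "framed_word w gs"
        by (auto simp: framed_vecs_def)
      have "\<xi> y = \<Phi> gs" "corr \<xi>0 gs = \<xi>0 y" using fun_cong[OF \<xi>(2), of gs] gs by (simp_all add: corr_def y)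
      moreover have "\<xi>0 y = 0" if "grade gs \<notin> S" using that S[of gs] word_vec_QQ_piece[OF gs] \<xi>0(2) y by auto
      ultimately show "\<xi> y - \<xi>0 y = 0" by (auto simp: \<Phi>_def P)
    qed
    then show ?thesis using \<xi>0(2)[OF that] by simp
  qed
  have "dual_restrict Q w \<xi> = \<eta>" using eq \<eta> by (auto simp: dual_restrict_def QQdual_carrier fun_eq_iff)
  moreover have "\<exists>x\<in>QQ_piece Q w (ldim (content gs)) (hdeg gs). \<eta> x \<noteq> 0" if "corr \<xi> gs \<noteq> 0" for gs
    using that S[of gs] by (simp add: \<xi>(2) \<Phi>_def P split: if_splits)
  ultimately show ?thesis using that \<xi>(1) by blast
qed

text \<open>By \<open>MM_ideal_eq\<close> membership in the ideal means that the values on words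
  over \<open>X_w\<close> vanish, and such words span \<open>QQ_space Q w\<close>.\<close>

lemma dual_restrict_kernel:
  assumes \<xi>: "\<xi> \<in> carrier PPdual"
  shows "dual_restrict Q w \<xi> = (\<lambda>_. 0) \<longleftrightarrow> coha_of \<xi> \<in> MM_ideal Q w"
proof -
  have f: "functional \<xi>" using \<xi> PPdual_carrier by blast
  have "coha_of \<xi> \<in> MM_ideal Q w \<longleftrightarrow> (\<forall>gs. framed_word w gs \<longrightarrow> corr \<xi> gs = 0)"
    using coha_of[OF \<xi>] by (simp add: MM_ideal_eq framed_zero_def)
  also have "\<dots> \<longleftrightarrow> (\<forall>x\<in>framed_vecs w. \<xi> x = 0)" by (auto simp: framed_vecs_def corr_def)
  also have "\<dots> \<longleftrightarrow> (\<forall>x\<in>QQ_space Q w. \<xi> x = 0)"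
    using rat_space.linear_functional_span_zero[OF PP_space f framed_vecs_carrier, of w]
      rat_space.lin_span_superset[OF PP_space, of "framed_vecs w"] unfolding QQ_space_span by blast
  also have "\<dots> \<longleftrightarrow> dual_restrict Q w \<xi> = (\<lambda>_. 0)" by (auto simp: dual_restrict_def fun_eq_iff)
  finally show ?thesis by simp
qed

lemma MM_proj_eq_iff:
  assumes \<xi>: "\<xi> \<in> carrier PPdual" and \<eta>: "\<eta> \<in> carrier PPdual"
  shows "MM_proj Q w (coha_of \<xi>) = MM_proj Q w (coha_of \<eta>) \<longleftrightarrow> dual_restrict Q w \<xi> = dual_restrict Q w \<eta>"
proof -
  interpret I: rat_subspace "HH Q" "MM_ideal Q w"
    by (intro rat_subspace.intro HH_space rat_subspace_axioms.intro MM_ideal_submodule)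
  define \<delta> where "\<delta> = \<xi> + (\<lambda>x. (-1) * \<eta> x)"
  have m\<eta>: "(\<lambda>x. (-1) * \<eta> x) \<in> carrier PPdual" by (rule PPdual_scale[OF \<eta>])
  have \<delta>: "\<delta> \<in> carrier PPdual" unfolding \<delta>_def by (rule PPdual_add[OF \<xi> m\<eta>])
  have "\<xi> = \<delta> + \<eta>" by (simp add: \<delta>_def fun_eq_iff)
  then have split: "coha_of \<xi> = coha_of \<delta> + coha_of \<eta>" using lin_map_coha_of \<delta> \<eta> by (simp add: lin_map_def)
  have "MM_proj Q w (coha_of \<xi>) = MM_proj Q w (coha_of \<eta>) \<longleftrightarrow> (\<exists>x\<in>MM_ideal Q w. coha_of \<xi> = x + coha_of \<eta>)"
    unfolding MM_proj_def using I.coset_eq_iff[of "coha_of \<xi>" "coha_of \<eta>"] coha_of(1) \<xi> \<eta> by simp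
  also have "\<dots> \<longleftrightarrow> coha_of \<delta> \<in> MM_ideal Q w" unfolding split by auto
  also have "\<dots> \<longleftrightarrow> dual_restrict Q w \<delta> = (\<lambda>_. 0)" by (rule dual_restrict_kernel[OF \<delta>, symmetric])
  also have "\<dots> \<longleftrightarrow> dual_restrict Q w \<xi> = dual_restrict Q w \<eta>"
    unfolding \<delta>_def dual_restrict_add dual_restrict_scale by (auto simp: fun_eq_iff)
  finally show ?thesis .
qed

definition framed_iso :: "('v \<Rightarrow> nat) \<Rightarrow> ('v pfva \<Rightarrow> rat) \<Rightarrow> 'v coha set" where
  "framed_iso w \<eta> = MM_proj Q w (coha_of (SOME \<xi>. \<xi> \<in> carrier PPdual \<and> dual_restrict Q w \<xi> = \<eta>))"

text \<open>Two extensions of a functional differ by one that vanishes on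
  \<open>QQ_space Q w\<close>, whose image lies in the ideal. So the choice in
  \<open>framed_iso\<close> is immaterial and the square commutes.\<close>

lemma framed_iso_restrict:
  assumes \<xi>: "\<xi> \<in> carrier PPdual"
  shows "framed_iso w (dual_restrict Q w \<xi>) = MM_proj Q w (coha_of \<xi>)"
proof -
  define \<xi>' where "\<xi>' = (SOME \<zeta>. \<zeta> \<in> carrier PPdual \<and> dual_restrict Q w \<zeta> = dual_restrict Q w \<xi>)"
  have "\<xi>' \<in> carrier PPdual \<and> dual_restrict Q w \<xi>' = dual_restrict Q w \<xi>"
    unfolding \<xi>'_def by (rule someI[of _ \<xi>]) (simp add: \<xi>)
  then show ?thesis unfolding framed_iso_def \<xi>'_def[symmetric] using MM_proj_eq_iff \<xi> by blast
qed

lemma dual_restrict_image: "dual_restrict Q w ` carrier PPdual = carrier (QQdual w)"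
proof (intro equalityI subsetI)
  fix \<eta> assume "\<eta> \<in> carrier (QQdual w)"
  from framed_extension[OF this] show "\<eta> \<in> dual_restrict Q w ` carrier PPdual" by (metis image_eqI)
qed (use dual_restrict_carrier in blast)

text \<open>A homogeneous functional has a homogeneous extension, because
  \<open>framed_extension\<close> creates no new grades.\<close>

lemma dual_restrict_piece:
  "dual_restrict Q w ` PPdual_piece \<alpha> n = gdual_piece (QQ Q w) (QQ_piece Q w) \<alpha> n"
proof (intro equalityI subsetI)
  fix \<eta> assume "\<eta> \<in> dual_restrict Q w ` PPdual_piece \<alpha> n"
  then show "\<eta> \<in> gdual_piece (QQ Q w) (QQ_piece Q w) \<alpha> n"
    using dual_restrict_carrier by (fastforce simp: gdual_piece_def QQ_piece_def dual_restrict_def)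
next
  fix \<eta> assume \<eta>: "\<eta> \<in> gdual_piece (QQ Q w) (QQ_piece Q w) \<alpha> n"
  then have "\<eta> \<in> carrier (QQdual w)" by (simp add: gdual_piece_def)
  then obtain \<xi> where \<xi>: "\<xi> \<in> carrier PPdual" "dual_restrict Q w \<xi> = \<eta>"
    "\<And>gs. corr \<xi> gs \<noteq> 0 \<Longrightarrow> \<exists>x\<in>QQ_piece Q w (ldim (content gs)) (hdeg gs). \<eta> x \<noteq> 0"
    using framed_extension by blast
  have "grade gs = (\<alpha>, - n)" if "corr \<xi> gs \<noteq> 0" for gs
    using \<xi>(3)[OF that] \<eta> unfolding gdual_piece_def grade_def by blast
  then have "\<xi> \<in> PPdual_piece \<alpha> n" using \<xi>(1) by (simp add: PPdual_piece_iff)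
  then show "\<eta> \<in> dual_restrict Q w ` PPdual_piece \<alpha> n" using \<xi>(2) by blast
qed

lemma graded_iso_framed_iso:
  "graded_iso (QQdual w) (gdual_piece (QQ Q w) (QQ_piece Q w)) (MM Q w) (MM_piece Q w) (framed_iso w)"
proof -
  interpret I: rat_subspace "HH Q" "MM_ideal Q w"
    by (intro rat_subspace.intro HH_space rat_subspace_axioms.intro MM_ideal_submodule)
  have MM: "MM Q w = I.quo" by (simp add: MM_def)
  have carr: "carrier (MM Q w) = MM_proj Q w ` carrier (HH Q)"
    unfolding MM I.quot_carrier by (simp add: MM_proj_def)
  have F: "bij_betw coha_of (carrier PPdual) (carrier (HH Q))"
    "\<And>\<alpha> n. coha_of ` PPdual_piece \<alpha> n = HH_piece Q \<alpha> n"
    using graded_iso_coha_of by (auto simp: graded_iso_def)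
  have image: "framed_iso w ` dual_restrict Q w ` A = MM_proj Q w ` coha_of ` A" if "A \<subseteq> carrier PPdual" for A
    unfolding image_image by (rule image_cong[OF refl]) (use framed_iso_restrict that in blast)
  have onto: "framed_iso w ` carrier (QQdual w) = carrier (MM Q w)"
    using image[of "carrier PPdual"] bij_betw_imp_surj_on[OF F(1)] by (simp add: dual_restrict_image carr)
  have proj: "MM_proj Q w (x \<oplus>\<^bsub>HH Q\<^esub> y) = MM_proj Q w x \<oplus>\<^bsub>MM Q w\<^esub> MM_proj Q w y"
    "MM_proj Q w (c \<odot>\<^bsub>HH Q\<^esub> x) = c \<odot>\<^bsub>MM Q w\<^esub> MM_proj Q w x"
    if "x \<in> carrier (HH Q)" "y \<in> carrier (HH Q)" for x y c
    unfolding MM MM_proj_def using I.quot_add I.quot_smult that by metis+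
  have ext: "\<exists>\<xi>. \<xi> \<in> carrier PPdual \<and> \<eta> = dual_restrict Q w \<xi>" if "\<eta> \<in> carrier (QQdual w)" for \<eta>
    using that unfolding dual_restrict_image[symmetric] by blast
  show ?thesis unfolding graded_iso_def
  proof (intro conjI allI)
    show "lin_map (QQdual w) (MM Q w) (framed_iso w)" unfolding lin_map_def
    proof (intro conjI ballI allI)
      show "framed_iso w \<in> carrier (QQdual w) \<rightarrow> carrier (MM Q w)" using onto by blast
      fix \<eta> assume "\<eta> \<in> carrier (QQdual w)"
      then obtain \<xi> where \<xi>: "\<xi> \<in> carrier PPdual" "\<eta> = dual_restrict Q w \<xi>" using ext by blast
      have lin: "coha_of (\<xi> + \<zeta>) = coha_of \<xi> \<oplus>\<^bsub>HH Q\<^esub> coha_of \<zeta>" "coha_of (\<lambda>x. c * \<xi> x) = c \<odot>\<^bsub>HH Q\<^esub> coha_of \<xi>"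
        if "\<zeta> \<in> carrier PPdual" for \<zeta> c
        using lin_map_coha_of \<xi>(1) that unfolding lin_map_def gdual_simps by blast+
      show "framed_iso w (c \<odot>\<^bsub>QQdual w\<^esub> \<eta>) = c \<odot>\<^bsub>MM Q w\<^esub> framed_iso w \<eta>" for c
        unfolding gdual_simps \<xi>(2) dual_restrict_scale[symmetric] framed_iso_restrict[OF \<xi>(1)]
          framed_iso_restrict[OF PPdual_scale[OF \<xi>(1)]] lin(2)[OF \<xi>(1)]
        by (rule proj(2)) (rule coha_of(1)[OF \<xi>(1)])+
      fix \<eta>' assume "\<eta>' \<in> carrier (QQdual w)"
      then obtain \<xi>' where \<xi>': "\<xi>' \<in> carrier PPdual" "\<eta>' = dual_restrict Q w \<xi>'" using ext by blast
      show "framed_iso w (\<eta> \<oplus>\<^bsub>QQdual w\<^esub> \<eta>') = framed_iso w \<eta> \<oplus>\<^bsub>MM Q w\<^esub> framed_iso w \<eta>'"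
        unfolding gdual_simps \<xi>(2) \<xi>'(2) dual_restrict_add[symmetric] framed_iso_restrict[OF \<xi>(1)]
          framed_iso_restrict[OF \<xi>'(1)] framed_iso_restrict[OF PPdual_add[OF \<xi>(1) \<xi>'(1)]] lin(1)[OF \<xi>'(1)]
        by (rule proj(1)) (rule coha_of(1)[OF \<xi>(1)] coha_of(1)[OF \<xi>'(1)])+
    qed
    have "inj_on (framed_iso w) (carrier (QQdual w))"
    proof (rule inj_onI)
      fix \<eta> \<eta>' assume \<eta>: "\<eta> \<in> carrier (QQdual w)" "\<eta>' \<in> carrier (QQdual w)" "framed_iso w \<eta> = framed_iso w \<eta>'"
      obtain \<xi> \<xi>' where \<xi>: "\<xi> \<in> carrier PPdual" "\<eta> = dual_restrict Q w \<xi>"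
        "\<xi>' \<in> carrier PPdual" "\<eta>' = dual_restrict Q w \<xi>'" using ext[OF \<eta>(1)] ext[OF \<eta>(2)] by blast
      show "\<eta> = \<eta>'"
        using \<eta>(3) MM_proj_eq_iff[OF \<xi>(1,3), of w] framed_iso_restrict[OF \<xi>(1)] framed_iso_restrict[OF \<xi>(3)]
        by (simp add: \<xi>(2,4))
    qed
    then show "bij_betw (framed_iso w) (carrier (QQdual w)) (carrier (MM Q w))"
      using onto by (simp add: bij_betw_def)
    fix \<alpha> n
    have "PPdual_piece \<alpha> n \<subseteq> carrier PPdual" by (auto simp: gdual_piece_def)
    from image[OF this] show "framed_iso w ` gdual_piece (QQ Q w) (QQ_piece Q w) \<alpha> n = MM_piece Q w \<alpha> n"
      unfolding dual_restrict_piece F(2) MM_piece_def .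
  qed
qed

end

theorem theorem6p4:
  fixes Q :: "('v::linorder, 'a) pre_digraph"
  assumes "symmetric_quiver Q"
  shows "\<exists>F. graded_iso
        (gdual (PP Q) (PP_piece Q)) (gdual_piece (PP Q) (PP_piece Q)) (HH Q) (HH_piece Q) F \<and> is_F Q F \<and>
      (\<forall>w :: 'v \<Rightarrow> nat.
        lin_map (gdual (PP Q) (PP_piece Q)) (gdual (QQ Q w) (QQ_piece Q w)) (dual_restrict Q w) \<and>
        dual_restrict Q w ` carrier (gdual (PP Q) (PP_piece Q))
          = carrier (gdual (QQ Q w) (QQ_piece Q w)) \<and> (\<exists>G. graded_iso
            (gdual (QQ Q w) (QQ_piece Q w)) (gdual_piece (QQ Q w) (QQ_piece Q w))
            (MM Q w) (MM_piece Q w) G \<and> (\<forall>\<xi> \<in> carrier (gdual (PP Q) (PP_piece Q)).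
            G (dual_restrict Q w \<xi>) = MM_proj Q w (F \<xi>))))"
proof -
  interpret lin_sym_quiver Q by unfold_locales (rule assms)
  show ?thesis using graded_iso_coha_of is_F_coha_of lin_map_dual_restrict dual_restrict_image
      graded_iso_framed_iso framed_iso_restrict by blast
qed

end
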